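(* Let $d\ge1$, $s\in(0,1)$, $T\in(0,\infty)$, $0<\lambda\le\Lambda<\infty$, and let $K$ be a kernel satisfying the upper bound (U) and the coercivity condition (C). Let $\mu$ be a nonnegative Radon measure on $\mathbb R^d$ and let $u_1,u_2$ be (possibly signed) weak solutions to the Cauchy problem for $\partial_tu-\mathcal L_tu=0$ in $(0,T]\times\mathbb R^d$ with $u_1(0)=\mu=u_2(0)$. In addition, assume that $$u_1,u_2\in L^\infty((0,T);L^2_{\rm loc}(\mathbb R^d))\cap L^2((0,T);H^s_{\rm loc}(\mathbb R^d))\cap L^1((0,T);L^1(\mathbb R^d;w)).$$ Then $u_1=u_2$ in $(0,T]\times\mathbb R^d$.
   Context: Kernel. $K:(0,T)\times\mathbb R^d\times\mathbb R^d\to[0,\infty]$ is measurable and symmetric, $K(t;x,y)=K(t;y,x)$. The operator is $-\mathcal L_t u(t,x)=\mathrm{p.v.}\int_{\mathbb R^d}(u(t,x)-u(t,y))K(t;x,y)\,\mathrm dy$, understood weakly via $\mathcal E^{(t)}(u,v)=\int_{\mathbb R^d}\int_{\mathbb R^d}(u(x)-u(y))(v(x)-v(y))K(t;x,y)\,\mathrm dy\,\mathrm dx$. Upper bound (U): $K(t;x,y)\le \Lambda|x-y|^{-d-2s}$ for all $t\in(0,T)$, $x,y\in\mathbb R^d$. Coercivity (C): $\iint_{B_r(x_o)\times B_r(x_o)}|v(x)-v(y)|^2K(t;x,y)\,\mathrm dy\,\mathrm dx\ge\lambda\,[v]^2_{H^s(B_r(x_o))}$ for all $t\in(0,T)$,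 $r>0$, $x_o\in\mathbb R^d$, $v\in H^s(B_r(x_o))$, where $[v]_{H^s(B)}^2=\iint_{B\times B}\frac{|v(x)-v(y)|^2}{|x-y|^{d+2s}}\,\mathrm dx\,\mathrm dy$. Weighted space. $w(x)=(1+|x|)^{-d-2s}$ and $L^1(\mathbb R^d;w)$ is the set of $u\in L^1_{\rm loc}(\mathbb R^d)$ with $\|u\|_{L^1(\mathbb R^d;w)}=\int_{\mathbb R^d}|u(x)|w(x)\,\mathrm dx<\infty$. Local weak solution. For an interval $I$ and a bounded domain $\Omega\subset\mathbb R^d$, $u\in L^\infty(I;L^2_{\rm loc}(\Omega))\cap L^2(I;H^s_{\rm loc}(\Omega))\cap L^1(I;L^1(\mathbb R^d;w))$ is a weak supersolution of $\partial_tu-\mathcal L_tu=0$ in $I\times\Omega$ if $-\int_I\int_{\mathbb R^d}u\,\partial_t\phi\,\mathrm dx\,\mathrm dt+\int_I\mathcal E^{(t)}(u(t),\phi(t))\,\mathrm dt\ge0$ for all $\phi\in H^1(I;L^2(\Omega))\cap L^2(I;H^s(\mathbb R^d))$ with $\phi\ge0$ and $\operatorname{supp}\phi\subset I\times\Omega$; a weak subsolution if $-u$ is a weak supersolution; a weak solution if both. Global weak solution. $u\in L^{\infty}(I;L^2_{\rm loc}(\mathbb R^d))\cap L^2(I;H^s_{\rm loc}(\mathbb R^d))\cap L^1(I;L^1(\mathbb R^d;w))$ is a global weak solution in $I\times\mathbb R^d$ if it is a local weak solution in $I\times B_R(0)$ for every $R>0$. Cauchy problem. For a signed Radon measure $\mu$,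 $u$ solves $\partial_tu-\mathcal L_tu=0$ with $u(0)=\mu$ if $u$ is a global weak solution in $(\varepsilon,T)\times\mathbb R^d$ for every $\varepsilon\in(0,T)$ and $\int\psi\,\mathrm d\mu=\lim_{t\searrow0}\int\psi(x)u(t,x)\,\mathrm dx$ for all $\psi\in C_c(\mathbb R^d)$. Writing $(0,T]$ means that the time interior is $(0,T)$ and $u(T,\cdot)$ is the value at the final time of the representative of $u$ continuous in time; test functions vanish near $t=T$. *)

theory Defs
  imports "HOL-Analysis.Analysis"
begin

text \<open>
  The space $R^d$ is an arbitrary Euclidean space \<open>'a\<close> with $d$ = \<open>DIM('a)\<close> (at least 1 by the
  type class). Elements of Bochner spaces such as $L^p(I;X)$ are represented by functions of
  $(t,x)$ that are jointly Lebesgue measurable on $I \times R^d$; as the spaces $X$ occurring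
  with $p < \infty$ are separable, this agrees with strong measurability of $t \mapsto u(t)$.
\<close>

definition meas_on :: "real set \<Rightarrow> 'a::euclidean_space set \<Rightarrow> (real \<Rightarrow> 'a \<Rightarrow> real) \<Rightarrow> bool" where
  "meas_on I \<Omega> u \<longleftrightarrow> (\<lambda>(t, x). u t x) \<in> borel_measurable (lebesgue_on (I \<times> \<Omega>))"

definition L2_sqnorm :: "'a::euclidean_space set \<Rightarrow> ('a \<Rightarrow> real) \<Rightarrow> ennreal" where
  "L2_sqnorm A v = (\<integral>\<^sup>+x\<in>A. ennreal ((v x)\<^sup>2) \<partial>lebesgue)"

definition Hs_sqseminorm :: "real \<Rightarrow> 'a::euclidean_space set \<Rightarrow> ('a \<Rightarrow> real) \<Rightarrow> ennreal" where
  "Hs_sqseminorm s A v =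
     (\<integral>\<^sup>+(x, y)\<in>A \<times> A. ennreal ((v x - v y)\<^sup>2 / norm (x - y) powr (real DIM('a) + 2 * s)) \<partial>lebesgue)"

definition Hs :: "real \<Rightarrow> 'a::euclidean_space set \<Rightarrow> ('a \<Rightarrow> real) set" where
  "Hs s A = {v. v \<in> borel_measurable (lebesgue_on A) \<and> L2_sqnorm A v < \<infinity> \<and> Hs_sqseminorm s A v < \<infinity>}"

definition jump_kernel :: "real \<Rightarrow> (real \<Rightarrow> 'a::euclidean_space \<Rightarrow> 'a \<Rightarrow> ennreal) \<Rightarrow> bool" where
  "jump_kernel T K \<longleftrightarrow>
     (\<lambda>(t, x, y). K t x y) \<in> borel_measurable (lebesgue_on ({0<..<T} \<times> UNIV \<times> UNIV)) \<and>
     (\<forall>t\<in>{0<..<T}. \<forall>x y. K t x y = K t y x)"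

text \<open>
  The bound is an inequality in $[0,\infty]$; for $x = y$ and $\Lambda > 0$ the right-hand side is
  $\Lambda / 0 = \infty$, so the diagonal is unconstrained.
\<close>

definition kernel_upper_bound ::
    "real \<Rightarrow> real \<Rightarrow> real \<Rightarrow> (real \<Rightarrow> 'a::euclidean_space \<Rightarrow> 'a \<Rightarrow> ennreal) \<Rightarrow> bool" where
  "kernel_upper_bound s \<Lambda> T K \<longleftrightarrow>
     (\<forall>t\<in>{0<..<T}. \<forall>x y. K t x y \<le> ennreal \<Lambda> / ennreal (norm (x - y) powr (real DIM('a) + 2 * s)))"

definition kernel_coercive ::
    "real \<Rightarrow> real \<Rightarrow> real \<Rightarrow> (real \<Rightarrow> 'a::euclidean_space \<Rightarrow> 'a \<Rightarrow> ennreal) \<Rightarrow> bool" where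
  "kernel_coercive s l T K \<longleftrightarrow>
     (\<forall>t\<in>{0<..<T}. \<forall>r>0. \<forall>x\<^sub>0. \<forall>v\<in>Hs s (ball x\<^sub>0 r).
        (\<integral>\<^sup>+(x, y)\<in>ball x\<^sub>0 r \<times> ball x\<^sub>0 r. ennreal ((v x - v y)\<^sup>2) * K t x y \<partial>lebesgue)
          \<ge> ennreal l * Hs_sqseminorm s (ball x\<^sub>0 r) v)"

text \<open>
  Under the upper bound the kernel is infinite at most on the diagonal, a null set, so
  \<^const>\<open>enn2real\<close> loses nothing.
\<close>

definition energy ::
    "('a::euclidean_space \<Rightarrow> 'a \<Rightarrow> ennreal) \<Rightarrow> ('a \<Rightarrow> real) \<Rightarrow> ('a \<Rightarrow> real) \<Rightarrow> real" where
  "energy k u v = (\<integral>(x, y). (u x - u y) * (v x - v y) * enn2real (k x y) \<partial>lebesgue)"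

definition tail_weight :: "real \<Rightarrow> 'a::euclidean_space \<Rightarrow> real" where
  "tail_weight s x = (1 + norm x) powr (- real DIM('a) - 2 * s)"

definition Linf_L2loc :: "real set \<Rightarrow> 'a::euclidean_space set \<Rightarrow> (real \<Rightarrow> 'a \<Rightarrow> real) \<Rightarrow> bool" where
  "Linf_L2loc I \<Omega> u \<longleftrightarrow> meas_on I \<Omega> u \<and>
     (\<forall>C. compact C \<and> C \<subseteq> \<Omega> \<longrightarrow>
        (\<exists>M::real. AE t in lebesgue_on I. L2_sqnorm C (u t) \<le> ennreal M))"

definition L2_Hs ::
    "real \<Rightarrow> real set \<Rightarrow> 'a::euclidean_space set \<Rightarrow> (real \<Rightarrow> 'a \<Rightarrow> real) \<Rightarrow> bool" where
  "L2_Hs s I A u \<longleftrightarrow> meas_on I A u \<and>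
     (\<integral>\<^sup>+t\<in>I. (L2_sqnorm A (u t) + Hs_sqseminorm s A (u t)) \<partial>lebesgue) < \<infinity>"

definition L2_Hsloc ::
    "real \<Rightarrow> real set \<Rightarrow> 'a::euclidean_space set \<Rightarrow> (real \<Rightarrow> 'a \<Rightarrow> real) \<Rightarrow> bool" where
  "L2_Hsloc s I \<Omega> u \<longleftrightarrow>
     (\<forall>A. open A \<and> compact (closure A) \<and> closure A \<subseteq> \<Omega> \<longrightarrow> L2_Hs s I A u)"

text \<open>
  Local integrability in $x$ is implied, since the weight is bounded below on bounded sets.
\<close>

definition L1_L1w :: "real \<Rightarrow> real set \<Rightarrow> (real \<Rightarrow> 'a::euclidean_space \<Rightarrow> real) \<Rightarrow> bool" where
  "L1_L1w s I u \<longleftrightarrow> meas_on I UNIV u \<and>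
     (\<integral>\<^sup>+t\<in>I. (\<integral>\<^sup>+x. ennreal (\<bar>u t x\<bar> * tail_weight s x) \<partial>lebesgue) \<partial>lebesgue) < \<infinity>"

definition solution_class ::
    "real \<Rightarrow> real set \<Rightarrow> 'a::euclidean_space set \<Rightarrow> (real \<Rightarrow> 'a \<Rightarrow> real) \<Rightarrow> bool" where
  "solution_class s I \<Omega> u \<longleftrightarrow> Linf_L2loc I \<Omega> u \<and> L2_Hsloc s I \<Omega> u \<and> L1_L1w s I u"

definition L2_L2 :: "real set \<Rightarrow> 'a::euclidean_space set \<Rightarrow> (real \<Rightarrow> 'a \<Rightarrow> real) \<Rightarrow> bool" where
  "L2_L2 I \<Omega> u \<longleftrightarrow> meas_on I \<Omega> u \<and> (\<integral>\<^sup>+t\<in>I. L2_sqnorm \<Omega> (u t) \<partial>lebesgue) < \<infinity>"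

definition Cc_infinity :: "real set \<Rightarrow> (real \<Rightarrow> real) set" where
  "Cc_infinity I = {\<eta>. (\<forall>k. (deriv ^^ k) \<eta> differentiable_on UNIV) \<and>
     compact (closure {t. \<eta> t \<noteq> 0}) \<and> closure {t. \<eta> t \<noteq> 0} \<subseteq> I}"

text \<open>
  \<open>H1_L2 I \<Omega> \<phi> g\<close>: $\phi \in H^1(I;L^2(\Omega))$ for an open interval $I$, with weak time derivative
  $\partial_t \phi = g$. The two time integrals are $L^2(\Omega)$-valued Bochner integrals, compared
  as elements of $L^2(\Omega)$.
\<close>

definition H1_L2 :: "real set \<Rightarrow> 'a::euclidean_space set \<Rightarrow>
    (real \<Rightarrow> 'a \<Rightarrow> real) \<Rightarrow> (real \<Rightarrow> 'a \<Rightarrow> real) \<Rightarrow> bool" where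
  "H1_L2 I \<Omega> \<phi> g \<longleftrightarrow> L2_L2 I \<Omega> \<phi> \<and> L2_L2 I \<Omega> g \<and>
     (\<forall>\<eta>\<in>Cc_infinity I. AE x in lebesgue_on \<Omega>.
        (LINT t:I|lebesgue. deriv \<eta> t * \<phi> t x) = - (LINT t:I|lebesgue. \<eta> t * g t x))"

text \<open>
  \<open>I\<close> is an open interval and \<open>\<Omega>\<close> a bounded domain, and test functions are extended by zero to
  all of $R \times R^d$. The support is closed in $R \times R^d$, so test functions vanish near
  both ends of \<open>I\<close>. As \<open>\<phi>\<close> vanishes outside \<open>\<Omega>\<close>, so does its time derivative \<open>g\<close>, and the first
  integral is taken over \<open>I \<times> \<Omega>\<close>. For \<open>u\<close> in the solution class all integrals below converge
  absolutely, hence double integrals may be taken over the product space.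
\<close>

definition weak_supersolution :: "real \<Rightarrow> (real \<Rightarrow> 'a::euclidean_space \<Rightarrow> 'a \<Rightarrow> ennreal) \<Rightarrow>
    real set \<Rightarrow> 'a set \<Rightarrow> (real \<Rightarrow> 'a \<Rightarrow> real) \<Rightarrow> bool" where
  "weak_supersolution s K I \<Omega> u \<longleftrightarrow> solution_class s I \<Omega> u \<and>
     (\<forall>\<phi> g. H1_L2 I \<Omega> \<phi> g \<and> L2_Hs s I UNIV \<phi> \<and> (\<forall>t x. \<phi> t x \<ge> 0) \<and>
            closure {(t, x). \<phi> t x \<noteq> 0} \<subseteq> I \<times> \<Omega> \<longrightarrow>
        - (LINT (t, x):I \<times> \<Omega>|lebesgue. u t x * g t x)
          + (LINT t:I|lebesgue. energy (K t) (u t) (\<phi> t)) \<ge> 0)"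

definition weak_subsolution :: "real \<Rightarrow> (real \<Rightarrow> 'a::euclidean_space \<Rightarrow> 'a \<Rightarrow> ennreal) \<Rightarrow>
    real set \<Rightarrow> 'a set \<Rightarrow> (real \<Rightarrow> 'a \<Rightarrow> real) \<Rightarrow> bool" where
  "weak_subsolution s K I \<Omega> u \<longleftrightarrow> weak_supersolution s K I \<Omega> (\<lambda>t x. - u t x)"

definition weak_solution :: "real \<Rightarrow> (real \<Rightarrow> 'a::euclidean_space \<Rightarrow> 'a \<Rightarrow> ennreal) \<Rightarrow>
    real set \<Rightarrow> 'a set \<Rightarrow> (real \<Rightarrow> 'a \<Rightarrow> real) \<Rightarrow> bool" where
  "weak_solution s K I \<Omega> u \<longleftrightarrow> weak_supersolution s K I \<Omega> u \<and> weak_subsolution s K I \<Omega> u"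

definition global_weak_solution :: "real \<Rightarrow> (real \<Rightarrow> 'a::euclidean_space \<Rightarrow> 'a \<Rightarrow> ennreal) \<Rightarrow>
    real set \<Rightarrow> (real \<Rightarrow> 'a \<Rightarrow> real) \<Rightarrow> bool" where
  "global_weak_solution s K I u \<longleftrightarrow>
     solution_class s I UNIV u \<and> (\<forall>R>0. weak_solution s K I (ball 0 R) u)"

text \<open>
  Nonnegative Radon measures on a Euclidean space: inner and outer regularity are automatic.
\<close>

definition radon_measure :: "'a::euclidean_space measure \<Rightarrow> bool" where
  "radon_measure \<mu> \<longleftrightarrow> sets \<mu> = sets borel \<and> (\<forall>C. compact C \<longrightarrow> emeasure \<mu> C < \<infinity>)"

definition cauchy_solution :: "real \<Rightarrow> (real \<Rightarrow> 'a::euclidean_space \<Rightarrow> 'a \<Rightarrow> ennreal) \<Rightarrow>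
    real \<Rightarrow> 'a measure \<Rightarrow> (real \<Rightarrow> 'a \<Rightarrow> real) \<Rightarrow> bool" where
  "cauchy_solution s K T \<mu> u \<longleftrightarrow>
     (\<forall>\<epsilon>\<in>{0<..<T}. global_weak_solution s K {\<epsilon><..<T} u) \<and>
     (\<forall>\<psi>. continuous_on UNIV \<psi> \<and> compact (closure {x. \<psi> x \<noteq> 0}) \<longrightarrow>
        ((\<lambda>t. \<integral>x. \<psi> x * u t x \<partial>lebesgue) \<longlongrightarrow> (\<integral>x. \<psi> x \<partial>\<mu>)) (at_right 0))"

text \<open>
  \<open>v\<close> is a representative of \<open>u\<close> (given on $(0,T) \times R^d$) that is continuous in time on
  $(0,T]$ with values in $L^2_{loc}(R^d)$; it determines the value of \<open>u\<close> at the final time.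
\<close>

definition time_continuous_rep ::
    "real \<Rightarrow> (real \<Rightarrow> 'a::euclidean_space \<Rightarrow> real) \<Rightarrow> (real \<Rightarrow> 'a \<Rightarrow> real) \<Rightarrow> bool" where
  "time_continuous_rep T u v \<longleftrightarrow>
     (AE t in lebesgue_on {0<..<T}. AE x in lebesgue. v t x = u t x) \<and>
     (\<forall>t\<in>{0<..T}. v t \<in> borel_measurable lebesgue \<and>
        (\<forall>C. compact C \<longrightarrow> L2_sqnorm C (v t) < \<infinity> \<and>
           ((\<lambda>\<tau>. L2_sqnorm C (\<lambda>x. v \<tau> x - v t x)) \<longlongrightarrow> 0) (at t within {0<..T})))"

end

theory Submission imports Defs begin

text \<open>The difference \<open>u\<close> of two solutions has zero initial data. Testing its equation with \<open>\<xi>\<^sup>2 u\<close>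
  on \<open>ball x0 2\<close> (a doubling of the time variable replaces time regularity) gives a Caccioppoli
  inequality in which the far field enters through the tail \<open>\<integral>\<bar>u\<bar> w(x - x0) dx\<close> times the local L1
  norm. A Nash-type inequality and an iteration over the radii between 1 and 2 turn this into
  \<open>sup\<^bsub>\<tau>\<le>t\<^esub> \<parallel>u(\<tau>)\<parallel> \<le> C \<integral>\<^bsub>0\<^esub>\<^bsup>t\<^esup>\<integral>\<bar>u\<bar> w(x - x0) dx d\<tau>\<close> in \<open>L\<^sup>2\<close> of the unit ball about \<open>x0\<close>.
  Integrating against \<open>w(x0) dx0\<close> bounds the weighted mass \<open>\<integral>\<bar>u(t)\<bar> w dx\<close> by a constant times its
  time integral over \<open>(0, t)\<close>, so it vanishes.\<close>

section \<open>Translations in L2\<close>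

text \<open>Two obstacles shape the proof. The far field is controlled only in L1 in time, so the
  product of tail and local L1 norm has to be estimated with the supremum in time of the local L2
  norm, the very quantity to be bounded; since that norm enters there only to the first power,
  Young's inequality absorbs it. The other error, the commutator of cutoff and form, is quadratic in
  \<open>u\<close> with a large factor; two chained cutoff steps and the Nash inequality at a small
  radius h make it small, at the price of negative powers of the gap between the radii. The weight
  (2 - r)^(-N) pays for this loss. Boundedness of \<open>u\<close> in time with values in local L2
  starts the iteration: the starting bound may depend on the centre, but it is halved at each step
  and leaves no trace, so the final constant is the same for all centres, which is what permits
  integrating over \<open>x0\<close>. The same boundedness allows zero initial data, known against
  continuous functions, to be tested with merely square-integrable ones.\<close>

lemma nn_integral_translate:
  fixes f :: "'c::euclidean_space \<Rightarrow> ennreal"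
  assumes [measurable]: "f \<in> borel_measurable borel"
  shows "(\<integral>\<^sup>+x. f (x + h) \<partial>lborel) = (\<integral>\<^sup>+x. f x \<partial>lborel)"
proof -
  have "(\<integral>\<^sup>+x. f x \<partial>lborel) = (\<integral>\<^sup>+x. f x \<partial>(distr lborel borel ((+) h)))"
    by (simp add: lborel_distr_plus)
  also have "\<dots> = (\<integral>\<^sup>+x. f (h + x) \<partial>lborel)"
    by (rule nn_integral_distr) auto
  finally show ?thesis by (simp add: add.commute)
qed

text \<open>A measurable function is an a.e. limit of continuous ones. Forcing these into the range
  and near the support of \<open>f\<close> keeps them continuous and supplies the dominating
  function for convergence in L2.\<close>

lemma L2_approx_continuous_bounded:
  fixes f :: "'c::euclidean_space \<Rightarrow> real"
  assumes [measurable]: "f \<in> borel_measurable borel"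
    and supp: "\<And>x. norm x > R \<Longrightarrow> f x = 0"
    and bd: "\<And>x. \<bar>f x\<bar> \<le> M" and e: "0 < (e::real)"
  obtains g where "continuous_on UNIV g" "\<And>x. norm x > R + 1 \<Longrightarrow> g x = 0"
    "(\<integral>\<^sup>+x. ennreal ((f x - g x)\<^sup>2) \<partial>lborel) < ennreal e"
proof -
  have M: "0 \<le> M" using bd[of 0] by linarith
  have "f \<in> borel_measurable lebesgue"
    using assms(1) by (intro measurable_completion) simp
  then have "f measurable_on UNIV"
    using measurable_on_iff_borel_measurable[of UNIV f] by simp
  then obtain N g where N: "negligible N" and cg: "\<And>n. continuous_on UNIV (g n)"
    and lim: "\<And>x. x \<notin> N \<Longrightarrow> (\<lambda>n. g n x) \<longlonglongrightarrow> f x"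
    unfolding measurable_on_def by auto
  \<comment> \<open>Clamping to [-M, M] and multiplying by a radial cutoff that equals 1 up to
    radius \<open>R\<close> leave the limit \<open>f\<close> unchanged.\<close>
  define h where "h n x = max (-M) (min M (g n x)) * max 0 (min 1 (R + 1 - norm x))" for n x
  have ch: "continuous_on UNIV (h n)" for n
    unfolding h_def by (intro continuous_intros cg)
  have [measurable]: "h n \<in> borel_measurable borel" for n
    using ch by (rule borel_measurable_continuous_onI)
  have hs: "h n x = 0" if "norm x > R + 1" for n x
    using that by (simp add: h_def)
  have hb: "\<bar>h n x\<bar> \<le> M" for n x
  proof -
    have "\<bar>max (-M) (min M (g n x))\<bar> * \<bar>max 0 (min 1 (R + 1 - norm x))\<bar> \<le> M * 1"
      by (rule mult_mono) (use M in auto)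
    then show ?thesis by (simp add: h_def abs_mult)
  qed
  have hl: "(\<lambda>n. h n x) \<longlonglongrightarrow> f x" if "x \<notin> N" for x
  proof -
    have "(\<lambda>n. h n x) \<longlonglongrightarrow> max (-M) (min M (f x)) * max 0 (min 1 (R + 1 - norm x))"
      unfolding h_def by (intro tendsto_intros lim that)
    moreover have "max (-M) (min M (f x)) = f x" using bd[of x] by auto
    moreover have "f x * max 0 (min 1 (R + 1 - norm x)) = f x"
      using supp[of x] by (cases "norm x > R") auto
    ultimately show ?thesis by simp
  qed
  have "AE x in lebesgue. x \<notin> N"
    using N by (simp add: negligible_iff_null_sets AE_not_in)
  then have AEN: "AE x in lborel. x \<notin> N" by (simp add: AE_completion_iff)
  have fin: "(\<integral>\<^sup>+x. ennreal ((2*M)\<^sup>2) * indicator (cball (0::'c) (R + 1)) x \<partial>lborel) < \<infinity>"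
    by (subst nn_integral_cmult_indicator)
       (use emeasure_lborel_cball_finite[of "0::'c" "R + 1"] in
         \<open>auto simp: ennreal_mult_less_top infinity_ennreal_def\<close>)
  have "(\<lambda>n. \<integral>\<^sup>+x. ennreal ((f x - h n x)\<^sup>2) \<partial>lborel) \<longlonglongrightarrow> (\<integral>\<^sup>+x. 0 \<partial>(lborel::'c measure))"
  proof (rule nn_integral_dominated_convergence[OF _ _ _ _ fin])
    show "AE x in lborel. ennreal ((f x - h n x)\<^sup>2) \<le> ennreal ((2*M)\<^sup>2) * indicator (cball 0 (R + 1)) x" for n
    proof (rule AE_I2)
      fix x :: 'c
      have "(f x - h n x)\<^sup>2 \<le> (2*M)\<^sup>2"
        by (rule abs_le_square_iff[THEN iffD1]) (use bd[of x] hb[of n x] M in auto)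
      moreover have "f x = 0 \<and> h n x = 0" if "x \<notin> cball 0 (R+1)"
        using that supp[of x] hs[of x n] by auto
      ultimately show "ennreal ((f x - h n x)\<^sup>2) \<le> ennreal ((2*M)\<^sup>2) * indicator (cball 0 (R + 1)) x"
        by (cases "x \<in> cball 0 (R+1)") (auto intro!: ennreal_leI)
    qed
    show "AE x in lborel. (\<lambda>n. ennreal ((f x - h n x)\<^sup>2)) \<longlonglongrightarrow> 0"
      using AEN
    proof eventually_elim
      case (elim x)
      have "(\<lambda>n. ennreal ((f x - h n x)\<^sup>2)) \<longlonglongrightarrow> ennreal ((f x - f x)\<^sup>2)"
        by (intro tendsto_intros tendsto_ennrealI hl elim)
      then show ?case by simp
    qed
  qed (auto intro!: borel_measurable_times_ennreal borel_measurable_indicator)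
  then have "eventually (\<lambda>n. (\<integral>\<^sup>+x. ennreal ((f x - h n x)\<^sup>2) \<partial>lborel) < ennreal e) sequentially"
    using e by (intro order_tendstoD(2)) auto
  then obtain n where "(\<integral>\<^sup>+x. ennreal ((f x - h n x)\<^sup>2) \<partial>lborel) < ennreal e"
    by (auto simp: eventually_sequentially)
  then show ?thesis using that[of "h n"] ch hs by blast
qed

lemma sq_diff_le: "(a - c)\<^sup>2 \<le> 2 * (a - b)\<^sup>2 + 2 * (b - (c::real))\<^sup>2"
  using sum_squares_bound[of "a-b" "b-c"] zero_le_power2[of "a - b - (b - c)"]
  by (simp add: power2_eq_square algebra_simps)

lemma nn_integral_sq_diff_le:
  fixes f g h :: "'c \<Rightarrow> real"
  assumes [measurable]: "f \<in> borel_measurable M" "g \<in> borel_measurable M" "h \<in> borel_measurable M"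
  shows "(\<integral>\<^sup>+x. ennreal ((f x - h x)\<^sup>2) \<partial>M) \<le>
    2 * (\<integral>\<^sup>+x. ennreal ((f x - g x)\<^sup>2) \<partial>M) + 2 * (\<integral>\<^sup>+x. ennreal ((g x - h x)\<^sup>2) \<partial>M)"
proof -
  have "(\<integral>\<^sup>+x. ennreal ((f x - h x)\<^sup>2) \<partial>M) \<le>
    (\<integral>\<^sup>+x. 2 * ennreal ((f x - g x)\<^sup>2) + 2 * ennreal ((g x - h x)\<^sup>2) \<partial>M)"
  proof (rule nn_integral_mono)
    fix x
    have "ennreal ((f x - h x)\<^sup>2) \<le> ennreal (2 * (f x - g x)\<^sup>2 + 2 * (g x - h x)\<^sup>2)"
      by (rule ennreal_leI[OF sq_diff_le])
    then show "ennreal ((f x - h x)\<^sup>2) \<le> 2 * ennreal ((f x - g x)\<^sup>2) + 2 * ennreal ((g x - h x)\<^sup>2)"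
      by (simp add: ennreal_plus ennreal_mult)
  qed
  also have "\<dots> = 2 * (\<integral>\<^sup>+x. ennreal ((f x - g x)\<^sup>2) \<partial>M) + 2 * (\<integral>\<^sup>+x. ennreal ((g x - h x)\<^sup>2) \<partial>M)"
    by (subst nn_integral_add) (auto simp: nn_integral_cmult)
  finally show ?thesis .
qed

text \<open>Truncation at height \<open>n\<close> converges in L2 with the square of
  \<open>f\<close> as dominating function, which reduces the claim to bounded functions.\<close>

lemma L2_approx_continuous:
  fixes f :: "'c::euclidean_space \<Rightarrow> real"
  assumes [measurable]: "f \<in> borel_measurable borel"
    and supp: "\<And>x. norm x > R \<Longrightarrow> f x = 0"
    and fin: "(\<integral>\<^sup>+x. ennreal ((f x)\<^sup>2) \<partial>lborel) < \<infinity>" and e: "0 < (e::real)"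
  obtains g where "continuous_on UNIV g" "\<And>x. norm x > R + 1 \<Longrightarrow> g x = 0"
    "(\<integral>\<^sup>+x. ennreal ((f x - g x)\<^sup>2) \<partial>lborel) < ennreal e"
proof -
  define h where "h n x = max (-real n) (min (real n) (f x))" for n x
  have [measurable]: "h n \<in> borel_measurable borel" for n
    unfolding h_def by measurable
  have "(\<lambda>n. \<integral>\<^sup>+x. ennreal ((f x - h n x)\<^sup>2) \<partial>lborel) \<longlonglongrightarrow> (\<integral>\<^sup>+x. 0 \<partial>(lborel::'c measure))"
  proof (rule nn_integral_dominated_convergence[OF _ _ _ _ fin])
    show "AE x in lborel. ennreal ((f x - h n x)\<^sup>2) \<le> ennreal ((f x)\<^sup>2)" for n
      by (intro AE_I2 ennreal_leI abs_le_square_iff[THEN iffD1]) (auto simp: h_def)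
    show "AE x in lborel. (\<lambda>n. ennreal ((f x - h n x)\<^sup>2)) \<longlonglongrightarrow> 0"
    proof (intro AE_I2 tendsto_eventually)
      fix x
      obtain m where m: "\<bar>f x\<bar> \<le> real m" using real_arch_simple by blast
      show "eventually (\<lambda>n. ennreal ((f x - h n x)\<^sup>2) = 0) sequentially"
        by (rule eventually_sequentiallyI[of m]) (use m in \<open>auto simp: h_def\<close>)
    qed
  qed auto
  then have "eventually (\<lambda>n. (\<integral>\<^sup>+x. ennreal ((f x - h n x)\<^sup>2) \<partial>lborel) < ennreal (e/4)) sequentially"
    using e by (intro order_tendstoD(2)) auto
  then obtain n where n: "(\<integral>\<^sup>+x. ennreal ((f x - h n x)\<^sup>2) \<partial>lborel) < ennreal (e/4)"
    by (auto simp: eventually_sequentially)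
  obtain g where g: "continuous_on UNIV g" "\<And>x. norm x > R + 1 \<Longrightarrow> g x = 0"
    "(\<integral>\<^sup>+x. ennreal ((h n x - g x)\<^sup>2) \<partial>lborel) < ennreal (e/4)"
    by (rule L2_approx_continuous_bounded[of "h n" R "real n" "e/4"])
       (use supp e in \<open>auto simp: h_def\<close>)
  have [measurable]: "g \<in> borel_measurable borel"
    using g(1) by (rule borel_measurable_continuous_onI)
  have "(\<integral>\<^sup>+x. ennreal ((f x - g x)\<^sup>2) \<partial>lborel) \<le>
    2 * (\<integral>\<^sup>+x. ennreal ((f x - h n x)\<^sup>2) \<partial>lborel) + 2 * (\<integral>\<^sup>+x. ennreal ((h n x - g x)\<^sup>2) \<partial>lborel)"
    by (rule nn_integral_sq_diff_le) auto
  also have "\<dots> < 2 * ennreal (e/4) + 2 * ennreal (e/4)"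
    by (intro add_strict_mono ennreal_mult_strict_left_mono n g(3)) auto
  also have "\<dots> = ennreal e"
    using e by (simp flip: ennreal_numeral ennreal_mult ennreal_plus)
  finally show ?thesis using that[of g] g by blast
qed

text \<open>Applied below to functions of (t, x) and of (t, x, y), with shifts in the time direction
  only. It stands in for regularity of \<open>u\<close> in time.\<close>

lemma L2_translation_continuous:
  fixes f :: "'c::euclidean_space \<Rightarrow> real"
  assumes [measurable]: "f \<in> borel_measurable borel"
    and supp: "\<And>x. norm x > R \<Longrightarrow> f x = 0"
    and fin: "(\<integral>\<^sup>+x. ennreal ((f x)\<^sup>2) \<partial>lborel) < \<infinity>" and e: "0 < (e::real)"
  obtains d where "0 < d"
    "\<And>h. norm h < d \<Longrightarrow> (\<integral>\<^sup>+x. ennreal ((f (x + h) - f x)\<^sup>2) \<partial>lborel) < ennreal e"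
proof -
  \<comment> \<open>Bookkeeping: 2 (e/16) + 2 (2 (e/8) + 2 (e/16)) = 7e/8, where e/8 is the share
    that uniform continuity of \<open>g\<close> has to deliver.\<close>
  obtain g where g: "continuous_on UNIV g" "\<And>x. norm x > R + 1 \<Longrightarrow> g x = 0"
    "(\<integral>\<^sup>+x. ennreal ((f x - g x)\<^sup>2) \<partial>lborel) < ennreal (e/16)"
    using L2_approx_continuous[of f R "e/16"] assms by auto
  have [measurable]: "g \<in> borel_measurable borel"
    using g(1) by (rule borel_measurable_continuous_onI)
  define c where "c = measure lborel (cball (0::'c) (R + 2)) + 1"
  have c: "emeasure lborel (cball (0::'c) (R + 2)) \<le> ennreal c" "0 < c"
    using emeasure_eq_ennreal_measure[of lborel "cball (0::'c) (R+2)"]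
      emeasure_lborel_cball_finite[of "0::'c" "R+2"]
    by (auto simp: c_def add_nonneg_pos intro!: ennreal_leI)
  define q where "q = sqrt (e / (8 * c))"
  have q: "0 < q" "q\<^sup>2 = e / (8 * c)" using e c by (auto simp: q_def)
  have "uniformly_continuous_on (cball 0 (R + 3)) g"
    using g(1) by (intro compact_uniformly_continuous continuous_on_subset[OF g(1)]) auto
  then obtain d0 where d0: "0 < d0"
    "\<And>x y. x \<in> cball 0 (R+3) \<Longrightarrow> y \<in> cball 0 (R+3) \<Longrightarrow> dist x y < d0 \<Longrightarrow> dist (g x) (g y) < q"
    using q(1) unfolding uniformly_continuous_on_def by metis
  show ?thesis
  proof (rule that[of "min 1 d0"])
    show "0 < min 1 d0" using d0 by auto
    fix h :: 'c assume h: "norm h < min 1 d0"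
    have gh: "(g (x + h) - g x)\<^sup>2 \<le> q\<^sup>2 * indicator (cball 0 (R+2)) x" for x
    proof (cases "x \<in> cball 0 (R+2)")
      case True
      then have "norm x \<le> R + 2" by simp
      moreover have "norm (x + h) \<le> norm x + norm h" by (rule norm_triangle_ineq)
      ultimately have "norm (x + h) \<le> R + 3" using h by simp
      then have "dist (g (x+h)) (g x) < q"
        using True h \<open>norm (x + h) \<le> R + 3\<close>
        by (intro d0(2)) (simp_all only: mem_cball_0, simp_all add: dist_norm)
      then have "\<bar>g (x + h) - g x\<bar> \<le> \<bar>q\<bar>" using q(1) by (auto simp: dist_real_def)
      then show ?thesis using True by (simp add: abs_le_square_iff)
    next
      case False
      then have "norm x > R + 2" by simp
      moreover have "norm x \<le> norm (x + h) + norm h" using norm_triangle_ineq4[of "x + h" h] by simp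
      ultimately have "g (x + h) = 0" "g x = 0" using h by (auto intro!: g(2))
      then show ?thesis by simp
    qed
    have "(\<integral>\<^sup>+x. ennreal ((g (x + h) - g x)\<^sup>2) \<partial>lborel) \<le>
        (\<integral>\<^sup>+x. ennreal (q\<^sup>2) * indicator (cball 0 (R+2)) x \<partial>(lborel::'c measure))"
    proof (rule nn_integral_mono)
      fix x show "ennreal ((g (x + h) - g x)\<^sup>2) \<le> ennreal (q\<^sup>2) * indicator (cball 0 (R+2)) x"
        using ennreal_leI[OF gh[of x]] by (cases "x \<in> cball 0 (R+2)") auto
    qed
    also have "\<dots> \<le> ennreal (q\<^sup>2) * ennreal c"
      by (subst nn_integral_cmult_indicator) (auto intro!: mult_left_mono c)
    also have "\<dots> = ennreal (e/8)"
      using q c e by (simp flip: ennreal_mult)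
    finally have A: "(\<integral>\<^sup>+x. ennreal ((g (x + h) - g x)\<^sup>2) \<partial>lborel) \<le> ennreal (e/8)" .
    have B: "(\<integral>\<^sup>+x. ennreal ((f (x + h) - g (x + h))\<^sup>2) \<partial>lborel) = (\<integral>\<^sup>+x. ennreal ((f x - g x)\<^sup>2) \<partial>lborel)"
      by (rule nn_integral_translate[of "\<lambda>x. ennreal ((f x - g x)\<^sup>2)"]) auto
    have C: "(\<integral>\<^sup>+x. ennreal ((g x - f x)\<^sup>2) \<partial>lborel) = (\<integral>\<^sup>+x. ennreal ((f x - g x)\<^sup>2) \<partial>lborel)"
      by (simp add: power2_commute)
    have "(\<integral>\<^sup>+x. ennreal ((f (x + h) - f x)\<^sup>2) \<partial>lborel) \<le>
       2 * (\<integral>\<^sup>+x. ennreal ((f (x + h) - g (x + h))\<^sup>2) \<partial>lborel) + 2 * (\<integral>\<^sup>+x. ennreal ((g (x + h) - f x)\<^sup>2) \<partial>lborel)"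
      by (rule nn_integral_sq_diff_le) auto
    also have "(\<integral>\<^sup>+x. ennreal ((g (x + h) - f x)\<^sup>2) \<partial>lborel) \<le>
       2 * (\<integral>\<^sup>+x. ennreal ((g (x + h) - g x)\<^sup>2) \<partial>lborel) + 2 * (\<integral>\<^sup>+x. ennreal ((g x - f x)\<^sup>2) \<partial>lborel)"
      by (rule nn_integral_sq_diff_le) auto
    also have "2 * (\<integral>\<^sup>+x. ennreal ((f (x + h) - g (x + h))\<^sup>2) \<partial>lborel) + 2 * (2 * (\<integral>\<^sup>+x. ennreal ((g (x + h) - g x)\<^sup>2) \<partial>lborel) + 2 * (\<integral>\<^sup>+x. ennreal ((g x - f x)\<^sup>2) \<partial>lborel))
      \<le> 2 * ennreal (e/16) + 2 * (2 * ennreal (e/8) + 2 * ennreal (e/16))"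
      unfolding B C
      by (intro add_mono mult_left_mono A order.strict_implies_order[OF g(3)]) auto
    also have "\<dots> = ennreal (e * (7/8))"
      using e by (simp flip: ennreal_numeral ennreal_mult ennreal_plus)
    also have "\<dots> < ennreal e" using e by (intro ennreal_lessI) simp_all
    finally show "(\<integral>\<^sup>+x. ennreal ((f (x + h) - f x)\<^sup>2) \<partial>lborel) < ennreal e"
      by (simp add: mult_left_mono)
  qed
qed

section \<open>The tail weight and the Riesz kernel\<close>

lemma emeasure_cball_0:
  "0 \<le> r \<Longrightarrow> emeasure lborel (cball (0::'a::euclidean_space) r)
     = ennreal (unit_ball_vol (real DIM('a)) * r powr real DIM('a))"
  by (cases "r = 0") (auto simp: emeasure_cball powr_realpow)

text \<open>One criterion for both ends: growing balls give integrability at infinity, shrinking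
  balls give it at the origin. The exempt point 0 is a null set.\<close>

lemma nn_integral_finite_of_cballs:
  fixes f :: "'a::euclidean_space \<Rightarrow> ennreal" and c r :: "nat \<Rightarrow> real"
  assumes [measurable]: "f \<in> borel_measurable borel"
    and c: "\<And>k. 0 \<le> c k" and r: "\<And>k. 0 \<le> r k"
    and f: "\<And>x. x \<noteq> 0 \<Longrightarrow> 0 < f x \<Longrightarrow> \<exists>k. x \<in> cball 0 (r k) \<and> f x \<le> ennreal (c k)"
    and sm: "summable (\<lambda>k. c k * r k powr real DIM('a))"
  shows "(\<integral>\<^sup>+x. f x \<partial>lborel) < \<infinity>"
proof -
  have "(\<integral>\<^sup>+x. f x \<partial>lborel) \<le> (\<integral>\<^sup>+x. (\<Sum>k. ennreal (c k) * indicator (cball 0 (r k)) x) \<partial>(lborel::'a measure))"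
  proof (rule nn_integral_mono_AE)
    show "AE x in lborel. f x \<le> (\<Sum>k. ennreal (c k) * indicator (cball 0 (r k)) x)"
      using AE_lborel_singleton[of 0]
    proof eventually_elim
      case (elim x)
      show ?case
      proof (cases "f x = 0")
        case False
        then obtain k where k: "x \<in> cball 0 (r k)" "f x \<le> ennreal (c k)"
          using f[OF elim] by (auto simp: zero_less_iff_neq_zero)
        have "(\<Sum>j\<in>{k}. ennreal (c j) * indicator (cball 0 (r j)) x)
            \<le> (\<Sum>j. ennreal (c j) * indicator (cball 0 (r j)) x)"
          by (rule sum_le_suminf) auto
        moreover have "(\<Sum>j\<in>{k}. ennreal (c j) * indicator (cball 0 (r j)) x) = ennreal (c k)"
          using k(1) by (simp del: sum_mult_indicator)
        ultimately show ?thesis using k(2) by (auto intro: order_trans)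
      qed auto
    qed
  qed
  also have "\<dots> = (\<Sum>k. \<integral>\<^sup>+x. ennreal (c k) * indicator (cball 0 (r k)) x \<partial>(lborel::'a measure))"
    by (rule nn_integral_suminf) (auto intro!: borel_measurable_times_ennreal borel_measurable_indicator)
  also have "\<dots> = (\<Sum>k. ennreal (unit_ball_vol (real DIM('a)) * (c k * r k powr real DIM('a))))"
  proof (rule suminf_cong)
    fix k
    show "(\<integral>\<^sup>+x. ennreal (c k) * indicator (cball 0 (r k)) x \<partial>(lborel::'a measure))
       = ennreal (unit_ball_vol (real DIM('a)) * (c k * r k powr real DIM('a)))"
      by (subst nn_integral_cmult_indicator)
         (use c[of k] r[of k] in \<open>auto simp: emeasure_cball_0 ennreal_mult[symmetric] mult_ac\<close>)
  qed
  also have "\<dots> = ennreal (\<Sum>k. unit_ball_vol (real DIM('a)) * (c k * r k powr real DIM('a)))"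
    by (rule suminf_ennreal2) (auto intro!: mult_nonneg_nonneg c summable_mult sm)
  also have "\<dots> < \<infinity>" by simp
  finally show ?thesis .
qed

lemma tail_weight_pos: "0 < tail_weight s (x::'a::euclidean_space)"
  by (auto simp: tail_weight_def add_pos_nonneg order_less_le[of 0] add_nonneg_eq_0_iff)

lemma tail_weight_measurable [measurable]:
  "(tail_weight s :: 'a::euclidean_space \<Rightarrow> real) \<in> borel_measurable borel"
  unfolding tail_weight_def by measurable

text \<open>From one dyadic ball to the next the weight loses a factor 2^(d + 2s) while the volume
  gains 2^d; what remains is a geometric series of ratio 2^(-2s).\<close>

lemma tail_weight_integrable:
  assumes s: "0 < s"
  shows "(\<integral>\<^sup>+x. ennreal (tail_weight s x) \<partial>(lborel::'a::euclidean_space measure)) < \<infinity>"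
proof (rule nn_integral_finite_of_cballs
    [where c = "\<lambda>k. 2 powr (real DIM('a) + 2 * s) * (2 powr real k) powr (- real DIM('a) - 2 * s)"
       and r = "\<lambda>k. 2 powr real k"])
  let ?D = "real DIM('a) + 2 * s"
  show "\<exists>k. x \<in> cball 0 (2 powr real k) \<and> ennreal (tail_weight s x)
     \<le> ennreal (2 powr ?D * (2 powr real k) powr (- real DIM('a) - 2 * s))" for x :: 'a
  proof (cases "norm x \<le> 1")
    case True
    have "tail_weight s x \<le> (1 + norm x) powr 0"
      unfolding tail_weight_def by (rule powr_mono) (use s in auto)
    also have "\<dots> \<le> 2 powr ?D"
      using s norm_ge_zero[of x] by (auto intro!: ge_one_powr_ge_zero)
    finally show ?thesis using True by (intro exI[of _ 0]) (auto intro!: ennreal_leI)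
  next
    case False
    define k where "k = nat \<lceil>log 2 (norm x)\<rceil>"
    have l: "0 < log 2 (norm x)" using False by (intro zero_less_log_cancel_iff[THEN iffD2]) auto
    have k: "log 2 (norm x) \<le> real k" "real k < log 2 (norm x) + 1"
      using l by (auto simp: k_def) linarith+
    have n: "norm x = 2 powr log 2 (norm x)" using False by (intro powr_log_cancel[symmetric]) auto
    have 1: "norm x \<le> 2 powr real k" by (subst n) (use k in simp)
    have "2 powr (real k - 1) \<le> 2 powr (log 2 (norm x))" using k by simp
    then have 2: "2 powr (real k - 1) \<le> 1 + norm x" using n by linarith
    have "tail_weight s x \<le> (2 powr (real k - 1)) powr (- real DIM('a) - 2 * s)"
      unfolding tail_weight_def by (rule powr_mono2') (use s 2 in auto)
    also have "\<dots> = 2 powr ?D * (2 powr real k) powr (- real DIM('a) - 2 * s)"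
      by (simp add: powr_powr powr_add[symmetric] algebra_simps)
    finally show ?thesis using 1 by (intro exI[of _ k]) (auto intro!: ennreal_leI)
  qed
  have "2 powr ?D * (2 powr real k) powr (- real DIM('a) - 2 * s) * (2 powr real k) powr real DIM('a)
      = 2 powr ?D * (2 powr (- 2 * s)) ^ k" for k
    by (simp add: powr_powr powr_add[symmetric] powr_realpow[symmetric] algebra_simps)
  moreover have "summable (\<lambda>k. 2 powr ?D * (2 powr (- 2 * s)) ^ k)"
    by (intro summable_mult summable_geometric) (use s in \<open>auto simp: powr_less_one\<close>)
  ultimately show "summable (\<lambda>k. 2 powr ?D * (2 powr real k) powr (- real DIM('a) - 2 * s) * (2 powr real k) powr real DIM('a))"
    by (simp only:)
qed auto

text \<open>The comparison kernel of (U) and (C), with value 0 at the origin because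
  \<open>0 powr a = 0\<close>. A nonnegative kernel bounded by a multiple of it vanishes on the
  diagonal, which is a null set.\<close>

definition riesz :: "real \<Rightarrow> 'a::euclidean_space \<Rightarrow> real" where
  "riesz s z = norm z powr (- real DIM('a) - 2 * s)"

lemma riesz_nonneg [simp]: "0 \<le> riesz s z" by (simp add: riesz_def)
lemma riesz_0 [simp]: "riesz s 0 = 0" by (simp add: riesz_def)
lemma riesz_minus: "riesz s (x - y) = riesz s (y - x)"
  by (simp add: riesz_def norm_minus_commute)
lemma riesz_measurable [measurable]:
  "(riesz s :: 'a::euclidean_space \<Rightarrow> real) \<in> borel_measurable borel"
  unfolding riesz_def by measurable

text \<open>Here s < 1 enters: the integrand is |z|^(2 - 2s) |z|^(-d), the volume of a dyadic ball
  compensates the second power, and the first one is summable over shrinking radii.\<close>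

lemma riesz_second_moment:
  assumes s: "s < 1" and R: "0 < R"
  shows "(\<integral>\<^sup>+z. ennreal ((norm z)\<^sup>2 * riesz s z) * indicator (cball 0 R) z
    \<partial>(lborel::'a::euclidean_space measure)) < \<infinity>"
proof (rule nn_integral_finite_of_cballs
    [where c = "\<lambda>k. (R * 2 powr (- real k)) powr (2 - 2 * s) * (R * 2 powr (- real k - 1)) powr (- real DIM('a))"
       and r = "\<lambda>k. R * 2 powr (- real k)"])
  let ?d = "real DIM('a)"
  show "(\<lambda>z::'a. ennreal ((norm z)\<^sup>2 * riesz s z) * indicator (cball 0 R) z) \<in> borel_measurable borel"
    by (intro borel_measurable_times_ennreal borel_measurable_indicator) auto
  show "\<exists>k. z \<in> cball 0 (R * 2 powr (- real k)) \<and>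
      ennreal ((norm z)\<^sup>2 * riesz s z) * indicator (cball 0 R) z
     \<le> ennreal ((R * 2 powr (- real k)) powr (2 - 2 * s) * (R * 2 powr (- real k - 1)) powr (- ?d))"
    if z: "z \<noteq> 0" and pos: "0 < ennreal ((norm z)\<^sup>2 * riesz s z) * indicator (cball 0 R) z" for z :: 'a
  proof -
    have zR: "norm z \<le> R" using pos by (cases "norm z \<le> R") auto
    have nz: "0 < norm z" using z by simp
    define l where "l = log 2 (R / norm z)"
    have l0: "0 \<le> l" using zR nz R by (simp add: l_def)
    have l2: "norm z = R * 2 powr (-l)"
      using nz R by (simp add: l_def powr_minus)
    define k where "k = nat \<lfloor>l\<rfloor>"
    have k: "real k \<le> l" "l < real k + 1" using l0 by (auto simp: k_def)
    have 1: "norm z \<le> R * 2 powr (- real k)" using l2 k R by simp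
    have 2: "R * 2 powr (- real k - 1) \<le> norm z" using l2 k R by simp
    \<comment> \<open>The two powers are monotone in opposite directions, so the first is estimated
      by the outer and the second by the inner radius of the dyadic shell.\<close>
    have "(norm z)\<^sup>2 * riesz s z = norm z powr (2 - 2 * s) * norm z powr (- ?d)"
      using nz by (simp add: riesz_def powr_numeral[symmetric] powr_add[symmetric] algebra_simps del: powr_numeral)
    also have "\<dots> \<le> (R * 2 powr (- real k)) powr (2 - 2 * s) * (R * 2 powr (- real k - 1)) powr (- ?d)"
      by (intro mult_mono powr_mono2 powr_mono2' 1 2) (use s R in auto)
    finally show ?thesis using 1 by (intro exI[of _ k]) (auto simp: indicator_def intro!: ennreal_leI)
  qed
  have "(R * 2 powr (- real k)) powr (2 - 2 * s) * (R * 2 powr (- real k - 1)) powr (- ?d) * (R * 2 powr (- real k)) powr ?d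
      = (R powr (2 - 2 * s) * 2 powr ?d) * (2 powr (-(2 - 2 * s))) ^ k" for k
    using R by (simp add: powr_mult powr_powr powr_add[symmetric] powr_realpow[symmetric] field_simps)
  moreover have "summable (\<lambda>k. (R powr (2 - 2 * s) * 2 powr ?d) * (2 powr (-(2 - 2 * s))) ^ k)"
    by (intro summable_mult summable_geometric) (use s in \<open>auto simp: powr_less_one\<close>)
  ultimately show "summable (\<lambda>k. (R * 2 powr (- real k)) powr (2 - 2 * s) * (R * 2 powr (- real k - 1)) powr (- ?d) * (R * 2 powr (- real k)) powr ?d)"
    by simp
qed (use R in auto)

text \<open>In the application z joins a point of the cutoff's support to a far point and y is the
  far point seen from the centre. The lower bound \<delta> for |z| turns 1 + |y| into at most 4 |z|
  / \<delta>.\<close>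

lemma riesz_le_tail_weight:
  fixes z y :: "'a::euclidean_space"
  assumes s: "0 < s" and \<delta>: "0 < \<delta>" "\<delta> \<le> 1" and z: "\<delta> \<le> norm z" and y: "norm y \<le> norm z + 2"
  shows "riesz s z \<le> (4 / \<delta>) powr (real DIM('a) + 2 * s) * tail_weight s y"
proof -
  have "1 + norm y \<le> norm z + 3" using y by simp
  also have "3 \<le> 3 * (norm z / \<delta>)" using z \<delta> by (simp add: pos_le_divide_eq)
  also have "norm z + 3 * (norm z / \<delta>) \<le> norm z / \<delta> + 3 * (norm z / \<delta>)"
    using \<delta> z by (intro add_right_mono) (simp add: le_divide_eq mult_left_le)
  finally have *: "(1 + norm y) * (\<delta>/4) \<le> norm z" using \<delta> by (simp add: field_simps)
  have "riesz s z \<le> ((1 + norm y) * (\<delta>/4)) powr (- real DIM('a) - 2 * s)"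
    unfolding riesz_def by (rule powr_mono2') (use s \<delta> * in \<open>auto intro!: mult_pos_pos add_pos_nonneg\<close>)
  also have "\<dots> = (4 / \<delta>) powr (real DIM('a) + 2 * s) * tail_weight s y"
  proof -
    have "(\<delta>/4) powr (- real DIM('a) - 2 * s) = (4 / \<delta>) powr (real DIM('a) + 2 * s)"
      using \<delta> powr_minus_divide[of "\<delta>/4" "real DIM('a) + 2 * s"]
      by (simp add: powr_divide)
    then show ?thesis
      using \<delta> powr_mult[of "1 + norm y" "\<delta>/4" "- real DIM('a) - 2 * s"]
      by (simp add: tail_weight_def mult.commute)
  qed
  finally show ?thesis .
qed

text \<open>A Peetre-type inequality: 1 + |y| \<le> (1 + |x|) (1 + |y - x|).\<close>

lemma tail_weight_mult_le:
  fixes x y :: "'a::euclidean_space"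
  assumes s: "0 < s"
  shows "tail_weight s (y - x) \<le> (1 + norm x) powr (real DIM('a) + 2 * s) * tail_weight s y"
proof -
  have "norm y \<le> norm (y - x) + norm x" using norm_triangle_ineq[of "y - x" x] by simp
  then have "1 + norm y \<le> (1 + norm x) * (1 + norm (y - x))"
    using mult_nonneg_nonneg[OF norm_ge_zero[of x] norm_ge_zero[of "y-x"]]
    unfolding distrib_left distrib_right by linarith
  then have *: "(1 + norm y) / (1 + norm x) \<le> 1 + norm (y - x)"
    by (simp add: divide_le_eq add_pos_nonneg mult.commute)
  have "tail_weight s (y - x) \<le> ((1 + norm y) / (1 + norm x)) powr (- real DIM('a) - 2 * s)"
    unfolding tail_weight_def by (rule powr_mono2') (use s * in \<open>auto intro!: divide_pos_pos add_pos_nonneg\<close>)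
  also have "\<dots> = (1 + norm x) powr (real DIM('a) + 2 * s) * tail_weight s y"
  proof -
    have "(1 + norm x) powr (- real DIM('a) - 2 * s) = 1 / (1 + norm x) powr (real DIM('a) + 2 * s)"
      using powr_minus_divide[of "1 + norm x" "real DIM('a) + 2 * s"] by simp
    then show ?thesis by (simp add: tail_weight_def powr_divide add_nonneg_nonneg)
  qed
  finally show ?thesis .
qed

text \<open>As y is the sum of x and y - x, one of them has at least half the norm of y. The weight
  there is comparable to the weight at y, and the other factor is integrated.\<close>

lemma tail_weight_convolution:
  assumes s: "0 < s"
  shows "(\<integral>\<^sup>+x. ennreal (tail_weight s x * tail_weight s (y - x)) \<partial>lborel) \<le>
    ennreal (2 * 2 powr (real DIM('a) + 2 * s)) * (\<integral>\<^sup>+x. ennreal (tail_weight s x) \<partial>(lborel::'a measure))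
     * ennreal (tail_weight s (y::'a::euclidean_space))"
proof -
  let ?c = "2 powr (real DIM('a) + 2 * s)"
  have half: "tail_weight s v \<le> ?c * tail_weight s y" if "norm y \<le> 2 * norm v" for v :: 'a
  proof -
    have "tail_weight s v \<le> ((1 + norm y) / 2) powr (- real DIM('a) - 2 * s)"
      unfolding tail_weight_def by (rule powr_mono2') (use s that norm_ge_zero[of y] in \<open>auto simp: add_pos_nonneg\<close>)
    also have "\<dots> = ?c * tail_weight s y"
      using powr_minus_divide[of 2 "real DIM('a) + 2 * s"]
      by (simp add: tail_weight_def powr_divide add_nonneg_nonneg)
    finally show ?thesis .
  qed
  have pt: "tail_weight s x * tail_weight s (y - x) \<le>
      ?c * tail_weight s y * tail_weight s x + ?c * tail_weight s y * tail_weight s (y - x)" for x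
  proof (cases "norm y \<le> 2 * norm x")
    case True
    have "tail_weight s x * tail_weight s (y - x) \<le> (?c * tail_weight s y) * tail_weight s (y - x)"
      by (intro mult_right_mono half True) (auto intro: less_imp_le tail_weight_pos)
    moreover have "0 \<le> ?c * tail_weight s y * tail_weight s x"
      by (intro mult_nonneg_nonneg) (auto intro: less_imp_le tail_weight_pos)
    ultimately show ?thesis by linarith
  next
    case False
    then have "norm y \<le> 2 * norm (y - x)" using norm_triangle_ineq[of "y - x" x] by simp
    then have "tail_weight s x * tail_weight s (y - x) \<le> tail_weight s x * (?c * tail_weight s y)"
      by (intro mult_left_mono half) (auto intro: less_imp_le tail_weight_pos)
    moreover have "0 \<le> ?c * tail_weight s y * tail_weight s (y - x)"
      by (intro mult_nonneg_nonneg) (auto intro: less_imp_le tail_weight_pos)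
    ultimately show ?thesis by (simp add: mult_ac)
  qed
  have t0: "0 \<le> tail_weight s v" for v :: 'a by (auto intro: less_imp_le tail_weight_pos)
  have refl: "(\<integral>\<^sup>+x. ennreal (tail_weight s (y - x)) \<partial>lborel) = (\<integral>\<^sup>+x. ennreal (tail_weight s x) \<partial>(lborel::'a measure))"
  proof -
    have "(\<integral>\<^sup>+x. ennreal (tail_weight s (y - x)) \<partial>lborel) = (\<integral>\<^sup>+x. ennreal (tail_weight s (x + (- y))) \<partial>(lborel::'a measure))"
      by (simp add: tail_weight_def norm_minus_commute)
    also have "\<dots> = (\<integral>\<^sup>+x. ennreal (tail_weight s x) \<partial>(lborel::'a measure))"
      by (rule nn_integral_translate[of "\<lambda>x. ennreal (tail_weight s x)"]) auto
    finally show ?thesis .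
  qed
  have "(\<integral>\<^sup>+x. ennreal (tail_weight s x * tail_weight s (y - x)) \<partial>lborel) \<le>
    (\<integral>\<^sup>+x. ennreal (?c * tail_weight s y) * ennreal (tail_weight s x) + ennreal (?c * tail_weight s y) * ennreal (tail_weight s (y - x)) \<partial>lborel)"
    by (rule nn_integral_mono)
       (use pt t0 in \<open>auto simp: ennreal_mult[symmetric] ennreal_plus[symmetric] simp del: ennreal_plus intro!: ennreal_leI\<close>)
  also have "\<dots> = ennreal (?c * tail_weight s y) * (\<integral>\<^sup>+x. ennreal (tail_weight s x) \<partial>(lborel::'a measure))
     + ennreal (?c * tail_weight s y) * (\<integral>\<^sup>+x. ennreal (tail_weight s (y - x)) \<partial>(lborel::'a measure))"
    by (subst nn_integral_add) (auto simp: nn_integral_cmult)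
  also have "\<dots> = ennreal (2 * ?c) * (\<integral>\<^sup>+x. ennreal (tail_weight s x) \<partial>(lborel::'a measure)) * ennreal (tail_weight s y)"
    unfolding refl using t0[of y] by (simp add: ennreal_mult mult_ac flip: mult_2)
  finally show ?thesis .
qed

section \<open>Cutoffs and the bilinear form\<close>

text \<open>Together with \<open>hsq\<close> the Borel counterpart of \<open>L2_sqnorm\<close> and
  \<open>Hs_sqseminorm\<close>: on \<open>lborel\<close> and with iterated instead of product
  integrals, measurability proofs and Tonelli apply directly. The identification with the Lebesgue
  versions is left to the last section.\<close>

definition l2sq :: "'a::euclidean_space set \<Rightarrow> ('a \<Rightarrow> real) \<Rightarrow> ennreal" where
  "l2sq A v = (\<integral>\<^sup>+x\<in>A. ennreal ((v x)\<^sup>2) \<partial>lborel)"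

definition hsq :: "real \<Rightarrow> 'a::euclidean_space set \<Rightarrow> ('a \<Rightarrow> real) \<Rightarrow> ennreal" where
  "hsq s A v = (\<integral>\<^sup>+x\<in>A. (\<integral>\<^sup>+y\<in>A. ennreal ((v x - v y)\<^sup>2 * riesz s (x - y)) \<partial>lborel) \<partial>lborel)"

definition form :: "('a::euclidean_space \<Rightarrow> 'a \<Rightarrow> real) \<Rightarrow> ('a \<Rightarrow> real) \<Rightarrow> ('a \<Rightarrow> real) \<Rightarrow> real" where
  "form \<kappa> v \<psi> = (\<integral>(x, y). (v x - v y) * (\<psi> x - \<psi> y) * \<kappa> x y \<partial>(lborel \<Otimes>\<^sub>M lborel))"

lemma ball_borel [measurable]: "ball x r \<in> sets borel" "cball x r \<in> sets borel"
  by auto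

lemma l2sq_measurable [measurable (raw)]:
  assumes [measurable]: "(\<lambda>(m, x). f m x) \<in> borel_measurable (M \<Otimes>\<^sub>M borel)" "A \<in> sets borel"
  shows "(\<lambda>m. l2sq A (f m)) \<in> borel_measurable M"
  unfolding l2sq_def by measurable

lemma hsq_measurable [measurable (raw)]:
  assumes [measurable]: "(\<lambda>(m, x). f m x) \<in> borel_measurable (M \<Otimes>\<^sub>M borel)" "A \<in> sets borel"
  shows "(\<lambda>m. hsq s A (f m)) \<in> borel_measurable M"
  unfolding hsq_def by measurable

lemma form_measurable:
  assumes [measurable]: "(\<lambda>(m, x, y). \<kappa> m x y) \<in> borel_measurable (M \<Otimes>\<^sub>M borel \<Otimes>\<^sub>M borel)"
    "(\<lambda>(m, x). v m x) \<in> borel_measurable (M \<Otimes>\<^sub>M borel)"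
    "(\<lambda>(m, x). \<psi> m x) \<in> borel_measurable (M \<Otimes>\<^sub>M borel)"
  shows "(\<lambda>m. form (\<kappa> m) (v m) (\<psi> m)) \<in> borel_measurable M"
proof -
  have [measurable]: "(\<lambda>(p, x, y). \<kappa> p x y) \<in> borel_measurable (M \<Otimes>\<^sub>M lborel \<Otimes>\<^sub>M lborel)"
    using assms(1) by (simp cong: measurable_cong_sets sets_pair_measure_cong)
  show ?thesis
    unfolding form_def case_prod_beta'
    by (measurable, use assms(1) in \<open>simp add: case_prod_beta'\<close>)
qed

lemma nn_integral2_add:
  assumes [measurable]: "(\<lambda>(x, y). f x y) \<in> borel_measurable (borel \<Otimes>\<^sub>M borel)" "(\<lambda>(x, y). g x y) \<in> borel_measurable (borel \<Otimes>\<^sub>M borel)"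
  shows "(\<integral>\<^sup>+x. \<integral>\<^sup>+y. f x y + g x y \<partial>lborel \<partial>lborel) =
    (\<integral>\<^sup>+x. \<integral>\<^sup>+y. f x y \<partial>lborel \<partial>lborel) + (\<integral>\<^sup>+x. \<integral>\<^sup>+y. g x y \<partial>lborel \<partial>lborel)"
proof -
  have "(\<integral>\<^sup>+x. \<integral>\<^sup>+y. f x y + g x y \<partial>lborel \<partial>lborel) = (\<integral>\<^sup>+x. (\<integral>\<^sup>+y. f x y \<partial>lborel) + (\<integral>\<^sup>+y. g x y \<partial>lborel) \<partial>lborel)"
    by (intro nn_integral_cong nn_integral_add) measurable
  also have "\<dots> = (\<integral>\<^sup>+x. \<integral>\<^sup>+y. f x y \<partial>lborel \<partial>lborel) + (\<integral>\<^sup>+x. \<integral>\<^sup>+y. g x y \<partial>lborel \<partial>lborel)"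
    by (rule nn_integral_add) measurable
  finally show ?thesis .
qed

lemma nn_integral2_cmult:
  assumes [measurable]: "(\<lambda>(x, y). f x y) \<in> borel_measurable (borel \<Otimes>\<^sub>M borel)"
  shows "(\<integral>\<^sup>+x. \<integral>\<^sup>+y. c * f x y \<partial>lborel \<partial>lborel) = c * (\<integral>\<^sup>+x. \<integral>\<^sup>+y. f x y \<partial>lborel \<partial>lborel)"
proof -
  have "(\<integral>\<^sup>+x. \<integral>\<^sup>+y. c * f x y \<partial>lborel \<partial>lborel) = (\<integral>\<^sup>+x. c * (\<integral>\<^sup>+y. f x y \<partial>lborel) \<partial>lborel)"
    by (intro nn_integral_cong nn_integral_cmult) measurable
  also have "\<dots> = c * (\<integral>\<^sup>+x. \<integral>\<^sup>+y. f x y \<partial>lborel \<partial>lborel)"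
    by (rule nn_integral_cmult) measurable
  finally show ?thesis .
qed

lemma nn_integral2_indicator:
  assumes [measurable]: "(\<lambda>(x, y). f x y) \<in> borel_measurable (borel \<Otimes>\<^sub>M borel)" "A \<in> sets borel"
  shows "(\<integral>\<^sup>+x\<in>A. (\<integral>\<^sup>+y\<in>A. f x y \<partial>lborel) \<partial>lborel) =
    (\<integral>\<^sup>+x. \<integral>\<^sup>+y. f x y * indicator A y * indicator A x \<partial>lborel \<partial>lborel)"
  by (intro nn_integral_cong nn_integral_multc[symmetric]) measurable

lemma young_real: "0 < \<epsilon> \<Longrightarrow> \<bar>a * b\<bar> \<le> \<epsilon> * a\<^sup>2 + b\<^sup>2 / (\<epsilon>::real)"
proof -
  assume e: "0 < \<epsilon>"
  define c where "c = sqrt \<epsilon>"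
  have c: "0 < c" "\<epsilon> = c\<^sup>2" using e by (auto simp: c_def)
  have "2 * \<bar>(c * a) * (b / c)\<bar> \<le> (c * a)\<^sup>2 + (b / c)\<^sup>2"
    using zero_le_power2[of "c * a - b / c"] zero_le_power2[of "c * a + b / c"]
    by (simp add: abs_if power2_eq_square algebra_simps)
  then show ?thesis using c by (simp add: power_mult_distrib power_divide)
qed

text \<open>All data are Borel and total: \<open>u\<close> is continued by zero outside (0, T), so
  that time integrals and time shifts range over the whole line, and the bounds on \<open>k\<close>
  hold everywhere instead of almost everywhere. No equation is imposed yet; only integrability is
  exploited at this level.\<close>

locale nonlocal_data =
  fixes s T \<Lambda> :: real and k :: "real \<Rightarrow> 'a::euclidean_space \<Rightarrow> 'a \<Rightarrow> real" and u :: "real \<Rightarrow> 'a \<Rightarrow> real"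
  assumes s: "0 < s" "s < 1" and T: "0 < T" and \<Lambda>: "0 < \<Lambda>"
    and k_borel: "(\<lambda>(t, x, y). k t x y) \<in> borel_measurable borel"
    and k_nonneg: "\<And>t x y. 0 \<le> k t x y"
    and k_le: "\<And>t x y. k t x y \<le> \<Lambda> * riesz s (x - y)"
    and u_borel: "(\<lambda>(t, x). u t x) \<in> borel_measurable borel"
    and u_zero: "\<And>t x. t \<le> 0 \<or> T \<le> t \<Longrightarrow> u t x = 0"
    and u_L2: "\<And>R. \<exists>M::real. AE t in lborel. l2sq (ball 0 R) (u t) \<le> ennreal M"
    and u_Hs: "\<And>R. (\<integral>\<^sup>+t. hsq s (ball 0 R) (u t) \<partial>lborel) < \<infinity>"
    and u_L1: "(\<integral>\<^sup>+t. (\<integral>\<^sup>+x. ennreal (\<bar>u t x\<bar> * tail_weight s x) \<partial>lborel) \<partial>lborel) < \<infinity>"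
begin

lemma k_measurable [measurable (raw)]:
  assumes "f \<in> borel_measurable M" "g \<in> borel_measurable M" "h \<in> borel_measurable M"
  shows "(\<lambda>m. k (f m) (g m) (h m)) \<in> borel_measurable M"
  using measurable_compose[OF borel_measurable_Pair[OF assms(1) borel_measurable_Pair[OF assms(2,3)]] k_borel]
  by simp

lemma u_measurable [measurable (raw)]:
  assumes "f \<in> borel_measurable M" "g \<in> borel_measurable M"
  shows "(\<lambda>m. u (f m) (g m)) \<in> borel_measurable M"
  using measurable_compose[OF borel_measurable_Pair[OF assms] u_borel] by simp

end

text \<open>Three concentric radii: the cutoff equals 1 up to \<open>r\<close> and 0 from r +
  \<delta> on, and a second gap \<delta> separates its support from the complement of the ball
  \<open>B\<close>. The outer radius stays at most 2, which makes constants independent of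
  \<open>r\<close> available.\<close>

locale nonlocal_ball = nonlocal_data s T \<Lambda> k u
  for s T \<Lambda> and k :: "real \<Rightarrow> 'a::euclidean_space \<Rightarrow> 'a \<Rightarrow> real" and u +
  fixes x0 :: 'a and r \<delta> :: real
  assumes r: "0 \<le> r" and \<delta>: "0 < \<delta>" "\<delta> \<le> 1" and r\<delta>: "r + 2 * \<delta> \<le> 2"
begin

definition B :: "'a set" where "B = ball x0 (r + 2 * \<delta>)"

lemma mem_B [simp]: "x \<in> B \<longleftrightarrow> dist x0 x < r + 2 * \<delta>" by (simp add: B_def)

lemma B_borel [measurable]: "B \<in> sets borel" by (simp add: B_def)

definition \<xi> :: "'a \<Rightarrow> real" where "\<xi> x = max 0 (min 1 ((r + \<delta> - dist x0 x) / \<delta>))"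

definition C\<^sub>\<delta> :: real where "C\<^sub>\<delta> = (4 / \<delta>) powr (real DIM('a) + 2 * s)"

definition tl :: "real \<Rightarrow> ennreal" where
  "tl t = (\<integral>\<^sup>+y. ennreal (\<bar>u t y\<bar> * tail_weight s (y - x0)) \<partial>lborel)"

lemma \<xi>_borel [measurable]: "\<xi> \<in> borel_measurable borel"
  unfolding \<xi>_def by measurable

lemma \<xi>_bounds: "0 \<le> \<xi> x" "\<xi> x \<le> 1" by (auto simp: \<xi>_def)

lemma \<xi>_eq_0: "r + \<delta> \<le> dist x0 x \<Longrightarrow> \<xi> x = 0"
  using \<delta> divide_nonpos_pos[of "r + \<delta> - dist x0 x" \<delta>] unfolding \<xi>_def by linarith

lemma \<xi>_eq_1: "dist x0 x \<le> r \<Longrightarrow> \<xi> x = 1"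
  using \<delta> by (auto simp: \<xi>_def max_def min_def field_simps)

lemma \<xi>_lipschitz: "\<bar>\<xi> x - \<xi> y\<bar> \<le> 1 / \<delta> * norm (x - y)"
proof -
  have "\<bar>\<xi> x - \<xi> y\<bar> \<le> \<bar>(r + \<delta> - dist x0 x) / \<delta> - (r + \<delta> - dist x0 y) / \<delta>\<bar>"
    unfolding \<xi>_def by linarith
  also have "\<dots> = \<bar>dist x0 y - dist x0 x\<bar> / \<delta>"
    using \<delta> by (simp add: diff_divide_distrib[symmetric] abs_divide)
  also have "\<dots> \<le> norm (x - y) / \<delta>"
    using \<delta> dist_triangle[of x0 y x] dist_triangle[of x0 x y]
    by (intro divide_right_mono) (auto simp: dist_commute abs_le_iff simp flip: dist_norm)
  finally show ?thesis by simp
qed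

lemma C\<^sub>\<delta>_nonneg [simp]: "0 \<le> C\<^sub>\<delta>" by (simp add: C\<^sub>\<delta>_def)

text \<open>The support of the cutoff is at distance at least \<delta> from the complement of
  \<open>B\<close>, so the singularity is not met and the kernel is comparable to the tail weight
  centred at \<open>x0\<close>.\<close>

lemma riesz_far:
  assumes "dist x0 x \<le> r + \<delta>" "y \<notin> B"
  shows "riesz s (x - y) \<le> C\<^sub>\<delta> * tail_weight s (y - x0)"
  unfolding C\<^sub>\<delta>_def
proof (rule riesz_le_tail_weight)
  have "r + 2 * \<delta> \<le> dist x0 y" using assms by simp
  also have "\<dots> \<le> dist x0 x + norm (x - y)" using dist_triangle[of x0 y x] by (simp add: dist_norm)
  finally show "\<delta> \<le> norm (x - y)" using assms by simp
  have "norm (y - x0) \<le> norm (x - y) + dist x0 x"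
    using dist_triangle[of x0 y x] by (simp add: dist_norm norm_minus_commute)
  then show "norm (y - x0) \<le> norm (x - y) + 2" using assms r\<delta> \<delta> by simp
qed (use s \<delta> in auto)

text \<open>Two points of \<open>B\<close> are at distance at most 4 because the radius of
  \<open>B\<close> is at most 2; after a translation the bound depends neither on the position nor
  on the size of \<open>B\<close>.\<close>

lemma riesz_second_moment_B:
  assumes y: "y \<in> B"
  shows "(\<integral>\<^sup>+x\<in>B. ennreal ((norm (x - y))\<^sup>2 * riesz s (x - y)) \<partial>lborel) \<le>
    (\<integral>\<^sup>+z. ennreal ((norm z)\<^sup>2 * riesz s z) * indicator (cball 0 4) z \<partial>(lborel :: 'a measure))"
proof -
  have "(\<integral>\<^sup>+x\<in>B. ennreal ((norm (x - y))\<^sup>2 * riesz s (x - y)) \<partial>lborel) \<le>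
    (\<integral>\<^sup>+x. ennreal ((norm (x + (- y)))\<^sup>2 * riesz s (x + (- y))) * indicator (cball 0 4) (x + (- y)) \<partial>(lborel :: 'a measure))"
  proof (rule nn_integral_mono)
    fix x
    have "norm (x - y) \<le> 4" if "x \<in> B"
      using that y r\<delta> dist_triangle2[of x y x0] by (simp add: dist_norm norm_minus_commute)
    then show "ennreal ((norm (x - y))\<^sup>2 * riesz s (x - y)) * indicator B x \<le>
      ennreal ((norm (x + (- y)))\<^sup>2 * riesz s (x + (- y))) * indicator (cball 0 4) (x + (- y))"
      by (auto simp: indicator_def simp del: mem_B)
  qed
  also have "\<dots> = (\<integral>\<^sup>+z. ennreal ((norm z)\<^sup>2 * riesz s z) * indicator (cball 0 4) z \<partial>(lborel :: 'a measure))"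
    by (rule nn_integral_translate[of "\<lambda>z. ennreal ((norm z)\<^sup>2 * riesz s z) * indicator (cball 0 4) z"]) measurable
  finally show ?thesis .
qed

definition J :: ennreal where
  "J = (\<integral>\<^sup>+z. ennreal ((norm z)\<^sup>2 * riesz s z) * indicator (cball 0 4) z \<partial>(lborel :: 'a measure))"

definition W :: ennreal where
  "W = (\<integral>\<^sup>+z. ennreal (tail_weight s z) \<partial>(lborel :: 'a measure))"

lemma J_finite: "J < \<infinity>" unfolding J_def by (rule riesz_second_moment) (use s in auto)
lemma W_finite: "W < \<infinity>" unfolding W_def by (rule tail_weight_integrable) (use s in auto)

lemma W_shift: "(\<integral>\<^sup>+z. ennreal (tail_weight s (z - x0)) \<partial>lborel) = W"
  unfolding W_def using nn_integral_translate[of "\<lambda>z. ennreal (tail_weight s z)" "- x0"] by simp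

text \<open>The Lipschitz bound contributes the squared distance, which makes the kernel integrable
  across the diagonal. Integrating first in the variable that \<open>v\<close> does not see gives
  the factor \<open>J\<close>.\<close>

lemma commutator_bound:
  assumes [measurable]: "v \<in> borel_measurable borel" "p \<in> borel_measurable borel"
    and L: "0 \<le> L" "\<And>x y. \<bar>p x - p y\<bar> \<le> L * norm (x - y)"
  shows "(\<integral>\<^sup>+x\<in>B. (\<integral>\<^sup>+y\<in>B. ennreal ((v y)\<^sup>2 * (p x - p y)\<^sup>2 * riesz s (x - y)) \<partial>lborel) \<partial>lborel)
     \<le> ennreal (L\<^sup>2) * J * l2sq B v"
proof -
  have "(\<integral>\<^sup>+x\<in>B. (\<integral>\<^sup>+y\<in>B. ennreal ((v y)\<^sup>2 * (p x - p y)\<^sup>2 * riesz s (x - y)) \<partial>lborel) \<partial>lborel) \<le>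
    (\<integral>\<^sup>+x. (\<integral>\<^sup>+y. ennreal (L\<^sup>2) * ennreal ((v y)\<^sup>2) * indicator B y * (ennreal ((norm (x - y))\<^sup>2 * riesz s (x - y)) * indicator B x) \<partial>lborel) \<partial>lborel)"
    (is "_ \<le> (\<integral>\<^sup>+x. (\<integral>\<^sup>+y. ?f x y \<partial>lborel) \<partial>lborel)")
  proof (subst nn_integral2_indicator, measurable, intro nn_integral_mono)
    fix x y
    have "(p x - p y)\<^sup>2 \<le> (L * norm (x - y))\<^sup>2"
      using L by (subst abs_le_square_iff[symmetric]) simp
    then have "(v y)\<^sup>2 * (p x - p y)\<^sup>2 * riesz s (x - y) \<le> (v y)\<^sup>2 * (L * norm (x - y))\<^sup>2 * riesz s (x - y)"
      by (intro mult_right_mono mult_left_mono) auto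
    then show "ennreal ((v y)\<^sup>2 * (p x - p y)\<^sup>2 * riesz s (x - y)) * indicator B y * indicator B x \<le> ?f x y"
      by (auto simp: indicator_def ennreal_mult[symmetric] power_mult_distrib mult_ac intro!: ennreal_leI)
  qed
  also have "\<dots> = (\<integral>\<^sup>+y. (\<integral>\<^sup>+x. ?f x y \<partial>lborel) \<partial>lborel)"
    by (rule lborel_pair.Fubini') measurable
  also have "\<dots> = (\<integral>\<^sup>+y. ennreal (L\<^sup>2) * ennreal ((v y)\<^sup>2) * indicator B y * (\<integral>\<^sup>+x\<in>B. ennreal ((norm (x - y))\<^sup>2 * riesz s (x - y)) \<partial>lborel) \<partial>lborel)"
    by (intro nn_integral_cong nn_integral_cmult) measurable
  also have "\<dots> \<le> (\<integral>\<^sup>+y. ennreal (L\<^sup>2) * J * (ennreal ((v y)\<^sup>2) * indicator B y) \<partial>lborel)"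
  proof (intro nn_integral_mono)
    fix y show "ennreal (L\<^sup>2) * ennreal ((v y)\<^sup>2) * indicator B y * (\<integral>\<^sup>+x\<in>B. ennreal ((norm (x - y))\<^sup>2 * riesz s (x - y)) \<partial>lborel)
       \<le> ennreal (L\<^sup>2) * J * (ennreal ((v y)\<^sup>2) * indicator B y)"
      using riesz_second_moment_B[of y]
      by (cases "y \<in> B") (auto simp: J_def mult_ac intro!: mult_left_mono)
  qed
  also have "\<dots> = ennreal (L\<^sup>2) * J * l2sq B v"
    unfolding l2sq_def by (rule nn_integral_cmult) measurable
  finally show ?thesis .
qed

text \<open>Discrete product rule: p(x) v(x) - p(y) v(y) = p(x) (v(x) - v(y)) + v(y) (p(x) - p(y)).
  The second summand is the commutator.\<close>

lemma hsq_mult: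
  assumes [measurable]: "v \<in> borel_measurable borel" "p \<in> borel_measurable borel"
    and p: "\<And>x. \<bar>p x\<bar> \<le> 1" and L: "0 \<le> L" "\<And>x y. \<bar>p x - p y\<bar> \<le> L * norm (x - y)"
  shows "hsq s B (\<lambda>x. p x * v x) \<le> 2 * hsq s B v + 2 * (ennreal (L\<^sup>2) * J * l2sq B v)"
proof -
  have "hsq s B (\<lambda>x. p x * v x) \<le>
    (\<integral>\<^sup>+x. (\<integral>\<^sup>+y. 2 * (ennreal ((v x - v y)\<^sup>2 * riesz s (x - y)) * indicator B y * indicator B x)
      + 2 * (ennreal ((v y)\<^sup>2 * (p x - p y)\<^sup>2 * riesz s (x - y)) * indicator B y * indicator B x) \<partial>lborel) \<partial>lborel)"
    unfolding hsq_def
  proof (subst nn_integral2_indicator, measurable, intro nn_integral_mono)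
    fix x y
    have "(p x * v x - p y * v y)\<^sup>2 \<le> 2 * (p x * (v x - v y))\<^sup>2 + 2 * (v y * (p x - p y))\<^sup>2"
      using sq_diff_le[of "p x * v x" "p y * v y" "p x * v y"]
      by (simp add: left_diff_distrib right_diff_distrib mult.commute)
    also have "(p x * (v x - v y))\<^sup>2 \<le> (v x - v y)\<^sup>2"
      using p[of x] by (subst abs_le_square_iff[symmetric]) (auto simp: abs_mult mult_left_le_one_le)
    finally have "(p x * v x - p y * v y)\<^sup>2 * riesz s (x - y) \<le>
       (2 * (v x - v y)\<^sup>2 + 2 * (v y * (p x - p y))\<^sup>2) * riesz s (x - y)"
      by (intro mult_right_mono) auto
    also have "\<dots> = 2 * ((v x - v y)\<^sup>2 * riesz s (x - y)) + 2 * ((v y)\<^sup>2 * (p x - p y)\<^sup>2 * riesz s (x - y))"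
      by (simp only: power_mult_distrib distrib_right mult.assoc)
    finally have "ennreal ((p x * v x - p y * v y)\<^sup>2 * riesz s (x - y)) \<le>
       ennreal (2 * ((v x - v y)\<^sup>2 * riesz s (x - y)) + 2 * ((v y)\<^sup>2 * (p x - p y)\<^sup>2 * riesz s (x - y)))"
      by (rule ennreal_leI)
    also have "\<dots> = 2 * ennreal ((v x - v y)\<^sup>2 * riesz s (x - y)) + 2 * ennreal ((v y)\<^sup>2 * (p x - p y)\<^sup>2 * riesz s (x - y))"
      by (simp add: ennreal_plus ennreal_mult)
    finally have "ennreal ((p x * v x - p y * v y)\<^sup>2 * riesz s (x - y)) \<le>
       2 * ennreal ((v x - v y)\<^sup>2 * riesz s (x - y)) + 2 * ennreal ((v y)\<^sup>2 * (p x - p y)\<^sup>2 * riesz s (x - y))" .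
    then show "ennreal ((p x * v x - p y * v y)\<^sup>2 * riesz s (x - y)) * indicator B y * indicator B x \<le>
       2 * (ennreal ((v x - v y)\<^sup>2 * riesz s (x - y)) * indicator B y * indicator B x)
      + 2 * (ennreal ((v y)\<^sup>2 * (p x - p y)\<^sup>2 * riesz s (x - y)) * indicator B y * indicator B x)"
      by (auto simp: indicator_def)
  qed
  also have "\<dots> = 2 * hsq s B v + 2 * (\<integral>\<^sup>+x\<in>B. (\<integral>\<^sup>+y\<in>B. ennreal ((v y)\<^sup>2 * (p x - p y)\<^sup>2 * riesz s (x - y)) \<partial>lborel) \<partial>lborel)"
    unfolding hsq_def
    by (subst nn_integral2_add, measurable, subst (1 2) nn_integral2_cmult, measurable, subst (1 2) nn_integral2_indicator, measurable)
  also have "\<dots> \<le> 2 * hsq s B v + 2 * (ennreal (L\<^sup>2) * J * l2sq B v)"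
    by (intro add_left_mono mult_left_mono commutator_bound L) auto
  finally show ?thesis .
qed

lemma l2sq_mult_le:
  assumes p: "\<And>x. \<bar>p x\<bar> \<le> 1" shows "l2sq A (\<lambda>x. p x * v x) \<le> l2sq A v"
  unfolding l2sq_def
proof (intro nn_integral_mono mult_right_mono ennreal_leI)
  fix x show "(p x * v x)\<^sup>2 \<le> (v x)\<^sup>2"
    using p[of x] by (subst abs_le_square_iff[symmetric]) (auto simp: abs_mult mult_left_le_one_le)
qed auto

lemma l2sq_UNIV: "(\<And>x. x \<notin> A \<Longrightarrow> v x = 0) \<Longrightarrow> l2sq UNIV v = l2sq A v"
  unfolding l2sq_def by (intro nn_integral_cong) (auto simp: indicator_def)

text \<open>Test functions of the weak equation must lie in H^s of the whole space, whereas all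
  bounds are local. A pair with one point outside \<open>B\<close> contributes only through the
  other point, and there the kernel is nonsingular since \<open>v\<close> vanishes from r + \<delta>
  on.\<close>

lemma hsq_UNIV_le:
  assumes [measurable]: "v \<in> borel_measurable borel" and v: "\<And>x. r + \<delta> \<le> dist x0 x \<Longrightarrow> v x = 0"
  shows "hsq s UNIV v \<le> hsq s B v + 2 * (ennreal C\<^sub>\<delta> * W * l2sq B v)"
proof -
  let ?g = "\<lambda>x y. ennreal ((v x)\<^sup>2) * indicator B x * (ennreal C\<^sub>\<delta> * ennreal (tail_weight s (y - x0)))"
  let ?h = "\<lambda>x y. ennreal ((v x - v y)\<^sup>2 * riesz s (x - y)) * indicator B y * indicator B x"
  have far: "ennreal ((v x)\<^sup>2 * riesz s (x - y)) \<le> ?g x y" if "y \<notin> B" for x y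
  proof (cases "v x = 0")
    case False
    then have d: "dist x0 x < r + \<delta>" using v[of x] by force
    then have "(v x)\<^sup>2 * riesz s (x - y) \<le> (v x)\<^sup>2 * (C\<^sub>\<delta> * tail_weight s (y - x0))"
      by (intro mult_left_mono riesz_far that) auto
    then show ?thesis using d \<delta>
      by (auto simp: ennreal_mult[symmetric] less_imp_le[OF tail_weight_pos] intro!: ennreal_leI)
  qed auto
  have vB: "v x = 0" if "x \<notin> B" for x using that \<delta> by (intro v) auto
  have "hsq s UNIV v \<le> (\<integral>\<^sup>+x. (\<integral>\<^sup>+y. ?h x y + (?g x y + ?g y x) \<partial>lborel) \<partial>lborel)"
    unfolding hsq_def
  proof (subst nn_integral2_indicator, measurable, intro nn_integral_mono)
    fix x y :: 'a
    show "ennreal ((v x - v y)\<^sup>2 * riesz s (x - y)) * indicator UNIV y * indicator UNIV x \<le> ?h x y + (?g x y + ?g y x)"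
    proof (cases "y \<in> B")
      case y: True
      show ?thesis
      proof (cases "x \<in> B")
        case False
        then show ?thesis using far[of x y] vB[OF False] riesz_minus[of s x y]
          by (simp add: add_increasing)
      qed (use y in simp)
    next
      case False
      then show ?thesis using far[of y x] vB[OF False]
        by (simp add: add_increasing2)
    qed
  qed
  also have "\<dots> = (\<integral>\<^sup>+x. (\<integral>\<^sup>+y. ?h x y \<partial>lborel) \<partial>lborel) + ((\<integral>\<^sup>+x. \<integral>\<^sup>+y. ?g x y \<partial>lborel \<partial>lborel) + (\<integral>\<^sup>+x. \<integral>\<^sup>+y. ?g y x \<partial>lborel \<partial>lborel))"
    by (subst nn_integral2_add, measurable, subst nn_integral2_add, measurable)
  also have "(\<integral>\<^sup>+x. \<integral>\<^sup>+y. ?g y x \<partial>lborel \<partial>lborel) = (\<integral>\<^sup>+y. \<integral>\<^sup>+x. ?g y x \<partial>lborel \<partial>lborel)"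
    by (rule lborel_pair.Fubini') measurable
  also have "(\<integral>\<^sup>+x. \<integral>\<^sup>+y. ?g x y \<partial>lborel \<partial>lborel) = (\<integral>\<^sup>+x. ennreal ((v x)\<^sup>2) * indicator B x * (ennreal C\<^sub>\<delta> * W) \<partial>lborel)"
    by (intro nn_integral_cong, subst nn_integral_cmult, measurable, subst nn_integral_cmult, measurable, subst W_shift, rule refl)
  also have "\<dots> = ennreal C\<^sub>\<delta> * W * l2sq B v"
    unfolding l2sq_def by (subst nn_integral_multc, measurable, simp add: mult_ac)
  also have "(\<integral>\<^sup>+x. (\<integral>\<^sup>+y. ?h x y \<partial>lborel) \<partial>lborel) = hsq s B v"
    unfolding hsq_def by (subst nn_integral2_indicator, measurable)
  finally show ?thesis by (simp only: mult_2)
qed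

end

section \<open>Continuously differentiable transition functions in time\<close>

lemma has_derivative_pos_part_sq:
  "((\<lambda>y::real. (max 0 y)\<^sup>2) has_real_derivative 2 * max 0 y) (at y)"
proof -
  consider "y < 0" | "y = 0" | "y > 0" by linarith
  then show ?thesis
  proof cases
    case 1
    have "((\<lambda>y::real. 0) has_real_derivative 0) (at y)" by simp
    then have "((\<lambda>y::real. (max 0 y)\<^sup>2) has_real_derivative 0) (at y)"
      by (rule has_field_derivative_transform_within_open[where S = "{..<0}"]) (use 1 in auto)
    then show ?thesis using 1 by simp
  next
    case 2
    have "(\<lambda>h::real. ((max 0 (0 + h))\<^sup>2 - (max 0 0)\<^sup>2) / h) \<midarrow>0\<rightarrow> 0"
    proof (rule Lim_transform_eventually)
      have "(\<lambda>h::real. max 0 h) \<midarrow>0\<rightarrow> max 0 0" by (intro tendsto_intros)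
      then show "(\<lambda>h::real. max 0 h) \<midarrow>0\<rightarrow> 0" by simp
      show "\<forall>\<^sub>F h in at (0::real). max 0 h = ((max 0 (0 + h))\<^sup>2 - (max 0 0)\<^sup>2) / h"
        unfolding eventually_at_filter by (auto simp: max_def power2_eq_square)
    qed
    then show ?thesis using 2 by (simp add: DERIV_def)
  next
    case 3
    have "((\<lambda>y::real. y\<^sup>2) has_real_derivative 2 * y) (at y)"
      by (auto intro!: derivative_eq_intros)
    then have "((\<lambda>y::real. (max 0 y)\<^sup>2) has_real_derivative 2 * y) (at y)"
      by (rule has_field_derivative_transform_within_open[where S = "{0<..}"]) (use 3 in auto)
    then show ?thesis using 3 by simp
  qed
qed

text \<open>Nested squares of positive parts give an explicit C1 transition from 0 on the negative
  half-line to 1 beyond y = 1, with derivative \<open>step_fun'\<close> between 0 and 4.\<close>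

definition step_fun :: "real \<Rightarrow> real" where
  "step_fun y = (max 0 (1 - (max 0 (1 - y))\<^sup>2))\<^sup>2"

definition step_fun' :: "real \<Rightarrow> real" where
  "step_fun' y = 4 * max 0 (1 - (max 0 (1 - y))\<^sup>2) * max 0 (1 - y)"

lemma step_fun_deriv: "(step_fun has_real_derivative step_fun' y) (at y)"
proof -
  have "((\<lambda>y. (max 0 (1 - (max 0 (1 - y))\<^sup>2))\<^sup>2) has_real_derivative
      (2 * max 0 (1 - (max 0 (1 - y))\<^sup>2)) * (0 - (2 * max 0 (1 - y)) * (0 - 1))) (at y)"
    by (intro DERIV_chain2[OF has_derivative_pos_part_sq] DERIV_diff DERIV_const DERIV_ident)
  then show ?thesis unfolding step_fun_def[abs_def] step_fun'_def by (simp add: mult_ac)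
qed

lemma step_fun_cont: "continuous_on UNIV step_fun'"
  unfolding step_fun'_def[abs_def] by (intro continuous_intros)

lemma step_fun_0: "y \<le> 0 \<Longrightarrow> step_fun y = 0"
  by (auto simp: step_fun_def max_def abs_square_le_1 one_le_power)

lemma step_fun_1: "1 \<le> y \<Longrightarrow> step_fun y = 1" by (simp add: step_fun_def)

lemma step_fun_bounds: "0 \<le> step_fun y" "step_fun y \<le> 1"
  by (auto simp: step_fun_def max_def intro!: power_le_one)

lemma step_fun'_bounds: "0 \<le> step_fun' y" "step_fun' y \<le> 4"
proof -
  show "0 \<le> step_fun' y" by (simp add: step_fun'_def)
  show "step_fun' y \<le> 4"
  proof (cases "y \<le> 0")
    case True
    then have "1 \<le> (max 0 (1 - y))\<^sup>2" by (simp add: one_le_power)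
    then show ?thesis by (simp add: step_fun'_def max_def)
  next
    case False
    have "max 0 (1 - (max 0 (1 - y))\<^sup>2) * max 0 (1 - y) \<le> 1 * 1"
      by (rule mult_mono) (use False in auto)
    then show ?thesis by (simp add: step_fun'_def)
  qed
qed

lemma step_fun'_0: "y \<le> 0 \<Longrightarrow> step_fun' y = 0"
  by (auto simp: step_fun'_def max_def abs_square_le_1 one_le_power)

lemma step_fun'_1: "1 \<le> y \<Longrightarrow> step_fun' y = 0"
  by (auto simp: step_fun'_def)

lemma l2sq_mono: "A \<subseteq> A' \<Longrightarrow> l2sq A v \<le> l2sq A' v"
  unfolding l2sq_def by (intro nn_integral_mono) (auto simp: indicator_def)

lemma hsq_mono:
  "A \<subseteq> A' \<Longrightarrow> hsq s A v \<le> hsq s A' v"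
  unfolding hsq_def
  by (intro nn_integral_mono mult_mono mult_left_mono) (auto simp: indicator_def)

lemma hsq_contraction:
  assumes "\<And>x y. \<bar>w x - w y\<bar> \<le> \<bar>v x - v y\<bar>"
  shows "hsq s A w \<le> hsq s A v"
  unfolding hsq_def
  by (intro nn_integral_mono mult_right_mono ennreal_leI) (use assms in \<open>auto simp: abs_le_square_iff\<close>)

section \<open>Absolute convergence of the form and of the pairing with \<open>u\<close>\<close>

context nonlocal_ball
begin

definition absform :: "real \<Rightarrow> ('a \<Rightarrow> real) \<Rightarrow> ennreal" where
  "absform t \<psi> = (\<integral>\<^sup>+x. \<integral>\<^sup>+y. ennreal (\<bar>u t x - u t y\<bar> * \<bar>\<psi> x - \<psi> y\<bar> * k t x y) \<partial>lborel \<partial>lborel)"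

definition absprod :: "real \<Rightarrow> ('a \<Rightarrow> real) \<Rightarrow> ennreal" where
  "absprod t \<psi> = (\<integral>\<^sup>+x. ennreal \<bar>u t x * \<psi> x\<bar> \<partial>lborel)"

definition absint :: "('a \<Rightarrow> real) \<Rightarrow> ennreal" where
  "absint \<psi> = (\<integral>\<^sup>+x. ennreal \<bar>\<psi> x\<bar> \<partial>lborel)"

text \<open>Pairs inside \<open>B\<close> are handled by Young's inequality and the kernel bound. If
  one point lies outside \<open>B\<close>, then \<psi> vanishes there and only the other point
  counts, with a nonsingular kernel; splitting |u(x) - u(y)| yields the local pairing times the
  total weight and the tail times the integral of |\<psi>|. The parameter \<epsilon> stays free
  because \<psi> will later be a small increment while \<open>u\<close> is not small.\<close>

lemma absform_le:
  assumes [measurable]: "\<psi> \<in> borel_measurable borel" and \<psi>: "\<And>x. r + \<delta> \<le> dist x0 x \<Longrightarrow> \<psi> x = 0"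
    and \<epsilon>: "0 < \<epsilon>"
  shows "absform t \<psi> \<le> ennreal \<Lambda> * (ennreal \<epsilon> * hsq s B (u t) + ennreal (1 / \<epsilon>) * hsq s B \<psi>)
    + 2 * (ennreal (\<Lambda> * C\<^sub>\<delta>) * (W * absprod t \<psi> + tl t * absint \<psi>))"
proof -
  let ?w = "\<lambda>y. ennreal (tail_weight s (y - x0))"
  let ?c = "ennreal (\<Lambda> * C\<^sub>\<delta>)"
  let ?U = "\<lambda>x y. ennreal ((u t x - u t y)\<^sup>2 * riesz s (x - y)) * indicator B y * indicator B x"
  let ?P = "\<lambda>x y. ennreal ((\<psi> x - \<psi> y)\<^sup>2 * riesz s (x - y)) * indicator B y * indicator B x"
  let ?g = "\<lambda>x y. ennreal \<bar>u t x * \<psi> x\<bar> * ?w y + ennreal \<bar>\<psi> x\<bar> * (ennreal \<bar>u t y\<bar> * ?w y)"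
  have t0: "0 \<le> tail_weight s v" for v :: 'a by (auto intro: less_imp_le tail_weight_pos)
  have hsqB: "hsq s B v = (\<integral>\<^sup>+x. \<integral>\<^sup>+y. ennreal ((v x - v y)\<^sup>2 * riesz s (x - y)) * indicator B y * indicator B x \<partial>lborel \<partial>lborel)"
    if [measurable]: "v \<in> borel_measurable borel" for v
    unfolding hsq_def by (rule nn_integral2_indicator) measurable
  have [measurable]: "u t \<in> borel_measurable borel" by measurable
  have \<psi>B: "\<psi> x = 0" if "x \<notin> B" for x using that \<delta> by (intro \<psi>) auto
  have far: "ennreal (\<bar>u t x - u t y\<bar> * \<bar>\<psi> x\<bar> * k t x' y') \<le> ?c * ?g x y"
    if y: "y \<notin> B" and k': "k t x' y' \<le> \<Lambda> * riesz s (x - y)" for x y x' y'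
  proof (cases "\<psi> x = 0")
    case False
    then have d: "dist x0 x \<le> r + \<delta>" using \<psi>[of x] by force
    have "\<bar>u t x - u t y\<bar> * \<bar>\<psi> x\<bar> * k t x' y' \<le> ((\<bar>u t x\<bar> + \<bar>u t y\<bar>) * \<bar>\<psi> x\<bar>) * (\<Lambda> * (C\<^sub>\<delta> * tail_weight s (y - x0)))"
      using riesz_far[OF d y] \<Lambda> k_nonneg
      by (intro mult_mono order_trans[OF k'] mult_left_mono) auto
    also have "\<dots> = \<Lambda> * C\<^sub>\<delta> * (\<bar>u t x * \<psi> x\<bar> * tail_weight s (y - x0) + \<bar>\<psi> x\<bar> * (\<bar>u t y\<bar> * tail_weight s (y - x0)))"
      by (simp add: algebra_simps abs_mult)
    finally have "ennreal (\<bar>u t x - u t y\<bar> * \<bar>\<psi> x\<bar> * k t x' y') \<le>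
      ennreal (\<Lambda> * C\<^sub>\<delta> * (\<bar>u t x * \<psi> x\<bar> * tail_weight s (y - x0) + \<bar>\<psi> x\<bar> * (\<bar>u t y\<bar> * tail_weight s (y - x0))))"
      by (rule ennreal_leI)
    also have "\<dots> = ?c * ?g x y"
      using \<Lambda> t0 by (simp add: ennreal_mult ennreal_plus)
    finally show ?thesis .
  qed auto
  have near: "ennreal (\<bar>u t x - u t y\<bar> * \<bar>\<psi> x - \<psi> y\<bar> * k t x y) \<le>
     ennreal \<Lambda> * (ennreal \<epsilon> * ?U x y + ennreal (1 / \<epsilon>) * ?P x y)" if "x \<in> B" "y \<in> B" for x y
  proof -
    have "\<bar>u t x - u t y\<bar> * \<bar>\<psi> x - \<psi> y\<bar> * k t x y \<le>
      (\<epsilon> * (u t x - u t y)\<^sup>2 + (\<psi> x - \<psi> y)\<^sup>2 / \<epsilon>) * (\<Lambda> * riesz s (x - y))"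
      using young_real[OF \<epsilon>, of "u t x - u t y" "\<psi> x - \<psi> y"] \<epsilon>
      by (intro mult_mono k_le) (auto simp: abs_mult k_nonneg)
    also have "\<dots> = \<Lambda> * (\<epsilon> * ((u t x - u t y)\<^sup>2 * riesz s (x - y)) + (1 / \<epsilon>) * ((\<psi> x - \<psi> y)\<^sup>2 * riesz s (x - y)))"
      by (simp add: algebra_simps)
    finally have "ennreal (\<bar>u t x - u t y\<bar> * \<bar>\<psi> x - \<psi> y\<bar> * k t x y) \<le>
      ennreal (\<Lambda> * (\<epsilon> * ((u t x - u t y)\<^sup>2 * riesz s (x - y)) + (1 / \<epsilon>) * ((\<psi> x - \<psi> y)\<^sup>2 * riesz s (x - y))))"
      by (rule ennreal_leI)
    also have "\<dots> = ennreal \<Lambda> * (ennreal \<epsilon> * ennreal ((u t x - u t y)\<^sup>2 * riesz s (x - y)) + ennreal (1 / \<epsilon>) * ennreal ((\<psi> x - \<psi> y)\<^sup>2 * riesz s (x - y)))"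
      using \<Lambda> \<epsilon> by (simp add: ennreal_mult ennreal_plus del: times_divide_eq_left)
    finally show ?thesis using that by simp
  qed
  \<comment> \<open>The far term is added in both orders, as either point may be the one outside
    \<open>B\<close>; this is the source of the factor 2.\<close>
  have "absform t \<psi> \<le> (\<integral>\<^sup>+x. \<integral>\<^sup>+y. ennreal \<Lambda> * (ennreal \<epsilon> * ?U x y + ennreal (1 / \<epsilon>) * ?P x y)
      + (?c * ?g x y + ?c * ?g y x) \<partial>lborel \<partial>lborel)"
    unfolding absform_def
  proof (intro nn_integral_mono)
    fix x y :: 'a
    show "ennreal (\<bar>u t x - u t y\<bar> * \<bar>\<psi> x - \<psi> y\<bar> * k t x y) \<le> ennreal \<Lambda> * (ennreal \<epsilon> * ?U x y + ennreal (1 / \<epsilon>) * ?P x y)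
      + (?c * ?g x y + ?c * ?g y x)"
    proof (cases "y \<in> B")
      case y: True
      show ?thesis
      proof (cases "x \<in> B")
        case True
        from near[OF True y] show ?thesis by (rule order_trans) simp
      next
        case False
        have "ennreal (\<bar>u t x - u t y\<bar> * \<bar>\<psi> x - \<psi> y\<bar> * k t x y) = ennreal (\<bar>u t y - u t x\<bar> * \<bar>\<psi> y\<bar> * k t x y)"
          using \<psi>B[OF False] by (simp add: abs_minus_commute)
        also have "\<dots> \<le> ?c * ?g y x"
          by (rule far[OF False]) (use k_le[of t x y] riesz_minus[of s x y] in simp)
        finally show ?thesis by (rule order_trans) (simp add: add_increasing)
      qed
    next
      case False
      have "ennreal (\<bar>u t x - u t y\<bar> * \<bar>\<psi> x - \<psi> y\<bar> * k t x y) \<le> ?c * ?g x y"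
        using far[OF False k_le] \<psi>B[OF False] by simp
      then show ?thesis by (rule order_trans) (simp add: add_increasing add_increasing2)
    qed
  qed
  also have "\<dots> = ennreal \<Lambda> * (ennreal \<epsilon> * (\<integral>\<^sup>+x. \<integral>\<^sup>+y. ?U x y \<partial>lborel \<partial>lborel) + ennreal (1 / \<epsilon>) * (\<integral>\<^sup>+x. \<integral>\<^sup>+y. ?P x y \<partial>lborel \<partial>lborel))
      + (?c * (\<integral>\<^sup>+x. \<integral>\<^sup>+y. ?g x y \<partial>lborel \<partial>lborel) + ?c * (\<integral>\<^sup>+x. \<integral>\<^sup>+y. ?g y x \<partial>lborel \<partial>lborel))"
    by (simp add: nn_integral2_add nn_integral2_cmult del: nn_integral_cmult)
  also have "(\<integral>\<^sup>+x. \<integral>\<^sup>+y. ?g y x \<partial>lborel \<partial>lborel) = (\<integral>\<^sup>+y. \<integral>\<^sup>+x. ?g y x \<partial>lborel \<partial>lborel)"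
    by (rule lborel_pair.Fubini') measurable
  also have "(\<integral>\<^sup>+x. \<integral>\<^sup>+y. ?g x y \<partial>lborel \<partial>lborel) = (\<integral>\<^sup>+x. ennreal \<bar>u t x * \<psi> x\<bar> * W + ennreal \<bar>\<psi> x\<bar> * tl t \<partial>lborel)"
  proof (rule nn_integral_cong)
    fix x
    have "(\<integral>\<^sup>+y. ?g x y \<partial>lborel) = ennreal \<bar>u t x * \<psi> x\<bar> * (\<integral>\<^sup>+y. ?w y \<partial>lborel) + ennreal \<bar>\<psi> x\<bar> * (\<integral>\<^sup>+y. ennreal \<bar>u t y\<bar> * ?w y \<partial>lborel)"
      by (subst nn_integral_add, measurable, subst (1 2) nn_integral_cmult, measurable)
    then show "(\<integral>\<^sup>+y. ?g x y \<partial>lborel) = ennreal \<bar>u t x * \<psi> x\<bar> * W + ennreal \<bar>\<psi> x\<bar> * tl t"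
      using t0 by (simp add: W_shift tl_def ennreal_mult)
  qed
  also have "\<dots> = W * absprod t \<psi> + tl t * absint \<psi>"
    unfolding absprod_def absint_def
    by (subst nn_integral_add, measurable, subst (1 2) nn_integral_multc, measurable, simp add: mult.commute)
  finally show ?thesis
    by (simp only: hsqB[OF \<open>u t \<in> borel_measurable borel\<close>] hsqB[OF assms(1)] mult_2[of "_::ennreal"])
qed

text \<open>The weight \<epsilon> is free for the same reason: it controls the part with
  \<open>u\<close> when \<psi> is replaced by an increment that tends to 0.\<close>

lemma absprod_le:
  assumes [measurable]: "\<psi> \<in> borel_measurable borel" and \<psi>: "\<And>x. x \<notin> A \<Longrightarrow> \<psi> x = 0"
    and [measurable]: "A \<in> sets borel" and \<epsilon>: "0 < \<epsilon>"
  shows "absprod t \<psi> \<le> ennreal \<epsilon> * l2sq A (u t) + ennreal (1 / \<epsilon>) * l2sq A \<psi>"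
proof -
  have "absprod t \<psi> \<le> (\<integral>\<^sup>+x. ennreal \<epsilon> * (ennreal ((u t x)\<^sup>2) * indicator A x) + ennreal (1/\<epsilon>) * (ennreal ((\<psi> x)\<^sup>2) * indicator A x) \<partial>lborel)"
    unfolding absprod_def
  proof (rule nn_integral_mono)
    fix x
    have "ennreal \<bar>u t x * \<psi> x\<bar> \<le> ennreal (\<epsilon> * (u t x)\<^sup>2 + 1/\<epsilon> * (\<psi> x)\<^sup>2)"
      using young_real[OF \<epsilon>, of "u t x" "\<psi> x"] by (intro ennreal_leI) simp
    also have "\<dots> = ennreal \<epsilon> * ennreal ((u t x)\<^sup>2) + ennreal (1/\<epsilon>) * ennreal ((\<psi> x)\<^sup>2)"
      using \<epsilon> by (simp add: ennreal_mult ennreal_plus del: times_divide_eq_left)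
    finally show "ennreal \<bar>u t x * \<psi> x\<bar> \<le> ennreal \<epsilon> * (ennreal ((u t x)\<^sup>2) * indicator A x) + ennreal (1/\<epsilon>) * (ennreal ((\<psi> x)\<^sup>2) * indicator A x)"
      using \<psi>[of x] by (cases "x \<in> A") auto
  qed
  also have "\<dots> = ennreal \<epsilon> * l2sq A (u t) + ennreal (1 / \<epsilon>) * l2sq A \<psi>"
    unfolding l2sq_def by (subst nn_integral_add, measurable, subst (1 2) nn_integral_cmult, measurable)
  finally show ?thesis .
qed

lemma absint_le:
  assumes [measurable]: "\<psi> \<in> borel_measurable borel" and \<psi>: "\<And>x. x \<notin> A \<Longrightarrow> \<psi> x = 0"
    and [measurable]: "A \<in> sets borel" and \<epsilon>: "0 < \<epsilon>"
  shows "absint \<psi> \<le> ennreal \<epsilon> * emeasure lborel A + ennreal (1 / \<epsilon>) * l2sq A \<psi>"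
proof -
  have "absint \<psi> \<le> (\<integral>\<^sup>+x. ennreal \<epsilon> * indicator A x + ennreal (1/\<epsilon>) * (ennreal ((\<psi> x)\<^sup>2) * indicator A x) \<partial>lborel)"
    unfolding absint_def
  proof (rule nn_integral_mono)
    fix x
    have "ennreal \<bar>\<psi> x\<bar> \<le> ennreal (\<epsilon> + 1/\<epsilon> * (\<psi> x)\<^sup>2)"
      using young_real[OF \<epsilon>, of 1 "\<psi> x"] by (intro ennreal_leI) simp
    also have "\<dots> = ennreal \<epsilon> + ennreal (1/\<epsilon>) * ennreal ((\<psi> x)\<^sup>2)"
      using \<epsilon> by (simp add: ennreal_mult ennreal_plus del: times_divide_eq_left)
    finally show "ennreal \<bar>\<psi> x\<bar> \<le> ennreal \<epsilon> * indicator A x + ennreal (1/\<epsilon>) * (ennreal ((\<psi> x)\<^sup>2) * indicator A x)"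
      using \<psi>[of x] by (cases "x \<in> A") auto
  qed
  also have "\<dots> = ennreal \<epsilon> * emeasure lborel A + ennreal (1 / \<epsilon>) * l2sq A \<psi>"
  proof -
    have "(\<integral>\<^sup>+x. ennreal \<epsilon> * indicator A x + ennreal (1/\<epsilon>) * (ennreal ((\<psi> x)\<^sup>2) * indicator A x) \<partial>lborel)
      = (\<integral>\<^sup>+x. ennreal \<epsilon> * indicator A x \<partial>lborel) + (\<integral>\<^sup>+x. ennreal (1/\<epsilon>) * (ennreal ((\<psi> x)\<^sup>2) * indicator A x) \<partial>lborel)"
      by (rule nn_integral_add) measurable
    also have "(\<integral>\<^sup>+x. ennreal \<epsilon> * indicator A x \<partial>lborel) = ennreal \<epsilon> * emeasure lborel A"
      by (rule nn_integral_cmult_indicator) simp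
    also have "(\<integral>\<^sup>+x. ennreal (1/\<epsilon>) * (ennreal ((\<psi> x)\<^sup>2) * indicator A x) \<partial>lborel) = ennreal (1 / \<epsilon>) * l2sq A \<psi>"
      unfolding l2sq_def by (rule nn_integral_cmult) measurable
    finally show ?thesis .
  qed
  finally show ?thesis .
qed

lemma B_subset: "B \<subseteq> ball 0 (norm x0 + 2)"
proof
  fix x assume "x \<in> B"
  then show "x \<in> ball 0 (norm x0 + 2)"
    using r\<delta> norm_triangle_ineq[of x0 "x - x0"] by (simp add: dist_norm norm_minus_commute)
qed

lemma u_L2_B: obtains M where "0 \<le> M" "AE t in lborel. l2sq (ball 0 R) (u t) \<le> ennreal M"
proof -
  obtain M :: real where "AE t in lborel. l2sq (ball 0 R) (u t) \<le> ennreal M" using u_L2 by blast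
  then have "AE t in lborel. l2sq (ball 0 R) (u t) \<le> ennreal (max 0 M)"
    by eventually_elim (auto simp: ennreal_max_0 max.commute)
  then show ?thesis by (intro that[of "max 0 M"]) auto
qed

lemma hsq_time: "(\<integral>\<^sup>+t. hsq s B (u t) \<partial>lborel) < \<infinity>"
  by (rule le_less_trans[OF nn_integral_mono[OF hsq_mono[OF B_subset]] u_Hs])

lemma l2sq_time: "(\<integral>\<^sup>+t. l2sq B (u t) \<partial>lborel) < \<infinity>"
proof -
  obtain M where M: "0 \<le> M" "AE t in lborel. l2sq (ball 0 (norm x0 + 2)) (u t) \<le> ennreal M"
    by (rule u_L2_B)
  have "(\<integral>\<^sup>+t. l2sq B (u t) \<partial>lborel) \<le> (\<integral>\<^sup>+t. ennreal M * indicator {0..T} t \<partial>lborel)"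
  proof (rule nn_integral_mono_AE)
    show "AE t in lborel. l2sq B (u t) \<le> ennreal M * indicator {0..T} t"
      using M(2)
    proof eventually_elim
      case (elim t)
      show ?case
      proof (cases "t \<in> {0..T}")
        case True then show ?thesis using order_trans[OF l2sq_mono[OF B_subset] elim] by simp
      next
        case False
        then have "u t x = 0" for x by (intro u_zero) auto
        then show ?thesis by (simp add: l2sq_def)
      qed
    qed
  qed
  also have "\<dots> < \<infinity>" using T by (simp add: nn_integral_cmult_indicator ennreal_mult_less_top)
  finally show ?thesis .
qed

lemma tl_measurable [measurable]: "tl \<in> borel_measurable borel"
  unfolding tl_def[abs_def] by measurable

lemma tl_time: "(\<integral>\<^sup>+t. tl t \<partial>lborel) < \<infinity>"
proof -
  let ?c = "(1 + norm x0) powr (real DIM('a) + 2 * s)"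
  have "(\<integral>\<^sup>+t. tl t \<partial>lborel) \<le> (\<integral>\<^sup>+t. (\<integral>\<^sup>+x. ennreal ?c * ennreal (\<bar>u t x\<bar> * tail_weight s x) \<partial>lborel) \<partial>lborel)"
    unfolding tl_def
  proof (intro nn_integral_mono)
    fix t x
    have "\<bar>u t x\<bar> * tail_weight s (x - x0) \<le> \<bar>u t x\<bar> * (?c * tail_weight s x)"
      by (intro mult_left_mono tail_weight_mult_le s) auto
    then show "ennreal (\<bar>u t x\<bar> * tail_weight s (x - x0)) \<le> ennreal ?c * ennreal (\<bar>u t x\<bar> * tail_weight s x)"
      using less_imp_le[OF tail_weight_pos, of s x]
      by (subst ennreal_mult[symmetric]) (auto intro!: ennreal_leI simp: mult_ac)
  qed
  also have "\<dots> = ennreal ?c * (\<integral>\<^sup>+t. (\<integral>\<^sup>+x. ennreal (\<bar>u t x\<bar> * tail_weight s x) \<partial>lborel) \<partial>lborel)"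
    by (rule nn_integral2_cmult) measurable
  also have "\<dots> < \<infinity>" using u_L1 by (simp add: ennreal_mult_less_top)
  finally show ?thesis .
qed

text \<open>The class to which \<open>\<xi>\<^sup>2 u\<close> belongs at almost every time: possibly
  signed, without continuity, with support inside radius r + \<delta>.\<close>

definition adm :: "('a \<Rightarrow> real) \<Rightarrow> bool" where
  "adm \<psi> \<longleftrightarrow> \<psi> \<in> borel_measurable borel \<and> (\<forall>x. r + \<delta> \<le> dist x0 x \<longrightarrow> \<psi> x = 0)
     \<and> l2sq B \<psi> < \<infinity> \<and> hsq s B \<psi> < \<infinity>"

definition fpair :: "real \<Rightarrow> ('a \<Rightarrow> real) \<Rightarrow> real" where
  "fpair t \<psi> = (\<integral>x. u t x * \<psi> x \<partial>lborel)"

lemma admD: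
  assumes "adm \<psi>"
  shows "\<psi> \<in> borel_measurable borel" "\<And>x. r + \<delta> \<le> dist x0 x \<Longrightarrow> \<psi> x = 0" "\<And>x. x \<notin> B \<Longrightarrow> \<psi> x = 0"
    "l2sq B \<psi> < \<infinity>" "hsq s B \<psi> < \<infinity>"
  using assms \<delta> by (auto simp: adm_def)

lemma absform_measurable [measurable]:
  assumes [measurable]: "(\<lambda>(m, x). \<psi> m x) \<in> borel_measurable (M \<Otimes>\<^sub>M borel)" "f \<in> borel_measurable M"
  shows "(\<lambda>m. absform (f m) (\<psi> m)) \<in> borel_measurable M"
  unfolding absform_def by measurable

lemma absprod_measurable [measurable]:
  assumes [measurable]: "(\<lambda>(m, x). \<psi> m x) \<in> borel_measurable (M \<Otimes>\<^sub>M borel)" "f \<in> borel_measurable M"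
  shows "(\<lambda>m. absprod (f m) (\<psi> m)) \<in> borel_measurable M"
  unfolding absprod_def by measurable

lemma form_u_measurable [measurable]:
  assumes [measurable]: "(\<lambda>(m, x). \<psi> m x) \<in> borel_measurable (M \<Otimes>\<^sub>M borel)" "f \<in> borel_measurable M"
  shows "(\<lambda>m. form (k (f m)) (u (f m)) (\<psi> m)) \<in> borel_measurable M"
  by (rule form_measurable) measurable

lemma fpair_measurable [measurable]:
  assumes [measurable]: "(\<lambda>(m, x). \<psi> m x) \<in> borel_measurable (M \<Otimes>\<^sub>M borel)" "f \<in> borel_measurable M"
  shows "(\<lambda>m. fpair (f m) (\<psi> m)) \<in> borel_measurable M"
  unfolding fpair_def by measurable

lemma abs_time_zero:
  assumes "t \<le> 0 \<or> T \<le> t"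
  shows "absform t \<psi> = 0" "absprod t \<psi> = 0" "form (k t) (u t) \<psi> = 0" "fpair t \<psi> = 0"
  using u_zero[OF assms] by (auto simp: absform_def absprod_def form_def fpair_def case_prod_beta')

lemma emeasure_B: "emeasure lborel B < \<infinity>" unfolding B_def by (rule emeasure_lborel_ball_finite)

text \<open>The point is that \<open>a\<close> and \<open>b\<close> do not depend on \<psi>: later
  \<psi> runs through a family indexed by a second time variable and the bound is integrated over
  that variable.\<close>

lemma abs_time:
  obtains a b where "a < \<infinity>" "b < \<infinity>"
    "\<And>\<psi>. \<psi> \<in> borel_measurable borel \<Longrightarrow> (\<And>x. r + \<delta> \<le> dist x0 x \<Longrightarrow> \<psi> x = 0) \<Longrightarrow>
      (\<integral>\<^sup>+t. absform t \<psi> + absprod t \<psi> \<partial>lborel) \<le> a + b * (hsq s B \<psi> + l2sq B \<psi>)"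
proof -
  define c where "c = 2 * ennreal (\<Lambda> * C\<^sub>\<delta>)"
  define a where "a = ennreal \<Lambda> * (\<integral>\<^sup>+t. hsq s B (u t) \<partial>lborel) + (c * W + 1) * (\<integral>\<^sup>+t. l2sq B (u t) \<partial>lborel)
    + c * emeasure lborel B * (\<integral>\<^sup>+t. tl t \<partial>lborel)"
  define b where "b = (ennreal \<Lambda> + c * W + 1) * ennreal T + c * (\<integral>\<^sup>+t. tl t \<partial>lborel)"
  have c: "c < \<infinity>" by (simp add: c_def ennreal_mult_less_top)
  show ?thesis
  proof (rule that[of a b])
    show "a < \<infinity>" unfolding a_def
      using c W_finite emeasure_B hsq_time l2sq_time tl_time by (simp add: ennreal_mult_less_top)
    show "b < \<infinity>" unfolding b_def
      using c W_finite tl_time by (simp add: ennreal_mult_less_top)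
    fix \<psi> :: "'a \<Rightarrow> real"
    assume [measurable]: "\<psi> \<in> borel_measurable borel" and \<psi>: "\<And>x. r + \<delta> \<le> dist x0 x \<Longrightarrow> \<psi> x = 0"
    define S where "S = hsq s B \<psi> + l2sq B \<psi>"
    have \<psi>B: "\<psi> x = 0" if "x \<notin> B" for x using that \<delta> by (intro \<psi>) auto
    have "(\<integral>\<^sup>+t. absform t \<psi> + absprod t \<psi> \<partial>lborel) \<le>
      (\<integral>\<^sup>+t. (ennreal \<Lambda> * hsq s B (u t) + (c * W + 1) * l2sq B (u t) + c * emeasure lborel B * tl t)
         + (S * (ennreal \<Lambda> + c * W + 1) * indicator {0..T} t + S * c * tl t) \<partial>lborel)"
    proof (rule nn_integral_mono)
      fix t
      show "absform t \<psi> + absprod t \<psi> \<le> (ennreal \<Lambda> * hsq s B (u t) + (c * W + 1) * l2sq B (u t) + c * emeasure lborel B * tl t)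
         + (S * (ennreal \<Lambda> + c * W + 1) * indicator {0..T} t + S * c * tl t)"
      proof (cases "t \<in> {0..T}")
        case False
        then have "t \<le> 0 \<or> T \<le> t" by auto
        then show ?thesis by (simp add: abs_time_zero)
      next
        case True
        have P: "absprod t \<psi> \<le> l2sq B (u t) + S"
          using absprod_le[of \<psi> B 1 t] \<psi>B by (auto simp: S_def intro: order_trans add_left_mono add_increasing)
        have I: "absint \<psi> \<le> emeasure lborel B + S"
          using absint_le[of \<psi> B 1] \<psi>B by (auto simp: S_def intro: order_trans add_left_mono add_increasing)
        have "absform t \<psi> \<le> ennreal \<Lambda> * (hsq s B (u t) + hsq s B \<psi>) + c * (W * absprod t \<psi> + tl t * absint \<psi>)"
          using absform_le[of \<psi> 1 t] \<psi> by (simp add: c_def mult.assoc)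
        also have "\<dots> \<le> ennreal \<Lambda> * (hsq s B (u t) + S) + c * (W * (l2sq B (u t) + S) + tl t * (emeasure lborel B + S))"
          by (intro add_mono mult_left_mono P I) (auto simp: S_def)
        finally have "absform t \<psi> + absprod t \<psi> \<le> ennreal \<Lambda> * (hsq s B (u t) + S) + c * (W * (l2sq B (u t) + S) + tl t * (emeasure lborel B + S)) + (l2sq B (u t) + S)"
          using P by (rule add_mono)
        also have "\<dots> = (ennreal \<Lambda> * hsq s B (u t) + (c * W + 1) * l2sq B (u t) + c * emeasure lborel B * tl t)
         + (S * (ennreal \<Lambda> + c * W + 1) + S * c * tl t)"
          by (simp add: distrib_left distrib_right mult_ac add_ac)
        finally show ?thesis using True by simp
      qed
    qed
    also have "\<dots> = (\<integral>\<^sup>+t. (ennreal \<Lambda> * hsq s B (u t) + (c * W + 1) * l2sq B (u t) + c * emeasure lborel B * tl t) \<partial>lborel)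
         + (\<integral>\<^sup>+t. (S * (ennreal \<Lambda> + c * W + 1) * indicator {0..T} t + S * c * tl t) \<partial>lborel)"
      by (rule nn_integral_add) measurable
    also have "(\<integral>\<^sup>+t. (ennreal \<Lambda> * hsq s B (u t) + (c * W + 1) * l2sq B (u t) + c * emeasure lborel B * tl t) \<partial>lborel)
       = (\<integral>\<^sup>+t. (ennreal \<Lambda> * hsq s B (u t) + (c * W + 1) * l2sq B (u t)) \<partial>lborel) + (\<integral>\<^sup>+t. c * emeasure lborel B * tl t \<partial>lborel)"
      by (rule nn_integral_add) measurable
    also have "(\<integral>\<^sup>+t. (ennreal \<Lambda> * hsq s B (u t) + (c * W + 1) * l2sq B (u t)) \<partial>lborel)
       = (\<integral>\<^sup>+t. ennreal \<Lambda> * hsq s B (u t) \<partial>lborel) + (\<integral>\<^sup>+t. (c * W + 1) * l2sq B (u t) \<partial>lborel)"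
      by (rule nn_integral_add) measurable
    also have "(\<integral>\<^sup>+t. (S * (ennreal \<Lambda> + c * W + 1) * indicator {0..T} t + S * c * tl t) \<partial>lborel)
      = (\<integral>\<^sup>+t. S * (ennreal \<Lambda> + c * W + 1) * indicator {0..T} t \<partial>lborel) + (\<integral>\<^sup>+t. S * c * tl t \<partial>lborel)"
      by (rule nn_integral_add) measurable
    also have "(\<integral>\<^sup>+t. ennreal \<Lambda> * hsq s B (u t) \<partial>lborel) = ennreal \<Lambda> * (\<integral>\<^sup>+t. hsq s B (u t) \<partial>lborel)"
      by (rule nn_integral_cmult) measurable
    also have "(\<integral>\<^sup>+t. (c * W + 1) * l2sq B (u t) \<partial>lborel) = (c * W + 1) * (\<integral>\<^sup>+t. l2sq B (u t) \<partial>lborel)"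
      by (rule nn_integral_cmult) measurable
    also have "(\<integral>\<^sup>+t. c * emeasure lborel B * tl t \<partial>lborel) = c * emeasure lborel B * (\<integral>\<^sup>+t. tl t \<partial>lborel)"
      by (rule nn_integral_cmult) measurable
    also have "(\<integral>\<^sup>+t. S * c * tl t \<partial>lborel) = S * c * (\<integral>\<^sup>+t. tl t \<partial>lborel)"
      by (rule nn_integral_cmult) measurable
    also have "(\<integral>\<^sup>+t. S * (ennreal \<Lambda> + c * W + 1) * indicator {0..T} t \<partial>lborel) = S * (ennreal \<Lambda> + c * W + 1) * ennreal T"
      using T by (subst nn_integral_cmult_indicator) auto
    finally show "(\<integral>\<^sup>+t. absform t \<psi> + absprod t \<psi> \<partial>lborel) \<le> a + b * (hsq s B \<psi> + l2sq B \<psi>)"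
      by (simp add: a_def b_def S_def[symmetric] distrib_left distrib_right mult_ac)
  qed
qed

lemma adm_time:
  assumes "adm \<psi>"
  shows "(\<integral>\<^sup>+t. absform t \<psi> \<partial>lborel) < \<infinity>" "(\<integral>\<^sup>+t. absprod t \<psi> \<partial>lborel) < \<infinity>"
proof -
  note [measurable] = admD(1)[OF assms]
  obtain a b where ab0: "a < \<infinity>" "b < \<infinity>"
    "\<And>\<psi>. \<psi> \<in> borel_measurable borel \<Longrightarrow> (\<And>x. r + \<delta> \<le> dist x0 x \<Longrightarrow> \<psi> x = 0) \<Longrightarrow>
      (\<integral>\<^sup>+t. absform t \<psi> + absprod t \<psi> \<partial>lborel) \<le> a + b * (hsq s B \<psi> + l2sq B \<psi>)"
    by (rule abs_time) blast
  note ab = ab0(1,2) ab0(3)[OF admD(1,2)[OF assms]]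
  have "a + b * (hsq s B \<psi> + l2sq B \<psi>) < \<infinity>"
    using ab admD[OF assms] by (simp add: ennreal_mult_less_top)
  then have *: "(\<integral>\<^sup>+t. absform t \<psi> + absprod t \<psi> \<partial>lborel) < \<infinity>"
    using ab(3) by (rule le_less_trans[rotated])
  show "(\<integral>\<^sup>+t. absform t \<psi> \<partial>lborel) < \<infinity>"
    by (rule le_less_trans[OF nn_integral_mono *]) simp
  show "(\<integral>\<^sup>+t. absprod t \<psi> \<partial>lborel) < \<infinity>"
    by (rule le_less_trans[OF nn_integral_mono *]) simp
qed

lemma form_integrand_integrable:
  assumes [measurable]: "\<psi> \<in> borel_measurable borel" and "absform t \<psi> < \<infinity>"
  shows "integrable (lborel \<Otimes>\<^sub>M lborel) (\<lambda>(x, y). (u t x - u t y) * (\<psi> x - \<psi> y) * k t x y)"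
proof (rule integrableI_bounded)
  have "(\<integral>\<^sup>+p. ennreal (norm (case p of (x, y) \<Rightarrow> (u t x - u t y) * (\<psi> x - \<psi> y) * k t x y)) \<partial>(lborel \<Otimes>\<^sub>M lborel)) = absform t \<psi>"
    unfolding absform_def
    by (subst lborel.nn_integral_fst[symmetric], measurable) (simp add: abs_mult k_nonneg)
  then show "(\<integral>\<^sup>+p. ennreal (norm (case p of (x, y) \<Rightarrow> (u t x - u t y) * (\<psi> x - \<psi> y) * k t x y)) \<partial>(lborel \<Otimes>\<^sub>M lborel)) < \<infinity>"
    using assms by simp
qed measurable

lemma form_le_absform:
  assumes [measurable]: "\<psi> \<in> borel_measurable borel"
  shows "ennreal \<bar>form (k t) (u t) \<psi>\<bar> \<le> absform t \<psi>"
proof (cases "absform t \<psi> < \<infinity>")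
  case True
  from integral_norm_bound_ennreal[OF form_integrand_integrable[OF assms True]]
  have "ennreal \<bar>form (k t) (u t) \<psi>\<bar> \<le> (\<integral>\<^sup>+p. ennreal (norm (case p of (x, y) \<Rightarrow> (u t x - u t y) * (\<psi> x - \<psi> y) * k t x y)) \<partial>(lborel \<Otimes>\<^sub>M lborel))"
    by (simp add: form_def)
  also have "\<dots> = absform t \<psi>"
    unfolding absform_def
    by (subst lborel.nn_integral_fst[symmetric], measurable) (simp add: abs_mult k_nonneg)
  finally show ?thesis .
qed (auto simp: not_less top_unique)

lemma form_diff:
  assumes "\<psi>1 \<in> borel_measurable borel" "\<psi>2 \<in> borel_measurable borel"
    and "absform t \<psi>1 < \<infinity>" "absform t \<psi>2 < \<infinity>"
  shows "form (k t) (u t) (\<lambda>x. \<psi>1 x - \<psi>2 x) = form (k t) (u t) \<psi>1 - form (k t) (u t) \<psi>2"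
proof -
  have "form (k t) (u t) \<psi>1 - form (k t) (u t) \<psi>2 =
    (\<integral>p. (case p of (x, y) \<Rightarrow> (u t x - u t y) * (\<psi>1 x - \<psi>1 y) * k t x y) -
      (case p of (x, y) \<Rightarrow> (u t x - u t y) * (\<psi>2 x - \<psi>2 y) * k t x y) \<partial>(lborel \<Otimes>\<^sub>M lborel))"
    unfolding form_def
    by (rule Bochner_Integration.integral_diff[symmetric]) (intro form_integrand_integrable assms)+
  also have "\<dots> = form (k t) (u t) (\<lambda>x. \<psi>1 x - \<psi>2 x)"
    unfolding form_def by (rule Bochner_Integration.integral_cong) (auto simp: algebra_simps)
  finally show ?thesis by simp
qed

lemma prod_integrable:
  assumes [measurable]: "\<psi> \<in> borel_measurable borel" and "absprod t \<psi> < \<infinity>"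
  shows "integrable lborel (\<lambda>x. u t x * \<psi> x)"
  by (rule integrableI_bounded) (use assms(2) in \<open>auto simp: absprod_def\<close>)

lemma fpair_le_absprod:
  assumes [measurable]: "\<psi> \<in> borel_measurable borel"
  shows "ennreal \<bar>fpair t \<psi>\<bar> \<le> absprod t \<psi>"
proof (cases "absprod t \<psi> < \<infinity>")
  case True
  from integral_norm_bound_ennreal[OF prod_integrable[OF assms True]]
  show ?thesis by (simp add: fpair_def absprod_def)
qed (auto simp: not_less top_unique)

lemma fpair_diff:
  assumes "\<psi>1 \<in> borel_measurable borel" "\<psi>2 \<in> borel_measurable borel"
    and "absprod t \<psi>1 < \<infinity>" "absprod t \<psi>2 < \<infinity>"
  shows "fpair t (\<lambda>x. \<psi>1 x - \<psi>2 x) = fpair t \<psi>1 - fpair t \<psi>2"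
  unfolding fpair_def right_diff_distrib
  by (rule Bochner_Integration.integral_diff) (intro prod_integrable assms)+

lemma form_time_integrable: assumes "adm \<psi>" shows "integrable lborel (\<lambda>t. form (k t) (u t) \<psi>)"
proof (rule integrableI_bounded)
  note [measurable] = admD(1)[OF assms]
  show "(\<lambda>t. form (k t) (u t) \<psi>) \<in> borel_measurable lborel" by measurable
  show "(\<integral>\<^sup>+t. ennreal (norm (form (k t) (u t) \<psi>)) \<partial>lborel) < \<infinity>"
    by (rule le_less_trans[OF nn_integral_mono adm_time(1)[OF assms]])
       (use form_le_absform[OF admD(1)[OF assms]] in auto)
qed

lemma fpair_time_integrable: assumes "adm \<psi>" shows "integrable lborel (\<lambda>t. fpair t \<psi>)"
proof (rule integrableI_bounded)
  note [measurable] = admD(1)[OF assms]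
  show "(\<lambda>t. fpair t \<psi>) \<in> borel_measurable lborel" by measurable
  show "(\<integral>\<^sup>+t. ennreal (norm (fpair t \<psi>)) \<partial>lborel) < \<infinity>"
    by (rule le_less_trans[OF nn_integral_mono adm_time(2)[OF assms]])
       (use fpair_le_absprod[OF admD(1)[OF assms]] in auto)
qed

end

text \<open>What is used of a solution with zero initial data. Product test functions suffice; they
  are nonnegative, as in the notion of super- and subsolution, and vanish near both ends of (0, T).
  The initial condition is required at almost every small time because \<open>u\<close> will be a
  Borel version of a difference of solutions.\<close>

locale nonlocal_cauchy = nonlocal_data s T \<Lambda> k u
  for s T l \<Lambda> :: real and k :: "real \<Rightarrow> 'a::euclidean_space \<Rightarrow> 'a \<Rightarrow> real" and u :: "real \<Rightarrow> 'a \<Rightarrow> real" +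
  assumes l: "0 < l"
    and coercive: "AE t in lborel. 0 < t \<and> t < T \<longrightarrow>
      (\<forall>x0 r v. 0 < r \<longrightarrow> v \<in> borel_measurable borel \<longrightarrow> l2sq (ball x0 r) v < \<infinity> \<longrightarrow> hsq s (ball x0 r) v < \<infinity> \<longrightarrow>
        ennreal l * hsq s (ball x0 r) v \<le>
        (\<integral>\<^sup>+x\<in>ball x0 r. (\<integral>\<^sup>+y\<in>ball x0 r. ennreal ((v x - v y)\<^sup>2 * k t x y) \<partial>lborel) \<partial>lborel))"
    and weak: "\<And>\<eta> \<eta>' \<psi> a b x0 \<rho>. (\<And>t. (\<eta> has_real_derivative \<eta>' t) (at t)) \<Longrightarrow> continuous_on UNIV \<eta>' \<Longrightarrow>
      (\<And>t. 0 \<le> \<eta> t) \<Longrightarrow> 0 < a \<Longrightarrow> b < T \<Longrightarrow> (\<And>t. t \<le> a \<or> b \<le> t \<Longrightarrow> \<eta> t = 0) \<Longrightarrow>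
      \<psi> \<in> borel_measurable borel \<Longrightarrow> (\<And>x. 0 \<le> \<psi> x) \<Longrightarrow> \<rho> < 2 \<Longrightarrow> (\<And>x. \<rho> \<le> dist x0 x \<Longrightarrow> \<psi> x = 0) \<Longrightarrow>
      l2sq UNIV \<psi> < \<infinity> \<Longrightarrow> hsq s UNIV \<psi> < \<infinity> \<Longrightarrow>
      (\<integral>t. \<eta> t * form (k t) (u t) \<psi> \<partial>lborel) = (\<integral>t. \<eta>' t * (\<integral>x. u t x * \<psi> x \<partial>lborel) \<partial>lborel)"
    and init: "\<And>\<psi> R e. continuous_on UNIV \<psi> \<Longrightarrow> (\<And>x. norm x > R \<Longrightarrow> \<psi> x = 0) \<Longrightarrow> 0 < e \<Longrightarrow>
      \<exists>d>0. AE t in lborel. 0 < t \<and> t < d \<longrightarrow> \<bar>\<integral>x. u t x * \<psi> x \<partial>lborel\<bar> \<le> e"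

section \<open>Test functions that need not vanish at the initial time\<close>

locale nonlocal_cutoff = nonlocal_cauchy s T l \<Lambda> k u + nonlocal_ball s T \<Lambda> k u x0 r \<delta>
  for s T l \<Lambda> and k :: "real \<Rightarrow> 'a::euclidean_space \<Rightarrow> 'a \<Rightarrow> real" and u and x0 r \<delta>
begin

text \<open>Zero initial data are given against continuous functions only. Density in L2 extends
  them to \<psi>, because the local L2 norm of \<open>u\<close> stays bounded as t tends to
  0.\<close>

lemma init_adm:
  assumes \<psi>: "adm \<psi>" and e: "0 < (e::real)"
  obtains d where "0 < d" "AE t in lborel. 0 < t \<and> t < d \<longrightarrow> \<bar>fpair t \<psi>\<bar> \<le> e"
proof -
  note [measurable] = admD(1)[OF \<psi>]
  define R where "R = norm x0 + 2"
  obtain M where M: "0 \<le> M" "AE t in lborel. l2sq (ball 0 (R + 2)) (u t) \<le> ennreal M" by (rule u_L2_B)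
  \<comment> \<open>With this choice \<epsilon> M \<le> e/4, and the approximation error e
    \<epsilon> / 4 divided by \<epsilon> is again e/4.\<close>
  define \<epsilon> where "\<epsilon> = e / 4 / (M + 1)"
  have \<epsilon>: "0 < \<epsilon>" using e M by (simp add: \<epsilon>_def)
  have \<psi>R: "\<psi> x = 0" if "norm x > R" for x
    using that B_subset by (intro admD(3)[OF \<psi>]) (auto simp: R_def)
  have "(\<integral>\<^sup>+x. ennreal ((\<psi> x)\<^sup>2) \<partial>lborel) = l2sq B \<psi>"
    using l2sq_UNIV[of B \<psi>] admD(3)[OF \<psi>] by (simp add: l2sq_def)
  then have fin: "(\<integral>\<^sup>+x. ennreal ((\<psi> x)\<^sup>2) \<partial>lborel) < \<infinity>" using admD(4)[OF \<psi>] by simp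
  obtain g where g: "continuous_on UNIV g" "\<And>x. norm x > R + 1 \<Longrightarrow> g x = 0"
    "(\<integral>\<^sup>+x. ennreal ((\<psi> x - g x)\<^sup>2) \<partial>lborel) < ennreal (e * \<epsilon> / 4)"
    using L2_approx_continuous[where f = \<psi> and R = R and e = "e * \<epsilon> / 4"] \<psi>R fin e \<epsilon> by auto
  have [measurable]: "g \<in> borel_measurable borel"
    using g(1) by (rule borel_measurable_continuous_onI)
  have g0: "g x = 0" if "x \<notin> ball 0 (R + 2)" for x using that by (intro g(2)) auto
  have \<psi>0: "\<psi> x = 0" if "x \<notin> ball 0 (R + 2)" for x using that by (intro \<psi>R) auto
  have l2fin: "l2sq (ball 0 (R+2)) \<psi> < \<infinity>"
    using fin l2sq_mono[of "ball 0 (R+2)" UNIV \<psi>] by (auto simp: l2sq_def intro: le_less_trans)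
  have l2d: "l2sq (ball 0 (R+2)) (\<lambda>x. \<psi> x - g x) \<le> ennreal (e * \<epsilon> / 4)"
    using less_imp_le[OF g(3)] l2sq_mono[of "ball 0 (R+2)" UNIV "\<lambda>x. \<psi> x - g x"] by (auto simp: l2sq_def intro: order_trans)
  obtain d where d: "0 < d" "AE t in lborel. 0 < t \<and> t < d \<longrightarrow> \<bar>\<integral>x. u t x * g x \<partial>lborel\<bar> \<le> e / 2"
    using init[where \<psi> = g and R = "R + 1" and e = "e/2"] g(1,2) e by auto
  have "AE t in lborel. 0 < t \<and> t < d \<longrightarrow> \<bar>fpair t \<psi>\<bar> \<le> e"
    using M(2) d(2)
  proof eventually_elim
    case (elim t)
    show ?case
    proof
      assume "0 < t \<and> t < d"
      then have gt: "\<bar>fpair t g\<bar> \<le> e / 2" using elim(2) by (simp add: fpair_def)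
      have "absprod t \<psi> \<le> ennreal 1 * l2sq (ball 0 (R+2)) (u t) + ennreal (1/1) * l2sq (ball 0 (R+2)) \<psi>"
        by (rule absprod_le) (use \<psi>0 in auto)
      also have "\<dots> < \<infinity>" using elim(1) l2fin by (auto intro: le_less_trans)
      finally have A: "absprod t \<psi> < \<infinity>" .
      have "absprod t (\<lambda>x. \<psi> x - g x) \<le> ennreal \<epsilon> * l2sq (ball 0 (R+2)) (u t) + ennreal (1/\<epsilon>) * l2sq (ball 0 (R+2)) (\<lambda>x. \<psi> x - g x)"
        by (rule absprod_le) (use \<psi>0 g0 \<epsilon> in auto)
      also have "\<dots> \<le> ennreal \<epsilon> * ennreal M + ennreal (1/\<epsilon>) * ennreal (e * \<epsilon> / 4)"
        by (intro add_mono mult_left_mono elim l2d) auto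
      also have "\<dots> = ennreal (\<epsilon> * M + e / 4)"
        using \<epsilon> M e by (simp add: ennreal_mult[symmetric] ennreal_plus[symmetric] del: ennreal_plus)
      also have "\<dots> \<le> ennreal (e / 2)"
      proof (rule ennreal_leI)
        have "\<epsilon> * M \<le> \<epsilon> * (M + 1)" using \<epsilon> by simp
        also have "\<dots> = e / 4" using M(1) nonzero_eq_divide_eq[of "M + 1" \<epsilon> "e / 4"] by (auto simp: \<epsilon>_def)
        finally show "\<epsilon> * M + e / 4 \<le> e / 2" by simp
      qed
      finally have D: "absprod t (\<lambda>x. \<psi> x - g x) \<le> ennreal (e / 2)" .
      have "fpair t (\<lambda>x. \<psi> x - (\<psi> x - g x)) = fpair t \<psi> - fpair t (\<lambda>x. \<psi> x - g x)"
        by (rule fpair_diff) (use A D in \<open>auto intro: le_less_trans\<close>)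
      then have "fpair t \<psi> = fpair t g + fpair t (\<lambda>x. \<psi> x - g x)" by simp
      moreover have "\<bar>fpair t (\<lambda>x. \<psi> x - g x)\<bar> \<le> e / 2"
        using order_trans[OF fpair_le_absprod D] e by (simp add: ennreal_le_iff)
      ultimately show "\<bar>fpair t \<psi>\<bar> \<le> e" using gt by linarith
    qed
  qed
  then show ?thesis using d(1) that by blast
qed

text \<open>The time weight is multiplied by cutoffs that vanish near 0 and tend to 1. Their
  derivatives are of order n on intervals of length of order 1/n, so they average the pairing of
  \<open>u\<close> with \<psi> over small times, and this average tends to 0 by the initial
  condition.\<close>

lemma weak_adm_nonneg:
  assumes \<psi>: "adm \<psi>" and \<psi>0: "\<And>x. 0 \<le> \<psi> x"
    and \<eta>: "\<And>t. (\<eta> has_real_derivative \<eta>' t) (at t)" "continuous_on UNIV \<eta>'"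
    and \<eta>0: "\<And>t. 0 \<le> \<eta> t" and bd: "\<And>t. \<bar>\<eta> t\<bar> \<le> C" "\<And>t. \<bar>\<eta>' t\<bar> \<le> C"
    and b: "b < T" "\<And>t. b \<le> t \<Longrightarrow> \<eta> t = 0"
  shows "(\<integral>t. \<eta> t * form (k t) (u t) \<psi> \<partial>lborel) = (\<integral>t. \<eta>' t * fpair t \<psi> \<partial>lborel)"
proof -
  note [measurable] = admD(1)[OF \<psi>]
  have C: "0 \<le> C" using bd(1)[of 0] by linarith
  have "continuous_on UNIV \<eta>" using \<eta>(1) by (intro DERIV_continuous_on) (auto intro: has_field_derivative_at_within)
  then have [measurable]: "\<eta> \<in> borel_measurable borel" by (rule borel_measurable_continuous_onI)
  have [measurable]: "\<eta>' \<in> borel_measurable borel" using \<eta>(2) by (rule borel_measurable_continuous_onI)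
  have [measurable]: "step_fun \<in> borel_measurable borel"  "step_fun' \<in> borel_measurable borel"
    unfolding step_fun_def[abs_def] step_fun'_def[abs_def] by measurable
  have fi: "integrable lborel (\<lambda>t. form (k t) (u t) \<psi>)" by (rule form_time_integrable[OF \<psi>])
  have pi: "integrable lborel (\<lambda>t. fpair t \<psi>)" by (rule fpair_time_integrable[OF \<psi>])
  \<comment> \<open>Equal to 0 up to time 1/(n+1) and to 1 from time 2/(n+1) on.\<close>
  define cut where "cut n t = step_fun (real (Suc n) * t - 1)" for n t
  define cut' where "cut' n t = real (Suc n) * step_fun' (real (Suc n) * t - 1)" for n t
  have [measurable]: "cut n \<in> borel_measurable borel" "cut' n \<in> borel_measurable borel" for n
    unfolding cut_def cut'_def by measurable
  have cutd: "(cut n has_real_derivative cut' n t) (at t)" for n t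
  proof -
    have "((\<lambda>t. real (Suc n) * t - 1) has_real_derivative real (Suc n)) (at t)"
      by (auto intro!: derivative_eq_intros)
    from DERIV_chain2[OF step_fun_deriv this] show ?thesis
      unfolding cut_def[abs_def] cut'_def by (simp add: mult.commute)
  qed
  have cutb: "0 \<le> cut n t" "cut n t \<le> 1" "0 \<le> cut' n t" "cut' n t \<le> 4 * real (Suc n)" for n t
  proof -
    show "0 \<le> cut n t" "cut n t \<le> 1" by (simp_all add: cut_def step_fun_bounds)
    show "0 \<le> cut' n t" by (simp add: cut'_def step_fun'_bounds)
    show "cut' n t \<le> 4 * real (Suc n)"
      unfolding cut'_def mult.commute[of 4] by (intro mult_left_mono step_fun'_bounds) auto
  qed
  have cut1: "\<forall>\<^sub>F n in sequentially. cut n t = 1" if "0 < t" for t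
  proof -
    obtain m where m: "2 / t \<le> real m" using real_arch_simple by blast
    show ?thesis
    proof (rule eventually_sequentiallyI[of m])
      fix n assume "m \<le> n"
      then have "2 / t \<le> real (Suc n)" using m by simp
      then have "2 \<le> real (Suc n) * t" using that by (simp add: pos_divide_le_eq)
      then show "cut n t = 1" unfolding cut_def by (intro step_fun_1) simp
    qed
  qed
  have cut0: "cut n t = 0" if "t \<le> 1 / real (Suc n)" for n t
    using that unfolding cut_def by (intro step_fun_0) (simp add: field_simps)
  have cut'0: "cut' n t = 0" if "t \<notin> {0<..<2 / real (Suc n)}" for n t
  proof (cases "t \<le> 0")
    case True
    then have "real (Suc n) * t \<le> 0" by (intro mult_nonneg_nonpos) auto
    then show ?thesis unfolding cut'_def by (simp add: step_fun'_0)
  next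
    case False
    then have "2 \<le> real (Suc n) * t" using that by (simp add: field_simps)
    then show ?thesis unfolding cut'_def by (simp add: step_fun'_1)
  qed
  have l2: "l2sq UNIV \<psi> < \<infinity>" using l2sq_UNIV[of B \<psi>] admD(3,4)[OF \<psi>] by simp
  have "hsq s UNIV \<psi> \<le> hsq s B \<psi> + 2 * (ennreal C\<^sub>\<delta> * W * l2sq B \<psi>)"
    by (rule hsq_UNIV_le[OF admD(1,2)[OF \<psi>]])
  also have "\<dots> < \<infinity>" using admD(4,5)[OF \<psi>] W_finite by (simp add: ennreal_mult_less_top)
  finally have h: "hsq s UNIV \<psi> < \<infinity>" .
  have eq: "(\<integral>t. \<eta> t * cut n t * form (k t) (u t) \<psi> \<partial>lborel) =
     (\<integral>t. \<eta>' t * cut n t * fpair t \<psi> \<partial>lborel) + (\<integral>t. \<eta> t * cut' n t * fpair t \<psi> \<partial>lborel)" for n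
  proof -
    have "(\<integral>t. (\<eta> t * cut n t) * form (k t) (u t) \<psi> \<partial>lborel) =
       (\<integral>t. (\<eta>' t * cut n t + cut' n t * \<eta> t) * (\<integral>x. u t x * \<psi> x \<partial>lborel) \<partial>lborel)"
    proof (rule weak[of "\<lambda>t. \<eta> t * cut n t" _ "1 / real (Suc n)" b \<psi> "r + \<delta>" x0])
      show "((\<lambda>t. \<eta> t * cut n t) has_real_derivative \<eta>' t * cut n t + cut' n t * \<eta> t) (at t)" for t
        by (rule DERIV_mult[OF \<eta>(1) cutd])
      have "continuous_on UNIV (cut n)" using cutd by (intro DERIV_continuous_on) (auto intro: has_field_derivative_at_within)
      moreover have "continuous_on UNIV (cut' n)"
        unfolding cut'_def by (intro continuous_intros continuous_on_compose2[OF step_fun_cont]) auto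
      ultimately show "continuous_on UNIV (\<lambda>t. \<eta>' t * cut n t + cut' n t * \<eta> t)"
        by (intro continuous_intros \<eta>(2) \<open>continuous_on UNIV \<eta>\<close>)
      show "\<eta> t * cut n t = 0" if "t \<le> 1 / real (Suc n) \<or> b \<le> t" for t
        using that cut0 b by auto
    qed (use \<eta>0 cutb b \<psi>0 r\<delta> \<delta> admD(2)[OF \<psi>] l2 h in auto)
    also have "\<dots> = (\<integral>t. \<eta>' t * cut n t * fpair t \<psi> + \<eta> t * cut' n t * fpair t \<psi> \<partial>lborel)"
      by (intro Bochner_Integration.integral_cong) (auto simp: fpair_def algebra_simps)
    also have "\<dots> = (\<integral>t. \<eta>' t * cut n t * fpair t \<psi> \<partial>lborel) + (\<integral>t. \<eta> t * cut' n t * fpair t \<psi> \<partial>lborel)"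
    proof (rule Bochner_Integration.integral_add)
      show "integrable lborel (\<lambda>t. \<eta>' t * cut n t * fpair t \<psi>)"
      proof (rule Bochner_Integration.integrable_bound[OF integrable_mult_right[of C, OF pi]])
        show "AE t in lborel. norm (\<eta>' t * cut n t * fpair t \<psi>) \<le> norm (C * fpair t \<psi>)"
          using bd cutb C mult_mono[of "\<bar>\<eta>' _\<bar>" C "\<bar>cut n _\<bar>" 1]
          by (intro AE_I2) (auto simp: abs_mult intro!: mult_right_mono)
      qed measurable
      show "integrable lborel (\<lambda>t. \<eta> t * cut' n t * fpair t \<psi>)"
      proof (rule Bochner_Integration.integrable_bound[OF integrable_mult_right[of "C * (4 * real (Suc n))", OF pi]])
        show "AE t in lborel. norm (\<eta> t * cut' n t * fpair t \<psi>) \<le> norm (C * (4 * real (Suc n)) * fpair t \<psi>)"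
        proof (rule AE_I2)
          fix t
          have "\<bar>\<eta> t\<bar> * \<bar>cut' n t\<bar> \<le> C * (4 * real (Suc n))"
            using bd cutb C by (intro mult_mono) auto
          then show "norm (\<eta> t * cut' n t * fpair t \<psi>) \<le> norm (C * (4 * real (Suc n)) * fpair t \<psi>)"
            using C by (auto simp: abs_mult intro!: mult_right_mono)
        qed
      qed measurable
    qed
    finally show ?thesis .
  qed
  have L1: "(\<lambda>n. \<integral>t. \<eta> t * cut n t * form (k t) (u t) \<psi> \<partial>lborel) \<longlonglongrightarrow> (\<integral>t. \<eta> t * form (k t) (u t) \<psi> \<partial>lborel)"
  proof (rule integral_dominated_convergence[where w = "\<lambda>t. C * \<bar>form (k t) (u t) \<psi>\<bar>"])
    show "integrable lborel (\<lambda>t. C * \<bar>form (k t) (u t) \<psi>\<bar>)" using fi by simp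
    show "AE t in lborel. (\<lambda>n. \<eta> t * cut n t * form (k t) (u t) \<psi>) \<longlonglongrightarrow> \<eta> t * form (k t) (u t) \<psi>"
    proof (intro AE_I2 tendsto_eventually)
      fix t show "\<forall>\<^sub>F n in sequentially. \<eta> t * cut n t * form (k t) (u t) \<psi> = \<eta> t * form (k t) (u t) \<psi>"
      proof (cases "0 < t")
        case True show ?thesis using cut1[OF True] by eventually_elim simp
      qed (simp add: abs_time_zero)
    qed
    show "AE t in lborel. norm (\<eta> t * cut n t * form (k t) (u t) \<psi>) \<le> C * \<bar>form (k t) (u t) \<psi>\<bar>" for n
      using bd cutb C mult_mono[of "\<bar>\<eta> _\<bar>" C "\<bar>cut n _\<bar>" 1]
      by (intro AE_I2) (auto simp: abs_mult intro!: mult_right_mono)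
  qed measurable
  have L2: "(\<lambda>n. \<integral>t. \<eta>' t * cut n t * fpair t \<psi> \<partial>lborel) \<longlonglongrightarrow> (\<integral>t. \<eta>' t * fpair t \<psi> \<partial>lborel)"
  proof (rule integral_dominated_convergence[where w = "\<lambda>t. C * \<bar>fpair t \<psi>\<bar>"])
    show "integrable lborel (\<lambda>t. C * \<bar>fpair t \<psi>\<bar>)" using pi by simp
    show "AE t in lborel. (\<lambda>n. \<eta>' t * cut n t * fpair t \<psi>) \<longlonglongrightarrow> \<eta>' t * fpair t \<psi>"
    proof (intro AE_I2 tendsto_eventually)
      fix t show "\<forall>\<^sub>F n in sequentially. \<eta>' t * cut n t * fpair t \<psi> = \<eta>' t * fpair t \<psi>"
      proof (cases "0 < t")
        case True show ?thesis using cut1[OF True] by eventually_elim simp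
      qed (simp add: abs_time_zero)
    qed
    show "AE t in lborel. norm (\<eta>' t * cut n t * fpair t \<psi>) \<le> C * \<bar>fpair t \<psi>\<bar>" for n
      using bd cutb C mult_mono[of "\<bar>\<eta>' _\<bar>" C "\<bar>cut n _\<bar>" 1]
      by (intro AE_I2) (auto simp: abs_mult intro!: mult_right_mono)
  qed measurable
  have L3: "(\<lambda>n. \<integral>t. \<eta> t * cut' n t * fpair t \<psi> \<partial>lborel) \<longlonglongrightarrow> 0"
  proof (rule LIMSEQ_I)
    fix e :: real assume e: "0 < e"
    \<comment> \<open>One 8 is the derivative bound 4 (n+1) times the length 2/(n+1) of its support;
      the added 8 covers C = 0 and makes the final inequality strict.\<close>
    define e' where "e' = e / (8 * C + 8)"
    have e': "0 < e'" using e C by (simp add: e'_def)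
    obtain d where d: "0 < d" "AE t in lborel. 0 < t \<and> t < d \<longrightarrow> \<bar>fpair t \<psi>\<bar> \<le> e'"
      by (rule init_adm[OF \<psi> e'])
    obtain m where m: "2 / d \<le> real m" using real_arch_simple by blast
    show "\<exists>no. \<forall>n\<ge>no. norm ((\<integral>t. \<eta> t * cut' n t * fpair t \<psi> \<partial>lborel) - 0) < e"
    proof (intro exI allI impI)
      fix n assume n: "m \<le> n"
      let ?N = "real (Suc n)"
      have "2 / d \<le> ?N" using m n by simp
      then have nd: "2 / ?N \<le> d" using d(1) by (simp add: field_simps)
      have A: "AE t in lborel. norm (\<eta> t * cut' n t * fpair t \<psi>) \<le> (C * (4 * ?N) * e') * indicator {0<..<2 / ?N} t"
        using d(2)
      proof eventually_elim
        case (elim t)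
        show ?case
        proof (cases "t \<in> {0<..<2/?N}")
          case True
          then have "\<bar>fpair t \<psi>\<bar> \<le> e'" using elim nd by auto
          then have "\<bar>\<eta> t\<bar> * \<bar>cut' n t\<bar> * \<bar>fpair t \<psi>\<bar> \<le> (C * (4 * ?N)) * e'"
            using bd cutb[of n t] C by (intro mult_mono) auto
          then show ?thesis using True by (simp add: abs_mult)
        next
          case False then show ?thesis using cut'0[OF False] by simp
        qed
      qed
      have ii: "integrable lborel (\<lambda>t. (C * (4 * ?N) * e') * indicator {0<..<2 / ?N} t :: real)"
        by (intro integrable_mult_right integrable_real_indicator) auto
      have "norm (\<integral>t. \<eta> t * cut' n t * fpair t \<psi> \<partial>lborel) \<le> (\<integral>t. norm (\<eta> t * cut' n t * fpair t \<psi>) \<partial>lborel)"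
        by (rule integral_norm_bound)
      also have "\<dots> \<le> (\<integral>t. (C * (4 * ?N) * e') * indicator {0<..<2 / ?N} t \<partial>lborel)"
        by (rule integral_mono_AE[OF _ ii A], rule Bochner_Integration.integrable_bound[OF ii])
          (measurable, use A in \<open>eventually_elim, auto\<close>)
      also have "\<dots> = C * (4 * ?N) * e' * (2 / ?N)" by simp
      also have "\<dots> = 8 * C * e'" by (simp add: field_simps)
      also have "\<dots> < (8 * C + 8) * e'" using e' by (simp add: algebra_simps)
      also have "\<dots> = e" using C by (simp add: e'_def)
      finally show "norm ((\<integral>t. \<eta> t * cut' n t * fpair t \<psi> \<partial>lborel) - 0) < e" by simp
    qed
  qed
  from LIMSEQ_unique[OF L1[unfolded eq] tendsto_add[OF L2 L3]] show ?thesis by simp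
qed

text \<open>Positive and negative part are contractions of \<psi> and hence admissible; at almost
  every time form and pairing are finite on both parts and therefore additive.\<close>

lemma weak_adm:
  assumes \<psi>: "adm \<psi>"
    and \<eta>: "\<And>t. (\<eta> has_real_derivative \<eta>' t) (at t)" "continuous_on UNIV \<eta>'"
    and \<eta>0: "\<And>t. 0 \<le> \<eta> t" and bd: "\<And>t. \<bar>\<eta> t\<bar> \<le> C" "\<And>t. \<bar>\<eta>' t\<bar> \<le> C"
    and b: "b < T" "\<And>t. b \<le> t \<Longrightarrow> \<eta> t = 0"
  shows "(\<integral>t. \<eta> t * form (k t) (u t) \<psi> \<partial>lborel) = (\<integral>t. \<eta>' t * fpair t \<psi> \<partial>lborel)"
proof -
  note [measurable] = admD(1)[OF \<psi>]
  define p where "p x = max 0 (\<psi> x)" for x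
  define q where "q x = max 0 (- \<psi> x)" for x
  have [measurable]: "p \<in> borel_measurable borel" "q \<in> borel_measurable borel" by (auto simp: p_def[abs_def] q_def[abs_def])
  have adm: "adm p" "adm q"
  proof -
    have "hsq s B p \<le> hsq s B \<psi>" "hsq s B q \<le> hsq s B \<psi>"
      by (rule hsq_contraction; auto simp: p_def q_def)+
    moreover have "l2sq B p \<le> l2sq B \<psi>" "l2sq B q \<le> l2sq B \<psi>"
      unfolding l2sq_def by (intro nn_integral_mono mult_right_mono ennreal_leI; auto simp: p_def q_def max_def)+
    ultimately show "adm p" "adm q"
      using admD[OF \<psi>] unfolding adm_def by (auto simp: p_def q_def intro: le_less_trans)
  qed
  have eq: "\<psi> = (\<lambda>x. p x - q x)" by (auto simp: p_def q_def)
  have \<eta>c: "continuous_on UNIV \<eta>" using \<eta>(1) by (intro DERIV_continuous_on) (auto intro: has_field_derivative_at_within)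
  then have [measurable]: "\<eta> \<in> borel_measurable borel" by (rule borel_measurable_continuous_onI)
  have [measurable]: "\<eta>' \<in> borel_measurable borel" using \<eta>(2) by (rule borel_measurable_continuous_onI)
  have aeF: "AE t in lborel. form (k t) (u t) \<psi> = form (k t) (u t) p - form (k t) (u t) q"
  proof -
    have "AE t in lborel. absform t p \<noteq> \<infinity>" "AE t in lborel. absform t q \<noteq> \<infinity>"
      by (rule nn_integral_noteq_infinite; use adm_time(1) adm in \<open>auto simp: less_top\<close>)+
    then show ?thesis
      by eventually_elim (subst eq, rule form_diff, auto simp: less_top)
  qed
  have aeP: "AE t in lborel. fpair t \<psi> = fpair t p - fpair t q"
  proof -
    have "AE t in lborel. absprod t p \<noteq> \<infinity>" "AE t in lborel. absprod t q \<noteq> \<infinity>"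
      by (rule nn_integral_noteq_infinite; use adm_time(2) adm in \<open>auto simp: less_top\<close>)+
    then show ?thesis
      by eventually_elim (subst eq, rule fpair_diff, auto simp: less_top)
  qed
  have bdi: "integrable lborel (\<lambda>t. g t * f t)"
    if [measurable]: "g \<in> borel_measurable borel" and g: "\<And>t. \<bar>g t\<bar> \<le> C" and f: "integrable lborel f" for f g :: "real \<Rightarrow> real"
  proof (rule Bochner_Integration.integrable_bound[OF integrable_mult_right[of C, OF f]])
    have [measurable]: "f \<in> borel_measurable borel" using f by simp
    show "(\<lambda>t. g t * f t) \<in> borel_measurable lborel" by measurable
    show "AE t in lborel. norm (g t * f t) \<le> norm (C * f t)"
    proof (rule AE_I2)
      fix t show "norm (g t * f t) \<le> norm (C * f t)"
        using g[of t] by (auto simp: abs_mult intro!: mult_right_mono)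
    qed
  qed
  note meas = borel_measurable_integrable[OF form_time_integrable] borel_measurable_integrable[OF fpair_time_integrable]
  note [measurable] = meas[OF \<psi>] meas[OF adm(1)] meas[OF adm(2)]
  have "(\<integral>t. \<eta> t * form (k t) (u t) \<psi> \<partial>lborel) = (\<integral>t. \<eta> t * form (k t) (u t) p - \<eta> t * form (k t) (u t) q \<partial>lborel)"
  proof (rule integral_cong_AE)
    show "AE t in lborel. \<eta> t * form (k t) (u t) \<psi> = \<eta> t * form (k t) (u t) p - \<eta> t * form (k t) (u t) q"
      using aeF by eventually_elim (simp add: right_diff_distrib)
  qed auto
  also have "\<dots> = (\<integral>t. \<eta> t * form (k t) (u t) p \<partial>lborel) - (\<integral>t. \<eta> t * form (k t) (u t) q \<partial>lborel)"
    by (intro Bochner_Integration.integral_diff bdi form_time_integrable adm bd) auto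
  also have "(\<integral>t. \<eta> t * form (k t) (u t) p \<partial>lborel) = (\<integral>t. \<eta>' t * fpair t p \<partial>lborel)"
    by (rule weak_adm_nonneg[OF adm(1) _ \<eta> \<eta>0 bd b]) (auto simp: p_def)
  also have "(\<integral>t. \<eta> t * form (k t) (u t) q \<partial>lborel) = (\<integral>t. \<eta>' t * fpair t q \<partial>lborel)"
    by (rule weak_adm_nonneg[OF adm(2) _ \<eta> \<eta>0 bd b]) (auto simp: q_def)
  also have "(\<integral>t. \<eta>' t * fpair t p \<partial>lborel) - (\<integral>t. \<eta>' t * fpair t q \<partial>lborel) = (\<integral>t. \<eta>' t * fpair t p - \<eta>' t * fpair t q \<partial>lborel)"
    by (intro Bochner_Integration.integral_diff[symmetric] bdi fpair_time_integrable adm bd) auto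
  also have "\<dots> = (\<integral>t. \<eta>' t * fpair t \<psi> \<partial>lborel)"
  proof (rule integral_cong_AE)
    show "AE t in lborel. \<eta>' t * fpair t p - \<eta>' t * fpair t q = \<eta>' t * fpair t \<psi>"
      using aeP by eventually_elim (simp add: right_diff_distrib)
  qed auto
  finally show ?thesis .
qed

end

section \<open>Continuity in time of families of test functions\<close>

text \<open>Convergence to 0 as z tends to 0, for extended values; z = 0 is included, so that
  \<open>X 0 = 0\<close> follows.\<close>

definition vanish :: "(real \<Rightarrow> ennreal) \<Rightarrow> bool" where
  "vanish X \<longleftrightarrow> (\<forall>e::real. 0 < e \<longrightarrow> (\<exists>d>0. \<forall>z. \<bar>z\<bar> < d \<longrightarrow> X z \<le> ennreal e))"

text \<open>First \<epsilon> is fixed to make the first term small, then z. This is the pattern of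
  Young's inequality when only one of the two factors tends to 0.\<close>

lemma vanish_interp:
  assumes Y: "vanish Y" and A: "A < \<infinity>" and K: "\<And>\<epsilon>. 0 < \<epsilon> \<Longrightarrow> K \<epsilon> < \<infinity>"
    and X: "\<And>\<epsilon> z. 0 < \<epsilon> \<Longrightarrow> X z \<le> ennreal \<epsilon> * A + K \<epsilon> * Y z"
  shows "vanish X"
  unfolding vanish_def
proof (intro allI impI)
  fix e :: real assume e: "0 < e"
  obtain a where a: "0 \<le> a" "A = ennreal a" using A by (cases A) auto
  define \<epsilon> where "\<epsilon> = e / 2 / (a + 1)"
  have \<epsilon>: "0 < \<epsilon>" using e a by (simp add: \<epsilon>_def)
  have \<epsilon>a: "\<epsilon> * a \<le> e / 2"
  proof -
    have "\<epsilon> * a \<le> \<epsilon> * (a + 1)" using \<epsilon> by simp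
    also have "\<dots> = e / 2" using a nonzero_eq_divide_eq[of "a + 1" \<epsilon> "e / 2"] by (auto simp: \<epsilon>_def)
    finally show ?thesis .
  qed
  obtain c where c: "0 \<le> c" "K \<epsilon> = ennreal c" using K[OF \<epsilon>] by (cases "K \<epsilon>") auto
  define e' where "e' = e / 2 / (c + 1)"
  have e': "0 < e'" using e c by (simp add: e'_def)
  have ce: "c * e' \<le> e / 2"
  proof -
    have "c * e' \<le> (c + 1) * e'" using e' by simp
    also have "\<dots> = e / 2" using c nonzero_eq_divide_eq[of "c + 1" e' "e / 2"] by (auto simp: e'_def mult.commute)
    finally show ?thesis .
  qed
  obtain d where d: "d > 0" "\<And>z. \<bar>z\<bar> < d \<Longrightarrow> Y z \<le> ennreal e'"
    using Y e' unfolding vanish_def by blast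
  show "\<exists>d>0. \<forall>z. \<bar>z\<bar> < d \<longrightarrow> X z \<le> ennreal e"
  proof (intro exI conjI allI impI)
    fix z assume z: "\<bar>z\<bar> < d"
    have "X z \<le> ennreal \<epsilon> * ennreal a + ennreal c * ennreal e'"
      by (rule order_trans[OF X[OF \<epsilon>]], unfold a c, intro add_mono mult_left_mono d z) auto
    also have "\<dots> = ennreal (\<epsilon> * a + c * e')"
      using \<epsilon> a c e' by (simp add: ennreal_mult ennreal_plus)
    also have "\<dots> \<le> ennreal e" by (rule ennreal_leI) (use \<epsilon>a ce in linarith)
    finally show "X z \<le> ennreal e" .
  qed (rule d)
qed

lemma vanish_mono: "vanish Y \<Longrightarrow> (\<And>z. X z \<le> Y z) \<Longrightarrow> vanish X"
  by (rule vanish_interp[where A = 0 and K = "\<lambda>_. 1"]) auto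

lemma vanish_cmult: "vanish Y \<Longrightarrow> c < \<infinity> \<Longrightarrow> vanish (\<lambda>z. c * Y z)"
  by (rule vanish_interp[where A = 0 and K = "\<lambda>_. c"]) auto

lemma vanish_add:
  assumes "vanish X" "vanish Y" shows "vanish (\<lambda>z. X z + Y z)"
  unfolding vanish_def
proof (intro allI impI)
  fix e :: real assume "0 < e"
  then have "0 < e / 2" by simp
  then obtain c d where "c > 0" "\<And>z. \<bar>z\<bar> < c \<Longrightarrow> X z \<le> ennreal (e/2)" "d > 0" "\<And>z. \<bar>z\<bar> < d \<Longrightarrow> Y z \<le> ennreal (e/2)"
    using assms unfolding vanish_def by metis
  moreover have "ennreal e = ennreal (e/2) + ennreal (e/2)" using \<open>0 < e\<close> by (simp flip: ennreal_plus)
  ultimately show "\<exists>d>0. \<forall>z. \<bar>z\<bar> < d \<longrightarrow> X z + Y z \<le> ennreal e"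
    by (intro exI[of _ "min c d"]) (auto intro!: add_mono)
qed

text \<open>Prepares the limit in the doubled time variable, where the weight sits at the midpoint t
  + z/2. The difference splits into the change of \<Phi> against a bounded weight and the change of
  the weight against \<Phi> at z = 0; the latter is uniformly small because \<open>\<Phi> 0\<close>
  lives on [0, T].\<close>

lemma weighted_integral_continuous:
  fixes \<Phi> :: "real \<Rightarrow> real \<Rightarrow> real"
  assumes g: "continuous_on UNIV g" "\<And>t. \<bar>g t\<bar> \<le> C"
    and [measurable]: "\<And>z. \<Phi> z \<in> borel_measurable borel" and i0: "integrable lborel (\<Phi> 0)"
    and v: "vanish (\<lambda>z. \<integral>\<^sup>+t. ennreal \<bar>\<Phi> z t - \<Phi> 0 t\<bar> \<partial>lborel)"
    and T: "0 \<le> T" and \<Phi>0: "\<And>t. t \<le> 0 \<or> T \<le> t \<Longrightarrow> \<Phi> 0 t = 0"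
  shows "vanish (\<lambda>z. ennreal \<bar>(\<integral>t. g (t + z / 2) * \<Phi> z t \<partial>lborel) - (\<integral>t. g t * \<Phi> 0 t \<partial>lborel)\<bar>)"
proof -
  have [measurable]: "g \<in> borel_measurable borel" using g(1) by (rule borel_measurable_continuous_onI)
  have C: "0 \<le> C" using g(2)[of 0] by linarith
  define V where "V z = (\<integral>\<^sup>+t. ennreal \<bar>\<Phi> z t - \<Phi> 0 t\<bar> \<partial>lborel)" for z
  define Y where "Y z = (\<integral>\<^sup>+t. ennreal (\<bar>g (t + z / 2) - g t\<bar> * \<bar>\<Phi> 0 t\<bar>) \<partial>lborel)" for z
  have F: "(\<integral>\<^sup>+t. ennreal \<bar>\<Phi> 0 t\<bar> \<partial>lborel) < \<infinity>"
    using i0 unfolding integrable_iff_bounded by simp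
  have vY: "vanish Y"
    unfolding vanish_def
  proof (intro allI impI)
    fix e :: real assume e: "0 < e"
    obtain a where a: "0 \<le> a" "(\<integral>\<^sup>+t. ennreal \<bar>\<Phi> 0 t\<bar> \<partial>lborel) = ennreal a" using F by (cases "\<integral>\<^sup>+t. ennreal \<bar>\<Phi> 0 t\<bar> \<partial>lborel") auto
    define q where "q = e / (a + 1)"
    have q: "0 < q" using e a by (simp add: q_def)
    have "uniformly_continuous_on {-1..T+1} g"
      by (intro compact_uniformly_continuous continuous_on_subset[OF g(1)]) auto
    then obtain d where d: "0 < d" "\<And>x y. x \<in> {-1..T+1} \<Longrightarrow> y \<in> {-1..T+1} \<Longrightarrow> dist x y < d \<Longrightarrow> dist (g x) (g y) < q"
      using q unfolding uniformly_continuous_on_def by metis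
    show "\<exists>d>0. \<forall>z. \<bar>z\<bar> < d \<longrightarrow> Y z \<le> ennreal e"
    proof (intro exI[of _ "min 1 d"] conjI allI impI)
      fix z assume z: "\<bar>z\<bar> < min 1 d"
      have "Y z \<le> (\<integral>\<^sup>+t. ennreal q * ennreal \<bar>\<Phi> 0 t\<bar> \<partial>lborel)"
        unfolding Y_def
      proof (rule nn_integral_mono)
        fix t
        show "ennreal (\<bar>g (t + z / 2) - g t\<bar> * \<bar>\<Phi> 0 t\<bar>) \<le> ennreal q * ennreal \<bar>\<Phi> 0 t\<bar>"
        proof (cases "t \<le> 0 \<or> T \<le> t")
          case False
          then have "dist (g (t + z / 2)) (g t) < q"
            using z by (intro d(2)) (auto simp: dist_real_def)
          then have "\<bar>g (t + z / 2) - g t\<bar> * \<bar>\<Phi> 0 t\<bar> \<le> q * \<bar>\<Phi> 0 t\<bar>"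
            by (intro mult_right_mono) (auto simp: dist_real_def)
          then show ?thesis using q by (subst ennreal_mult[symmetric]) (auto intro: ennreal_leI)
        qed (simp add: \<Phi>0)
      qed
      also have "\<dots> = ennreal q * ennreal a" by (subst nn_integral_cmult) (auto simp: a)
      also have "\<dots> \<le> ennreal e"
        using q a e by (subst ennreal_mult[symmetric]) (auto intro!: ennreal_leI simp: q_def field_simps)
      finally show "Y z \<le> ennreal e" .
    qed (use d in auto)
  qed
  have vV: "vanish V" using v by (simp add: V_def[abs_def])
  \<comment> \<open>The last summand matters where \<open>V z\<close> is infinite: it keeps the
    bound valid also for C = 0, where the first product would be 0.\<close>
  have "vanish (\<lambda>z. ennreal C * V z + Y z + V z)"
    by (intro vanish_add vanish_cmult vV vY) auto
  then show ?thesis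
  proof (rule vanish_mono)
    fix z
    show "ennreal \<bar>(\<integral>t. g (t + z / 2) * \<Phi> z t \<partial>lborel) - (\<integral>t. g t * \<Phi> 0 t \<partial>lborel)\<bar> \<le> ennreal C * V z + Y z + V z"
    proof (cases "V z < \<infinity>")
      case True
      then have "integrable lborel (\<lambda>t. \<Phi> z t - \<Phi> 0 t)"
        unfolding V_def by (intro integrableI_bounded) auto
      from Bochner_Integration.integrable_add[OF this i0] have iz: "integrable lborel (\<Phi> z)" by simp
      have bdi: "integrable lborel (\<lambda>t. h t * f t)"
        if [measurable]: "h \<in> borel_measurable borel" and h: "\<And>t. \<bar>h t\<bar> \<le> C" and f: "integrable lborel f" for f h :: "real \<Rightarrow> real"
      proof (rule Bochner_Integration.integrable_bound[OF integrable_mult_right[of C, OF f]])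
        have [measurable]: "f \<in> borel_measurable borel" using f by simp
        show "(\<lambda>t. h t * f t) \<in> borel_measurable lborel" by measurable
        show "AE t in lborel. norm (h t * f t) \<le> norm (C * f t)"
        proof (rule AE_I2)
          fix t show "norm (h t * f t) \<le> norm (C * f t)"
            using h[of t] by (auto simp: abs_mult intro!: mult_right_mono)
        qed
      qed
      have i1: "integrable lborel (\<lambda>t. g (t + z / 2) * \<Phi> z t)" by (intro bdi g iz) measurable
      have i2: "integrable lborel (\<lambda>t. g t * \<Phi> 0 t)" by (intro bdi g i0) measurable
      have "(\<integral>t. g (t + z / 2) * \<Phi> z t \<partial>lborel) - (\<integral>t. g t * \<Phi> 0 t \<partial>lborel)
        = (\<integral>t. g (t + z / 2) * \<Phi> z t - g t * \<Phi> 0 t \<partial>lborel)"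
        by (rule Bochner_Integration.integral_diff[symmetric, OF i1 i2])
      then have "ennreal \<bar>(\<integral>t. g (t + z / 2) * \<Phi> z t \<partial>lborel) - (\<integral>t. g t * \<Phi> 0 t \<partial>lborel)\<bar>
        \<le> (\<integral>\<^sup>+t. ennreal \<bar>g (t + z / 2) * \<Phi> z t - g t * \<Phi> 0 t\<bar> \<partial>lborel)"
        using integral_norm_bound_ennreal[OF Bochner_Integration.integrable_diff[OF i1 i2]] by simp
      also have "\<dots> \<le> (\<integral>\<^sup>+t. ennreal C * ennreal \<bar>\<Phi> z t - \<Phi> 0 t\<bar> + ennreal (\<bar>g (t + z / 2) - g t\<bar> * \<bar>\<Phi> 0 t\<bar>) \<partial>lborel)"
      proof (rule nn_integral_mono)
        fix t
        have "\<bar>g (t + z / 2) * \<Phi> z t - g t * \<Phi> 0 t\<bar> = \<bar>g (t + z / 2) * (\<Phi> z t - \<Phi> 0 t) + (g (t + z / 2) - g t) * \<Phi> 0 t\<bar>"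
          by (simp add: algebra_simps)
        also have "\<dots> \<le> \<bar>g (t + z / 2) * (\<Phi> z t - \<Phi> 0 t)\<bar> + \<bar>(g (t + z / 2) - g t) * \<Phi> 0 t\<bar>" by (rule abs_triangle_ineq)
        also have "\<dots> \<le> C * \<bar>\<Phi> z t - \<Phi> 0 t\<bar> + \<bar>g (t + z / 2) - g t\<bar> * \<bar>\<Phi> 0 t\<bar>"
          using g(2)[of "t + z/2"] by (auto simp: abs_mult intro!: mult_right_mono)
        finally have "ennreal \<bar>g (t + z / 2) * \<Phi> z t - g t * \<Phi> 0 t\<bar> \<le> ennreal (C * \<bar>\<Phi> z t - \<Phi> 0 t\<bar> + \<bar>g (t + z / 2) - g t\<bar> * \<bar>\<Phi> 0 t\<bar>)"
          by (rule ennreal_leI)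
        then show "ennreal \<bar>g (t + z / 2) * \<Phi> z t - g t * \<Phi> 0 t\<bar> \<le> ennreal C * ennreal \<bar>\<Phi> z t - \<Phi> 0 t\<bar> + ennreal (\<bar>g (t + z / 2) - g t\<bar> * \<bar>\<Phi> 0 t\<bar>)"
          using C by (simp add: ennreal_plus ennreal_mult)
      qed
      also have "\<dots> = (\<integral>\<^sup>+t. ennreal C * ennreal \<bar>\<Phi> z t - \<Phi> 0 t\<bar> \<partial>lborel) + Y z"
        unfolding Y_def by (rule nn_integral_add) measurable
      also have "(\<integral>\<^sup>+t. ennreal C * ennreal \<bar>\<Phi> z t - \<Phi> 0 t\<bar> \<partial>lborel) = ennreal C * V z"
        unfolding V_def by (rule nn_integral_cmult) measurable
      finally show ?thesis by (rule order_trans) simp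
    qed (auto simp: not_less top_unique)
  qed
qed

lemma nn_integral_lborel2:
  assumes "g \<in> borel_measurable borel"
  shows "(\<integral>\<^sup>+p. g p \<partial>(lborel :: ('a::euclidean_space \<times> 'b::euclidean_space) measure)) = (\<integral>\<^sup>+x. \<integral>\<^sup>+y. g (x, y) \<partial>lborel \<partial>lborel)"
proof -
  have "g \<in> borel_measurable (lborel \<Otimes>\<^sub>M lborel)" using assms by (simp add: lborel_prod)
  from lborel.nn_integral_fst[OF this] show ?thesis by (simp add: lborel_prod)
qed

lemma nn_integral_lborel3:
  assumes [measurable]: "g \<in> borel_measurable borel"
  shows "(\<integral>\<^sup>+p. g p \<partial>(lborel :: ('c::euclidean_space \<times> 'a::euclidean_space \<times> 'b::euclidean_space) measure))
     = (\<integral>\<^sup>+t. \<integral>\<^sup>+x. \<integral>\<^sup>+y. g (t, x, y) \<partial>lborel \<partial>lborel \<partial>lborel)"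
  by (subst nn_integral_lborel2[OF assms], rule nn_integral_cong, rule nn_integral_lborel2)
     (rule measurable_compose[OF _ assms], auto intro!: borel_measurable_Pair)

section \<open>The test function \<open>\<xi>\<^sup>2 u\<close> and its time increments\<close>

context nonlocal_cutoff
begin

text \<open>The Caccioppoli test function, with its own time \<tau> kept apart from the time t at
  which the form is evaluated.\<close>

definition tst :: "real \<Rightarrow> 'a \<Rightarrow> real" where "tst \<tau> x = (\<xi> x)\<^sup>2 * u \<tau> x"

lemma tst_measurable [measurable (raw)]:
  assumes [measurable]: "f \<in> borel_measurable M" "g \<in> borel_measurable M"
  shows "(\<lambda>m. tst (f m) (g m)) \<in> borel_measurable M"
  unfolding tst_def by measurable

lemma tst_support: "r + \<delta> \<le> dist x0 x \<Longrightarrow> tst \<tau> x = 0" by (simp add: tst_def \<xi>_eq_0)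

lemma tst_zero: "\<tau> \<le> 0 \<or> T \<le> \<tau> \<Longrightarrow> tst \<tau> x = 0" by (simp add: tst_def u_zero)

lemma \<xi>_sq_bound: "\<bar>(\<xi> x)\<^sup>2\<bar> \<le> 1" using \<xi>_bounds[of x] by (simp add: power_le_one)

lemma \<xi>_sq_lipschitz: "\<bar>(\<xi> x)\<^sup>2 - (\<xi> y)\<^sup>2\<bar> \<le> 2 / \<delta> * norm (x - y)"
proof -
  have "(\<xi> x)\<^sup>2 - (\<xi> y)\<^sup>2 = (\<xi> x + \<xi> y) * (\<xi> x - \<xi> y)" by (simp add: power2_eq_square algebra_simps)
  then have "\<bar>(\<xi> x)\<^sup>2 - (\<xi> y)\<^sup>2\<bar> = \<bar>\<xi> x + \<xi> y\<bar> * \<bar>\<xi> x - \<xi> y\<bar>" by (simp add: abs_mult)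
  also have "\<dots> \<le> 2 * (1 / \<delta> * norm (x - y))"
    using \<xi>_bounds[of x] \<xi>_bounds[of y] by (intro mult_mono \<xi>_lipschitz) auto
  finally show ?thesis by simp
qed

lemma l2sq_tst: "l2sq A (tst \<tau>) \<le> l2sq A (u \<tau>)"
  unfolding tst_def[abs_def] by (rule l2sq_mult_le[OF \<xi>_sq_bound])

lemma hsq_tst: "hsq s B (tst \<tau>) \<le> 2 * hsq s B (u \<tau>) + 2 * (ennreal ((2 / \<delta>)\<^sup>2) * J * l2sq B (u \<tau>))"
  unfolding tst_def[abs_def]
  by (rule hsq_mult[OF _ _ \<xi>_sq_bound _ \<xi>_sq_lipschitz]) (use \<delta> in auto)

lemma hsq_tst_time: "(\<integral>\<^sup>+t. hsq s B (tst t) \<partial>lborel) < \<infinity>"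
proof -
  have "(\<integral>\<^sup>+t. hsq s B (tst t) \<partial>lborel) \<le> (\<integral>\<^sup>+t. 2 * hsq s B (u t) + 2 * (ennreal ((2 / \<delta>)\<^sup>2) * J * l2sq B (u t)) \<partial>lborel)"
    by (intro nn_integral_mono hsq_tst)
  also have "\<dots> = (\<integral>\<^sup>+t. 2 * hsq s B (u t) \<partial>lborel) + (\<integral>\<^sup>+t. 2 * (ennreal ((2 / \<delta>)\<^sup>2) * J * l2sq B (u t)) \<partial>lborel)"
    by (rule nn_integral_add) measurable
  also have "\<dots> = 2 * (\<integral>\<^sup>+t. hsq s B (u t) \<partial>lborel) + 2 * (ennreal ((2 / \<delta>)\<^sup>2) * J * (\<integral>\<^sup>+t. l2sq B (u t) \<partial>lborel))"
    by (simp add: nn_integral_cmult)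
  also have "\<dots> < \<infinity>" using hsq_time l2sq_time J_finite by (simp add: ennreal_mult_less_top)
  finally show ?thesis .
qed

lemma l2sq_tst_time: "(\<integral>\<^sup>+t. l2sq B (tst t) \<partial>lborel) < \<infinity>"
  by (rule le_less_trans[OF nn_integral_mono[OF l2sq_tst] l2sq_time])

lemma tst_adm: "AE \<tau> in lborel. adm (tst \<tau>)"
proof -
  have "AE \<tau> in lborel. hsq s B (tst \<tau>) \<noteq> \<infinity>"
    by (rule nn_integral_noteq_infinite) (use hsq_tst_time in \<open>auto simp: less_top\<close>)
  moreover have "AE \<tau> in lborel. l2sq B (tst \<tau>) \<noteq> \<infinity>"
    by (rule nn_integral_noteq_infinite) (use l2sq_tst_time in \<open>auto simp: less_top\<close>)
  ultimately show ?thesis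
    by eventually_elim (auto simp: adm_def tst_support less_top)
qed

definition dtst :: "real \<Rightarrow> real \<Rightarrow> 'a \<Rightarrow> real" where "dtst z t x = tst (t + z) x - tst t x"

lemma dtst_measurable [measurable (raw)]:
  assumes [measurable]: "f \<in> borel_measurable M" "g \<in> borel_measurable M" "h \<in> borel_measurable M"
  shows "(\<lambda>m. dtst (f m) (g m) (h m)) \<in> borel_measurable M"
  unfolding dtst_def by measurable

lemma dtst_support: "r + \<delta> \<le> dist x0 x \<Longrightarrow> dtst z t x = 0" "x \<notin> B \<Longrightarrow> dtst z t x = 0"
  using \<delta> by (auto simp: dtst_def tst_support)

lemma norm_le_of_B: "x \<in> B \<Longrightarrow> norm x \<le> norm x0 + 2"
  using subsetD[OF B_subset, of x] by auto

text \<open>Translation continuity in L2 of time-space, with shifts (z, 0); the bounded support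
  comes from \<open>B\<close> in space and from \<open>u\<close> being zero outside (0, T) in
  time.\<close>

lemma vanish_l2: "vanish (\<lambda>z. \<integral>\<^sup>+t. l2sq B (dtst z t) \<partial>lborel)"
  unfolding vanish_def
proof (intro allI impI)
  fix e :: real assume e: "0 < e"
  define f where "f p = (case p of (t, x) \<Rightarrow> indicator B x * tst t x)" for p :: "real \<times> 'a"
  have fb: "f \<in> borel_measurable borel"
    unfolding borel_prod[symmetric] f_def[abs_def] by measurable
  have supp: "f p = 0" if "norm p > T + (norm x0 + 2)" for p
  proof (rule ccontr)
    obtain t x where p: "p = (t, x)" by force
    assume "f p \<noteq> 0"
    then have "x \<in> B" "tst t x \<noteq> 0" by (auto simp: p f_def indicator_def)
    then have "norm x \<le> norm x0 + 2" "\<bar>t\<bar> \<le> T"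
      using norm_le_of_B tst_zero[of t x] by fastforce+
    then show False using that norm_Pair_le[of t x] by (simp add: p)
  qed
  have sq: "(\<integral>\<^sup>+p. ennreal ((f p)\<^sup>2) \<partial>lborel) = (\<integral>\<^sup>+t. l2sq B (tst t) \<partial>lborel)"
    unfolding l2sq_def
    by (subst nn_integral_lborel2, use fb in measurable, intro nn_integral_cong) (auto simp: f_def indicator_def)
  obtain d where d: "0 < d" "\<And>h. norm h < d \<Longrightarrow> (\<integral>\<^sup>+x. ennreal ((f (x + h) - f x)\<^sup>2) \<partial>lborel) < ennreal e"
    using L2_translation_continuous[OF fb supp _ e] l2sq_tst_time sq by auto
  have "(\<integral>\<^sup>+t. l2sq B (dtst z t) \<partial>lborel) \<le> ennreal e" if "\<bar>z\<bar> < d" for z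
  proof -
    have "(\<integral>\<^sup>+t. l2sq B (dtst z t) \<partial>lborel) = (\<integral>\<^sup>+p. ennreal ((f (p + (z, 0)) - f p)\<^sup>2) \<partial>lborel)"
      unfolding l2sq_def
    proof (subst nn_integral_lborel2)
      show "(\<lambda>p. ennreal ((f (p + (z, 0)) - f p)\<^sup>2)) \<in> borel_measurable borel"
        using fb by measurable
    qed (intro nn_integral_cong, auto simp: f_def indicator_def dtst_def)
    also have "\<dots> < ennreal e" using that by (intro d(2)) (simp add: norm_Pair)
    finally show ?thesis by simp
  qed
  then show "\<exists>d>0. \<forall>z. \<bar>z\<bar> < d \<longrightarrow> (\<integral>\<^sup>+t. l2sq B (dtst z t) \<partial>lborel) \<le> ennreal e"
    using d(1) by blast
qed

text \<open>Multiplying the spatial difference by the square root of the kernel turns the fractional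
  seminorm into an ordinary L2 norm in (t, x, y), to which translation continuity applies.\<close>

lemma vanish_hsq: "vanish (\<lambda>z. \<integral>\<^sup>+t. hsq s B (dtst z t) \<partial>lborel)"
  unfolding vanish_def
proof (intro allI impI)
  fix e :: real assume e: "0 < e"
  define f where "f p = (case p of (t, x, y) \<Rightarrow> indicator B x * indicator B y * ((tst t x - tst t y) * sqrt (riesz s (x - y))))" for p :: "real \<times> 'a \<times> 'a"
  have fb: "f \<in> borel_measurable borel"
    unfolding borel_prod[symmetric] f_def[abs_def] by measurable
  have supp: "f p = 0" if "norm p > T + ((norm x0 + 2) + (norm x0 + 2))" for p
  proof (rule ccontr)
    obtain t x y where p: "p = (t, x, y)" by (cases p) auto
    assume "f p \<noteq> 0"
    then have "x \<in> B" "y \<in> B" "tst t x \<noteq> 0 \<or> tst t y \<noteq> 0" by (auto simp: p f_def indicator_def)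
    then have "norm x \<le> norm x0 + 2" "norm y \<le> norm x0 + 2" "\<bar>t\<bar> \<le> T"
      using norm_le_of_B tst_zero[of t x] tst_zero[of t y] by fastforce+
    then show False using that norm_Pair_le[of t "(x, y)"] norm_Pair_le[of x y] by (simp add: p)
  qed
  have hsqB: "hsq s B v = (\<integral>\<^sup>+x. \<integral>\<^sup>+y. ennreal ((v x - v y)\<^sup>2 * riesz s (x - y)) * indicator B y * indicator B x \<partial>lborel \<partial>lborel)"
    if [measurable]: "v \<in> borel_measurable borel" for v
    unfolding hsq_def by (rule nn_integral2_indicator) measurable
  have sq: "(\<integral>\<^sup>+p. ennreal ((f p)\<^sup>2) \<partial>lborel) = (\<integral>\<^sup>+t. hsq s B (tst t) \<partial>lborel)"
  proof (subst nn_integral_lborel3)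
    show "(\<lambda>p. ennreal ((f p)\<^sup>2)) \<in> borel_measurable borel" using fb by measurable
    show "(\<integral>\<^sup>+t. \<integral>\<^sup>+x. \<integral>\<^sup>+y. ennreal ((f (t, x, y))\<^sup>2) \<partial>lborel \<partial>lborel \<partial>lborel) = (\<integral>\<^sup>+t. hsq s B (tst t) \<partial>lborel)"
      by (subst hsqB, measurable, intro nn_integral_cong) (auto simp: f_def indicator_def power_mult_distrib)
  qed
  obtain d where d: "0 < d" "\<And>h. norm h < d \<Longrightarrow> (\<integral>\<^sup>+x. ennreal ((f (x + h) - f x)\<^sup>2) \<partial>lborel) < ennreal e"
    using L2_translation_continuous[OF fb supp _ e] hsq_tst_time sq by auto
  have "(\<integral>\<^sup>+t. hsq s B (dtst z t) \<partial>lborel) \<le> ennreal e" if "\<bar>z\<bar> < d" for z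
  proof -
    have "(\<integral>\<^sup>+t. hsq s B (dtst z t) \<partial>lborel) = (\<integral>\<^sup>+p. ennreal ((f (p + (z, 0)) - f p)\<^sup>2) \<partial>lborel)"
    proof (subst nn_integral_lborel3)
      show "(\<lambda>p. ennreal ((f (p + (z, 0)) - f p)\<^sup>2)) \<in> borel_measurable borel"
        using fb by measurable
      show "(\<integral>\<^sup>+t. hsq s B (dtst z t) \<partial>lborel) = (\<integral>\<^sup>+t. \<integral>\<^sup>+x. \<integral>\<^sup>+y. ennreal ((f ((t, x, y) + (z, 0)) - f (t, x, y))\<^sup>2) \<partial>lborel \<partial>lborel \<partial>lborel)"
      proof (subst hsqB, measurable, intro nn_integral_cong)
        fix t x y
        have "(f ((t, x, y) + (z, 0)) - f (t, x, y))\<^sup>2 = (indicator B x * indicator B y * (dtst z t x - dtst z t y) * sqrt (riesz s (x - y)))\<^sup>2"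
          by (simp add: f_def dtst_def zero_prod_def algebra_simps)
        then show "ennreal ((dtst z t x - dtst z t y)\<^sup>2 * riesz s (x - y)) * indicator B y * indicator B x
          = ennreal ((f ((t, x, y) + (z, 0)) - f (t, x, y))\<^sup>2)"
          by (auto simp: indicator_def power_mult_distrib)
      qed
    qed
    also have "\<dots> < ennreal e" using that by (intro d(2)) (simp add: norm_Pair)
    finally show ?thesis by simp
  qed
  then show "\<exists>d>0. \<forall>z. \<bar>z\<bar> < d \<longrightarrow> (\<integral>\<^sup>+t. hsq s B (dtst z t) \<partial>lborel) \<le> ennreal e"
    using d(1) by blast
qed

end

text \<open>Substitution z = \<tau> - t: the midpoint becomes t + z/2 and, as \<rho> is even, the
  concentration factor depends on z alone. Absolute integrability is transported along, which
  justifies Fubini in the new variables.\<close>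

lemma shear_integral:
  fixes F :: "real \<Rightarrow> real \<Rightarrow> real" and w \<rho> :: "real \<Rightarrow> real"
  assumes i: "integrable (lborel \<Otimes>\<^sub>M lborel) (\<lambda>(\<tau>, t). w ((t + \<tau>) / 2) * \<rho> (t - \<tau>) * F \<tau> t)"
    and [measurable]: "(\<lambda>(\<tau>, t). F \<tau> t) \<in> borel_measurable (borel \<Otimes>\<^sub>M borel)"
      "w \<in> borel_measurable borel" "\<rho> \<in> borel_measurable borel"
    and even: "\<And>z. \<rho> (- z) = \<rho> z"
  shows "integrable lborel (\<lambda>z. \<rho> z * (\<integral>t. w (t + z / 2) * F (t + z) t \<partial>lborel))"
    and "(\<integral>(\<tau>, t). w ((t + \<tau>) / 2) * \<rho> (t - \<tau>) * F \<tau> t \<partial>(lborel \<Otimes>\<^sub>M lborel))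
      = (\<integral>z. \<rho> z * (\<integral>t. w (t + z / 2) * F (t + z) t \<partial>lborel) \<partial>lborel)"
proof -
  define f where "f \<tau> t = w ((t + \<tau>) / 2) * \<rho> (t - \<tau>) * F \<tau> t" for \<tau> t
  have fm [measurable]: "(\<lambda>(\<tau>, t). f \<tau> t) \<in> borel_measurable (borel \<Otimes>\<^sub>M borel)"
    unfolding f_def by measurable
  have [measurable]: "(\<lambda>z. f (t + z) t) \<in> borel_measurable borel" "(\<lambda>\<tau>. f \<tau> t) \<in> borel_measurable borel" for t
    by measurable
  have fi: "integrable (lborel \<Otimes>\<^sub>M lborel) (\<lambda>(\<tau>, t). f \<tau> t)" using i by (simp add: f_def)
  have gm [measurable]: "(\<lambda>(t, z). f (t + z) t) \<in> borel_measurable (lborel \<Otimes>\<^sub>M lborel)"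
    by measurable
  have "(\<integral>\<^sup>+p. ennreal (norm (case p of (t, z) \<Rightarrow> f (t + z) t)) \<partial>(lborel \<Otimes>\<^sub>M lborel)) =
      (\<integral>\<^sup>+t. \<integral>\<^sup>+z. ennreal \<bar>f (t + z) t\<bar> \<partial>lborel \<partial>lborel)"
    by (subst lborel.nn_integral_fst[symmetric]) auto
  also have "\<dots> = (\<integral>\<^sup>+t. \<integral>\<^sup>+\<tau>. ennreal \<bar>f \<tau> t\<bar> \<partial>lborel \<partial>lborel)"
  proof (rule nn_integral_cong)
    fix t show "(\<integral>\<^sup>+z. ennreal \<bar>f (t + z) t\<bar> \<partial>lborel) = (\<integral>\<^sup>+\<tau>. ennreal \<bar>f \<tau> t\<bar> \<partial>lborel)"
      using nn_integral_translate[of "\<lambda>\<tau>. ennreal \<bar>f \<tau> t\<bar>" t] by (simp add: add.commute)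
  qed
  also have "\<dots> = (\<integral>\<^sup>+p. ennreal (norm (case p of (\<tau>, t) \<Rightarrow> f \<tau> t)) \<partial>(lborel \<Otimes>\<^sub>M lborel))"
    by (subst lborel_pair.nn_integral_snd[symmetric]) auto
  also have "\<dots> < \<infinity>" using fi unfolding integrable_iff_bounded by simp
  finally have gi: "integrable (lborel \<Otimes>\<^sub>M lborel) (\<lambda>(t, z). f (t + z) t)"
    by (intro integrableI_bounded) auto
  have inner: "(\<integral>t. f (t + z) t \<partial>lborel) = \<rho> z * (\<integral>t. w (t + z / 2) * F (t + z) t \<partial>lborel)" for z
  proof -
    have "f (t + z) t = \<rho> z * (w (t + z / 2) * F (t + z) t)" for t
      using even[of z] by (simp add: f_def field_simps)
    then show ?thesis by simp
  qed
  from lborel_pair.integrable_snd[OF gi]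
  show "integrable lborel (\<lambda>z. \<rho> z * (\<integral>t. w (t + z / 2) * F (t + z) t \<partial>lborel))" by (simp add: inner)
  have "(\<integral>z. \<rho> z * (\<integral>t. w (t + z / 2) * F (t + z) t \<partial>lborel) \<partial>lborel) = (\<integral>z. (\<integral>t. f (t + z) t \<partial>lborel) \<partial>lborel)"
    by (simp add: inner)
  also have "\<dots> = (\<integral>t. (\<integral>z. f (t + z) t \<partial>lborel) \<partial>lborel)"
    by (rule lborel_pair.Fubini_integral[OF gi])
  also have "\<dots> = (\<integral>t. (\<integral>\<tau>. f \<tau> t \<partial>lborel) \<partial>lborel)"
  proof (rule Bochner_Integration.integral_cong[OF refl])
    fix t show "(\<integral>z. f (t + z) t \<partial>lborel) = (\<integral>\<tau>. f \<tau> t \<partial>lborel)"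
      using lborel_integral_real_affine[of 1 "\<lambda>\<tau>. f \<tau> t" t] by simp
  qed
  also have "\<dots> = (\<integral>(\<tau>, t). f \<tau> t \<partial>(lborel \<Otimes>\<^sub>M lborel))"
    by (rule lborel_pair.integral_snd[OF fi])
  finally show "(\<integral>(\<tau>, t). w ((t + \<tau>) / 2) * \<rho> (t - \<tau>) * F \<tau> t \<partial>(lborel \<Otimes>\<^sub>M lborel))
      = (\<integral>z. \<rho> z * (\<integral>t. w (t + z / 2) * F (t + z) t \<partial>lborel) \<partial>lborel)"
    by (simp add: f_def)
qed

text \<open>An even C1 bump supported in [-h, h]. It is left unnormalised: both sides of the
  identity to be proved carry the same integral, which cancels in the limit.\<close>

definition bump :: "real \<Rightarrow> real \<Rightarrow> real" where "bump h z = (max 0 (h\<^sup>2 - z\<^sup>2))\<^sup>2"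
definition bump' :: "real \<Rightarrow> real \<Rightarrow> real" where "bump' h z = - (4 * max 0 (h\<^sup>2 - z\<^sup>2) * z)"

lemma bump_deriv: "(bump h has_real_derivative bump' h z) (at z)"
proof -
  have "((\<lambda>z. h\<^sup>2 - z\<^sup>2) has_real_derivative - (2 * z)) (at z)"
    by (auto intro!: derivative_eq_intros)
  from DERIV_chain2[OF has_derivative_pos_part_sq this] show ?thesis
    unfolding bump_def[abs_def] bump'_def by (simp add: mult_ac)
qed

lemma bump_measurable [measurable]: "bump h \<in> borel_measurable borel" "bump' h \<in> borel_measurable borel"
  unfolding bump_def[abs_def] bump'_def[abs_def] by measurable

lemma bump_cont: "continuous_on UNIV (bump h)" "continuous_on UNIV (bump' h)"
  unfolding bump_def[abs_def] bump'_def[abs_def] by (intro continuous_intros)+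

lemma bump_even: "bump h (- z) = bump h z" "bump' h (- z) = - bump' h z"
  by (auto simp: bump_def bump'_def)

lemma bump_nonneg: "0 \<le> bump h z" by (simp add: bump_def)

lemma bump_zero: "0 \<le> h \<Longrightarrow> h \<le> \<bar>z\<bar> \<Longrightarrow> bump h z = 0" "0 \<le> h \<Longrightarrow> h \<le> \<bar>z\<bar> \<Longrightarrow> bump' h z = 0"
  using abs_le_square_iff[of h z] by (auto simp: bump_def bump'_def)

lemma bump_le: "bump h z \<le> (h\<^sup>2)\<^sup>2"
  unfolding bump_def by (rule power_mono) auto

lemma bump'_le:
  assumes h: "0 \<le> h" shows "\<bar>bump' h z\<bar> \<le> 4 * h\<^sup>2 * h"
proof (cases "h \<le> \<bar>z\<bar>")
  case False
  have "\<bar>4 * max 0 (h\<^sup>2 - z\<^sup>2)\<bar> * \<bar>z\<bar> \<le> (4 * h\<^sup>2) * h"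
    by (rule mult_mono) (use False in auto)
  then show ?thesis by (simp add: bump'_def abs_mult)
qed (use bump_zero[OF h] h in simp)

lemma bump_integral:
  assumes h: "0 < h" shows "integrable lborel (bump h)" "0 < (\<integral>z. bump h z \<partial>lborel)"
proof -
  have ii: "integrable lborel (\<lambda>z. (h\<^sup>2)\<^sup>2 * indicator {-h..h} z :: real)"
    by (intro integrable_mult_right integrable_real_indicator) (use h in \<open>auto simp: emeasure_lborel_Icc_eq\<close>)
  show I: "integrable lborel (bump h)"
  proof (rule Bochner_Integration.integrable_bound[OF ii])
    show "AE z in lborel. norm (bump h z) \<le> norm ((h\<^sup>2)\<^sup>2 * indicator {-h..h} z :: real)"
    proof (rule AE_I2)
      fix z show "norm (bump h z) \<le> norm ((h\<^sup>2)\<^sup>2 * indicator {-h..h} z :: real)"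
        using bump_le[of h z] bump_nonneg[of h z] bump_zero[of h z] h
        by (cases "z \<in> {-h..h}") auto
    qed
  qed measurable
  \<comment> \<open>On the middle half of the support the difference of squares is at least 3/4 of
    the square of h.\<close>
  have "0 < (3/4 * h\<^sup>2)\<^sup>2 * h" using h by simp
  also have "\<dots> = (\<integral>z. (3/4 * h\<^sup>2)\<^sup>2 * indicator {-h/2..h/2} z \<partial>lborel)"
    using h by simp
  also have "\<dots> \<le> (\<integral>z. bump h z \<partial>lborel)"
  proof (rule integral_mono[OF _ I])
    show "integrable lborel (\<lambda>z. (3/4 * h\<^sup>2)\<^sup>2 * indicator {-h/2..h/2} z :: real)"
      by (intro integrable_mult_right integrable_real_indicator) (use h in \<open>auto simp: emeasure_lborel_Icc_eq\<close>)
    fix z show "(3/4 * h\<^sup>2)\<^sup>2 * indicator {-h/2..h/2} z \<le> bump h z"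
    proof (cases "z \<in> {-h/2..h/2}")
      case True
      then have "z\<^sup>2 \<le> (h/2)\<^sup>2" by (subst abs_le_square_iff[symmetric]) auto
      then have "3/4 * h\<^sup>2 \<le> max 0 (h\<^sup>2 - z\<^sup>2)" by (simp add: power_divide le_max_iff_disj)
      then have "(3/4 * h\<^sup>2)\<^sup>2 \<le> bump h z" unfolding bump_def by (intro power_mono) auto
      then show ?thesis using True by simp
    qed (simp add: bump_nonneg)
  qed
  finally show "0 < (\<integral>z. bump h z \<partial>lborel)" .
qed

text \<open>The bumps as an approximate identity, with the error measured relative to their
  unnormalised mass.\<close>

lemma concentrate:
  assumes v: "vanish (\<lambda>z. ennreal \<bar>H z - H 0\<bar>)" and h0: "0 < h0"
    and i: "\<And>h. 0 < h \<Longrightarrow> h < h0 \<Longrightarrow> integrable lborel (\<lambda>z. bump h z * H z)"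
    and e: "0 < (e :: real)"
  shows "\<exists>d>0. \<forall>h. 0 < h \<and> h < d \<longrightarrow> \<bar>(\<integral>z. bump h z * H z \<partial>lborel) - H 0 * (\<integral>z. bump h z \<partial>lborel)\<bar> \<le> e * (\<integral>z. bump h z \<partial>lborel)"
proof -
  obtain d where d: "d > 0" "\<And>z. \<bar>z\<bar> < d \<Longrightarrow> ennreal \<bar>H z - H 0\<bar> \<le> ennreal e"
    using v e unfolding vanish_def by blast
  show ?thesis
  proof (intro exI[of _ "min d h0"] conjI allI impI)
    fix h assume h: "0 < h \<and> h < min d h0"
    note I = bump_integral(1)[of h]
    have "(\<integral>z. bump h z * H z \<partial>lborel) - H 0 * (\<integral>z. bump h z \<partial>lborel) = (\<integral>z. bump h z * H z - H 0 * bump h z \<partial>lborel)"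
      using h I i by (subst Bochner_Integration.integral_diff) auto
    also have "\<bar>\<dots>\<bar> \<le> (\<integral>z. norm (bump h z * H z - H 0 * bump h z) \<partial>lborel)"
      using integral_norm_bound[of lborel "\<lambda>z. bump h z * H z - H 0 * bump h z"] by simp
    also have "\<dots> \<le> (\<integral>z. e * bump h z \<partial>lborel)"
    proof (rule integral_mono)
      show "integrable lborel (\<lambda>z. norm (bump h z * H z - H 0 * bump h z))" using h I i by (intro Bochner_Integration.integrable_norm Bochner_Integration.integrable_diff) auto
      show "integrable lborel (\<lambda>z. e * bump h z)" using h I by simp
      fix z
      have "bump h z * H z - H 0 * bump h z = bump h z * (H z - H 0)" by (simp add: algebra_simps)
      then have "norm (bump h z * H z - H 0 * bump h z) = bump h z * \<bar>H z - H 0\<bar>"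
        by (simp add: abs_mult bump_nonneg)
      also have "\<dots> \<le> bump h z * e"
      proof (cases "\<bar>z\<bar> < d")
        case True
        then have "\<bar>H z - H 0\<bar> \<le> e" using d(2) e by (simp add: ennreal_le_iff)
        then show ?thesis by (intro mult_left_mono bump_nonneg)
      next
        case False
        then show ?thesis using h bump_zero(1)[of h z] by simp
      qed
      finally show "norm (bump h z * H z - H 0 * bump h z) \<le> e * bump h z" by (simp add: mult.commute)
    qed
    finally show "\<bar>(\<integral>z. bump h z * H z \<partial>lborel) - H 0 * (\<integral>z. bump h z \<partial>lborel)\<bar> \<le> e * (\<integral>z. bump h z \<partial>lborel)"
      by simp
  qed (use d h0 in auto)
qed

lemma concentrate_eq:
  assumes v: "vanish (\<lambda>z. ennreal \<bar>F z - F 0\<bar>)" "vanish (\<lambda>z. ennreal \<bar>G z - G 0\<bar>)" and h0: "0 < h0"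
    and i: "\<And>h. 0 < h \<Longrightarrow> h < h0 \<Longrightarrow> integrable lborel (\<lambda>z. bump h z * F z)"
      "\<And>h. 0 < h \<Longrightarrow> h < h0 \<Longrightarrow> integrable lborel (\<lambda>z. bump h z * G z)"
    and eq: "\<And>h. 0 < h \<Longrightarrow> h < h0 \<Longrightarrow> (\<integral>z. bump h z * F z \<partial>lborel) = (\<integral>z. bump h z * G z \<partial>lborel)"
  shows "F 0 = G 0"
proof (rule ccontr)
  assume ne: "F 0 \<noteq> G 0"
  define e where "e = \<bar>F 0 - G 0\<bar> / 3"
  have e: "0 < e" using ne by (simp add: e_def)
  obtain d1 where d1: "d1 > 0" "\<And>h. 0 < h \<Longrightarrow> h < d1 \<Longrightarrow> \<bar>(\<integral>z. bump h z * F z \<partial>lborel) - F 0 * (\<integral>z. bump h z \<partial>lborel)\<bar> \<le> e * (\<integral>z. bump h z \<partial>lborel)"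
    using concentrate[OF v(1) h0 i(1) e] by auto
  obtain d2 where d2: "d2 > 0" "\<And>h. 0 < h \<Longrightarrow> h < d2 \<Longrightarrow> \<bar>(\<integral>z. bump h z * G z \<partial>lborel) - G 0 * (\<integral>z. bump h z \<partial>lborel)\<bar> \<le> e * (\<integral>z. bump h z \<partial>lborel)"
    using concentrate[OF v(2) h0 i(2) e] by auto
  define h where "h = min h0 (min d1 d2) / 2"
  have h: "0 < h" "h < h0" "h < d1" "h < d2" using h0 d1 d2 by (auto simp: h_def min_def)
  define c where "c = (\<integral>z. bump h z \<partial>lborel)"
  have c: "0 < c" unfolding c_def by (rule bump_integral(2)[OF h(1)])
  have "\<bar>F 0 * c - G 0 * c\<bar> \<le> 2 * e * c"
    using d1(2)[OF h(1,3)] d2(2)[OF h(1,4)] eq[OF h(1,2)] unfolding c_def[symmetric] by linarith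
  then have "\<bar>F 0 - G 0\<bar> * c \<le> 2 * e * c" using c by (simp add: abs_mult flip: left_diff_distrib)
  then have "\<bar>F 0 - G 0\<bar> \<le> 2 * e" using c by simp
  then show False using e by (simp add: e_def)
qed

section \<open>Continuity of form and pairing under time shifts, and the energy identity\<close>

context nonlocal_cutoff
begin

lemma tl_zero: "t \<le> 0 \<or> T \<le> t \<Longrightarrow> tl t = 0"
  using u_zero[of t] by (simp add: tl_def)

lemma absint_measurable [measurable]:
  assumes [measurable]: "(\<lambda>(m, x). \<psi> m x) \<in> borel_measurable (M \<Otimes>\<^sub>M borel)"
  shows "(\<lambda>m. absint (\<psi> m)) \<in> borel_measurable M"
  unfolding absint_def by measurable

lemma absint_tst_bounded:
  obtains N where "0 \<le> N" "AE t in lborel. absint (tst t) \<le> ennreal N"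
proof -
  obtain M where M: "0 \<le> M" "AE t in lborel. l2sq (ball 0 (norm x0 + 2)) (u t) \<le> ennreal M"
    by (rule u_L2_B)
  obtain m where m: "0 \<le> m" "emeasure lborel B = ennreal m"
    using emeasure_B by (cases "emeasure lborel B") auto
  have "AE t in lborel. absint (tst t) \<le> ennreal (m + M)"
    using M(2)
  proof eventually_elim
    case (elim t)
    have "absint (tst t) \<le> ennreal 1 * emeasure lborel B + ennreal (1 / 1) * l2sq B (tst t)"
      using \<delta> by (intro absint_le) (auto simp: tst_support)
    also have "\<dots> \<le> ennreal m + ennreal M"
      using order_trans[OF order_trans[OF l2sq_tst l2sq_mono[OF B_subset]] elim]
      by (simp add: m add_left_mono)
    finally show ?case using m M by (simp add: ennreal_plus)
  qed
  then show ?thesis using m M by (intro that[of "m + M"]) auto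
qed

lemma absform_family:
  assumes [measurable]: "(\<lambda>(t, x). \<phi> t x) \<in> borel_measurable (borel \<Otimes>\<^sub>M borel)"
    and \<phi>: "\<And>t x. r + \<delta> \<le> dist x0 x \<Longrightarrow> \<phi> t x = 0" and \<epsilon>: "0 < \<epsilon>"
  shows "(\<integral>\<^sup>+t. absform t (\<phi> t) \<partial>lborel) \<le>
    ennreal \<Lambda> * (ennreal \<epsilon> * (\<integral>\<^sup>+t. hsq s B (u t) \<partial>lborel) + ennreal (1 / \<epsilon>) * (\<integral>\<^sup>+t. hsq s B (\<phi> t) \<partial>lborel))
    + 2 * (ennreal (\<Lambda> * C\<^sub>\<delta>) * (W * (\<integral>\<^sup>+t. absprod t (\<phi> t) \<partial>lborel) + (\<integral>\<^sup>+t. tl t * absint (\<phi> t) \<partial>lborel)))"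
proof -
  have "(\<integral>\<^sup>+t. absform t (\<phi> t) \<partial>lborel) \<le> (\<integral>\<^sup>+t. ennreal \<Lambda> * (ennreal \<epsilon> * hsq s B (u t) + ennreal (1 / \<epsilon>) * hsq s B (\<phi> t))
    + 2 * (ennreal (\<Lambda> * C\<^sub>\<delta>) * (W * absprod t (\<phi> t) + tl t * absint (\<phi> t))) \<partial>lborel)"
    by (intro nn_integral_mono absform_le \<phi> \<epsilon>) measurable
  also have "\<dots> = (\<integral>\<^sup>+t. ennreal \<Lambda> * (ennreal \<epsilon> * hsq s B (u t) + ennreal (1 / \<epsilon>) * hsq s B (\<phi> t)) \<partial>lborel)
    + (\<integral>\<^sup>+t. 2 * (ennreal (\<Lambda> * C\<^sub>\<delta>) * (W * absprod t (\<phi> t) + tl t * absint (\<phi> t))) \<partial>lborel)"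
    by (rule nn_integral_add) measurable
  also have "\<dots> = ennreal \<Lambda> * (\<integral>\<^sup>+t. (ennreal \<epsilon> * hsq s B (u t) + ennreal (1 / \<epsilon>) * hsq s B (\<phi> t)) \<partial>lborel)
    + 2 * (ennreal (\<Lambda> * C\<^sub>\<delta>) * (\<integral>\<^sup>+t. (W * absprod t (\<phi> t) + tl t * absint (\<phi> t)) \<partial>lborel))"
    by (simp add: nn_integral_cmult)
  also have "(\<integral>\<^sup>+t. (W * absprod t (\<phi> t) + tl t * absint (\<phi> t)) \<partial>lborel) = W * (\<integral>\<^sup>+t. absprod t (\<phi> t) \<partial>lborel) + (\<integral>\<^sup>+t. tl t * absint (\<phi> t) \<partial>lborel)"
    by (subst nn_integral_add, measurable, subst nn_integral_cmult, measurable)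
  also have "(\<integral>\<^sup>+t. (ennreal \<epsilon> * hsq s B (u t) + ennreal (1 / \<epsilon>) * hsq s B (\<phi> t)) \<partial>lborel) = ennreal \<epsilon> * (\<integral>\<^sup>+t. hsq s B (u t) \<partial>lborel) + ennreal (1 / \<epsilon>) * (\<integral>\<^sup>+t. hsq s B (\<phi> t) \<partial>lborel)"
    by (subst nn_integral_add, measurable, subst (1 2) nn_integral_cmult, measurable)
  finally show ?thesis .
qed

lemma absprod_family:
  assumes [measurable]: "(\<lambda>(t, x). \<phi> t x) \<in> borel_measurable (borel \<Otimes>\<^sub>M borel)"
    and \<phi>: "\<And>t x. r + \<delta> \<le> dist x0 x \<Longrightarrow> \<phi> t x = 0" and \<epsilon>: "0 < \<epsilon>"
  shows "(\<integral>\<^sup>+t. absprod t (\<phi> t) \<partial>lborel) \<le>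
    ennreal \<epsilon> * (\<integral>\<^sup>+t. l2sq B (u t) \<partial>lborel) + ennreal (1 / \<epsilon>) * (\<integral>\<^sup>+t. l2sq B (\<phi> t) \<partial>lborel)"
proof -
  have "(\<integral>\<^sup>+t. absprod t (\<phi> t) \<partial>lborel) \<le> (\<integral>\<^sup>+t. ennreal \<epsilon> * l2sq B (u t) + ennreal (1 / \<epsilon>) * l2sq B (\<phi> t) \<partial>lborel)"
    by (intro nn_integral_mono absprod_le \<phi> \<epsilon>) (measurable, use \<delta> in auto)
  also have "\<dots> = ennreal \<epsilon> * (\<integral>\<^sup>+t. l2sq B (u t) \<partial>lborel) + ennreal (1 / \<epsilon>) * (\<integral>\<^sup>+t. l2sq B (\<phi> t) \<partial>lborel)"
    by (subst nn_integral_add, measurable, subst (1 2) nn_integral_cmult, measurable)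
  finally show ?thesis .
qed

lemma abs_tst_time:
  "(\<integral>\<^sup>+t. absprod t (tst t) \<partial>lborel) < \<infinity>" "(\<integral>\<^sup>+t. absform t (tst t) \<partial>lborel) < \<infinity>"
proof -
  have "(\<integral>\<^sup>+t. absprod t (tst t) \<partial>lborel) \<le> ennreal 1 * (\<integral>\<^sup>+t. l2sq B (u t) \<partial>lborel) + ennreal (1 / 1) * (\<integral>\<^sup>+t. l2sq B (tst t) \<partial>lborel)"
    by (rule absprod_family) (auto simp: tst_support)
  also have "\<dots> < \<infinity>" using l2sq_time l2sq_tst_time by simp
  finally show P: "(\<integral>\<^sup>+t. absprod t (tst t) \<partial>lborel) < \<infinity>" .
  obtain N where N: "0 \<le> N" "AE t in lborel. absint (tst t) \<le> ennreal N" by (rule absint_tst_bounded)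
  have "(\<integral>\<^sup>+t. tl t * absint (tst t) \<partial>lborel) \<le> (\<integral>\<^sup>+t. tl t * ennreal N \<partial>lborel)"
    using N(2) by (intro nn_integral_mono_AE) (auto elim!: eventually_mono intro: mult_left_mono)
  also have "\<dots> < \<infinity>" using tl_time by (subst nn_integral_multc) (auto simp: ennreal_mult_less_top)
  finally have I: "(\<integral>\<^sup>+t. tl t * absint (tst t) \<partial>lborel) < \<infinity>" .
  have "(\<integral>\<^sup>+t. absform t (tst t) \<partial>lborel) \<le>
    ennreal \<Lambda> * (ennreal 1 * (\<integral>\<^sup>+t. hsq s B (u t) \<partial>lborel) + ennreal (1 / 1) * (\<integral>\<^sup>+t. hsq s B (tst t) \<partial>lborel))
    + 2 * (ennreal (\<Lambda> * C\<^sub>\<delta>) * (W * (\<integral>\<^sup>+t. absprod t (tst t) \<partial>lborel) + (\<integral>\<^sup>+t. tl t * absint (tst t) \<partial>lborel)))"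
    by (rule absform_family) (auto simp: tst_support)
  also have "\<dots> < \<infinity>" using hsq_time hsq_tst_time P I W_finite by (simp add: ennreal_mult_less_top)
  finally show "(\<integral>\<^sup>+t. absform t (tst t) \<partial>lborel) < \<infinity>" .
qed

lemma vanish_absprod: "vanish (\<lambda>z. \<integral>\<^sup>+t. absprod t (dtst z t) \<partial>lborel)"
proof (rule vanish_interp[OF vanish_l2 l2sq_time])
  fix \<epsilon> z :: real assume e: "0 < \<epsilon>"
  show "(\<integral>\<^sup>+t. absprod t (dtst z t) \<partial>lborel) \<le> ennreal \<epsilon> * (\<integral>\<^sup>+t. l2sq B (u t) \<partial>lborel) + ennreal (1 / \<epsilon>) * (\<integral>\<^sup>+t. l2sq B (dtst z t) \<partial>lborel)"
    by (rule absprod_family[OF _ _ e]) (measurable, auto simp: dtst_support)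
qed auto

text \<open>The restriction to [0, T] is forced by Young's inequality, whose constant term, the
  volume of \<open>B\<close>, is integrable over bounded times only.\<close>

lemma vanish_absint: "vanish (\<lambda>z. \<integral>\<^sup>+t\<in>{0..T}. absint (dtst z t) \<partial>lborel)"
proof (rule vanish_interp[OF vanish_l2, where A = "ennreal T * emeasure lborel B" and K = "\<lambda>\<epsilon>. ennreal (1 / \<epsilon>)"])
  show "ennreal T * emeasure lborel B < \<infinity>" using emeasure_B by (simp add: ennreal_mult_less_top)
  fix \<epsilon> z :: real assume e: "0 < \<epsilon>"
  have "(\<integral>\<^sup>+t\<in>{0..T}. absint (dtst z t) \<partial>lborel) \<le> (\<integral>\<^sup>+t. ennreal \<epsilon> * emeasure lborel B * indicator {0..T} t + ennreal (1 / \<epsilon>) * l2sq B (dtst z t) \<partial>lborel)"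
  proof (rule nn_integral_mono)
    fix t
    have "absint (dtst z t) \<le> ennreal \<epsilon> * emeasure lborel B + ennreal (1 / \<epsilon>) * l2sq B (dtst z t)"
      by (rule absint_le[OF _ _ _ e]) (auto simp: dtst_support simp del: mem_B)
    then show "absint (dtst z t) * indicator {0..T} t \<le> ennreal \<epsilon> * emeasure lborel B * indicator {0..T} t + ennreal (1 / \<epsilon>) * l2sq B (dtst z t)"
      by (auto simp: indicator_def)
  qed
  also have "\<dots> = (\<integral>\<^sup>+t. ennreal \<epsilon> * emeasure lborel B * indicator {0..T} t \<partial>lborel) + (\<integral>\<^sup>+t. ennreal (1 / \<epsilon>) * l2sq B (dtst z t) \<partial>lborel)"
    by (rule nn_integral_add) measurable
  also have "(\<integral>\<^sup>+t. ennreal (1 / \<epsilon>) * l2sq B (dtst z t) \<partial>lborel) = ennreal (1 / \<epsilon>) * (\<integral>\<^sup>+t. l2sq B (dtst z t) \<partial>lborel)"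
    by (rule nn_integral_cmult) measurable
  also have "(\<integral>\<^sup>+t. ennreal \<epsilon> * emeasure lborel B * indicator {0..T} t \<partial>lborel) = ennreal \<epsilon> * (ennreal T * emeasure lborel B)"
    using T by (subst nn_integral_cmult_indicator) (auto simp: mult_ac)
  finally show "(\<integral>\<^sup>+t\<in>{0..T}. absint (dtst z t) \<partial>lborel) \<le> ennreal \<epsilon> * (ennreal T * emeasure lborel B) + ennreal (1 / \<epsilon>) * (\<integral>\<^sup>+t. l2sq B (dtst z t) \<partial>lborel)" .
qed auto

text \<open>The tail is merely integrable in time and may be unbounded, so it is cut into a bounded
  part and a remainder of small integral.\<close>

lemma tl_truncation:
  assumes e: "0 < (e::real)" obtains n :: nat where "(\<integral>\<^sup>+t. (tl t - min (tl t) (of_nat n)) \<partial>lborel) \<le> ennreal e"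
proof -
  have "AE t in lborel. tl t \<noteq> \<infinity>" by (rule nn_integral_noteq_infinite) (use tl_time in \<open>auto simp: less_top\<close>)
  then have "(\<lambda>n. \<integral>\<^sup>+t. (tl t - min (tl t) (of_nat n)) \<partial>lborel) \<longlonglongrightarrow> (\<integral>\<^sup>+t. 0 \<partial>(lborel::real measure))"
  proof (intro nn_integral_dominated_convergence[where w = tl])
    show "AE t in lborel. (\<lambda>n. tl t - min (tl t) (of_nat n)) \<longlonglongrightarrow> 0" if "AE t in lborel. tl t \<noteq> \<infinity>"
      using that
    proof eventually_elim
      case (elim t)
      then obtain a where a: "tl t = ennreal a" "0 \<le> a" by (cases "tl t") auto
      obtain m where m: "a \<le> real m" using real_arch_simple by blast
      show ?case
      proof (intro tendsto_eventually eventually_sequentiallyI[of m])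
        fix n assume "m \<le> n"
        then have "ennreal a \<le> of_nat n" using m a by (simp add: ennreal_of_nat_eq_real_of_nat ennreal_leI)
        then show "tl t - min (tl t) (of_nat n) = 0" by (simp add: a min_def)
      qed
    qed
    show "AE t in lborel. tl t - min (tl t) (of_nat n) \<le> tl t" for n by (simp add: diff_le_self_ennreal)
  qed (use tl_time in auto)
  then have "eventually (\<lambda>n. (\<integral>\<^sup>+t. (tl t - min (tl t) (of_nat n)) \<partial>lborel) < ennreal e) sequentially"
    using e by (intro order_tendstoD(2)) auto
  then show ?thesis using that by (auto simp: eventually_sequentially intro: less_imp_le)
qed

text \<open>The bounded part of the tail meets increments that tend to 0 in L1; the remainder meets
  increments that are merely bounded, by 2N uniformly in z, but its own integral is small.\<close>

lemma vanish_tl_absint: "vanish (\<lambda>z. \<integral>\<^sup>+t. tl t * absint (dtst z t) \<partial>lborel)"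
proof -
  obtain N where N: "0 \<le> N" "AE t in lborel. absint (tst t) \<le> ennreal N" by (rule absint_tst_bounded)
  have "\<exists>m::nat. 0 < \<epsilon> \<longrightarrow> (\<integral>\<^sup>+t. (tl t - min (tl t) (of_nat m)) \<partial>lborel) \<le> ennreal \<epsilon>" for \<epsilon> :: real
    using tl_truncation[of \<epsilon>] by blast
  then have "\<exists>n :: real \<Rightarrow> nat. \<forall>\<epsilon>. 0 < \<epsilon> \<longrightarrow> (\<integral>\<^sup>+t. (tl t - min (tl t) (of_nat (n \<epsilon>))) \<partial>lborel) \<le> ennreal \<epsilon>"
    by (intro choice allI)
  then obtain n :: "real \<Rightarrow> nat" where n: "\<And>\<epsilon>. 0 < \<epsilon> \<Longrightarrow> (\<integral>\<^sup>+t. (tl t - min (tl t) (of_nat (n \<epsilon>))) \<partial>lborel) \<le> ennreal \<epsilon>" by auto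
  show ?thesis
  proof (rule vanish_interp[OF vanish_absint, where A = "ennreal (2 * N)" and K = "\<lambda>\<epsilon>. of_nat (n \<epsilon>)"])
    fix \<epsilon> z :: real assume e: "0 < \<epsilon>"
    \<comment> \<open>The essential bound at the shifted time t + z, with its own null set.\<close>
    have N': "AE t in lborel. absint (tst (z + 1 * t)) \<le> ennreal N"
      by (rule AE_borel_affine[OF _ _ N(2)]) (auto, measurable)
    have "(\<integral>\<^sup>+t. tl t * absint (dtst z t) \<partial>lborel) \<le>
      (\<integral>\<^sup>+t. ennreal (2 * N) * (tl t - min (tl t) (of_nat (n \<epsilon>))) + of_nat (n \<epsilon>) * (absint (dtst z t) * indicator {0..T} t) \<partial>lborel)"
    proof (rule nn_integral_mono_AE)
      show "AE t in lborel. tl t * absint (dtst z t) \<le> ennreal (2 * N) * (tl t - min (tl t) (of_nat (n \<epsilon>))) + of_nat (n \<epsilon>) * (absint (dtst z t) * indicator {0..T} t)"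
        using N(2) N'
      proof eventually_elim
        case (elim t)
        show ?case
        proof (cases "t \<le> 0 \<or> T \<le> t")
          case False
          have "absint (dtst z t) \<le> (\<integral>\<^sup>+x. ennreal \<bar>tst (t + z) x\<bar> + ennreal \<bar>tst t x\<bar> \<partial>lborel)"
            unfolding absint_def
          proof (rule nn_integral_mono)
            fix x
            have "\<bar>dtst z t x\<bar> \<le> \<bar>tst (t + z) x\<bar> + \<bar>tst t x\<bar>" unfolding dtst_def by (rule abs_triangle_ineq4)
            then show "ennreal \<bar>dtst z t x\<bar> \<le> ennreal \<bar>tst (t + z) x\<bar> + ennreal \<bar>tst t x\<bar>"
              by (subst ennreal_plus[symmetric]) (auto intro: ennreal_leI simp del: ennreal_plus)
          qed
          also have "\<dots> = absint (tst (t + z)) + absint (tst t)"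
            unfolding absint_def by (rule nn_integral_add) measurable
          also have "\<dots> \<le> ennreal N + ennreal N" using elim by (intro add_mono) (auto simp: add.commute)
          also have "\<dots> = ennreal (2 * N)" using N by (simp flip: ennreal_plus)
          finally have I: "absint (dtst z t) \<le> ennreal (2 * N)" .
          have "tl t = (tl t - min (tl t) (of_nat (n \<epsilon>))) + min (tl t) (of_nat (n \<epsilon>))"
            by (simp add: diff_add_cancel_ennreal)
          then have "tl t * absint (dtst z t) = (tl t - min (tl t) (of_nat (n \<epsilon>))) * absint (dtst z t) + min (tl t) (of_nat (n \<epsilon>)) * absint (dtst z t)"
            by (metis distrib_right)
          also have "\<dots> \<le> (tl t - min (tl t) (of_nat (n \<epsilon>))) * ennreal (2 * N) + of_nat (n \<epsilon>) * absint (dtst z t)"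
            by (intro add_mono mult_left_mono mult_right_mono I) auto
          finally show ?thesis using False by (simp add: mult.commute)
        qed (simp add: tl_zero)
      qed
    qed
    also have "\<dots> = (\<integral>\<^sup>+t. ennreal (2 * N) * (tl t - min (tl t) (of_nat (n \<epsilon>))) \<partial>lborel) + (\<integral>\<^sup>+t. of_nat (n \<epsilon>) * (absint (dtst z t) * indicator {0..T} t) \<partial>lborel)"
      by (rule nn_integral_add) measurable
    also have "(\<integral>\<^sup>+t. of_nat (n \<epsilon>) * (absint (dtst z t) * indicator {0..T} t) \<partial>lborel) = of_nat (n \<epsilon>) * (\<integral>\<^sup>+t\<in>{0..T}. absint (dtst z t) \<partial>lborel)"
      by (rule nn_integral_cmult) measurable
    also have "(\<integral>\<^sup>+t. ennreal (2 * N) * (tl t - min (tl t) (of_nat (n \<epsilon>))) \<partial>lborel) = ennreal (2 * N) * (\<integral>\<^sup>+t. (tl t - min (tl t) (of_nat (n \<epsilon>))) \<partial>lborel)"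
      by (rule nn_integral_cmult) measurable
    also have "\<dots> \<le> ennreal (2 * N) * ennreal \<epsilon>"
      by (intro mult_left_mono n e) auto
    finally show "(\<integral>\<^sup>+t. tl t * absint (dtst z t) \<partial>lborel) \<le> ennreal \<epsilon> * ennreal (2 * N) + of_nat (n \<epsilon>) * (\<integral>\<^sup>+t\<in>{0..T}. absint (dtst z t) \<partial>lborel)"
      by (simp add: mult.commute add_right_mono)
  qed (auto simp: of_nat_less_top)
qed

text \<open>The energy of \<open>u\<close> does not become small, so it carries the free \<epsilon>;
  every term with an increment is collected in one vanishing factor whose constant may depend on
  \<epsilon>.\<close>

lemma vanish_absform: "vanish (\<lambda>z. \<integral>\<^sup>+t. absform t (dtst z t) \<partial>lborel)"
proof (rule vanish_interp[where A = "ennreal \<Lambda> * (\<integral>\<^sup>+t. hsq s B (u t) \<partial>lborel)"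
      and K = "\<lambda>\<epsilon>. ennreal \<Lambda> * ennreal (1 / \<epsilon>) + 2 * ennreal (\<Lambda> * C\<^sub>\<delta>) * (W + 1)"])
  show "vanish (\<lambda>z. (\<integral>\<^sup>+t. hsq s B (dtst z t) \<partial>lborel) + ((\<integral>\<^sup>+t. absprod t (dtst z t) \<partial>lborel) + (\<integral>\<^sup>+t. tl t * absint (dtst z t) \<partial>lborel)))"
    by (intro vanish_add vanish_hsq vanish_absprod vanish_tl_absint)
  show "ennreal \<Lambda> * (\<integral>\<^sup>+t. hsq s B (u t) \<partial>lborel) < \<infinity>" using hsq_time by (simp add: ennreal_mult_less_top)
  fix \<epsilon> z :: real assume e: "0 < \<epsilon>"
  show "ennreal \<Lambda> * ennreal (1 / \<epsilon>) + 2 * ennreal (\<Lambda> * C\<^sub>\<delta>) * (W + 1) < \<infinity>"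
    using W_finite by (simp add: ennreal_mult_less_top)
  define a1 a2 a3 a4 where "a1 = (\<integral>\<^sup>+t. hsq s B (u t) \<partial>lborel)" "a2 = (\<integral>\<^sup>+t. hsq s B (dtst z t) \<partial>lborel)"
    "a3 = (\<integral>\<^sup>+t. absprod t (dtst z t) \<partial>lborel)" "a4 = (\<integral>\<^sup>+t. tl t * absint (dtst z t) \<partial>lborel)"
  note a = this
  have "(\<integral>\<^sup>+t. absform t (dtst z t) \<partial>lborel) \<le>
    ennreal \<Lambda> * (ennreal \<epsilon> * a1 + ennreal (1 / \<epsilon>) * a2) + 2 * (ennreal (\<Lambda> * C\<^sub>\<delta>) * (W * a3 + a4))"
    unfolding a by (rule absform_family[OF _ _ e]) (measurable, auto simp: dtst_support)
  also have "\<dots> \<le> ennreal \<epsilon> * (ennreal \<Lambda> * a1) + (ennreal \<Lambda> * ennreal (1 / \<epsilon>) * (a2 + (a3 + a4)) + 2 * ennreal (\<Lambda> * C\<^sub>\<delta>) * ((W + 1) * (a2 + (a3 + a4))))"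
  proof -
    have "W * a3 + a4 \<le> (W + 1) * (a2 + (a3 + a4))"
    proof -
      have "W * a3 + a4 \<le> W * (a2 + (a3 + a4)) + (a2 + (a3 + a4))"
        by (intro add_mono mult_left_mono) (auto simp: add_increasing add_increasing2)
      then show ?thesis by (simp add: distrib_right)
    qed
    then have "2 * (ennreal (\<Lambda> * C\<^sub>\<delta>) * (W * a3 + a4)) \<le> 2 * ennreal (\<Lambda> * C\<^sub>\<delta>) * ((W + 1) * (a2 + (a3 + a4)))"
      by (simp add: mult.assoc mult_left_mono)
    moreover have "ennreal \<Lambda> * ennreal (1 / \<epsilon>) * a2 \<le> ennreal \<Lambda> * ennreal (1 / \<epsilon>) * (a2 + (a3 + a4))"
      by (intro mult_left_mono) auto
    ultimately have "ennreal \<epsilon> * (ennreal \<Lambda> * a1) + (ennreal \<Lambda> * ennreal (1 / \<epsilon>) * a2 + 2 * (ennreal (\<Lambda> * C\<^sub>\<delta>) * (W * a3 + a4)))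
      \<le> ennreal \<epsilon> * (ennreal \<Lambda> * a1) + (ennreal \<Lambda> * ennreal (1 / \<epsilon>) * (a2 + (a3 + a4)) + 2 * ennreal (\<Lambda> * C\<^sub>\<delta>) * ((W + 1) * (a2 + (a3 + a4))))"
      by (intro add_left_mono add_mono)
    then show ?thesis by (simp add: distrib_left mult_ac add_ac)
  qed
  also have "\<dots> = ennreal \<epsilon> * (ennreal \<Lambda> * a1) + (ennreal \<Lambda> * ennreal (1 / \<epsilon>) + 2 * ennreal (\<Lambda> * C\<^sub>\<delta>) * (W + 1)) * (a2 + (a3 + a4))"
    by (simp only: distrib_right mult.assoc)
  finally show "(\<integral>\<^sup>+t. absform t (dtst z t) \<partial>lborel) \<le> ennreal \<epsilon> * (ennreal \<Lambda> * (\<integral>\<^sup>+t. hsq s B (u t) \<partial>lborel))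
    + (ennreal \<Lambda> * ennreal (1 / \<epsilon>) + 2 * ennreal (\<Lambda> * C\<^sub>\<delta>) * (W + 1)) * ((\<integral>\<^sup>+t. hsq s B (dtst z t) \<partial>lborel) + ((\<integral>\<^sup>+t. absprod t (dtst z t) \<partial>lborel) + (\<integral>\<^sup>+t. tl t * absint (dtst z t) \<partial>lborel)))"
    unfolding a .
qed

lemma form_uminus: "form \<kappa> v (\<lambda>x. - \<psi> x) = - form \<kappa> v \<psi>"
proof -
  have "form \<kappa> v (\<lambda>x. - \<psi> x) = (\<integral>p. - (case p of (x, y) \<Rightarrow> (v x - v y) * (\<psi> x - \<psi> y) * \<kappa> x y) \<partial>(lborel \<Otimes>\<^sub>M lborel))"
    unfolding form_def by (rule Bochner_Integration.integral_cong) (auto simp: algebra_simps)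
  then show ?thesis by (simp add: form_def)
qed

lemma vanish_form: "vanish (\<lambda>z. \<integral>\<^sup>+t. ennreal \<bar>form (k t) (u t) (tst (t + z)) - form (k t) (u t) (tst (t + 0))\<bar> \<partial>lborel)"
proof (rule vanish_mono[OF vanish_absform])
  fix z
  show "(\<integral>\<^sup>+t. ennreal \<bar>form (k t) (u t) (tst (t + z)) - form (k t) (u t) (tst (t + 0))\<bar> \<partial>lborel) \<le> (\<integral>\<^sup>+t. absform t (dtst z t) \<partial>lborel)"
  proof (cases "(\<integral>\<^sup>+t. absform t (dtst z t) \<partial>lborel) = \<infinity>")
    case False
    have 1: "AE t in lborel. absform t (dtst z t) \<noteq> \<infinity>"
      by (rule nn_integral_noteq_infinite[OF _ False]) measurable
    have 2: "AE t in lborel. absform t (tst t) \<noteq> \<infinity>"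
      by (rule nn_integral_noteq_infinite) (use abs_tst_time in \<open>auto simp: less_top\<close>)
    show ?thesis
    proof (rule nn_integral_mono_AE)
      show "AE t in lborel. ennreal \<bar>form (k t) (u t) (tst (t + z)) - form (k t) (u t) (tst (t + 0))\<bar> \<le> absform t (dtst z t)"
        using 1 2
      proof eventually_elim
        case (elim t)
        \<comment> \<open>The shifted test function is expressed through the increment and the
          unshifted one, for both of which \<open>absform\<close> is finite at this time.\<close>
        have "form (k t) (u t) (\<lambda>x. dtst z t x - (- tst t x)) = form (k t) (u t) (dtst z t) - form (k t) (u t) (\<lambda>x. - tst t x)"
        proof (rule form_diff)
          show "dtst z t \<in> borel_measurable borel" "(\<lambda>x. - tst t x) \<in> borel_measurable borel" by measurable
          have "absform t (\<lambda>x. - tst t x) = absform t (tst t)"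
            by (simp add: absform_def abs_minus_commute)
          then show "absform t (dtst z t) < \<infinity>" "absform t (\<lambda>x. - tst t x) < \<infinity>" using elim by (auto simp: less_top)
        qed
        then have "form (k t) (u t) (tst (t + z)) - form (k t) (u t) (tst t) = form (k t) (u t) (dtst z t)"
          by (simp add: form_uminus dtst_def)
        then show ?case using form_le_absform[of "dtst z t" t] by simp
      qed
    qed
  qed simp
qed

lemma vanish_fpair: "vanish (\<lambda>z. \<integral>\<^sup>+t. ennreal \<bar>fpair t (tst (t + z)) - fpair t (tst (t + 0))\<bar> \<partial>lborel)"
proof (rule vanish_mono[OF vanish_absprod])
  fix z
  show "(\<integral>\<^sup>+t. ennreal \<bar>fpair t (tst (t + z)) - fpair t (tst (t + 0))\<bar> \<partial>lborel) \<le> (\<integral>\<^sup>+t. absprod t (dtst z t) \<partial>lborel)"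
  proof (cases "(\<integral>\<^sup>+t. absprod t (dtst z t) \<partial>lborel) = \<infinity>")
    case False
    have 1: "AE t in lborel. absprod t (dtst z t) \<noteq> \<infinity>"
      by (rule nn_integral_noteq_infinite[OF _ False]) measurable
    have 2: "AE t in lborel. absprod t (tst t) \<noteq> \<infinity>"
      by (rule nn_integral_noteq_infinite) (use abs_tst_time in \<open>auto simp: less_top\<close>)
    show ?thesis
    proof (rule nn_integral_mono_AE)
      show "AE t in lborel. ennreal \<bar>fpair t (tst (t + z)) - fpair t (tst (t + 0))\<bar> \<le> absprod t (dtst z t)"
        using 1 2
      proof eventually_elim
        case (elim t)
        have "fpair t (\<lambda>x. dtst z t x - (- tst t x)) = fpair t (dtst z t) - fpair t (\<lambda>x. - tst t x)"
        proof (rule fpair_diff)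
          show "dtst z t \<in> borel_measurable borel" "(\<lambda>x. - tst t x) \<in> borel_measurable borel" by measurable
          have "absprod t (\<lambda>x. - tst t x) = absprod t (tst t)"
            by (simp add: absprod_def)
          then show "absprod t (dtst z t) < \<infinity>" "absprod t (\<lambda>x. - tst t x) < \<infinity>" using elim by (auto simp: less_top)
        qed
        then have "fpair t (tst (t + z)) - fpair t (tst t) = fpair t (dtst z t)"
          by (simp add: fpair_def dtst_def)
        then show ?case using fpair_le_absprod[of "dtst z t" t] by simp
      qed
    qed
  qed simp
qed

text \<open>Testing with \<open>\<eta>((t+\<tau>)/2) \<rho>\<^sub>h(t-\<tau>) \<xi>\<^sup>2 u(\<tau>)\<close> and integrating over \<open>\<tau>\<close>: the contribution of
  \<open>\<rho>\<^sub>h'\<close> is odd under the exchange of \<open>t\<close> and \<open>\<tau>\<close> and drops out, so \<open>h \<rightarrow> 0\<close> is harmless and no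
  time regularity of \<open>u\<close> is needed.\<close>

lemma energy_identity:
  assumes \<eta>: "\<And>t. (\<eta> has_real_derivative \<eta>' t) (at t)" "continuous_on UNIV \<eta>'"
    and \<eta>0: "\<And>t. 0 \<le> \<eta> t" and bd: "\<And>t. \<bar>\<eta> t\<bar> \<le> C" "\<And>t. \<bar>\<eta>' t\<bar> \<le> C"
    and b: "b < T" "\<And>t. b \<le> t \<Longrightarrow> \<eta> t = 0"
  shows "(\<integral>t. \<eta> t * form (k t) (u t) (tst t) \<partial>lborel) = (\<integral>t. 1/2 * \<eta>' t * fpair t (tst t) \<partial>lborel)"
proof -
  have C: "0 \<le> C" using bd(1)[of 0] by linarith
  have \<eta>c: "continuous_on UNIV \<eta>" using \<eta>(1) by (intro DERIV_continuous_on) (auto intro: has_field_derivative_at_within)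
  then have [measurable]: "\<eta> \<in> borel_measurable borel" by (rule borel_measurable_continuous_onI)
  have [measurable]: "\<eta>' \<in> borel_measurable borel" using \<eta>(2) by (rule borel_measurable_continuous_onI)
  define F where "F \<tau> t = form (k t) (u t) (tst \<tau>)" for \<tau> t
  define G where "G \<tau> t = fpair t (tst \<tau>)" for \<tau> t
  have [measurable]: "(\<lambda>(\<tau>, t). F \<tau> t) \<in> borel_measurable (borel \<Otimes>\<^sub>M borel)"
    unfolding F_def case_prod_beta by measurable
  have [measurable]: "(\<lambda>(\<tau>, t). G \<tau> t) \<in> borel_measurable (borel \<Otimes>\<^sub>M borel)"
    unfolding G_def case_prod_beta by measurable
  \<comment> \<open>Both orders give the integral of \<open>\<xi>\<^sup>2 u(\<tau>) u(t)\<close>.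
    This symmetry is what removes the derivative of the bump.\<close>
  have Gsym: "G \<tau> t = G t \<tau>" for \<tau> t
    unfolding G_def fpair_def tst_def by (rule Bochner_Integration.integral_cong) auto
  obtain A1 A2 where A: "A1 < \<infinity>" "A2 < \<infinity>"
    "\<And>\<psi>. \<psi> \<in> borel_measurable borel \<Longrightarrow> (\<And>x. r + \<delta> \<le> dist x0 x \<Longrightarrow> \<psi> x = 0) \<Longrightarrow>
      (\<integral>\<^sup>+t. absform t \<psi> + absprod t \<psi> \<partial>lborel) \<le> A1 + A2 * (hsq s B \<psi> + l2sq B \<psi>)"
    by (rule abs_time) blast
  \<comment> \<open>Absolute integrability in both times together, from the bound with constants
    independent of the test function.\<close>
  have dom: "(\<integral>\<^sup>+\<tau>. \<integral>\<^sup>+t. absform t (tst \<tau>) + absprod t (tst \<tau>) \<partial>lborel \<partial>lborel) < \<infinity>"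
  proof -
    have "(\<integral>\<^sup>+\<tau>. \<integral>\<^sup>+t. absform t (tst \<tau>) + absprod t (tst \<tau>) \<partial>lborel \<partial>lborel) \<le>
      (\<integral>\<^sup>+\<tau>. A1 * indicator {0..T} \<tau> + A2 * (hsq s B (tst \<tau>) + l2sq B (tst \<tau>)) \<partial>lborel)"
    proof (rule nn_integral_mono)
      fix \<tau>
      show "(\<integral>\<^sup>+t. absform t (tst \<tau>) + absprod t (tst \<tau>) \<partial>lborel) \<le> A1 * indicator {0..T} \<tau> + A2 * (hsq s B (tst \<tau>) + l2sq B (tst \<tau>))"
      proof (cases "\<tau> \<in> {0..T}")
        case True then show ?thesis using A(3)[of "tst \<tau>"] by (simp add: tst_support)
      next
        case False
        then have "tst \<tau> x = 0" for x by (intro tst_zero) auto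
        then show ?thesis by (simp add: absform_def absprod_def)
      qed
    qed
    also have "\<dots> = A1 * emeasure lborel {0..T} + A2 * ((\<integral>\<^sup>+\<tau>. hsq s B (tst \<tau>) \<partial>lborel) + (\<integral>\<^sup>+\<tau>. l2sq B (tst \<tau>) \<partial>lborel))"
      by (simp add: nn_integral_add nn_integral_cmult nn_integral_cmult_indicator)
    also have "\<dots> < \<infinity>" using A hsq_tst_time l2sq_tst_time T by (simp add: ennreal_mult_less_top)
    finally show ?thesis .
  qed
  have int2: "integrable (lborel \<Otimes>\<^sub>M lborel) (\<lambda>(\<tau>, t). w ((t + \<tau>) / 2) * \<rho> (t - \<tau>) * H \<tau> t)"
    if [measurable]: "(\<lambda>(\<tau>, t). H \<tau> t) \<in> borel_measurable (borel \<Otimes>\<^sub>M borel)" "w \<in> borel_measurable borel" "\<rho> \<in> borel_measurable borel"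
      and H: "\<And>\<tau> t. ennreal \<bar>H \<tau> t\<bar> \<le> absform t (tst \<tau>) + absprod t (tst \<tau>)"
      and w: "\<And>t. \<bar>w t\<bar> \<le> c1" and \<rho>: "\<And>t. \<bar>\<rho> t\<bar> \<le> c2" for w \<rho> :: "real \<Rightarrow> real" and H c1 c2
  proof (rule integrableI_bounded)
    have c: "0 \<le> c1" "0 \<le> c2" using w[of 0] \<rho>[of 0] by linarith+
    show "(\<lambda>(\<tau>, t). w ((t + \<tau>) / 2) * \<rho> (t - \<tau>) * H \<tau> t) \<in> borel_measurable (lborel \<Otimes>\<^sub>M lborel)" by measurable
    have "(\<integral>\<^sup>+p. ennreal (norm (case p of (\<tau>, t) \<Rightarrow> w ((t + \<tau>) / 2) * \<rho> (t - \<tau>) * H \<tau> t)) \<partial>(lborel \<Otimes>\<^sub>M lborel))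
      = (\<integral>\<^sup>+\<tau>. \<integral>\<^sup>+t. ennreal \<bar>w ((t + \<tau>) / 2) * \<rho> (t - \<tau>) * H \<tau> t\<bar> \<partial>lborel \<partial>lborel)"
      by (subst lborel.nn_integral_fst[symmetric]) auto
    also have "\<dots> \<le> (\<integral>\<^sup>+\<tau>. \<integral>\<^sup>+t. ennreal (c1 * c2) * (absform t (tst \<tau>) + absprod t (tst \<tau>)) \<partial>lborel \<partial>lborel)"
    proof (intro nn_integral_mono)
      fix \<tau> t
      have "\<bar>w ((t + \<tau>) / 2)\<bar> * \<bar>\<rho> (t - \<tau>)\<bar> * \<bar>H \<tau> t\<bar> \<le> (c1 * c2) * \<bar>H \<tau> t\<bar>"
        using w \<rho> c by (intro mult_right_mono mult_mono) auto
      then have "ennreal \<bar>w ((t + \<tau>) / 2) * \<rho> (t - \<tau>) * H \<tau> t\<bar> \<le> ennreal (c1 * c2) * ennreal \<bar>H \<tau> t\<bar>"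
        using c by (subst ennreal_mult[symmetric]) (auto simp: abs_mult intro: ennreal_leI)
      also have "\<dots> \<le> ennreal (c1 * c2) * (absform t (tst \<tau>) + absprod t (tst \<tau>))" by (intro mult_left_mono H) auto
      finally show "ennreal \<bar>w ((t + \<tau>) / 2) * \<rho> (t - \<tau>) * H \<tau> t\<bar> \<le> ennreal (c1 * c2) * (absform t (tst \<tau>) + absprod t (tst \<tau>))" .
    qed
    also have "\<dots> = ennreal (c1 * c2) * (\<integral>\<^sup>+\<tau>. \<integral>\<^sup>+t. absform t (tst \<tau>) + absprod t (tst \<tau>) \<partial>lborel \<partial>lborel)"
      by (rule nn_integral2_cmult) measurable
    also have "\<dots> < \<infinity>" using dom by (simp add: ennreal_mult_less_top)
    finally show "(\<integral>\<^sup>+p. ennreal (norm (case p of (\<tau>, t) \<Rightarrow> w ((t + \<tau>) / 2) * \<rho> (t - \<tau>) * H \<tau> t)) \<partial>(lborel \<Otimes>\<^sub>M lborel)) < \<infinity>" .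
  qed
  have Fb: "ennreal \<bar>F \<tau> t\<bar> \<le> absform t (tst \<tau>) + absprod t (tst \<tau>)" for \<tau> t
    using form_le_absform[of "tst \<tau>" t] by (auto simp: F_def intro: order_trans)
  have Gb: "ennreal \<bar>G \<tau> t\<bar> \<le> absform t (tst \<tau>) + absprod t (tst \<tau>)" for \<tau> t
    using fpair_le_absprod[of "tst \<tau>" t] by (auto simp: G_def intro: order_trans)
  \<comment> \<open>The chain rule for the midpoint (t + \<tau>)/2 produces the factor 1/2 of the
    energy identity.\<close>
  define \<eta>h where "\<eta>h t = 1/2 * \<eta>' t" for t
  have [measurable]: "\<eta>h \<in> borel_measurable borel" unfolding \<eta>h_def by measurable
  have \<eta>hb: "\<bar>\<eta>h t\<bar> \<le> C" for t using bd(2)[of t] C by (simp add: \<eta>h_def abs_mult)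
  define HA where "HA z = (\<integral>t. \<eta> (t + z / 2) * F (t + z) t \<partial>lborel)" for z
  define HB where "HB z = (\<integral>t. \<eta>h (t + z / 2) * G (t + z) t \<partial>lborel)" for z
  \<comment> \<open>The range h < T - b of bump widths keeps the doubled test functions away from
    the final time.\<close>
  have "HA 0 = HB 0"
  proof (rule concentrate_eq[of HA HB "T - b"])
    show "0 < T - b" using b by simp
    have "integrable lborel (\<lambda>t. form (k t) (u t) (tst t))"
    proof (rule integrableI_bounded)
      show "(\<integral>\<^sup>+t. ennreal (norm (form (k t) (u t) (tst t))) \<partial>lborel) < \<infinity>"
        by (rule le_less_trans[OF nn_integral_mono abs_tst_time(2)]) (simp add: form_le_absform)
    qed measurable
    then have "vanish (\<lambda>z. ennreal \<bar>(\<integral>t. \<eta> (t + z / 2) * F (t + z) t \<partial>lborel) - (\<integral>t. \<eta> t * F (t + 0) t \<partial>lborel)\<bar>)"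
      unfolding F_def
      by (intro weighted_integral_continuous[where T = T and \<Phi> = "\<lambda>z t. form (k t) (u t) (tst (t + z))", OF \<eta>c bd(1) _ _ vanish_form])
        (use T in \<open>auto simp: abs_time_zero\<close>)
    then show "vanish (\<lambda>z. ennreal \<bar>HA z - HA 0\<bar>)" by (simp add: HA_def)
    have "integrable lborel (\<lambda>t. fpair t (tst t))"
    proof (rule integrableI_bounded)
      show "(\<integral>\<^sup>+t. ennreal (norm (fpair t (tst t))) \<partial>lborel) < \<infinity>"
        by (rule le_less_trans[OF nn_integral_mono abs_tst_time(1)]) (simp add: fpair_le_absprod)
    qed measurable
    moreover have "continuous_on UNIV \<eta>h" unfolding \<eta>h_def by (intro continuous_intros \<eta>(2))
    ultimately have "vanish (\<lambda>z. ennreal \<bar>(\<integral>t. \<eta>h (t + z / 2) * G (t + z) t \<partial>lborel) - (\<integral>t. \<eta>h t * G (t + 0) t \<partial>lborel)\<bar>)"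
      unfolding G_def
      by (intro weighted_integral_continuous[where T = T and \<Phi> = "\<lambda>z t. fpair t (tst (t + z))", OF _ \<eta>hb _ _ vanish_fpair])
        (use T in \<open>auto simp: abs_time_zero\<close>)
    then show "vanish (\<lambda>z. ennreal \<bar>HB z - HB 0\<bar>)" by (simp add: HB_def)
  next
    fix h :: real assume h: "0 < h" "h < T - b"
    have bb: "\<bar>bump h t\<bar> \<le> (h\<^sup>2)\<^sup>2" for t using bump_le[of h t] bump_nonneg[of h t] by simp
    have b'b: "\<bar>bump' h t\<bar> \<le> 4 * h\<^sup>2 * h" for t using bump'_le[of h t] h by simp
    have IF: "integrable (lborel \<Otimes>\<^sub>M lborel) (\<lambda>(\<tau>, t). \<eta> ((t + \<tau>) / 2) * bump h (t - \<tau>) * F \<tau> t)"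
      by (rule int2[OF _ _ _ Fb bd(1) bb]) measurable
    have IG: "integrable (lborel \<Otimes>\<^sub>M lborel) (\<lambda>(\<tau>, t). \<eta>h ((t + \<tau>) / 2) * bump h (t - \<tau>) * G \<tau> t)"
      by (rule int2[OF _ _ _ Gb \<eta>hb bb]) measurable
    have IG': "integrable (lborel \<Otimes>\<^sub>M lborel) (\<lambda>(\<tau>, t). \<eta> ((t + \<tau>) / 2) * bump' h (t - \<tau>) * G \<tau> t)"
      by (rule int2[OF _ _ _ Gb bd(1) b'b]) measurable
    have SF: "integrable lborel (\<lambda>z. bump h z * HA z)"
      "(\<integral>(\<tau>, t). \<eta> ((t + \<tau>) / 2) * bump h (t - \<tau>) * F \<tau> t \<partial>(lborel \<Otimes>\<^sub>M lborel)) = (\<integral>z. bump h z * HA z \<partial>lborel)"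
      using shear_integral[OF IF] bump_even(1) by (auto simp: HA_def)
    have SG: "integrable lborel (\<lambda>z. bump h z * HB z)"
      "(\<integral>(\<tau>, t). \<eta>h ((t + \<tau>) / 2) * bump h (t - \<tau>) * G \<tau> t \<partial>(lborel \<Otimes>\<^sub>M lborel)) = (\<integral>z. bump h z * HB z \<partial>lborel)"
      using shear_integral[OF IG] bump_even(1) by (auto simp: HB_def)
    show "integrable lborel (\<lambda>z. bump h z * HA z)" "integrable lborel (\<lambda>z. bump h z * HB z)"
      by (rule SF(1) SG(1))+
    have odd: "(\<integral>(\<tau>, t). \<eta> ((t + \<tau>) / 2) * bump' h (t - \<tau>) * G \<tau> t \<partial>(lborel \<Otimes>\<^sub>M lborel)) = 0" (is "?I = 0")
    proof -
      define f where "f = (\<lambda>(\<tau>, t). \<eta> ((t + \<tau>) / 2) * bump' h (t - \<tau>) * G \<tau> t)"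
      have "f \<in> borel_measurable (lborel \<Otimes>\<^sub>M lborel)" unfolding f_def by measurable
      then have "(\<integral>(x, y). f (y, x) \<partial>(lborel \<Otimes>\<^sub>M lborel)) = integral\<^sup>L (lborel \<Otimes>\<^sub>M lborel) f"
        by (rule lborel_pair.integral_product_swap)
      moreover have "(\<integral>(x, y). f (y, x) \<partial>(lborel \<Otimes>\<^sub>M lborel)) = (\<integral>p. - f p \<partial>(lborel \<Otimes>\<^sub>M lborel))"
      proof (rule Bochner_Integration.integral_cong[OF refl])
        fix p :: "real \<times> real"
        obtain x y where p: "p = (x, y)" by force
        have "bump' h (x - y) = - bump' h (y - x)" using bump_even(2)[of h "y - x"] by simp
        then show "(case p of (x, y) \<Rightarrow> f (y, x)) = - f p"
          using Gsym[of x y] by (simp add: p f_def add.commute)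
      qed
      ultimately show ?thesis by (simp add: f_def)
    qed
    have "(\<integral>(\<tau>, t). \<eta> ((t + \<tau>) / 2) * bump h (t - \<tau>) * F \<tau> t \<partial>(lborel \<Otimes>\<^sub>M lborel)) =
      (\<integral>\<tau>. (\<integral>t. \<eta> ((t + \<tau>) / 2) * bump h (t - \<tau>) * F \<tau> t \<partial>lborel) \<partial>lborel)"
      by (rule lborel_pair.integral_fst[OF IF, symmetric])
    also have "\<dots> = (\<integral>\<tau>. (\<integral>t. \<eta>h ((t + \<tau>) / 2) * bump h (t - \<tau>) * G \<tau> t \<partial>lborel)
       + (\<integral>t. \<eta> ((t + \<tau>) / 2) * bump' h (t - \<tau>) * G \<tau> t \<partial>lborel) \<partial>lborel)"
    proof (rule integral_cong_AE)
      show "AE \<tau> in lborel. (\<integral>t. \<eta> ((t + \<tau>) / 2) * bump h (t - \<tau>) * F \<tau> t \<partial>lborel) =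
        (\<integral>t. \<eta>h ((t + \<tau>) / 2) * bump h (t - \<tau>) * G \<tau> t \<partial>lborel) + (\<integral>t. \<eta> ((t + \<tau>) / 2) * bump' h (t - \<tau>) * G \<tau> t \<partial>lborel)"
        using tst_adm lborel_pair.AE_integrable_fst[OF IG] lborel_pair.AE_integrable_fst[OF IG']
      proof eventually_elim
        case (elim \<tau>)
        define e where "e t = \<eta> ((t + \<tau>) / 2) * bump h (t - \<tau>)" for t
        define e' where "e' t = \<eta>h ((t + \<tau>) / 2) * bump h (t - \<tau>) + \<eta> ((t + \<tau>) / 2) * bump' h (t - \<tau>)" for t
        \<comment> \<open>For t \<ge> b + h either |t - \<tau>| \<ge> h and the bump vanishes, or
          \<tau> > b and the midpoint lies beyond \<open>b\<close>; hence the shifted end time b + h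
          < T.\<close>
        have "(\<integral>t. e t * form (k t) (u t) (tst \<tau>) \<partial>lborel) = (\<integral>t. e' t * fpair t (tst \<tau>) \<partial>lborel)"
        proof (rule weak_adm[OF elim(1), where b = "b + h" and C = "C * (h\<^sup>2)\<^sup>2 + C * (4 * h\<^sup>2 * h)"])
          fix t
          have "((\<lambda>t. (t + \<tau>) / 2) has_real_derivative 1/2) (at t)" by (auto intro!: derivative_eq_intros)
          from DERIV_chain2[OF \<eta>(1) this] have 1: "((\<lambda>t. \<eta> ((t + \<tau>) / 2)) has_real_derivative \<eta>h ((t + \<tau>) / 2)) (at t)"
            by (simp add: \<eta>h_def mult.commute)
          have "((\<lambda>t. t - \<tau>) has_real_derivative 1) (at t)" by (auto intro!: derivative_eq_intros)
          from DERIV_chain2[OF bump_deriv this] have 2: "((\<lambda>t. bump h (t - \<tau>)) has_real_derivative bump' h (t - \<tau>)) (at t)" by simp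
          show "(e has_real_derivative e' t) (at t)"
            using DERIV_mult[OF 1 2] unfolding e_def[abs_def] e'_def by (simp add: mult.commute)
          show "0 \<le> e t" unfolding e_def by (intro mult_nonneg_nonneg \<eta>0 bump_nonneg)
          have a1: "\<bar>\<eta> ((t + \<tau>) / 2) * bump h (t - \<tau>)\<bar> \<le> C * (h\<^sup>2)\<^sup>2"
            unfolding abs_mult by (intro mult_mono bd bb) (use C in auto)
          have a2: "\<bar>\<eta>h ((t + \<tau>) / 2) * bump h (t - \<tau>)\<bar> \<le> C * (h\<^sup>2)\<^sup>2"
            unfolding abs_mult by (intro mult_mono \<eta>hb bb) (use C in auto)
          have a3: "\<bar>\<eta> ((t + \<tau>) / 2) * bump' h (t - \<tau>)\<bar> \<le> C * (4 * h\<^sup>2 * h)"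
            unfolding abs_mult by (intro mult_mono bd b'b) (use C in auto)
          have "0 \<le> C * (4 * h\<^sup>2 * h)" using C h by simp
          then show "\<bar>e t\<bar> \<le> C * (h\<^sup>2)\<^sup>2 + C * (4 * h\<^sup>2 * h)" using a1 unfolding e_def by linarith
          show "\<bar>e' t\<bar> \<le> C * (h\<^sup>2)\<^sup>2 + C * (4 * h\<^sup>2 * h)" using a2 a3 unfolding e'_def by linarith
          show "e t = 0" if "b + h \<le> t"
          proof (cases "h \<le> \<bar>t - \<tau>\<bar>")
            case True then show ?thesis using bump_zero(1)[of h "t - \<tau>"] h by (simp add: e_def)
          next
            case False
            then have "b \<le> (t + \<tau>) / 2" using that h by (simp add: abs_if split: if_splits)
            then show ?thesis by (simp add: e_def b)
          qed
        next
          show "continuous_on UNIV e'"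
            unfolding e'_def \<eta>h_def
            by (intro continuous_intros continuous_on_compose2[OF \<eta>(2)] continuous_on_compose2[OF \<eta>c]
                continuous_on_compose2[OF bump_cont(1)] continuous_on_compose2[OF bump_cont(2)]) auto
        qed (use h in auto)
        then show ?case
          using elim(2,3) unfolding e_def e'_def F_def G_def
          by (subst Bochner_Integration.integral_add[symmetric]) (auto simp: distrib_right)
      qed
      show "(\<lambda>\<tau>. \<integral>t. \<eta> ((t + \<tau>) / 2) * bump h (t - \<tau>) * F \<tau> t \<partial>lborel) \<in> borel_measurable lborel"
        using lborel_pair.integrable_fst[OF IF] by simp
      show "(\<lambda>\<tau>. (\<integral>t. \<eta>h ((t + \<tau>) / 2) * bump h (t - \<tau>) * G \<tau> t \<partial>lborel)
       + (\<integral>t. \<eta> ((t + \<tau>) / 2) * bump' h (t - \<tau>) * G \<tau> t \<partial>lborel)) \<in> borel_measurable lborel"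
        using lborel_pair.integrable_fst[OF IG] lborel_pair.integrable_fst[OF IG'] by simp
    qed
    also have "\<dots> = (\<integral>\<tau>. (\<integral>t. \<eta>h ((t + \<tau>) / 2) * bump h (t - \<tau>) * G \<tau> t \<partial>lborel) \<partial>lborel)
       + (\<integral>\<tau>. (\<integral>t. \<eta> ((t + \<tau>) / 2) * bump' h (t - \<tau>) * G \<tau> t \<partial>lborel) \<partial>lborel)"
      by (rule Bochner_Integration.integral_add[OF lborel_pair.integrable_fst[OF IG] lborel_pair.integrable_fst[OF IG']])
    also have "\<dots> = (\<integral>(\<tau>, t). \<eta>h ((t + \<tau>) / 2) * bump h (t - \<tau>) * G \<tau> t \<partial>(lborel \<Otimes>\<^sub>M lborel))"
      using lborel_pair.integral_fst[OF IG] lborel_pair.integral_fst[OF IG'] odd by simp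
    finally show "(\<integral>z. bump h z * HA z \<partial>lborel) = (\<integral>z. bump h z * HB z \<partial>lborel)"
      by (simp add: SF(2) SG(2))
  qed
  then show ?thesis by (simp add: HA_def HB_def F_def G_def \<eta>h_def)
qed

end

section \<open>Energy inequality and Nash inequality\<close>

lemma antiderivative_real:
  fixes q :: "real \<Rightarrow> real"
  assumes "continuous_on UNIV q"
  obtains H where "\<And>t. (H has_real_derivative q t) (at t)"
proof -
  have "\<exists>F. \<forall>x :: real. - \<infinity> < ereal x \<longrightarrow> ereal x < \<infinity> \<longrightarrow> (F has_vector_derivative q x) (at x)"
    by (rule einterval_antiderivative) (use assms in \<open>auto simp: continuous_on_eq_continuous_at\<close>)
  then show ?thesis using that by (auto simp: has_real_derivative_iff_has_vector_derivative)
qed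

context nonlocal_cutoff
begin

definition ball_L1 :: "real \<Rightarrow> ennreal" where "ball_L1 t = (\<integral>\<^sup>+x\<in>B. ennreal \<bar>u t x\<bar> \<partial>lborel)"

text \<open>The right-hand side of the Caccioppoli inequality: the commutator of cutoff and form,
  and the far field.\<close>

definition err :: "real \<Rightarrow> ennreal" where
  "err t = 2 * (ennreal (\<Lambda> * (1 / \<delta>)\<^sup>2) * J * l2sq B (u t)) + 2 * (ennreal (\<Lambda> * C\<^sub>\<delta>) * (tl t * ball_L1 t))"

lemma ball_L1_measurable [measurable]: "ball_L1 \<in> borel_measurable borel"
  unfolding ball_L1_def[abs_def] by measurable

lemma err_measurable [measurable]: "err \<in> borel_measurable borel"
  unfolding err_def[abs_def] by measurable

text \<open>With a, b the values of \<open>u\<close> and p, q those of the cutoff, (a - b)(p^2 a -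
  q^2 b) = (p a - q b)^2 - a b (p - q)^2; this is the absolute value of the last term times the
  kernel. Since the cutoff vanishes off \<open>B\<close>, every branch is the square of its
  difference.\<close>

definition loss :: "real \<Rightarrow> 'a \<Rightarrow> 'a \<Rightarrow> real" where
  "loss t x y = \<bar>u t x * u t y\<bar> * k t x y *
     (if x \<in> B then (if y \<in> B then (\<xi> x - \<xi> y)\<^sup>2 else (\<xi> x)\<^sup>2) else (if y \<in> B then (\<xi> y)\<^sup>2 else 0))"

lemma loss_measurable [measurable]: "(\<lambda>(x, y). loss t x y) \<in> borel_measurable (borel \<Otimes>\<^sub>M borel)"
proof -
  show ?thesis unfolding loss_def mem_B by measurable
qed

lemma loss_nonneg: "0 \<le> loss t x y"
  unfolding loss_def by (intro mult_nonneg_nonneg) (auto simp: k_nonneg)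

lemma ball_L1_eq_absint: "ball_L1 t = absint (\<lambda>x. indicator B x * u t x)"
  unfolding ball_L1_def absint_def by (intro nn_integral_cong) (auto simp: indicator_def)

text \<open>Inside \<open>B\<close> the product |u(x) u(y)| is split by Young's inequality, and each
  half is a commutator term. For pairs with one point outside \<open>B\<close> the kernel is
  nonsingular and the double integral factorises into local L1 norm times tail.\<close>

lemma loss_integral: "(\<integral>\<^sup>+x. \<integral>\<^sup>+y. ennreal (loss t x y) \<partial>lborel \<partial>lborel) \<le> err t"
proof -
  let ?c = "ennreal (\<Lambda> * C\<^sub>\<delta>)"
  let ?n = "\<lambda>x y. ennreal ((u t y)\<^sup>2 * (\<xi> x - \<xi> y)\<^sup>2 * riesz s (x - y)) * indicator B y * indicator B x"
  let ?f = "\<lambda>x y. ennreal \<bar>u t x\<bar> * indicator B x * (ennreal \<bar>u t y\<bar> * ennreal (tail_weight s (y - x0)))"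
  have t0: "0 \<le> tail_weight s v" for v :: 'a by (auto intro: less_imp_le tail_weight_pos)
  have far: "ennreal (\<bar>u t x * u t y\<bar> * k' * (\<xi> x)\<^sup>2) \<le> ?c * ?f x y"
    if y: "y \<notin> B" and x: "x \<in> B" and k': "0 \<le> k'" "k' \<le> \<Lambda> * riesz s (x - y)" for x y k'
  proof (cases "\<xi> x = 0")
    case False
    then have d: "dist x0 x \<le> r + \<delta>" using \<xi>_eq_0[of x] by force
    have "\<bar>u t x * u t y\<bar> * k' * (\<xi> x)\<^sup>2 \<le> \<bar>u t x * u t y\<bar> * k' * 1"
      using \<xi>_sq_bound[of x] k' by (intro mult_left_mono) auto
    also have "\<dots> \<le> \<bar>u t x * u t y\<bar> * (\<Lambda> * (C\<^sub>\<delta> * tail_weight s (y - x0)))"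
      using riesz_far[OF d y] \<Lambda> by (auto intro!: mult_left_mono order_trans[OF k'(2)])
    finally have "ennreal (\<bar>u t x * u t y\<bar> * k' * (\<xi> x)\<^sup>2) \<le> ennreal (\<Lambda> * C\<^sub>\<delta> * (\<bar>u t x\<bar> * (\<bar>u t y\<bar> * tail_weight s (y - x0))))"
      by (intro ennreal_leI) (simp add: abs_mult mult_ac)
    also have "\<dots> = ?c * ?f x y" using \<Lambda> t0 x by (simp add: ennreal_mult)
    finally show ?thesis .
  qed auto
  have "(\<integral>\<^sup>+x. \<integral>\<^sup>+y. ennreal (loss t x y) \<partial>lborel \<partial>lborel) \<le>
    (\<integral>\<^sup>+x. \<integral>\<^sup>+y. ennreal \<Lambda> * (?n x y + ?n y x) + ?c * (?f x y + ?f y x) \<partial>lborel \<partial>lborel)"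
  proof (intro nn_integral_mono)
    fix x y :: 'a
    consider "x \<in> B" "y \<in> B" | "x \<in> B" "y \<notin> B" | "x \<notin> B" "y \<in> B" | "x \<notin> B" "y \<notin> B" by blast
    then show "ennreal (loss t x y) \<le> ennreal \<Lambda> * (?n x y + ?n y x) + ?c * (?f x y + ?f y x)"
    proof cases
      case 1
      have "\<bar>u t x * u t y\<bar> \<le> (u t y)\<^sup>2 + (u t x)\<^sup>2" using young_real[of 1 "u t x" "u t y"] by simp
      then have "loss t x y \<le> ((u t y)\<^sup>2 + (u t x)\<^sup>2) * (\<Lambda> * riesz s (x - y)) * (\<xi> x - \<xi> y)\<^sup>2"
        using 1 k_le[of t x y] k_nonneg[of t x y] by (auto simp: loss_def intro!: mult_right_mono mult_mono)
      also have "\<dots> = \<Lambda> * ((u t y)\<^sup>2 * (\<xi> x - \<xi> y)\<^sup>2 * riesz s (x - y) + (u t x)\<^sup>2 * (\<xi> y - \<xi> x)\<^sup>2 * riesz s (y - x))"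
        by (simp add: algebra_simps riesz_minus[of s y x] power2_commute[of "\<xi> y"])
      finally have "ennreal (loss t x y) \<le> ennreal (\<Lambda> * ((u t y)\<^sup>2 * (\<xi> x - \<xi> y)\<^sup>2 * riesz s (x - y) + (u t x)\<^sup>2 * (\<xi> y - \<xi> x)\<^sup>2 * riesz s (y - x)))"
        by (rule ennreal_leI)
      also have "\<dots> = ennreal \<Lambda> * (?n x y + ?n y x)" using 1 \<Lambda> by (simp add: ennreal_mult'' ennreal_plus)
      finally show ?thesis by (rule order_trans) simp
    next
      case 2
      then have "ennreal (loss t x y) = ennreal (\<bar>u t x * u t y\<bar> * k t x y * (\<xi> x)\<^sup>2)" by (simp add: loss_def)
      also have "\<dots> \<le> ?c * ?f x y" by (rule far[OF 2(2,1) k_nonneg k_le])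
      also have "\<dots> \<le> ?c * (?f x y + ?f y x)" by (intro mult_left_mono) auto
      finally show ?thesis by (rule order_trans) simp
    next
      case 3
      then have "ennreal (loss t x y) = ennreal (\<bar>u t y * u t x\<bar> * k t x y * (\<xi> y)\<^sup>2)" by (simp add: loss_def mult.commute)
      also have "\<dots> \<le> ?c * ?f y x" by (rule far[OF 3(1,2) k_nonneg]) (use k_le[of t x y] riesz_minus[of s x y] in simp)
      also have "\<dots> \<le> ?c * (?f x y + ?f y x)" by (intro mult_left_mono) auto
      finally show ?thesis by (rule order_trans) simp
    next
      case 4 then show ?thesis by (simp add: loss_def)
    qed
  qed
  also have "\<dots> = (\<integral>\<^sup>+x. \<integral>\<^sup>+y. ennreal \<Lambda> * (?n x y + ?n y x) \<partial>lborel \<partial>lborel) + (\<integral>\<^sup>+x. \<integral>\<^sup>+y. ?c * (?f x y + ?f y x) \<partial>lborel \<partial>lborel)"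
    by (rule nn_integral2_add) measurable
  also have "(\<integral>\<^sup>+x. \<integral>\<^sup>+y. ennreal \<Lambda> * (?n x y + ?n y x) \<partial>lborel \<partial>lborel) = ennreal \<Lambda> * ((\<integral>\<^sup>+x. \<integral>\<^sup>+y. ?n x y \<partial>lborel \<partial>lborel) + (\<integral>\<^sup>+x. \<integral>\<^sup>+y. ?n y x \<partial>lborel \<partial>lborel))"
    by (subst nn_integral2_cmult, measurable, subst nn_integral2_add, measurable)
  also have "(\<integral>\<^sup>+x. \<integral>\<^sup>+y. ?c * (?f x y + ?f y x) \<partial>lborel \<partial>lborel) = ?c * ((\<integral>\<^sup>+x. \<integral>\<^sup>+y. ?f x y \<partial>lborel \<partial>lborel) + (\<integral>\<^sup>+x. \<integral>\<^sup>+y. ?f y x \<partial>lborel \<partial>lborel))"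
    by (subst nn_integral2_cmult, measurable, subst nn_integral2_add, measurable)
  also have "(\<integral>\<^sup>+x. \<integral>\<^sup>+y. ?n y x \<partial>lborel \<partial>lborel) = (\<integral>\<^sup>+y. \<integral>\<^sup>+x. ?n y x \<partial>lborel \<partial>lborel)"
    by (rule lborel_pair.Fubini') measurable
  also have "(\<integral>\<^sup>+x. \<integral>\<^sup>+y. ?f y x \<partial>lborel \<partial>lborel) = (\<integral>\<^sup>+y. \<integral>\<^sup>+x. ?f y x \<partial>lborel \<partial>lborel)"
    by (rule lborel_pair.Fubini') measurable
  also have "(\<integral>\<^sup>+x. \<integral>\<^sup>+y. ?f x y \<partial>lborel \<partial>lborel) = (\<integral>\<^sup>+x. ennreal \<bar>u t x\<bar> * indicator B x * tl t \<partial>lborel)"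
  proof (rule nn_integral_cong)
    fix x
    have "(\<integral>\<^sup>+y. ?f x y \<partial>lborel) = ennreal \<bar>u t x\<bar> * indicator B x * (\<integral>\<^sup>+y. ennreal \<bar>u t y\<bar> * ennreal (tail_weight s (y - x0)) \<partial>lborel)"
      by (rule nn_integral_cmult) measurable
    then show "(\<integral>\<^sup>+y. ?f x y \<partial>lborel) = ennreal \<bar>u t x\<bar> * indicator B x * tl t"
      using t0 by (simp add: tl_def ennreal_mult)
  qed
  also have "\<dots> = ball_L1 t * tl t" unfolding ball_L1_def by (rule nn_integral_multc) measurable
  also have "(\<integral>\<^sup>+x. \<integral>\<^sup>+y. ?n x y \<partial>lborel \<partial>lborel) = (\<integral>\<^sup>+x\<in>B. (\<integral>\<^sup>+y\<in>B. ennreal ((u t y)\<^sup>2 * (\<xi> x - \<xi> y)\<^sup>2 * riesz s (x - y)) \<partial>lborel) \<partial>lborel)"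
    by (rule nn_integral2_indicator[symmetric]) measurable
  also have "\<dots> \<le> ennreal ((1 / \<delta>)\<^sup>2) * J * l2sq B (u t)"
    by (rule commutator_bound[OF _ _ _ \<xi>_lipschitz]) (use \<delta> in auto)
  finally have "(\<integral>\<^sup>+x. \<integral>\<^sup>+y. ennreal (loss t x y) \<partial>lborel \<partial>lborel) \<le>
     ennreal \<Lambda> * (ennreal ((1 / \<delta>)\<^sup>2) * J * l2sq B (u t) + ennreal ((1 / \<delta>)\<^sup>2) * J * l2sq B (u t)) + ?c * (ball_L1 t * tl t + ball_L1 t * tl t)"
    by (simp add: add_mono mult_left_mono)
  also have "\<dots> = err t"
    using \<Lambda> unfolding err_def mult_2[of "_::ennreal"] by (simp add: ennreal_mult distrib_left mult_ac)
  finally show ?thesis .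
qed

text \<open>Coercivity is applied to \<xi> u on \<open>B\<close>; pairs with one point outside
  \<open>B\<close> contribute an additional nonnegative square, which is dropped. Nonnegativity of
  the sum is recorded separately because it allows the whole left side to be discarded when only the
  supremum in time is wanted.\<close>

lemma form_lower:
  assumes co: "\<forall>x0 r v. 0 < r \<longrightarrow> v \<in> borel_measurable borel \<longrightarrow> l2sq (ball x0 r) v < \<infinity> \<longrightarrow> hsq s (ball x0 r) v < \<infinity> \<longrightarrow>
        ennreal l * hsq s (ball x0 r) v \<le>
        (\<integral>\<^sup>+x\<in>ball x0 r. (\<integral>\<^sup>+y\<in>ball x0 r. ennreal ((v x - v y)\<^sup>2 * k t x y) \<partial>lborel) \<partial>lborel)"
    and fin: "absform t (tst t) < \<infinity>" "err t < \<infinity>" "l2sq B (u t) < \<infinity>" "hsq s B (u t) < \<infinity>"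
  shows "ennreal l * hsq s B (\<lambda>x. \<xi> x * u t x) \<le> ennreal (form (k t) (u t) (tst t) + enn2real (err t))"
    and "0 \<le> form (k t) (u t) (tst t) + enn2real (err t)"
proof -
  define f where "f x y = (u t x - u t y) * (tst t x - tst t y) * k t x y" for x y
  define v where "v x = \<xi> x * u t x" for x
  have [measurable]: "v \<in> borel_measurable borel" unfolding v_def by measurable
  have fi: "integrable (lborel \<Otimes>\<^sub>M lborel) (\<lambda>(x, y). f x y)"
    unfolding f_def by (rule form_integrand_integrable[OF _ fin(1)]) measurable
  have [measurable]: "(\<lambda>(x, y). loss t x y) \<in> borel_measurable (lborel \<Otimes>\<^sub>M lborel)"
    using loss_measurable by (simp cong: measurable_cong_sets sets_pair_measure_cong)
  have L: "(\<integral>\<^sup>+p. ennreal (case p of (x, y) \<Rightarrow> loss t x y) \<partial>(lborel \<Otimes>\<^sub>M lborel)) \<le> err t"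
    using loss_integral[of t] by (subst lborel.nn_integral_fst[symmetric]) auto
  have gi: "integrable (lborel \<Otimes>\<^sub>M lborel) (\<lambda>(x, y). loss t x y)"
  proof (rule integrableI_nonneg)
    show "(\<integral>\<^sup>+p. ennreal (case p of (x, y) \<Rightarrow> loss t x y) \<partial>(lborel \<Otimes>\<^sub>M lborel)) < \<infinity>"
      using L fin(2) by (rule le_less_trans)
  qed (auto simp: loss_nonneg)
  have pt: "(v x - v y)\<^sup>2 * k t x y * indicator B y * indicator B x \<le> f x y + loss t x y" for x y
  proof -
    have z: "\<xi> z = 0" if "z \<notin> B" for z using that \<delta> by (intro \<xi>_eq_0) auto
    consider "x \<in> B" "y \<in> B" | "x \<in> B" "y \<notin> B" | "x \<notin> B" "y \<in> B" | "x \<notin> B" "y \<notin> B" by blast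
    then show ?thesis
    proof cases
      case 1
      have "f x y = (v x - v y)\<^sup>2 * k t x y - (u t x * u t y) * (\<xi> x - \<xi> y)\<^sup>2 * k t x y"
        by (simp add: f_def v_def tst_def power2_eq_square algebra_simps)
      moreover have "(u t x * u t y) * (\<xi> x - \<xi> y)\<^sup>2 * k t x y \<le> \<bar>u t x * u t y\<bar> * (\<xi> x - \<xi> y)\<^sup>2 * k t x y"
        by (intro mult_right_mono k_nonneg) auto
      ultimately show ?thesis using 1 by (simp add: loss_def mult_ac)
    next
      case 2
      have "f x y = (u t x)\<^sup>2 * (\<xi> x)\<^sup>2 * k t x y - (u t x * u t y) * (\<xi> x)\<^sup>2 * k t x y"
        using z[OF 2(2)] by (simp add: f_def tst_def power2_eq_square algebra_simps)
      moreover have "(u t x * u t y) * (\<xi> x)\<^sup>2 * k t x y \<le> \<bar>u t x * u t y\<bar> * (\<xi> x)\<^sup>2 * k t x y"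
        by (intro mult_right_mono k_nonneg) auto
      moreover have "0 \<le> (u t x)\<^sup>2 * (\<xi> x)\<^sup>2 * k t x y" by (intro mult_nonneg_nonneg k_nonneg) auto
      ultimately show ?thesis using 2 by (simp add: loss_def mult_ac)
    next
      case 3
      have "f x y = (u t y)\<^sup>2 * (\<xi> y)\<^sup>2 * k t x y - (u t x * u t y) * (\<xi> y)\<^sup>2 * k t x y"
        using z[OF 3(1)] by (simp add: f_def tst_def power2_eq_square algebra_simps)
      moreover have "(u t x * u t y) * (\<xi> y)\<^sup>2 * k t x y \<le> \<bar>u t x * u t y\<bar> * (\<xi> y)\<^sup>2 * k t x y"
        by (intro mult_right_mono k_nonneg) auto
      moreover have "0 \<le> (u t y)\<^sup>2 * (\<xi> y)\<^sup>2 * k t x y" by (intro mult_nonneg_nonneg k_nonneg) auto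
      ultimately show ?thesis using 3 by (simp add: loss_def mult_ac)
    next
      case 4 then show ?thesis using z[OF 4(1)] z[OF 4(2)] by (simp add: f_def tst_def loss_nonneg)
    qed
  qed
  have nn: "0 \<le> f x y + loss t x y" for x y
    by (rule order_trans[OF _ pt]) (auto intro!: mult_nonneg_nonneg k_nonneg)
  have sum: "(\<integral>p. (case p of (x, y) \<Rightarrow> f x y) + (case p of (x, y) \<Rightarrow> loss t x y) \<partial>(lborel \<Otimes>\<^sub>M lborel))
     \<le> form (k t) (u t) (tst t) + enn2real (err t)"
  proof -
    have "(\<integral>p. (case p of (x, y) \<Rightarrow> loss t x y) \<partial>(lborel \<Otimes>\<^sub>M lborel)) = enn2real (\<integral>\<^sup>+p. ennreal (case p of (x, y) \<Rightarrow> loss t x y) \<partial>(lborel \<Otimes>\<^sub>M lborel))"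
      by (rule integral_eq_nn_integral) (auto simp: loss_nonneg)
    also have "\<dots> \<le> enn2real (err t)" using L fin(2) by (intro enn2real_mono) auto
    finally show ?thesis
      by (subst Bochner_Integration.integral_add[OF fi gi]) (simp add: form_def f_def[abs_def])
  qed
  have "0 \<le> (\<integral>p. (case p of (x, y) \<Rightarrow> f x y) + (case p of (x, y) \<Rightarrow> loss t x y) \<partial>(lborel \<Otimes>\<^sub>M lborel))"
    by (rule Bochner_Integration.integral_nonneg) (auto simp: nn)
  then show "0 \<le> form (k t) (u t) (tst t) + enn2real (err t)" using sum by linarith
  have "l2sq B v \<le> l2sq B (u t)"
    unfolding v_def using \<xi>_bounds by (intro l2sq_mult_le) (simp add: abs_le_iff)
  then have l2v: "l2sq B v < \<infinity>" using fin(3) by (rule le_less_trans)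
  have "hsq s B v \<le> 2 * hsq s B (u t) + 2 * (ennreal ((1 / \<delta>)\<^sup>2) * J * l2sq B (u t))"
    unfolding v_def by (rule hsq_mult[OF _ _ _ _ \<xi>_lipschitz]) (use \<delta> \<xi>_bounds in \<open>auto simp: abs_le_iff\<close>)
  also have "\<dots> < \<infinity>" using fin J_finite by (simp add: ennreal_mult_less_top)
  finally have hv: "hsq s B v < \<infinity>" .
  have "ennreal l * hsq s B v \<le> (\<integral>\<^sup>+x\<in>B. (\<integral>\<^sup>+y\<in>B. ennreal ((v x - v y)\<^sup>2 * k t x y) \<partial>lborel) \<partial>lborel)"
    using co[rule_format, of "r + 2 * \<delta>" v x0] l2v hv r \<delta> by (simp add: B_def[symmetric])
  also have "\<dots> = (\<integral>\<^sup>+x. \<integral>\<^sup>+y. ennreal ((v x - v y)\<^sup>2 * k t x y) * indicator B y * indicator B x \<partial>lborel \<partial>lborel)"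
    by (rule nn_integral2_indicator) measurable
  also have "\<dots> \<le> (\<integral>\<^sup>+x. \<integral>\<^sup>+y. ennreal (f x y + loss t x y) \<partial>lborel \<partial>lborel)"
  proof (intro nn_integral_mono)
    fix x y
    show "ennreal ((v x - v y)\<^sup>2 * k t x y) * indicator B y * indicator B x \<le> ennreal (f x y + loss t x y)"
      using ennreal_leI[OF pt[of x y]] by (auto simp: indicator_def)
  qed
  also have "\<dots> = (\<integral>\<^sup>+p. ennreal ((case p of (x, y) \<Rightarrow> f x y) + (case p of (x, y) \<Rightarrow> loss t x y)) \<partial>(lborel \<Otimes>\<^sub>M lborel))"
    using borel_measurable_integrable[OF Bochner_Integration.integrable_add[OF fi gi]]
    by (subst lborel.nn_integral_fst[symmetric]) auto
  also have "\<dots> = ennreal (\<integral>p. (case p of (x, y) \<Rightarrow> f x y) + (case p of (x, y) \<Rightarrow> loss t x y) \<partial>(lborel \<Otimes>\<^sub>M lborel))"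
    by (rule nn_integral_eq_integral[OF Bochner_Integration.integrable_add[OF fi gi]]) (auto simp: nn)
  also have "\<dots> \<le> ennreal (form (k t) (u t) (tst t) + enn2real (err t))" by (rule ennreal_leI[OF sum])
  finally show "ennreal l * hsq s B (\<lambda>x. \<xi> x * u t x) \<le> ennreal (form (k t) (u t) (tst t) + enn2real (err t))"
    by (simp add: v_def[abs_def])
qed

text \<open>The tail is integrable in time and the local L1 norm is essentially bounded, so their
  product is integrable.\<close>

lemma err_time: "(\<integral>\<^sup>+t. err t \<partial>lborel) < \<infinity>"
proof -
  obtain M where M: "0 \<le> M" "AE t in lborel. l2sq (ball 0 (norm x0 + 2)) (u t) \<le> ennreal M"
    by (rule u_L2_B)
  have ball_L1: "AE t in lborel. ball_L1 t \<le> emeasure lborel B + ennreal M"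
    using M(2)
  proof eventually_elim
    case (elim t)
    have "ball_L1 t \<le> ennreal 1 * emeasure lborel B + ennreal (1 / 1) * l2sq B (\<lambda>x. indicator B x * u t x)"
      unfolding ball_L1_eq_absint by (rule absint_le) (auto simp: indicator_def)
    also have "l2sq B (\<lambda>x. indicator B x * u t x) \<le> l2sq B (u t)"
      by (rule l2sq_mult_le) (auto simp: indicator_def)
    also have "l2sq B (u t) \<le> ennreal M" by (rule order_trans[OF l2sq_mono[OF B_subset] elim])
    finally show ?case by simp
  qed
  have "(\<integral>\<^sup>+t. err t \<partial>lborel) = (\<integral>\<^sup>+t. 2 * (ennreal (\<Lambda> * (1 / \<delta>)\<^sup>2) * J * l2sq B (u t)) \<partial>lborel) + (\<integral>\<^sup>+t. 2 * (ennreal (\<Lambda> * C\<^sub>\<delta>) * (tl t * ball_L1 t)) \<partial>lborel)"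
    unfolding err_def by (rule nn_integral_add) measurable
  also have "\<dots> = 2 * (ennreal (\<Lambda> * (1 / \<delta>)\<^sup>2) * J * (\<integral>\<^sup>+t. l2sq B (u t) \<partial>lborel)) + 2 * (ennreal (\<Lambda> * C\<^sub>\<delta>) * (\<integral>\<^sup>+t. tl t * ball_L1 t \<partial>lborel))"
    by (simp add: nn_integral_cmult)
  also have "\<dots> \<le> 2 * (ennreal (\<Lambda> * (1 / \<delta>)\<^sup>2) * J * (\<integral>\<^sup>+t. l2sq B (u t) \<partial>lborel)) + 2 * (ennreal (\<Lambda> * C\<^sub>\<delta>) * (\<integral>\<^sup>+t. tl t * (emeasure lborel B + ennreal M) \<partial>lborel))"
    using ball_L1 by (intro add_left_mono mult_left_mono nn_integral_mono_AE) (auto elim!: eventually_mono intro: mult_left_mono)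
  also have "(\<integral>\<^sup>+t. tl t * (emeasure lborel B + ennreal M) \<partial>lborel) = (\<integral>\<^sup>+t. tl t \<partial>lborel) * (emeasure lborel B + ennreal M)"
    by (rule nn_integral_multc) measurable
  also have "2 * (ennreal (\<Lambda> * (1 / \<delta>)\<^sup>2) * J * (\<integral>\<^sup>+t. l2sq B (u t) \<partial>lborel)) + 2 * (ennreal (\<Lambda> * C\<^sub>\<delta>) * \<dots>) < \<infinity>"
    using l2sq_time tl_time J_finite emeasure_B by (simp add: ennreal_mult_less_top)
  finally show ?thesis .
qed

lemma u_zero_quantities:
  assumes "t \<le> 0 \<or> T \<le> t"
  shows "hsq s B (\<lambda>x. \<xi> x * u t x) = 0" "err t = 0"
  using u_zero[OF assms] by (auto simp: hsq_def err_def l2sq_def tl_def)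

lemma form_lower_AE:
  "AE t in lborel. ennreal l * hsq s B (\<lambda>x. \<xi> x * u t x) \<le> ennreal (form (k t) (u t) (tst t) + enn2real (err t))
     \<and> 0 \<le> form (k t) (u t) (tst t) + enn2real (err t)"
proof -
  have "AE t in lborel. absform t (tst t) \<noteq> \<infinity>"
    by (rule nn_integral_noteq_infinite) (use abs_tst_time in \<open>auto simp: less_top\<close>)
  moreover have "AE t in lborel. err t \<noteq> \<infinity>"
    by (rule nn_integral_noteq_infinite) (use err_time in \<open>auto simp: less_top\<close>)
  moreover have "AE t in lborel. l2sq B (u t) \<noteq> \<infinity>"
    by (rule nn_integral_noteq_infinite) (use l2sq_time in \<open>auto simp: less_top\<close>)
  moreover have "AE t in lborel. hsq s B (u t) \<noteq> \<infinity>"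
    by (rule nn_integral_noteq_infinite) (use hsq_time in \<open>auto simp: less_top\<close>)
  ultimately show ?thesis
    using coercive
  proof eventually_elim
    case (elim t)
    show ?case
    proof (cases "t \<le> 0 \<or> T \<le> t")
      case True
      then show ?thesis by (simp add: u_zero_quantities abs_time_zero)
    next
      case False
      then have co: "\<forall>x0 r v. 0 < r \<longrightarrow> v \<in> borel_measurable borel \<longrightarrow> l2sq (ball x0 r) v < \<infinity> \<longrightarrow> hsq s (ball x0 r) v < \<infinity> \<longrightarrow>
        ennreal l * hsq s (ball x0 r) v \<le>
        (\<integral>\<^sup>+x\<in>ball x0 r. (\<integral>\<^sup>+y\<in>ball x0 r. ennreal ((v x - v y)\<^sup>2 * k t x y) \<partial>lborel) \<partial>lborel)"
        using elim(5) by auto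
      show ?thesis using form_lower[OF co] elim(1-4) by (simp add: less_top)
    qed
  qed
qed

text \<open>Integration over the half-line amounts to integration from 0, since \<open>u\<close>
  vanishes at negative times.\<close>

definition err_upto :: "real \<Rightarrow> ennreal" where "err_upto b = (\<integral>\<^sup>+t\<in>{..b}. err t \<partial>lborel)"

definition cut_energy :: "real \<Rightarrow> real" where "cut_energy t = fpair t (tst t)"

lemma err_upto_finite: "err_upto b < \<infinity>"
proof -
  have "err_upto b \<le> (\<integral>\<^sup>+t. err t \<partial>lborel)"
    unfolding err_upto_def by (intro nn_integral_mono) (auto simp: indicator_def)
  then show ?thesis using err_time by (rule le_less_trans)
qed

lemma cut_energy_measurable [measurable]: "cut_energy \<in> borel_measurable borel"
  unfolding cut_energy_def[abs_def] by measurable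

lemma cut_energy_integrable: "integrable lborel cut_energy"
proof (rule integrableI_bounded)
  show "(\<integral>\<^sup>+t. ennreal (norm (cut_energy t)) \<partial>lborel) < \<infinity>"
    by (rule le_less_trans[OF nn_integral_mono abs_tst_time(1)]) (simp add: cut_energy_def fpair_le_absprod)
qed measurable

lemma form_tst_integrable: "integrable lborel (\<lambda>t. form (k t) (u t) (tst t))"
proof (rule integrableI_bounded)
  show "(\<integral>\<^sup>+t. ennreal (norm (form (k t) (u t) (tst t))) \<partial>lborel) < \<infinity>"
    by (rule le_less_trans[OF nn_integral_mono abs_tst_time(2)]) (simp add: form_le_absform)
qed measurable

lemma err_integrable: "integrable lborel (\<lambda>t. enn2real (err t))"
proof (rule integrableI_bounded)
  show "(\<integral>\<^sup>+t. ennreal (norm (enn2real (err t))) \<partial>lborel) < \<infinity>"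
    by (rule le_less_trans[OF nn_integral_mono err_time]) (simp add: ennreal_enn2real_if)
qed measurable

lemma err_upto_real: "(\<integral>t. enn2real (err t) * indicator {..b} t \<partial>lborel) = enn2real (err_upto b)"
proof -
  have ae: "AE t in lborel. err t \<noteq> \<infinity>"
    by (rule nn_integral_noteq_infinite) (use err_time in \<open>auto simp: less_top\<close>)
  have "(\<integral>t. enn2real (err t) * indicator {..b} t \<partial>lborel) = enn2real (\<integral>\<^sup>+t. ennreal (enn2real (err t) * indicator {..b} t) \<partial>lborel)"
    by (rule integral_eq_nn_integral) auto
  also have "(\<integral>\<^sup>+t. ennreal (enn2real (err t) * indicator {..b} t) \<partial>lborel) = err_upto b"
    unfolding err_upto_def
  proof (rule nn_integral_cong_AE)
    show "AE t in lborel. ennreal (enn2real (err t) * indicator {..b} t) = err t * indicator {..b} t"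
      using ae by eventually_elim (auto simp: indicator_def less_top)
  qed
  finally show ?thesis .
qed

text \<open>Adding \<open>err\<close> makes the integrand on the left nonnegative almost everywhere,
  so that it may later be dropped or bounded below by the fractional energy. As \<eta> vanishes from
  \<open>b\<close> on, only errors up to \<open>b\<close> are paid for.\<close>

lemma weighted_energy:
  assumes \<eta>: "\<And>t. (\<eta> has_real_derivative \<eta>' t) (at t)" "continuous_on UNIV \<eta>'"
    and \<eta>0: "\<And>t. 0 \<le> \<eta> t" and bd: "\<And>t. \<eta> t \<le> c" "\<And>t. \<bar>\<eta>' t\<bar> \<le> C"
    and b: "b < T" "\<And>t. b \<le> t \<Longrightarrow> \<eta> t = 0"
  shows "integrable lborel (\<lambda>t. \<eta> t * (form (k t) (u t) (tst t) + enn2real (err t)))"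
    and "integrable lborel (\<lambda>t. \<eta>' t * cut_energy t)"
    and "(\<integral>t. \<eta> t * (form (k t) (u t) (tst t) + enn2real (err t)) \<partial>lborel) \<le> c * enn2real (err_upto b) + 1/2 * (\<integral>t. \<eta>' t * cut_energy t \<partial>lborel)"
proof -
  have c: "0 \<le> c" using \<eta>0[of 0] bd(1)[of 0] by linarith
  have C: "0 \<le> C" using bd(2)[of 0] by linarith
  have bdi: "integrable lborel (\<lambda>t. g t * f t)"
    if [measurable]: "g \<in> borel_measurable borel" and g: "\<And>t. \<bar>g t\<bar> \<le> d" and f: "integrable lborel f" for f g :: "real \<Rightarrow> real" and d
  proof (rule Bochner_Integration.integrable_bound[OF integrable_mult_right[of d, OF f]])
    have [measurable]: "f \<in> borel_measurable borel" using f by simp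
    show "(\<lambda>t. g t * f t) \<in> borel_measurable lborel" by measurable
    show "AE t in lborel. norm (g t * f t) \<le> norm (d * f t)"
    proof (rule AE_I2)
      fix t show "norm (g t * f t) \<le> norm (d * f t)"
        using g[of t] by (auto simp: abs_mult intro!: mult_right_mono)
    qed
  qed
  have "continuous_on UNIV \<eta>" using \<eta>(1) by (intro DERIV_continuous_on) (auto intro: has_field_derivative_at_within)
  then have m [measurable]: "\<eta> \<in> borel_measurable borel" by (rule borel_measurable_continuous_onI)
  have m' [measurable]: "\<eta>' \<in> borel_measurable borel" using \<eta>(2) by (rule borel_measurable_continuous_onI)
  have \<eta>b: "\<bar>\<eta> t\<bar> \<le> c" for t using \<eta>0[of t] bd(1)[of t] by simp
  have i1: "integrable lborel (\<lambda>t. \<eta> t * form (k t) (u t) (tst t))" by (rule bdi[OF m \<eta>b form_tst_integrable])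
  have i2: "integrable lborel (\<lambda>t. \<eta> t * enn2real (err t))" by (rule bdi[OF m \<eta>b err_integrable])
  show "integrable lborel (\<lambda>t. \<eta>' t * cut_energy t)" by (rule bdi[OF m' bd(2) cut_energy_integrable])
  show "integrable lborel (\<lambda>t. \<eta> t * (form (k t) (u t) (tst t) + enn2real (err t)))"
    using Bochner_Integration.integrable_add[OF i1 i2] by (simp add: distrib_left)
  have "(\<integral>t. \<eta> t * (form (k t) (u t) (tst t) + enn2real (err t)) \<partial>lborel) =
    (\<integral>t. \<eta> t * form (k t) (u t) (tst t) \<partial>lborel) + (\<integral>t. \<eta> t * enn2real (err t) \<partial>lborel)"
    using Bochner_Integration.integral_add[OF i1 i2] by (simp add: distrib_left)
  also have "(\<integral>t. \<eta> t * form (k t) (u t) (tst t) \<partial>lborel) = (\<integral>t. 1/2 * \<eta>' t * fpair t (tst t) \<partial>lborel)"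
    by (rule energy_identity[where C = "max c C", OF \<eta> \<eta>0 _ _ b]) (use \<eta>b bd(2) in \<open>auto simp: le_max_iff_disj\<close>)
  also have "\<dots> = 1/2 * (\<integral>t. \<eta>' t * cut_energy t \<partial>lborel)"
    unfolding mult.assoc cut_energy_def by (rule integral_mult_right_zero)
  also have "(\<integral>t. \<eta> t * enn2real (err t) \<partial>lborel) \<le> (\<integral>t. c * (enn2real (err t) * indicator {..b} t) \<partial>lborel)"
  proof (rule integral_mono[OF i2])
    show "integrable lborel (\<lambda>t. c * (enn2real (err t) * indicator {..b} t))"
      by (intro integrable_mult_right integrable_real_mult_indicator err_integrable) auto
    fix t show "\<eta> t * enn2real (err t) \<le> c * (enn2real (err t) * indicator {..b} t)"
      using bd(1)[of t] b(2)[of t] by (cases "t \<le> b") (auto intro: mult_right_mono)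
  qed
  also have "\<dots> = c * enn2real (err_upto b)" by (simp add: err_upto_real)
  finally show "(\<integral>t. \<eta> t * (form (k t) (u t) (tst t) + enn2real (err t)) \<partial>lborel) \<le> c * enn2real (err_upto b) + 1/2 * (\<integral>t. \<eta>' t * cut_energy t \<partial>lborel)"
    by simp
qed

lemma cut_energy_nonneg: "0 \<le> cut_energy t"
  unfolding cut_energy_def fpair_def tst_def
  by (rule Bochner_Integration.integral_nonneg) (simp add: mult.left_commute[of "u t _" "(\<xi> _)\<^sup>2"] power2_eq_square[symmetric])

text \<open>The time weights decrease from 1 to 0 shortly before \<open>b\<close>, so the derivative
  term has a favourable sign and is dropped; monotone convergence then lets the weights fill the
  half-line below \<open>b\<close>.\<close>

lemma energy_hsq:
  assumes b: "b < T"
  shows "ennreal l * (\<integral>\<^sup>+t\<in>{..<b}. hsq s B (\<lambda>x. \<xi> x * u t x) \<partial>lborel) \<le> err_upto b"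
proof -
  define q where "q t = hsq s B (\<lambda>x. \<xi> x * u t x)" for t
  have [measurable]: "q \<in> borel_measurable borel" unfolding q_def[abs_def] by measurable
  have step: "ennreal l * (\<integral>\<^sup>+t. q t * indicator {..b - 1 / real (Suc n)} t \<partial>lborel) \<le> err_upto b" for n
  proof -
    define \<eta> where "\<eta> t = step_fun (real (Suc n) * (b - t))" for t
    define \<eta>' where "\<eta>' t = - (real (Suc n) * step_fun' (real (Suc n) * (b - t)))" for t
    have d: "(\<eta> has_real_derivative \<eta>' t) (at t)" for t
    proof -
      have "((\<lambda>t. real (Suc n) * (b - t)) has_real_derivative - real (Suc n)) (at t)"
        by (auto intro!: derivative_eq_intros)
      from DERIV_chain2[OF step_fun_deriv this] show ?thesis
        unfolding \<eta>_def[abs_def] \<eta>'_def by (rule DERIV_cong) (simp only: mult_minus_right mult.commute)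
    qed
    have c: "continuous_on UNIV \<eta>'"
      unfolding \<eta>'_def by (intro continuous_intros continuous_on_compose2[OF step_fun_cont]) auto
    have 0: "0 \<le> \<eta> t" "\<eta> t \<le> 1" for t by (simp_all add: \<eta>_def step_fun_bounds)
    have b': "\<bar>\<eta>' t\<bar> \<le> real (Suc n) * 4" for t
    proof -
      have "\<bar>\<eta>' t\<bar> = real (Suc n) * step_fun' (real (Suc n) * (b - t))"
        using step_fun'_bounds(1) by (simp only: \<eta>'_def abs_minus_cancel abs_mult abs_of_nonneg of_nat_0_le_iff)
      also have "\<dots> \<le> real (Suc n) * 4" by (intro mult_left_mono step_fun'_bounds) auto
      finally show ?thesis .
    qed
    have z: "\<eta> t = 0" if "b \<le> t" for t
      unfolding \<eta>_def by (rule step_fun_0) (use that in \<open>simp add: mult_nonneg_nonpos\<close>)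
    have o: "\<eta> t = 1" if "t \<le> b - 1 / real (Suc n)" for t
      unfolding \<eta>_def
    proof (rule step_fun_1)
      have "1 = real (Suc n) * (1 / real (Suc n))" by simp
      also have "\<dots> \<le> real (Suc n) * (b - t)" by (rule mult_left_mono) (use that in auto)
      finally show "1 \<le> real (Suc n) * (b - t)" .
    qed
    note we = weighted_energy[OF d c 0 b' b z]
    have "continuous_on UNIV \<eta>" using d by (intro DERIV_continuous_on) (auto intro: has_field_derivative_at_within)
    then have [measurable]: "\<eta> \<in> borel_measurable borel" by (rule borel_measurable_continuous_onI)
    have "0 \<le> (\<integral>t. - (\<eta>' t * cut_energy t) \<partial>lborel)"
      by (rule Bochner_Integration.integral_nonneg)
        (auto simp: \<eta>'_def step_fun'_bounds cut_energy_nonneg intro!: mult_nonneg_nonneg)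
    then have "(\<integral>t. \<eta>' t * cut_energy t \<partial>lborel) \<le> 0" by simp
    then have le: "(\<integral>t. \<eta> t * (form (k t) (u t) (tst t) + enn2real (err t)) \<partial>lborel) \<le> enn2real (err_upto b)"
      using we(3) by simp
    have "ennreal l * (\<integral>\<^sup>+t. q t * indicator {..b - 1 / real (Suc n)} t \<partial>lborel) = (\<integral>\<^sup>+t. ennreal l * (q t * indicator {..b - 1 / real (Suc n)} t) \<partial>lborel)"
      by (rule nn_integral_cmult[symmetric]) measurable
    also have "\<dots> \<le> (\<integral>\<^sup>+t. ennreal (\<eta> t * (form (k t) (u t) (tst t) + enn2real (err t))) \<partial>lborel)"
    proof (rule nn_integral_mono_AE)
      show "AE t in lborel. ennreal l * (q t * indicator {..b - 1 / real (Suc n)} t) \<le> ennreal (\<eta> t * (form (k t) (u t) (tst t) + enn2real (err t)))"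
        using form_lower_AE
      proof eventually_elim
        case (elim t)
        then show ?case using o[of t] by (auto simp: q_def indicator_def)
      qed
    qed
    also have "\<dots> = ennreal (\<integral>t. \<eta> t * (form (k t) (u t) (tst t) + enn2real (err t)) \<partial>lborel)"
    proof (rule nn_integral_eq_integral[OF we(1)])
      show "AE t in lborel. 0 \<le> \<eta> t * (form (k t) (u t) (tst t) + enn2real (err t))"
        using form_lower_AE by eventually_elim (auto intro: mult_nonneg_nonneg 0)
    qed
    also have "\<dots> \<le> ennreal (enn2real (err_upto b))" by (rule ennreal_leI[OF le])
    finally show ?thesis using err_upto_finite[of b] by simp
  qed
  have sup: "(SUP n. q t * indicator {..b - 1 / real (Suc n)} t) = q t * indicator {..<b} t" for t
  proof (cases "t < b")
    case True
    obtain m where m: "1 / (b - t) \<le> real m" using real_arch_simple by blast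
    then have "1 / (b - t) \<le> real (Suc m)" by simp
    then have "t \<le> b - 1 / real (Suc m)" using True by (simp add: field_simps)
    then have "q t = q t * indicator {..b - 1 / real (Suc m)} t" by simp
    also have "\<dots> \<le> (SUP n. q t * indicator {..b - 1 / real (Suc n)} t)" by (rule SUP_upper) simp
    finally have "q t \<le> (SUP n. q t * indicator {..b - 1 / real (Suc n)} t)" .
    moreover have "(SUP n. q t * indicator {..b - 1 / real (Suc n)} t) \<le> q t"
      by (rule SUP_least) (auto simp: indicator_def)
    ultimately show ?thesis using True by simp
  next
    case False
    have "\<not> t \<le> b - 1 / real (Suc n)" for n
    proof -
      have "0 < 1 / real (Suc n)" by simp
      then show ?thesis using False by linarith
    qed
    then show ?thesis using False by simp
  qed
  have "(\<integral>\<^sup>+t\<in>{..<b}. q t \<partial>lborel) = (\<integral>\<^sup>+t. (SUP n. q t * indicator {..b - 1 / real (Suc n)} t) \<partial>lborel)"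
    unfolding sup ..
  also have "\<dots> = (SUP n. \<integral>\<^sup>+t. q t * indicator {..b - 1 / real (Suc n)} t \<partial>lborel)"
  proof (rule nn_integral_monotone_convergence_SUP)
    show "incseq (\<lambda>n t. q t * indicator {..b - 1 / real (Suc n)} t)"
    proof (intro incseq_SucI le_funI mult_left_mono)
      fix n t
      have "1 / real (Suc (Suc n)) \<le> 1 / real (Suc n)" by (intro divide_left_mono) auto
      then show "indicator {..b - 1 / real (Suc n)} t \<le> (indicator {..b - 1 / real (Suc (Suc n))} t :: ennreal)"
        by (auto simp: indicator_def)
    qed auto
  qed measurable
  finally have "ennreal l * (\<integral>\<^sup>+t\<in>{..<b}. q t \<partial>lborel) = (SUP n. ennreal l * (\<integral>\<^sup>+t. q t * indicator {..b - 1 / real (Suc n)} t \<partial>lborel))"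
    by (simp add: SUP_mult_left_ennreal)
  also have "\<dots> \<le> err_upto b" by (rule SUP_least) (rule step)
  finally show ?thesis by (simp add: q_def)
qed

text \<open>The time weight is the integral of \<open>q\<close> from t to b, whose derivative is -q.
  This is the supremum estimate in averaged form, for arbitrary continuous averages.\<close>

lemma weighted_cut_energy:
  assumes q: "continuous_on UNIV q" "\<And>t. 0 \<le> q t" "\<And>t. q t \<le> C" "\<And>t. t \<notin> {0<..<b} \<Longrightarrow> q t = 0"
    and b: "0 < b" "b < T"
  shows "(\<integral>t. q t * (cut_energy t - 2 * enn2real (err_upto b)) \<partial>lborel) \<le> 0"
proof -
  have m [measurable]: "q \<in> borel_measurable borel" using q(1) by (rule borel_measurable_continuous_onI)
  obtain H where H: "\<And>t. (H has_real_derivative q t) (at t)" using antiderivative_real[OF q(1)] by blast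
  have mono: "H x \<le> H y" if "x \<le> y" for x y
    using that by (rule DERIV_nonneg_imp_nondecreasing) (use H q(2) in blast)
  have const: "H x = H y" if "x \<le> y" "\<And>z. x < z \<Longrightarrow> z < y \<Longrightarrow> q z = 0" for x y
  proof (cases "x = y")
    case False
    have "H y = H x"
    proof (rule DERIV_isconst_end[of x y H])
      show "x < y" using that False by simp
      show "continuous_on {x..y} H" using H by (intro DERIV_continuous_on) (auto intro: has_field_derivative_at_within)
      fix z assume "x < z" "z < y"
      then have "q z = 0" by (rule that(2))
      then show "DERIV H z :> 0" using H[of z] by simp
    qed
    then show ?thesis by simp
  qed simp
  \<comment> \<open>Nonnegative, at most the total integral of \<open>q\<close>, and zero after
    \<open>b\<close>, because \<open>q\<close> is supported in (0, b).\<close>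
  define \<eta> where "\<eta> t = H b - H t" for t
  have e0: "0 \<le> \<eta> t" for t
  proof (cases "t \<le> b")
    case True then show ?thesis using mono by (simp add: \<eta>_def)
  next
    case False
    then have "H b = H t" by (intro const) (auto intro: q(4))
    then show ?thesis by (simp add: \<eta>_def)
  qed
  have ez: "\<eta> t = 0" if "b \<le> t" for t
    using const[OF that] q(4) by (simp add: \<eta>_def)
  have ec: "\<eta> t \<le> H b - H 0" for t
  proof (cases "0 \<le> t")
    case True then show ?thesis using mono[of 0 t] by (simp add: \<eta>_def)
  next
    case False
    then have "H t = H 0" by (intro const) (auto intro: q(4))
    then show ?thesis by (simp add: \<eta>_def)
  qed
  have ed: "(\<eta> has_real_derivative - q t) (at t)" for t
    unfolding \<eta>_def[abs_def] by (auto intro!: derivative_eq_intros H)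
  have C: "\<bar>- q t\<bar> \<le> C" for t using q by simp
  have cq: "continuous_on UNIV (\<lambda>t. - q t)" by (intro continuous_intros q(1))
  note we = weighted_energy[OF ed cq e0 ec C b(2) ez]
  have "0 \<le> (\<integral>t. \<eta> t * (form (k t) (u t) (tst t) + enn2real (err t)) \<partial>lborel)"
  proof (rule integral_nonneg_AE)
    show "AE t in lborel. 0 \<le> \<eta> t * (form (k t) (u t) (tst t) + enn2real (err t))"
      using form_lower_AE by eventually_elim (auto intro: mult_nonneg_nonneg e0)
  qed
  with we(3) have 1: "(\<integral>t. q t * cut_energy t \<partial>lborel) \<le> 2 * (H b - H 0) * enn2real (err_upto b)" by (simp add: algebra_simps)
  have "isCont q t" for t using q(1) by (simp add: continuous_on_eq_continuous_at)
  then have "(\<integral>t. q t * indicator {0..b} t \<partial>lborel) = H b - H 0"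
    using b by (intro integral_FTC_Icc_real H) auto
  moreover have qi: "q t * indicator {0..b} t = q t" for t using q(4)[of t] by (cases "t \<in> {0<..<b}") auto
  ultimately have Q: "(\<integral>t. q t \<partial>lborel) = H b - H 0" by simp
  have iq: "integrable lborel q"
    using has_bochner_integral_FTC_Icc_real[of 0 b H q] b H q(1) unfolding qi
    by (auto simp: continuous_on_eq_continuous_at has_bochner_integral_iff)
  have "integrable lborel (\<lambda>t. q t * cut_energy t)" using we(2) by simp
  then have "(\<integral>t. q t * cut_energy t - 2 * enn2real (err_upto b) * q t \<partial>lborel) = (\<integral>t. q t * cut_energy t \<partial>lborel) - 2 * enn2real (err_upto b) * (H b - H 0)"
    using iq Q by (subst Bochner_Integration.integral_diff) auto
  then show ?thesis using 1 by (simp add: algebra_simps)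
qed

text \<open>If the bound failed on a set of positive measure, averaging over that set would violate
  the averaged estimate; continuous weights tending to its indicator make this average admissible in
  the limit.\<close>

lemma energy_sup_cut:
  assumes b: "0 < b" "b < T"
  shows "AE t in lborel. 0 < t \<and> t < b \<longrightarrow> cut_energy t \<le> 2 * enn2real (err_upto b)"
proof -
  define c where "c = 2 * enn2real (err_upto b)"
  define E where "E = {t \<in> {0<..<b}. c < cut_energy t}"
  have [measurable]: "E \<in> sets borel" unfolding E_def by measurable
  define f where "f t = (indicator E t :: real)" for t
  have "f \<in> borel_measurable borel" unfolding f_def by measurable
  then have "f \<in> borel_measurable lebesgue" by (intro measurable_completion) simp
  then have "f measurable_on UNIV" using measurable_on_iff_borel_measurable[of UNIV f] by simp
  then obtain N g where N: "negligible N" and cg: "\<And>n. continuous_on UNIV (g n)"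
    and lim: "\<And>x. x \<notin> N \<Longrightarrow> (\<lambda>n. g n x) \<longlonglongrightarrow> f x"
    unfolding measurable_on_def by auto
  have "AE x in lebesgue. x \<notin> N" using N by (simp add: negligible_iff_null_sets AE_not_in)
  then have AEN: "AE x in lborel. x \<notin> N" by (simp add: AE_completion_iff)
  \<comment> \<open>Clamped to [0, 1] and forced to vanish outside (0, b) by a factor that tends to
    1 inside.\<close>
  define q where "q n t = max 0 (min 1 (g n t)) * min 1 (real n * max 0 (min t (b - t)))" for n t
  have cq: "continuous_on UNIV (q n)" for n
    unfolding q_def by (intro continuous_intros cg)
  then have [measurable]: "q n \<in> borel_measurable borel" for n by (rule borel_measurable_continuous_onI)
  have q0: "0 \<le> q n t" for n t unfolding q_def by (intro mult_nonneg_nonneg) auto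
  have q1: "q n t \<le> 1" for n t
    unfolding q_def using mult_mono[of "max 0 (min 1 (g n t))" 1 "min 1 (real n * max 0 (min t (b - t)))" 1] by simp
  have qz: "q n t = 0" if "t \<notin> {0<..<b}" for n t
  proof -
    have "max 0 (min t (b - t)) = 0" using that by auto
    then show ?thesis unfolding q_def by simp
  qed
  have ql: "(\<lambda>n. q n t) \<longlonglongrightarrow> f t" if "t \<notin> N" for t
  proof (cases "t \<in> {0<..<b}")
    case False
    then have "f t = 0" by (auto simp: f_def E_def indicator_def)
    then show ?thesis using qz[OF False] by simp
  next
    case True
    define a where "a = min t (b - t)"
    have a: "0 < a" using True by (simp add: a_def)
    obtain m where m: "1 / a \<le> real m" using real_arch_simple by blast
    have "\<forall>\<^sub>F n in sequentially. min 1 (real n * max 0 (min t (b - t))) = 1"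
    proof (rule eventually_sequentiallyI[of m])
      fix n assume "m \<le> n"
      then have "1 / a \<le> real n" using m by simp
      then have "1 \<le> real n * a" using a by (simp add: pos_divide_le_eq)
      then show "min 1 (real n * max 0 (min t (b - t))) = 1" using a by (simp add: a_def[symmetric] max_def)
    qed
    then have "(\<lambda>n. min 1 (real n * max 0 (min t (b - t)))) \<longlonglongrightarrow> 1" by (rule tendsto_eventually)
    then have "(\<lambda>n. q n t) \<longlonglongrightarrow> max 0 (min 1 (f t)) * 1"
      unfolding q_def by (intro tendsto_intros lim that)
    moreover have "max 0 (min 1 (f t)) = f t" by (simp add: f_def indicator_def)
    ultimately show ?thesis by simp
  qed
  have iw: "integrable lborel (\<lambda>t. \<bar>cut_energy t\<bar> + \<bar>c\<bar> * indicator {0..b} t)"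
    by (intro Bochner_Integration.integrable_add Bochner_Integration.integrable_abs cut_energy_integrable integrable_mult_right integrable_real_indicator)
      (use b in \<open>auto simp: emeasure_lborel_Icc_eq\<close>)
  have bnd: "\<bar>w * (cut_energy t - c)\<bar> \<le> \<bar>cut_energy t\<bar> + \<bar>c\<bar> * indicator {0..b} t" if "0 \<le> w" "w \<le> 1" "t \<notin> {0<..<b} \<Longrightarrow> w = 0" for w t
  proof (cases "t \<in> {0<..<b}")
    case True
    have "\<bar>w * (cut_energy t - c)\<bar> \<le> 1 * (\<bar>cut_energy t\<bar> + \<bar>c\<bar>)" unfolding abs_mult using that by (intro mult_mono) auto
    then show ?thesis using True by simp
  qed (use that in simp)
  have lim: "(\<lambda>n. \<integral>t. q n t * (cut_energy t - c) \<partial>lborel) \<longlonglongrightarrow> (\<integral>t. f t * (cut_energy t - c) \<partial>lborel)"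
  proof (rule integral_dominated_convergence[OF _ _ iw])
    show "AE t in lborel. (\<lambda>n. q n t * (cut_energy t - c)) \<longlonglongrightarrow> f t * (cut_energy t - c)"
      using AEN by eventually_elim (intro tendsto_intros ql)
    show "AE t in lborel. norm (q n t * (cut_energy t - c)) \<le> \<bar>cut_energy t\<bar> + \<bar>c\<bar> * indicator {0..b} t" for n
      using bnd[OF q0 q1 qz] by (intro AE_I2) simp
  qed (auto simp: f_def)
  have neg: "(\<integral>t. f t * (cut_energy t - c) \<partial>lborel) \<le> 0"
    by (rule LIMSEQ_le_const2[OF lim]) (use weighted_cut_energy[OF cq q0 q1 qz b] in \<open>auto simp: c_def\<close>)
  have fi: "integrable lborel (\<lambda>t. f t * (cut_energy t - c))"
  proof (rule Bochner_Integration.integrable_bound[OF iw])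
    show "AE t in lborel. norm (f t * (cut_energy t - c)) \<le> norm (\<bar>cut_energy t\<bar> + \<bar>c\<bar> * indicator {0..b} t)"
    proof (rule AE_I2)
      fix t
      have "\<bar>f t * (cut_energy t - c)\<bar> \<le> \<bar>cut_energy t\<bar> + \<bar>c\<bar> * indicator {0..b} t"
        by (rule bnd) (auto simp: f_def E_def indicator_def)
      then show "norm (f t * (cut_energy t - c)) \<le> norm (\<bar>cut_energy t\<bar> + \<bar>c\<bar> * indicator {0..b} t)" by simp
    qed
  qed (simp add: f_def)
  have fn: "0 \<le> f t * (cut_energy t - c)" for t by (auto simp: f_def E_def indicator_def)
  have "0 \<le> (\<integral>t. f t * (cut_energy t - c) \<partial>lborel)" by (rule Bochner_Integration.integral_nonneg) (simp add: fn)
  then have "(\<integral>t. f t * (cut_energy t - c) \<partial>lborel) = 0" using neg by simp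
  then have "AE t in lborel. f t * (cut_energy t - c) = 0"
    using integral_nonneg_eq_0_iff_AE[OF fi] fn by simp
  then show ?thesis
    by eventually_elim (auto simp: f_def E_def c_def indicator_def not_less split: if_splits)
qed

lemma energy_sup:
  assumes b: "0 < b" "b < T"
  shows "AE t in lborel. 0 < t \<and> t < b \<longrightarrow> l2sq (ball x0 r) (u t) \<le> 2 * err_upto b"
proof -
  have "AE t in lborel. absprod t (tst t) \<noteq> \<infinity>"
    by (rule nn_integral_noteq_infinite) (use abs_tst_time in \<open>auto simp: less_top\<close>)
  then show ?thesis
    using energy_sup_cut[OF b]
  proof eventually_elim
    case (elim t)
    show ?case
    proof
      assume "0 < t \<and> t < b"
      then have g: "cut_energy t \<le> 2 * enn2real (err_upto b)" using elim(2) by simp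
      have i: "integrable lborel (\<lambda>x. u t x * tst t x)"
        by (rule prod_integrable) (use elim(1) in \<open>measurable, auto simp: less_top\<close>)
      have nn: "0 \<le> u t x * tst t x" for x
        by (simp add: tst_def mult.left_commute[of "u t _" "(\<xi> _)\<^sup>2"] power2_eq_square[symmetric])
      have "l2sq (ball x0 r) (u t) \<le> (\<integral>\<^sup>+x. ennreal (u t x * tst t x) \<partial>lborel)"
        unfolding l2sq_def
      proof (rule nn_integral_mono)
        fix x show "ennreal ((u t x)\<^sup>2) * indicator (ball x0 r) x \<le> ennreal (u t x * tst t x)"
          using \<xi>_eq_1[of x] by (cases "x \<in> ball x0 r") (auto simp: tst_def power2_eq_square)
      qed
      also have "\<dots> = ennreal (cut_energy t)"
        unfolding cut_energy_def fpair_def by (rule nn_integral_eq_integral[OF i]) (simp add: nn)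
      also have "\<dots> \<le> ennreal (2 * enn2real (err_upto b))" by (rule ennreal_leI[OF g])
      also have "\<dots> = 2 * err_upto b" using err_upto_finite[of b] by (simp add: ennreal_mult)
      finally show "l2sq (ball x0 r) (u t) \<le> 2 * err_upto b" .
    qed
  qed
qed

text \<open>For y within distance h of x, v(x)^2 \<le> (v(x) - v(y))^2 + 2 |v(x)| |v(y)|, and off
  the diagonal the kernel is there at least h^(-d - 2s). Integrating over the h-ball in y and over x
  gives the claim; h \<le> \<delta> keeps the h-ball inside \<open>B\<close> whenever v(x) is
  nonzero.\<close>

lemma nash:
  assumes [measurable]: "v \<in> borel_measurable borel" and v: "\<And>x. r + \<delta> \<le> dist x0 x \<Longrightarrow> v x = 0"
    and h: "0 < h" "h \<le> \<delta>"
  shows "ennreal (unit_ball_vol (real DIM('a)) * h ^ DIM('a)) * l2sq B v \<le>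
    ennreal (h powr (real DIM('a) + 2 * s)) * hsq s B v + 2 * (absint v * absint v)"
proof -
  let ?m = "ennreal (unit_ball_vol (real DIM('a)) * h ^ DIM('a))"
  let ?D = "real DIM('a) + 2 * s"
  let ?a = "\<lambda>x y. ennreal ((v x - v y)\<^sup>2 * riesz s (x - y)) * indicator B y * indicator B x"
  have vol: "emeasure lborel (ball x h) = ?m" for x :: 'a using h by (simp add: emeasure_ball)
  have "?m * l2sq B v = (\<integral>\<^sup>+x. ?m * (ennreal ((v x)\<^sup>2) * indicator B x) \<partial>lborel)"
    unfolding l2sq_def by (rule nn_integral_cmult[symmetric]) measurable
  also have "\<dots> \<le> (\<integral>\<^sup>+x. \<integral>\<^sup>+y. ennreal (h powr ?D) * ?a x y + 2 * (ennreal \<bar>v x\<bar> * ennreal \<bar>v y\<bar>) \<partial>lborel \<partial>lborel)"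
  proof (rule nn_integral_mono)
    fix x
    show "?m * (ennreal ((v x)\<^sup>2) * indicator B x) \<le> (\<integral>\<^sup>+y. ennreal (h powr ?D) * ?a x y + 2 * (ennreal \<bar>v x\<bar> * ennreal \<bar>v y\<bar>) \<partial>lborel)"
    proof (cases "v x = 0")
      case False
      then have x: "dist x0 x < r + \<delta>" using v[of x] by force
      then have xB: "x \<in> B" using \<delta> by simp
      have "?m * (ennreal ((v x)\<^sup>2) * indicator B x) = (\<integral>\<^sup>+y. ennreal ((v x)\<^sup>2) * indicator (ball x h) y \<partial>lborel)"
        using xB nn_integral_cmult_indicator[of "ball x h" lborel "ennreal ((v x)\<^sup>2)"] by (simp add: vol mult.commute[of ?m] del: mem_B)
      also have "\<dots> \<le> (\<integral>\<^sup>+y. ennreal (h powr ?D) * ?a x y + 2 * (ennreal \<bar>v x\<bar> * ennreal \<bar>v y\<bar>) \<partial>lborel)"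
      proof (rule nn_integral_mono)
        fix y
        show "ennreal ((v x)\<^sup>2) * indicator (ball x h) y \<le> ennreal (h powr ?D) * ?a x y + 2 * (ennreal \<bar>v x\<bar> * ennreal \<bar>v y\<bar>)"
        proof (cases "y \<in> ball x h")
          case True
          then have "dist x0 y < r + 2 * \<delta>" using x h dist_triangle[of x0 y x] by simp
          then have yB: "y \<in> B" by simp
          have "(v x)\<^sup>2 \<le> (v x - v y)\<^sup>2 + 2 * (\<bar>v x\<bar> * \<bar>v y\<bar>)"
          proof -
            have "v x * v y \<le> \<bar>v x\<bar> * \<bar>v y\<bar>" using abs_ge_self[of "v x * v y"] by (simp add: abs_mult)
            moreover have "(v x)\<^sup>2 = (v x - v y)\<^sup>2 + 2 * (v x * v y) - (v y)\<^sup>2" by (simp add: power2_eq_square algebra_simps)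
            ultimately show ?thesis using zero_le_power2[of "v y"] by linarith
          qed
          also have "(v x - v y)\<^sup>2 \<le> h powr ?D * ((v x - v y)\<^sup>2 * riesz s (x - y))"
          proof (cases "x = y")
            case False
            then have n: "0 < norm (x - y)" by simp
            have "1 = h powr ?D * h powr (- ?D)" using h by (simp add: powr_add[symmetric])
            also have "\<dots> \<le> h powr ?D * norm (x - y) powr (- ?D)"
              using True n h s by (intro mult_left_mono powr_mono2') (auto simp: dist_norm)
            finally have "1 \<le> h powr ?D * riesz s (x - y)" by (simp add: riesz_def)
            then have "(v x - v y)\<^sup>2 * 1 \<le> (v x - v y)\<^sup>2 * (h powr ?D * riesz s (x - y))" by (rule mult_left_mono) simp
            then show ?thesis by (simp add: mult_ac)
          qed simp
          finally have "ennreal ((v x)\<^sup>2) \<le> ennreal (h powr ?D * ((v x - v y)\<^sup>2 * riesz s (x - y)) + 2 * (\<bar>v x\<bar> * \<bar>v y\<bar>))"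
            by (intro ennreal_leI) simp
          also have "\<dots> = ennreal (h powr ?D) * ?a x y + 2 * (ennreal \<bar>v x\<bar> * ennreal \<bar>v y\<bar>)"
            using xB yB by (simp add: ennreal_plus ennreal_mult del: mem_B)
          finally show ?thesis using True by simp
        qed simp
      qed
      finally show ?thesis .
    qed simp
  qed
  also have "\<dots> = (\<integral>\<^sup>+x. \<integral>\<^sup>+y. ennreal (h powr ?D) * ?a x y \<partial>lborel \<partial>lborel) + (\<integral>\<^sup>+x. \<integral>\<^sup>+y. 2 * (ennreal \<bar>v x\<bar> * ennreal \<bar>v y\<bar>) \<partial>lborel \<partial>lborel)"
    by (rule nn_integral2_add) measurable
  also have "(\<integral>\<^sup>+x. \<integral>\<^sup>+y. ennreal (h powr ?D) * ?a x y \<partial>lborel \<partial>lborel) = ennreal (h powr ?D) * (\<integral>\<^sup>+x. \<integral>\<^sup>+y. ?a x y \<partial>lborel \<partial>lborel)"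
    by (rule nn_integral2_cmult) measurable
  also have "(\<integral>\<^sup>+x. \<integral>\<^sup>+y. ?a x y \<partial>lborel \<partial>lborel) = hsq s B v"
    unfolding hsq_def by (rule nn_integral2_indicator[symmetric]) measurable
  also have "(\<integral>\<^sup>+x. \<integral>\<^sup>+y. 2 * (ennreal \<bar>v x\<bar> * ennreal \<bar>v y\<bar>) \<partial>lborel \<partial>lborel) = 2 * (\<integral>\<^sup>+x. \<integral>\<^sup>+y. ennreal \<bar>v x\<bar> * ennreal \<bar>v y\<bar> \<partial>lborel \<partial>lborel)"
    by (rule nn_integral2_cmult) measurable
  also have "(\<integral>\<^sup>+x. \<integral>\<^sup>+y. ennreal \<bar>v x\<bar> * ennreal \<bar>v y\<bar> \<partial>lborel \<partial>lborel) = (\<integral>\<^sup>+x. ennreal \<bar>v x\<bar> * absint v \<partial>lborel)"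
    unfolding absint_def by (intro nn_integral_cong nn_integral_cmult) measurable
  also have "\<dots> = absint v * absint v"
    unfolding absint_def by (rule nn_integral_multc) measurable
  finally show ?thesis .
qed

end

section \<open>Iteration over radii\<close>

text \<open>The expression bounded here is what two consecutive cutoff steps produce; the free radius
  \<open>h\<close> of the Nash inequality is tuned to a power of \<open>\<sigma>\<close> so that the factor in front of \<open>P\<close>
  drops to one half.\<close>

lemma iteration_step:
  fixes s d D e1 e2 e3 e4 :: real
  assumes s: "0 < s" "s < 1" and d: "0 \<le> d" and D: "0 \<le> D"
    and e: "0 \<le> e1" "0 \<le> e2" "0 \<le> e3" "0 \<le> e4"
  obtains N C where "0 \<le> N" "0 \<le> C"
    "\<And>\<sigma> P m. 0 < \<sigma> \<Longrightarrow> \<sigma> \<le> 1 \<Longrightarrow> 0 < P \<Longrightarrow> 0 \<le> m \<Longrightarrow> \<exists>h>0. h \<le> \<sigma> / 8 \<and>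
      e1 * (8 / \<sigma>)\<^sup>2 * (h powr (2 * s) * (e2 * (8 / \<sigma>)\<^sup>2 * (P * (\<sigma> / 2) powr (- N)) + e3 * (32 / \<sigma>) powr D * (sqrt (P * (\<sigma> / 2) powr (- N)) * m))
         + e4 * h powr (- d) * (sqrt (P * (\<sigma> / 2) powr (- N)) * m))
       + e3 * (32 / \<sigma>) powr D * (sqrt (P * (\<sigma> / 2) powr (- N)) * m)
      \<le> (P / 2 + C * m\<^sup>2) * \<sigma> powr (- N)"
proof -
  \<comment> \<open>With h of order \<delta>^(2/s) the factor h^(2s) is of order \<delta>^4 and
    cancels the two factors \<delta>^(-2) contributed by the two commutators.\<close>
  define p where "p = 2 / s"
  \<comment> \<open>Dominates the exponents of 1/\<delta> in all terms linear in \<open>X\<close>.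
    It is doubled to give \<open>N\<close> because Young's inequality squares these terms.\<close>
  define q where "q = 2 + D + p * d"
  define N where "N = 2 * q"
  define K where "K = e1 * e2 + e1 * e3 * 4 powr D + e1 * e4 + e3 * 4 powr D + 1"
  have K0: "1 \<le> K" unfolding K_def using e by (intro add_increasing mult_nonneg_nonneg) auto
  have Kle: "e1 * e2 \<le> K" "e1 * e3 * 4 powr D \<le> K" "e1 * e4 \<le> K" "e3 * 4 powr D \<le> K"
    unfolding K_def using e mult_nonneg_nonneg[of e1 e2] mult_nonneg_nonneg[of e1 e4] mult_nonneg_nonneg[of "e1 * e3" "4 powr D"]
      mult_nonneg_nonneg[of e3 "4 powr D"] by (auto simp: add_nonneg_nonneg)
  \<comment> \<open>Halving the gap costs the factor 2^N in \<open>a\<close>; two terms of size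
    \<theta> a then add up to half of P \<sigma>^(-N).\<close>
  define \<theta> where "\<theta> = 2 powr (- N) / 4"
  have \<theta>: "0 < \<theta>" by (simp add: \<theta>_def)
  define \<kappa> where "\<kappa> = min 1 ((\<theta> / K) powr (1 / (2 * s)))"
  have \<kappa>: "0 < \<kappa>" "\<kappa> \<le> 1" using \<theta> K0 by (auto simp: \<kappa>_def)
  have \<kappa>K: "K * \<kappa> powr (2 * s) \<le> \<theta>"
  proof -
    have "\<kappa> powr (2 * s) \<le> ((\<theta> / K) powr (1 / (2 * s))) powr (2 * s)"
      using \<kappa> s by (intro powr_mono2) (auto simp: \<kappa>_def)
    also have "\<dots> = \<theta> / K" using \<theta> K0 s by (simp add: powr_powr)
    finally show ?thesis using K0 by (simp add: field_simps)
  qed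
  \<comment> \<open>The remainder of Young's inequality with weight \<theta>: the squared
    coefficient over \<theta>, where 8^N converts powers of \<delta> = \<sigma>/8 into powers of
    \<sigma>.\<close>
  define C where "C = (3 * K * \<kappa> powr (- d))\<^sup>2 * 8 powr N / \<theta>"
  have p0: "0 < p" using s by (simp add: p_def)
  have q2: "2 \<le> q" "D \<le> q" "2 + p * d \<le> q" "2 + D \<le> q" using d D p0 by (auto simp: q_def)
  show ?thesis
  proof (rule that[of N C])
    show "0 \<le> N" using q2 by (simp add: N_def)
    show "0 \<le> C" using \<theta> by (simp add: C_def)
    fix \<sigma> P m :: real assume \<sigma>: "0 < \<sigma>" "\<sigma> \<le> 1" and P: "0 < P" and m: "0 \<le> m"
    define \<delta> where "\<delta> = \<sigma> / 8"
    have \<delta>: "0 < \<delta>" "\<delta> \<le> 1" using \<sigma> by (auto simp: \<delta>_def)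
    define a where "a = P * (\<sigma> / 2) powr (- N)"
    have a: "0 < a" using P \<sigma> by (simp add: a_def)
    define A where "A = sqrt a"
    have A: "0 < A" "A\<^sup>2 = a" using a by (auto simp: A_def)
    define h where "h = \<kappa> * \<delta> powr p"
    have h0: "0 < h" using \<kappa> \<delta> by (simp add: h_def)
    have hs: "h powr (2 * s) = \<kappa> powr (2 * s) * \<delta> powr 4"
      using \<kappa> \<delta> s by (simp add: h_def powr_mult powr_powr p_def)
    have hd: "h powr (- d) = \<kappa> powr (- d) * \<delta> powr (- (p * d))"
      using \<kappa> \<delta> by (simp add: h_def powr_mult powr_powr)
    have hle: "h \<le> \<delta>"
    proof -
      have "\<delta> powr p \<le> \<delta> powr 1" using \<delta> s by (intro powr_mono') (auto simp: p_def)
      then have "\<kappa> * \<delta> powr p \<le> 1 * \<delta>" using \<kappa> \<delta> by (intro mult_mono) auto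
      then show ?thesis by (simp add: h_def)
    qed
    have mono: "\<delta> powr x \<le> \<delta> powr (- q)" if "- q \<le> x" for x using \<delta> that by (intro powr_mono') auto
    have \<kappa>1: "\<kappa> powr (2 * s) \<le> 1" using \<kappa> s by (intro powr_le1) auto
    have \<kappa>2: "1 \<le> \<kappa> powr (- d)"
    proof -
      have "\<kappa> powr 0 \<le> \<kappa> powr (- d)" using \<kappa> d by (intro powr_mono') auto
      then show ?thesis using \<kappa> by simp
    qed
    have r1: "(8 / \<sigma>)\<^sup>2 = \<delta> powr (- 2)"
      using \<delta> \<sigma> by (simp add: \<delta>_def powr_minus powr_numeral power_divide inverse_eq_divide)
    have r2: "(32 / \<sigma>) powr D = 4 powr D * \<delta> powr (- D)"
    proof -
      have "32 / \<sigma> = 4 / \<delta>" by (simp add: \<delta>_def)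
      moreover have "(4 / \<delta>) powr D = 4 powr D * \<delta> powr (- D)"
        using \<delta> powr_divide[of 4 \<delta> D] powr_minus_divide[of \<delta> D] by simp
      ultimately show ?thesis by simp
    qed
    define Q where "Q = 3 * K * \<kappa> powr (- d)"
    define X where "X = A * m"
    have X: "0 \<le> X" using A m by (simp add: X_def)
    have t1: "e1 * \<delta> powr (- 2) * (\<kappa> powr (2 * s) * \<delta> powr 4 * (e2 * \<delta> powr (- 2) * a)) = (e1 * e2) * \<kappa> powr (2 * s) * a"
    proof -
      have "e1 * \<delta> powr (- 2) * (\<kappa> powr (2 * s) * \<delta> powr 4 * (e2 * \<delta> powr (- 2) * a)) =
        (e1 * e2) * \<kappa> powr (2 * s) * a * (\<delta> powr (- 2) * \<delta> powr 4 * \<delta> powr (- 2))" by (simp only: mult_ac)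
      also have "\<delta> powr (- 2) * \<delta> powr 4 * \<delta> powr (- 2) = \<delta> powr (- 2 + 4 + - 2)" by (simp only: powr_add)
      also have "\<dots> = 1" using \<delta> by simp
      finally show ?thesis by simp
    qed
    have t2: "e1 * \<delta> powr (- 2) * (\<kappa> powr (2 * s) * \<delta> powr 4 * (e3 * (4 powr D * \<delta> powr (- D)) * X)) \<le> K * \<kappa> powr (- d) * \<delta> powr (- q) * X"
    proof -
      have "e1 * \<delta> powr (- 2) * (\<kappa> powr (2 * s) * \<delta> powr 4 * (e3 * (4 powr D * \<delta> powr (- D)) * X)) =
        (e1 * e3 * 4 powr D) * \<kappa> powr (2 * s) * (\<delta> powr (- 2) * \<delta> powr 4 * \<delta> powr (- D)) * X" by (simp only: mult_ac)
      also have "\<delta> powr (- 2) * \<delta> powr 4 * \<delta> powr (- D) = \<delta> powr (- 2 + 4 + - D)" by (simp only: powr_add)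
      also have "\<dots> = \<delta> powr (2 - D)" by simp
      also have "(e1 * e3 * 4 powr D) * \<kappa> powr (2 * s) * \<delta> powr (2 - D) * X \<le> K * \<kappa> powr (- d) * \<delta> powr (- q) * X"
        using Kle \<kappa>1 \<kappa>2 K0 e X q2 by (intro mult_right_mono mult_mono mono) auto
      finally show ?thesis .
    qed
    have t3: "e1 * \<delta> powr (- 2) * (e4 * (\<kappa> powr (- d) * \<delta> powr (- (p * d))) * X) \<le> K * \<kappa> powr (- d) * \<delta> powr (- q) * X"
    proof -
      have "e1 * \<delta> powr (- 2) * (e4 * (\<kappa> powr (- d) * \<delta> powr (- (p * d))) * X) =
        (e1 * e4) * \<kappa> powr (- d) * (\<delta> powr (- 2) * \<delta> powr (- (p * d))) * X" by (simp only: mult_ac)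
      also have "\<delta> powr (- 2) * \<delta> powr (- (p * d)) = \<delta> powr (- 2 - p * d)" using \<delta> by (simp add: powr_add[symmetric])
      also have "(e1 * e4) * \<kappa> powr (- d) * \<delta> powr (- 2 - p * d) * X \<le> K * \<kappa> powr (- d) * \<delta> powr (- q) * X"
        using Kle \<kappa>2 K0 e X q2 by (intro mult_right_mono mult_mono mono) auto
      finally show ?thesis .
    qed
    have t4: "e3 * (4 powr D * \<delta> powr (- D)) * X \<le> K * \<kappa> powr (- d) * \<delta> powr (- q) * X"
    proof -
      have "(e3 * 4 powr D) * 1 * \<delta> powr (- D) * X \<le> K * \<kappa> powr (- d) * \<delta> powr (- q) * X"
        using Kle \<kappa>2 K0 e X q2 by (intro mult_right_mono mult_mono mono) auto
      then show ?thesis by (simp add: mult_ac)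
    qed
    have main: "e1 * \<delta> powr (- 2) * (h powr (2 * s) * (e2 * \<delta> powr (- 2) * a + e3 * (4 powr D * \<delta> powr (- D)) * X)
         + e4 * h powr (- d) * X) + e3 * (4 powr D * \<delta> powr (- D)) * X
      \<le> (P / 2 + C * m\<^sup>2) * \<sigma> powr (- N)" (is "?E \<le> _")
    proof -
      have "?E = e1 * \<delta> powr (- 2) * (\<kappa> powr (2 * s) * \<delta> powr 4 * (e2 * \<delta> powr (- 2) * a))
        + e1 * \<delta> powr (- 2) * (\<kappa> powr (2 * s) * \<delta> powr 4 * (e3 * (4 powr D * \<delta> powr (- D)) * X))
        + e1 * \<delta> powr (- 2) * (e4 * (\<kappa> powr (- d) * \<delta> powr (- (p * d))) * X)
        + e3 * (4 powr D * \<delta> powr (- D)) * X"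
        unfolding hs hd by (simp only: distrib_left add_ac)
      also have "\<dots> \<le> (e1 * e2) * \<kappa> powr (2 * s) * a + Q * \<delta> powr (- q) * X"
        using t1 t2 t3 t4 unfolding Q_def by linarith
      also have "(e1 * e2) * \<kappa> powr (2 * s) * a \<le> K * \<kappa> powr (2 * s) * a"
        using Kle a by (intro mult_right_mono) auto
      also have "\<dots> \<le> \<theta> * a" using \<kappa>K a by (intro mult_right_mono) auto
      \<comment> \<open>Since \<open>A\<close> is the square root of \<open>a\<close>, the mixed
        term A m splits into \<theta> a and a multiple of the square of m: the supremum is absorbed
        and the tail remains.\<close>
      also have "Q * \<delta> powr (- q) * X \<le> \<theta> * A\<^sup>2 + (Q * \<delta> powr (- q) * m)\<^sup>2 / \<theta>"
        using young_real[OF \<theta>, of A "Q * \<delta> powr (- q) * m"] abs_ge_self[of "A * (Q * \<delta> powr (- q) * m)"]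
        by (simp add: X_def mult_ac)
      also have "\<theta> * a + (\<theta> * A\<^sup>2 + (Q * \<delta> powr (- q) * m)\<^sup>2 / \<theta>) = (P / 2 + C * m\<^sup>2) * \<sigma> powr (- N)"
      proof -
        have e2: "(\<sigma> / 2) powr (- N) = 2 powr N * \<sigma> powr (- N)"
          using \<sigma> powr_divide[of \<sigma> 2 "- N"] powr_minus_divide[of 2 N] by simp
        have e1: "2 powr (- N) * 2 powr N = (1::real)" by (simp flip: powr_add)
        have "\<theta> * a = P / 4 * (2 powr (- N) * 2 powr N) * \<sigma> powr (- N)"
          unfolding \<theta>_def a_def e2 by simp
        then have 1: "\<theta> * a + \<theta> * A\<^sup>2 = P / 2 * \<sigma> powr (- N)"
          unfolding A(2) e1 by simp
        have "(\<delta> powr (- q))\<^sup>2 = \<delta> powr (- N)" using \<delta> by (simp add: N_def powr_power)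
        also have "\<dots> = 8 powr N * \<sigma> powr (- N)"
          using \<sigma> powr_divide[of \<sigma> 8 "- N"] powr_minus_divide[of 8 N] by (simp add: \<delta>_def)
        finally have 2: "(Q * \<delta> powr (- q) * m)\<^sup>2 / \<theta> = C * m\<^sup>2 * \<sigma> powr (- N)"
          by (simp add: power_mult_distrib C_def Q_def)
        show ?thesis using 1 2 by (simp add: distrib_right)
      qed
      finally show ?thesis by simp
    qed
    show "\<exists>h>0. h \<le> \<sigma> / 8 \<and>
      e1 * (8 / \<sigma>)\<^sup>2 * (h powr (2 * s) * (e2 * (8 / \<sigma>)\<^sup>2 * (P * (\<sigma> / 2) powr (- N)) + e3 * (32 / \<sigma>) powr D * (sqrt (P * (\<sigma> / 2) powr (- N)) * m))
         + e4 * h powr (- d) * (sqrt (P * (\<sigma> / 2) powr (- N)) * m))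
       + e3 * (32 / \<sigma>) powr D * (sqrt (P * (\<sigma> / 2) powr (- N)) * m)
      \<le> (P / 2 + C * m\<^sup>2) * \<sigma> powr (- N)"
      using h0 hle main unfolding r1 r2 a_def[symmetric] A_def[symmetric] X_def[symmetric] \<delta>_def[symmetric] by blast
  qed
qed

section \<open>One cutoff step with explicit constants\<close>

context nonlocal_cutoff
begin

text \<open>Cauchy-Schwarz in the form of Young's inequality with weight \<open>sqrt a\<close>. The
  ball of radius 2 bounds the volume of \<open>B\<close> for every \<open>r\<close>, and the added 1
  is the second Young term.\<close>

lemma ball_L1_le:
  assumes a: "0 < a" "l2sq B (u t) \<le> ennreal a"
  shows "ball_L1 t \<le> ennreal (sqrt a * (measure lborel (ball (0::'a) 2) + 1))"
proof -
  define c where "c = measure lborel (ball (0::'a) 2)"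
  have sa: "0 < sqrt a" using a by simp
  have "emeasure lborel B \<le> emeasure lborel (ball x0 2)"
    by (rule emeasure_mono) (use r\<delta> in \<open>auto simp: B_def\<close>)
  also have "\<dots> = emeasure lborel (ball (0::'a) 2)" by (simp add: emeasure_ball)
  also have "\<dots> = ennreal c"
    unfolding c_def using emeasure_lborel_ball_finite[of "0::'a" 2] by (intro emeasure_eq_ennreal_measure) auto
  finally have eB: "emeasure lborel B \<le> ennreal c" .
  have "ball_L1 t \<le> ennreal (sqrt a) * emeasure lborel B + ennreal (1 / sqrt a) * l2sq B (\<lambda>x. indicator B x * u t x)"
    unfolding ball_L1_eq_absint by (rule absint_le[OF _ _ _ sa]) (auto simp: indicator_def)
  also have "l2sq B (\<lambda>x. indicator B x * u t x) \<le> l2sq B (u t)"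
    by (rule l2sq_mult_le) (auto simp: indicator_def)
  also have "ennreal (sqrt a) * emeasure lborel B + ennreal (1 / sqrt a) * l2sq B (u t) \<le> ennreal (sqrt a) * ennreal c + ennreal (1 / sqrt a) * ennreal a"
    by (intro add_mono mult_left_mono eB a) auto
  also have "\<dots> = ennreal (sqrt a * c + 1 / sqrt a * a)"
    using a by (simp add: ennreal_mult ennreal_plus c_def del: times_divide_eq_left)
  also have "1 / sqrt a * a = sqrt a" using a by (simp add: real_div_sqrt)
  finally show ?thesis by (simp add: c_def distrib_left mult_left_mono)
qed

text \<open>In the far-field term the supremum bound \<open>a\<close> is spent on the local L1 norm,
  which leaves the tail alone to be integrated in time. The mixed quantity \<open>sqrt a * m\<close>
  arises here.\<close>

lemma err_upto_le:
  assumes a: "0 < a" "AE t in lborel. t < b \<longrightarrow> l2sq B (u t) \<le> ennreal a"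
    and y: "0 \<le> y" "(\<integral>\<^sup>+t\<in>{..b}. l2sq B (u t) \<partial>lborel) \<le> ennreal y"
    and m: "0 \<le> m" "(\<integral>\<^sup>+t\<in>{..b}. tl t \<partial>lborel) \<le> ennreal m"
  shows "err_upto b \<le> ennreal (2 * \<Lambda> * enn2real J * (1 / \<delta>)\<^sup>2 * y
    + 2 * \<Lambda> * (measure lborel (ball (0::'a) 2) + 1) * (4 / \<delta>) powr (real DIM('a) + 2 * s) * (sqrt a * m))"
proof -
  define c where "c = measure lborel (ball (0::'a) 2) + 1"
  have c: "0 \<le> c" by (simp add: c_def)
  have ae: "AE t in lborel. err t * indicator {..b} t \<le> 2 * (ennreal (\<Lambda> * (1 / \<delta>)\<^sup>2) * J * (l2sq B (u t) * indicator {..b} t))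
      + 2 * (ennreal (\<Lambda> * C\<^sub>\<delta>) * ennreal (sqrt a * c) * (tl t * indicator {..b} t))"
    using a(2) AE_lborel_singleton[of b]
  proof eventually_elim
    case (elim t)
    show ?case
    proof (cases "t < b")
      case True
      then have "ball_L1 t \<le> ennreal (sqrt a * c)" using elim(1) ball_L1_le[OF a(1)] by (simp add: c_def)
      then have "tl t * ball_L1 t \<le> tl t * ennreal (sqrt a * c)" by (rule mult_left_mono) simp
      then have "tl t * ball_L1 t \<le> ennreal (sqrt a * c) * tl t" by (simp only: mult.commute)
      then show ?thesis using True unfolding err_def by (simp add: mult.assoc add_left_mono mult_left_mono)
    next
      case False
      then show ?thesis using elim(2) by simp
    qed
  qed
  have "err_upto b \<le> (\<integral>\<^sup>+t. 2 * (ennreal (\<Lambda> * (1 / \<delta>)\<^sup>2) * J * (l2sq B (u t) * indicator {..b} t))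
      + 2 * (ennreal (\<Lambda> * C\<^sub>\<delta>) * ennreal (sqrt a * c) * (tl t * indicator {..b} t)) \<partial>lborel)"
    unfolding err_upto_def by (rule nn_integral_mono_AE[OF ae])
  also have "\<dots> = (\<integral>\<^sup>+t. 2 * (ennreal (\<Lambda> * (1 / \<delta>)\<^sup>2) * J * (l2sq B (u t) * indicator {..b} t)) \<partial>lborel)
      + (\<integral>\<^sup>+t. 2 * (ennreal (\<Lambda> * C\<^sub>\<delta>) * ennreal (sqrt a * c) * (tl t * indicator {..b} t)) \<partial>lborel)"
    by (rule nn_integral_add) measurable
  also have "\<dots> = 2 * (ennreal (\<Lambda> * (1 / \<delta>)\<^sup>2) * J * (\<integral>\<^sup>+t\<in>{..b}. l2sq B (u t) \<partial>lborel))
      + 2 * (ennreal (\<Lambda> * C\<^sub>\<delta>) * ennreal (sqrt a * c) * (\<integral>\<^sup>+t\<in>{..b}. tl t \<partial>lborel))"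
    by (simp add: nn_integral_cmult)
  also have "\<dots> \<le> 2 * (ennreal (\<Lambda> * (1 / \<delta>)\<^sup>2) * ennreal (enn2real J) * ennreal y) + 2 * (ennreal (\<Lambda> * C\<^sub>\<delta>) * ennreal (sqrt a * c) * ennreal m)"
    using J_finite by (intro add_mono mult_left_mono mult_mono y m) auto
  also have "\<dots> = ennreal (2 * (\<Lambda> * (1 / \<delta>)\<^sup>2 * enn2real J * y) + 2 * (\<Lambda> * C\<^sub>\<delta> * (sqrt a * c) * m))"
    using \<Lambda> y m a c by (simp add: ennreal_mult ennreal_plus)
  finally show ?thesis by (simp add: c_def[symmetric] C\<^sub>\<delta>_def mult_ac)
qed

text \<open>The Nash inequality integrated in time. Of the two L1 factors in it one is bounded by
  the supremum in time and the other by the tail, so their product contributes a multiple of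
  \<open>sqrt a * m\<close> instead of \<open>a\<close>, while the energy carries the small factor
  h^(2s).\<close>

lemma l2_time_le:
  assumes b: "b < T" and a: "0 < a" "AE t in lborel. t < b \<longrightarrow> l2sq B (u t) \<le> ennreal a"
    and R: "0 \<le> R" "err_upto b \<le> ennreal R"
    and m: "0 \<le> m" "(\<integral>\<^sup>+t\<in>{..b}. tl t \<partial>lborel) \<le> ennreal m"
    and h: "0 < h" "h \<le> \<delta>"
  shows "(\<integral>\<^sup>+t\<in>{..b}. l2sq (ball x0 r) (u t) \<partial>lborel) \<le>
    ennreal ((h powr (2 * s) * R / l + 2 * 3 powr (real DIM('a) + 2 * s) * (measure lborel (ball (0::'a) 2) + 1) * h powr (- real DIM('a)) * (sqrt a * m)) / unit_ball_vol (real DIM('a)))"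
proof -
  define c where "c = measure lborel (ball (0::'a) 2) + 1"
  have c: "0 \<le> c" by (simp add: c_def)
  define w where "w = unit_ball_vol (real DIM('a))"
  have w: "0 < w" by (simp add: w_def)
  let ?D = "real DIM('a) + 2 * s" and ?d = "DIM('a)"
  define v where "v t x = \<xi> x * u t x" for t x
  have [measurable]: "v t \<in> borel_measurable borel" for t unfolding v_def by measurable
  have [measurable]: "(\<lambda>(t, x). v t x) \<in> borel_measurable (borel \<Otimes>\<^sub>M borel)" unfolding v_def by measurable
  have v0: "v t x = 0" if "r + \<delta> \<le> dist x0 x" for t x using \<xi>_eq_0[OF that] by (simp add: v_def)
  have t0: "0 \<le> tail_weight s z" for z :: 'a by (auto intro: less_imp_le tail_weight_pos)
  have A: "l2sq (ball x0 r) (u t) \<le> l2sq B (v t)" for t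
    unfolding l2sq_def
  proof (rule nn_integral_mono)
    fix x show "ennreal ((u t x)\<^sup>2) * indicator (ball x0 r) x \<le> ennreal ((v t x)\<^sup>2) * indicator B x"
      using \<xi>_eq_1[of x] \<delta> by (cases "x \<in> ball x0 r") (auto simp: v_def)
  qed
  have ul1: "absint (v t) \<le> ball_L1 t" for t
    unfolding absint_def ball_L1_def
  proof (rule nn_integral_mono)
    fix x
    show "ennreal \<bar>v t x\<bar> \<le> ennreal \<bar>u t x\<bar> * indicator B x"
    proof (cases "x \<in> B")
      case True
      have "\<bar>v t x\<bar> \<le> \<bar>u t x\<bar>" using \<xi>_bounds[of x] by (simp add: v_def abs_mult mult_left_le_one_le)
      then show ?thesis using True by (simp add: ennreal_leI)
    next
      case False
      then have "v t x = 0" using \<delta> by (intro v0) auto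
      then show ?thesis by simp
    qed
  qed
  \<comment> \<open>On \<open>B\<close> one has 1 + |x - x0| \<le> 3, whence the power of 3.\<close>
  have ul2: "ball_L1 t \<le> ennreal (3 powr ?D) * tl t" for t
  proof -
    have "ball_L1 t \<le> (\<integral>\<^sup>+x. ennreal (3 powr ?D) * ennreal (\<bar>u t x\<bar> * tail_weight s (x - x0)) \<partial>lborel)"
      unfolding ball_L1_def
    proof (rule nn_integral_mono)
      fix x
      show "ennreal \<bar>u t x\<bar> * indicator B x \<le> ennreal (3 powr ?D) * ennreal (\<bar>u t x\<bar> * tail_weight s (x - x0))"
      proof (cases "x \<in> B")
        case True
        then have "1 + norm (x - x0) \<le> 3" using r\<delta> by (simp add: dist_norm norm_minus_commute)
        then have "3 powr (- real ?d - 2 * s) \<le> tail_weight s (x - x0)"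
          unfolding tail_weight_def using s by (intro powr_mono2') (auto simp: add_pos_nonneg)
        then have "3 powr ?D * 3 powr (- real ?d - 2 * s) \<le> 3 powr ?D * tail_weight s (x - x0)" by (rule mult_left_mono) simp
        then have "1 \<le> 3 powr ?D * tail_weight s (x - x0)" by (simp add: powr_add[symmetric])
        then have "\<bar>u t x\<bar> * 1 \<le> \<bar>u t x\<bar> * (3 powr ?D * tail_weight s (x - x0))" by (rule mult_left_mono) simp
        then have "ennreal \<bar>u t x\<bar> \<le> ennreal (3 powr ?D * (\<bar>u t x\<bar> * tail_weight s (x - x0)))"
          by (intro ennreal_leI) (simp add: mult_ac)
        then show ?thesis using True t0 by (simp add: ennreal_mult)
      qed simp
    qed
    also have "\<dots> = ennreal (3 powr ?D) * tl t" unfolding tl_def by (rule nn_integral_cmult) measurable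
    finally show ?thesis .
  qed
  have ae: "AE t in lborel. ennreal (w * h ^ ?d) * l2sq (ball x0 r) (u t) * indicator {..b} t \<le>
      ennreal (h powr ?D) * (hsq s B (v t) * indicator {..<b} t) + 2 * (ennreal (sqrt a * c) * ennreal (3 powr ?D) * (tl t * indicator {..b} t))"
    using a(2) AE_lborel_singleton[of b]
  proof eventually_elim
    case (elim t)
    show ?case
    proof (cases "t < b")
      case True
      then have 1: "ball_L1 t \<le> ennreal (sqrt a * c)" using elim(1) ball_L1_le[OF a(1)] by (simp add: c_def)
      have "ennreal (w * h ^ ?d) * l2sq (ball x0 r) (u t) \<le> ennreal (w * h ^ ?d) * l2sq B (v t)"
        by (intro mult_left_mono A) simp
      also have "\<dots> \<le> ennreal (h powr ?D) * hsq s B (v t) + 2 * (absint (v t) * absint (v t))"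
        unfolding w_def by (rule nash[OF _ v0 h]) measurable
      also have "absint (v t) * absint (v t) \<le> ennreal (sqrt a * c) * (ennreal (3 powr ?D) * tl t)"
        by (intro mult_mono order_trans[OF ul1 1] order_trans[OF ul1 ul2]) auto
      finally show ?thesis using True by (simp add: mult.assoc add_left_mono mult_left_mono)
    next
      case False
      then show ?thesis using elim(2) by simp
    qed
  qed
  have "ennreal (w * h ^ ?d) * (\<integral>\<^sup>+t\<in>{..b}. l2sq (ball x0 r) (u t) \<partial>lborel) = (\<integral>\<^sup>+t. ennreal (w * h ^ ?d) * l2sq (ball x0 r) (u t) * indicator {..b} t \<partial>lborel)"
    unfolding mult.assoc by (rule nn_integral_cmult[symmetric]) measurable
  also have "\<dots> \<le> (\<integral>\<^sup>+t. ennreal (h powr ?D) * (hsq s B (v t) * indicator {..<b} t) + 2 * (ennreal (sqrt a * c) * ennreal (3 powr ?D) * (tl t * indicator {..b} t)) \<partial>lborel)"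
    by (rule nn_integral_mono_AE[OF ae])
  also have "\<dots> = (\<integral>\<^sup>+t. ennreal (h powr ?D) * (hsq s B (v t) * indicator {..<b} t) \<partial>lborel) + (\<integral>\<^sup>+t. 2 * (ennreal (sqrt a * c) * ennreal (3 powr ?D) * (tl t * indicator {..b} t)) \<partial>lborel)"
    by (rule nn_integral_add) measurable
  also have "\<dots> = ennreal (h powr ?D) * (\<integral>\<^sup>+t\<in>{..<b}. hsq s B (v t) \<partial>lborel) + 2 * (ennreal (sqrt a * c) * ennreal (3 powr ?D) * (\<integral>\<^sup>+t\<in>{..b}. tl t \<partial>lborel))"
    by (simp add: nn_integral_cmult)
  also have "(\<integral>\<^sup>+t\<in>{..<b}. hsq s B (v t) \<partial>lborel) \<le> ennreal (R / l)"
  proof -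
    have "ennreal l * (\<integral>\<^sup>+t\<in>{..<b}. hsq s B (v t) \<partial>lborel) \<le> ennreal R"
      using order_trans[OF energy_hsq[OF b] R(2)] by (simp add: v_def[abs_def])
    then have "ennreal (1 / l) * (ennreal l * (\<integral>\<^sup>+t\<in>{..<b}. hsq s B (v t) \<partial>lborel)) \<le> ennreal (1 / l) * ennreal R"
      by (intro mult_left_mono) auto
    then show ?thesis using l R by (simp add: mult.assoc[symmetric] ennreal_mult[symmetric])
  qed
  also have "ennreal (h powr ?D) * ennreal (R / l) + 2 * (ennreal (sqrt a * c) * ennreal (3 powr ?D) * (\<integral>\<^sup>+t\<in>{..b}. tl t \<partial>lborel))
    \<le> ennreal (h powr ?D) * ennreal (R / l) + 2 * (ennreal (sqrt a * c) * ennreal (3 powr ?D) * ennreal m)"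
    by (intro add_left_mono mult_left_mono m) auto
  also have "\<dots> = ennreal (h powr ?D * (R / l) + 2 * (sqrt a * c * 3 powr ?D * m))"
    using R l m a c by (simp add: ennreal_mult ennreal_plus del: times_divide_eq_right)
  finally have main: "ennreal (w * h ^ ?d) * (\<integral>\<^sup>+t\<in>{..b}. l2sq (ball x0 r) (u t) \<partial>lborel) \<le> ennreal (h powr ?D * (R / l) + 2 * (sqrt a * c * 3 powr ?D * m))"
    by (simp add: add_left_mono add_right_mono mult_left_mono)
  have hp: "0 < w * h ^ ?d" using w h by simp
  have "(\<integral>\<^sup>+t\<in>{..b}. l2sq (ball x0 r) (u t) \<partial>lborel) = ennreal (1 / (w * h ^ ?d)) * (ennreal (w * h ^ ?d) * (\<integral>\<^sup>+t\<in>{..b}. l2sq (ball x0 r) (u t) \<partial>lborel))"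
    using hp w h by (simp only: mult.assoc[symmetric]) (simp add: ennreal_mult[symmetric])
  also have "\<dots> \<le> ennreal (1 / (w * h ^ ?d)) * ennreal (h powr ?D * (R / l) + 2 * (sqrt a * c * 3 powr ?D * m))"
    by (intro mult_left_mono main) auto
  also have "\<dots> = ennreal (1 / (w * h ^ ?d) * (h powr ?D * (R / l) + 2 * (sqrt a * c * 3 powr ?D * m)))"
    by (rule ennreal_mult[symmetric]) (use hp R l m a c in auto)
  also have "1 / (w * h ^ ?d) * (h powr ?D * (R / l) + 2 * (sqrt a * c * 3 powr ?D * m)) =
    (h powr (2 * s) * R / l + 2 * 3 powr ?D * c * h powr (- real ?d) * (sqrt a * m)) / w"
  proof -
    have 1: "h powr ?D = h ^ ?d * h powr (2 * s)" using h by (simp add: powr_add powr_realpow)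
    have 2: "h powr (- real ?d) = 1 / h ^ ?d" using h by (simp add: powr_minus powr_realpow inverse_eq_divide)
    have 3: "h ^ ?d \<noteq> 0" using h by simp
    show ?thesis unfolding 1 2 using 3 w l by (simp add: field_simps)
  qed
  finally show ?thesis by (simp add: w_def c_def)
qed

end

section \<open>Iteration, estimate of the weighted mass, and uniqueness\<close>

context nonlocal_cauchy
begin

lemma l2sq_zero: "t \<le> 0 \<or> T \<le> t \<Longrightarrow> l2sq A (u t) = 0"
  using u_zero[of t] by (simp add: l2sq_def)

text \<open>Two cutoff steps are chained. The outer one controls the fractional energy crudely; the
  Nash inequality on the middle ball converts this into a time integral of the L2 norm that is small
  for small h; the inner step spends that integral in its commutator term. The weight (2 - r)^(-N)
  changes only by 2^N when the gap is halved, which h can compensate.\<close>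

lemma improve_bound:
  obtains N C where "0 \<le> N" "0 \<le> C"
    "\<And>x0 b m P. 0 < b \<Longrightarrow> b < T \<Longrightarrow> 0 \<le> m \<Longrightarrow>
      (\<integral>\<^sup>+t\<in>{..b}. (\<integral>\<^sup>+y. ennreal (\<bar>u t y\<bar> * tail_weight s (y - x0)) \<partial>lborel) \<partial>lborel) \<le> ennreal m \<Longrightarrow> 0 < P \<Longrightarrow>
      (\<And>r. 1 \<le> r \<Longrightarrow> r < 2 \<Longrightarrow> AE t in lborel. t < b \<longrightarrow> l2sq (ball x0 r) (u t) \<le> ennreal (P * (2 - r) powr (- N))) \<Longrightarrow>
      (\<And>r. 1 \<le> r \<Longrightarrow> r < 2 \<Longrightarrow> AE t in lborel. t < b \<longrightarrow> l2sq (ball x0 r) (u t) \<le> ennreal ((P / 2 + C * m\<^sup>2) * (2 - r) powr (- N)))"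
proof -
  \<comment> \<open>The constants are named outside the interpretations below, since they have to be
    fixed before the centre and the radii are.\<close>
  define Jr where "Jr = enn2real (\<integral>\<^sup>+z. ennreal ((norm z)\<^sup>2 * riesz s z) * indicator (cball 0 4) z \<partial>(lborel :: 'a measure))"
  define c where "c = measure lborel (ball (0::'a) 2) + 1"
  define w where "w = unit_ball_vol (real DIM('a))"
  let ?D = "real DIM('a) + 2 * s"
  define g where "g = 2 * 3 powr ?D * c"
  have nn: "0 \<le> Jr" "0 \<le> c" "0 < w" "0 \<le> g" by (auto simp: Jr_def c_def w_def g_def)
  \<comment> \<open>The first coefficient collects the inner commutator, the volume of the unit ball
    from the Nash inequality and the coercivity constant; all coefficients already contain the
    factor 2 of the supremum estimate.\<close>
  obtain N C where NC: "0 \<le> N" "0 \<le> C"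
    "\<And>\<sigma> P m. 0 < \<sigma> \<Longrightarrow> \<sigma> \<le> 1 \<Longrightarrow> 0 < P \<Longrightarrow> 0 \<le> m \<Longrightarrow> \<exists>h>0. h \<le> \<sigma> / 8 \<and>
      2 * \<Lambda> * Jr / (w * l) * (8 / \<sigma>)\<^sup>2 * (h powr (2 * s) * (4 * \<Lambda> * Jr * T * (8 / \<sigma>)\<^sup>2 * (P * (\<sigma> / 2) powr (- N)) + 4 * \<Lambda> * c * (32 / \<sigma>) powr ?D * (sqrt (P * (\<sigma> / 2) powr (- N)) * m))
         + 2 * g * l * h powr (- real DIM('a)) * (sqrt (P * (\<sigma> / 2) powr (- N)) * m))
       + 4 * \<Lambda> * c * (32 / \<sigma>) powr ?D * (sqrt (P * (\<sigma> / 2) powr (- N)) * m)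
      \<le> (P / 2 + C * m\<^sup>2) * \<sigma> powr (- N)"
    by (rule iteration_step[of s "real DIM('a)" ?D "2 * \<Lambda> * Jr / (w * l)" "4 * \<Lambda> * Jr * T" "4 * \<Lambda> * c" "2 * g * l"])
      (use s nn \<Lambda> T l in auto)
  show ?thesis
  proof (rule that[OF NC(1,2)])
    fix x0 :: 'a and b m P r :: real
    assume b: "0 < b" "b < T" and m: "0 \<le> m" and P: "0 < P"
      and tail: "(\<integral>\<^sup>+t\<in>{..b}. (\<integral>\<^sup>+y. ennreal (\<bar>u t y\<bar> * tail_weight s (y - x0)) \<partial>lborel) \<partial>lborel) \<le> ennreal m"
      and Q: "\<And>r. 1 \<le> r \<Longrightarrow> r < 2 \<Longrightarrow> AE t in lborel. t < b \<longrightarrow> l2sq (ball x0 r) (u t) \<le> ennreal (P * (2 - r) powr (- N))"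
      and r: "1 \<le> r" "r < 2"
    define \<sigma> where "\<sigma> = 2 - r"
    have \<sigma>: "0 < \<sigma>" "\<sigma> \<le> 1" using r by (auto simp: \<sigma>_def)
    define a where "a = P * (\<sigma> / 2) powr (- N)"
    have a: "0 < a" using P \<sigma> by (simp add: a_def)
    \<comment> \<open>Two cutoff steps, each taking 2\<delta>, use up half of the gap \<sigma>: the
      outer ball ends at r + \<sigma>/2, where the hypothesis still has the gap \<sigma>/2 at its
      disposal.\<close>
    define \<delta> where "\<delta> = \<sigma> / 8"
    have \<delta>: "0 < \<delta>" "\<delta> \<le> 1" using \<sigma> by (auto simp: \<delta>_def)
    have \<sigma>8: "8 * \<delta> + r = 2" by (simp add: \<delta>_def \<sigma>_def field_simps)
    have rs: "0 \<le> r" "0 \<le> r + 2 * \<delta>" "0 < \<delta>" "\<delta> \<le> 1" "r + 2 * \<delta> \<le> 2" "r + 2 * \<delta> + 2 * \<delta> \<le> 2"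
      using r \<delta> \<sigma>8 by linarith+
    interpret c1: nonlocal_cutoff s T l \<Lambda> k u x0 r \<delta>
      by unfold_locales (rule rs)+
    interpret c2: nonlocal_cutoff s T l \<Lambda> k u x0 "r + 2 * \<delta>" \<delta>
      by unfold_locales (rule rs)+
    have B2: "c2.B = ball x0 (r + \<sigma> / 2)" unfolding c2.B_def by (simp add: \<delta>_def add.commute)
    have "AE t in lborel. t < b \<longrightarrow> l2sq (ball x0 (r + \<sigma> / 2)) (u t) \<le> ennreal (P * (2 - (r + \<sigma> / 2)) powr (- N))"
      by (rule Q) (use r in \<open>simp_all add: \<sigma>_def field_simps\<close>)
    moreover have "2 - (r + \<sigma> / 2) = \<sigma> / 2" by (simp add: \<sigma>_def field_simps)
    ultimately have a2: "AE t in lborel. t < b \<longrightarrow> l2sq c2.B (u t) \<le> ennreal a" by (simp add: B2 a_def)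
    have a1: "AE t in lborel. t < b \<longrightarrow> l2sq c1.B (u t) \<le> ennreal a"
      using a2
    proof eventually_elim
      case (elim t)
      have "c1.B \<subseteq> c2.B" using \<delta> by (auto simp: c1.B_def c2.B_def)
      then show ?case using elim order_trans[OF l2sq_mono] by blast
    qed
    have tl: "(\<integral>\<^sup>+t\<in>{..b}. c1.tl t \<partial>lborel) \<le> ennreal m" "(\<integral>\<^sup>+t\<in>{..b}. c2.tl t \<partial>lborel) \<le> ennreal m"
      using tail by (simp_all add: c1.tl_def c2.tl_def)
    have J: "enn2real c1.J = Jr" "enn2real c2.J = Jr" by (simp_all add: c1.J_def c2.J_def Jr_def)
    \<comment> \<open>Crude on purpose: supremum times length of the time interval. Smallness enters
      only between the two steps.\<close>
    have y2: "(\<integral>\<^sup>+t\<in>{..b}. l2sq c2.B (u t) \<partial>lborel) \<le> ennreal (T * a)"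
    proof -
      have "(\<integral>\<^sup>+t\<in>{..b}. l2sq c2.B (u t) \<partial>lborel) \<le> (\<integral>\<^sup>+t. ennreal a * indicator {0..b} t \<partial>lborel)"
      proof (rule nn_integral_mono_AE)
        show "AE t in lborel. l2sq c2.B (u t) * indicator {..b} t \<le> ennreal a * indicator {0..b} t"
          using a2 AE_lborel_singleton[of b]
        proof eventually_elim
          case (elim t)
          then show ?case using l2sq_zero[of t c2.B] by (cases "0 < t"; cases "t < b") auto
        qed
      qed
      also have "\<dots> = ennreal a * ennreal b" using b by (simp add: nn_integral_cmult_indicator)
      also have "\<dots> = ennreal (a * b)" using a b by (simp add: ennreal_mult)
      also have "\<dots> \<le> ennreal (T * a)" using a b by (intro ennreal_leI) (simp add: mult.commute mult_left_mono)
      finally show ?thesis .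
    qed
    define X where "X = sqrt a * m"
    have X: "0 \<le> X" using a m by (simp add: X_def)
    obtain h where h: "0 < h" "h \<le> \<sigma> / 8" and hb:
      "2 * \<Lambda> * Jr / (w * l) * (8 / \<sigma>)\<^sup>2 * (h powr (2 * s) * (4 * \<Lambda> * Jr * T * (8 / \<sigma>)\<^sup>2 * a + 4 * \<Lambda> * c * (32 / \<sigma>) powr ?D * X)
         + 2 * g * l * h powr (- real DIM('a)) * X)
       + 4 * \<Lambda> * c * (32 / \<sigma>) powr ?D * X
      \<le> (P / 2 + C * m\<^sup>2) * \<sigma> powr (- N)"
      using NC(3)[OF \<sigma> P m] unfolding a_def[symmetric] X_def[symmetric] by blast
    define R1 where "R1 = 2 * \<Lambda> * Jr * (1 / \<delta>)\<^sup>2 * (T * a) + 2 * \<Lambda> * c * (4 / \<delta>) powr ?D * X"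
    have R1: "c2.err_upto b \<le> ennreal R1" "0 \<le> R1"
      using c2.err_upto_le[OF a a2 _ y2 m tl(2)] a T nn X \<Lambda> unfolding R1_def J c_def[symmetric] X_def[symmetric] by auto
    define Y1 where "Y1 = (h powr (2 * s) * R1 / l + g * h powr (- real DIM('a)) * X) / w"
    have Y1: "(\<integral>\<^sup>+t\<in>{..b}. l2sq c1.B (u t) \<partial>lborel) \<le> ennreal Y1"
      using c2.l2_time_le[OF b(2) a a2 R1(2,1) m tl(2), of h] h
      unfolding Y1_def g_def c_def w_def X_def c1.B_def \<delta>_def[symmetric] by simp
    have Y10: "0 \<le> Y1" unfolding Y1_def using R1 X nn l by (intro divide_nonneg_pos add_nonneg_nonneg mult_nonneg_nonneg) auto
    define R2 where "R2 = 2 * \<Lambda> * Jr * (1 / \<delta>)\<^sup>2 * Y1 + 2 * \<Lambda> * c * (4 / \<delta>) powr ?D * X"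
    have R2: "c1.err_upto b \<le> ennreal R2"
      using c1.err_upto_le[OF a a1 Y10 Y1 m tl(1)] unfolding R2_def J c_def[symmetric] X_def[symmetric] .
    have R20: "0 \<le> R2" unfolding R2_def using Y10 X nn \<Lambda> by (intro add_nonneg_nonneg mult_nonneg_nonneg) auto
    have fin: "2 * R2 \<le> (P / 2 + C * m\<^sup>2) * \<sigma> powr (- N)"
    proof -
      \<comment> \<open>Pure algebra with the powers of h and \<sigma> abstracted: it identifies the
        chained estimate with the expression that the choice of h was made for.\<close>
      have gen: "2 * (2 * \<Lambda> * Jr * A * ((H * (2 * \<Lambda> * Jr * A * (T * a) + 2 * \<Lambda> * c * E * X) / l + g * G * X) / w) + 2 * \<Lambda> * c * E * X)
        = 2 * \<Lambda> * Jr / (w * l) * A * (H * (4 * \<Lambda> * Jr * T * A * a + 4 * \<Lambda> * c * E * X) + 2 * g * l * G * X) + 4 * \<Lambda> * c * E * X"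
        for A H G E :: real
      proof -
        have "2 * \<Lambda> * Jr * A * ((H * (2 * \<Lambda> * Jr * A * (T * a) + 2 * \<Lambda> * c * E * X) / l + g * G * X) / w)
          = 2 * \<Lambda> * Jr / (w * l) * A * (H * (2 * \<Lambda> * Jr * T * A * a + 2 * \<Lambda> * c * E * X) + g * l * G * X)"
          using nn l by (simp add: add_divide_distrib distrib_left mult_ac)
        then show ?thesis by (simp add: distrib_left)
      qed
      have e: "1 / \<delta> = 8 / \<sigma>" "4 / \<delta> = 32 / \<sigma>" by (auto simp: \<delta>_def)
      have "2 * R2 = 2 * \<Lambda> * Jr / (w * l) * (8 / \<sigma>)\<^sup>2 * (h powr (2 * s) * (4 * \<Lambda> * Jr * T * (8 / \<sigma>)\<^sup>2 * a + 4 * \<Lambda> * c * (32 / \<sigma>) powr ?D * X)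
         + 2 * g * l * h powr (- real DIM('a)) * X)
       + 4 * \<Lambda> * c * (32 / \<sigma>) powr ?D * X"
        unfolding R2_def Y1_def R1_def e by (rule gen)
      then show ?thesis using hb by simp
    qed
    show "AE t in lborel. t < b \<longrightarrow> l2sq (ball x0 r) (u t) \<le> ennreal ((P / 2 + C * m\<^sup>2) * (2 - r) powr (- N))"
      using c1.energy_sup[OF b]
    proof eventually_elim
      case (elim t)
      show ?case
      proof (cases "0 < t")
        case True
        have "2 * c1.err_upto b \<le> 2 * ennreal R2" by (intro mult_left_mono R2) auto
        also have "\<dots> = ennreal (2 * R2)" using R20 by (simp add: ennreal_mult)
        also have "\<dots> \<le> ennreal ((P / 2 + C * m\<^sup>2) * (2 - r) powr (- N))" using fin by (intro ennreal_leI) (simp add: \<sigma>_def)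
        finally show ?thesis using elim True by auto
      qed (simp add: l2sq_zero)
    qed
  qed
qed

text \<open>The map taking P to P/2 + C m^2 has the fixed point 2 C m^2, so iteration drives the
  bound there, and the start \<open>M\<close>, which may depend on \<open>x0\<close> and
  \<open>u\<close>, disappears. At r = 1 the weight (2 - r)^(-N) equals 1.\<close>

lemma local_estimate:
  obtains C where "0 \<le> C"
    "\<And>x0 b m. 0 < b \<Longrightarrow> b < T \<Longrightarrow> 0 \<le> m \<Longrightarrow>
      (\<integral>\<^sup>+t\<in>{..b}. (\<integral>\<^sup>+y. ennreal (\<bar>u t y\<bar> * tail_weight s (y - x0)) \<partial>lborel) \<partial>lborel) \<le> ennreal m \<Longrightarrow>
      AE t in lborel. t < b \<longrightarrow> l2sq (ball x0 1) (u t) \<le> ennreal (C * m\<^sup>2)"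
proof -
  obtain N C where NC: "0 \<le> N" "0 \<le> C" and step:
    "\<And>x0 b m P r. 0 < b \<Longrightarrow> b < T \<Longrightarrow> 0 \<le> m \<Longrightarrow>
      (\<integral>\<^sup>+t\<in>{..b}. (\<integral>\<^sup>+y. ennreal (\<bar>u t y\<bar> * tail_weight s (y - x0)) \<partial>lborel) \<partial>lborel) \<le> ennreal m \<Longrightarrow> 0 < P \<Longrightarrow>
      (\<And>r. 1 \<le> r \<Longrightarrow> r < 2 \<Longrightarrow> AE t in lborel. t < b \<longrightarrow> l2sq (ball x0 r) (u t) \<le> ennreal (P * (2 - r) powr (- N))) \<Longrightarrow> 1 \<le> r \<Longrightarrow> r < 2 \<Longrightarrow>
      AE t in lborel. t < b \<longrightarrow> l2sq (ball x0 r) (u t) \<le> ennreal ((P / 2 + C * m\<^sup>2) * (2 - r) powr (- N))"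
    by (rule improve_bound) blast
  show ?thesis
  proof (rule that[of "2 * C"])
    show "0 \<le> 2 * C" using NC by simp
    fix x0 :: 'a and b m :: real
    assume b: "0 < b" "b < T" and m: "0 \<le> m"
      and tail: "(\<integral>\<^sup>+t\<in>{..b}. (\<integral>\<^sup>+y. ennreal (\<bar>u t y\<bar> * tail_weight s (y - x0)) \<partial>lborel) \<partial>lborel) \<le> ennreal m"
    have sub: "ball x0 r \<subseteq> ball 0 (norm x0 + 2)" if "r < 2" for r
    proof
      fix x assume "x \<in> ball x0 r"
      then show "x \<in> ball 0 (norm x0 + 2)"
        using that norm_triangle_ineq[of x0 "x - x0"] by (simp add: dist_norm norm_minus_commute)
    qed
    obtain M0 :: real where M0: "AE t in lborel. l2sq (ball 0 (norm x0 + 2)) (u t) \<le> ennreal M0" using u_L2 by blast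
    define M where "M = max 1 M0"
    have M: "0 < M" by (simp add: M_def)
    define p where "p n = M / 2 ^ n + 2 * C * m\<^sup>2" for n
    have p0: "0 < p n" for n using M NC by (auto simp: p_def intro!: add_pos_nonneg)
    have iter: "\<forall>r. 1 \<le> r \<and> r < 2 \<longrightarrow> (AE t in lborel. t < b \<longrightarrow> l2sq (ball x0 r) (u t) \<le> ennreal (p n * (2 - r) powr (- N)))" for n
    proof (induction n)
      case 0
      show ?case
      proof (intro allI impI)
        fix r :: real assume r: "1 \<le> r \<and> r < 2"
        show "AE t in lborel. t < b \<longrightarrow> l2sq (ball x0 r) (u t) \<le> ennreal (p 0 * (2 - r) powr (- N))"
          using M0
        proof eventually_elim
          case (elim t)
          have "1 \<le> (2 - r) powr (- N)"
          proof -
            have "(2 - r) powr 0 \<le> (2 - r) powr (- N)" using r NC by (intro powr_mono') auto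
            then show ?thesis using r by simp
          qed
          then have "M * 1 \<le> p 0 * (2 - r) powr (- N)"
            using M NC p0[of 0] by (intro mult_mono) (auto simp: p_def)
          then have "ennreal M0 \<le> ennreal (p 0 * (2 - r) powr (- N))" by (intro ennreal_leI) (simp add: M_def)
          then have "l2sq (ball x0 r) (u t) \<le> ennreal (p 0 * (2 - r) powr (- N))"
            using elim l2sq_mono[OF sub, of r "u t"] r by (auto intro: order_trans)
          then show ?case by simp
        qed
      qed
    next
      case (Suc n)
      have "p (Suc n) = p n / 2 + C * m\<^sup>2" by (simp add: p_def field_simps)
      then show ?case using step[OF b m tail p0[of n]] Suc.IH by simp
    qed
    \<comment> \<open>Countably many exceptional sets are merged, so that the limit in n can be
      taken at a fixed time.\<close>
    have "AE t in lborel. \<forall>n. t < b \<longrightarrow> l2sq (ball x0 1) (u t) \<le> ennreal (p n)"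
      unfolding AE_all_countable using iter by force
    then show "AE t in lborel. t < b \<longrightarrow> l2sq (ball x0 1) (u t) \<le> ennreal (2 * C * m\<^sup>2)"
    proof eventually_elim
      case (elim t)
      show ?case
      proof
        assume t: "t < b"
        have "(\<lambda>n. M * (1/2) ^ n + 2 * C * m\<^sup>2) \<longlonglongrightarrow> M * 0 + 2 * C * m\<^sup>2"
          by (intro tendsto_intros LIMSEQ_power_zero) auto
        then have "p \<longlonglongrightarrow> 2 * C * m\<^sup>2" unfolding p_def[abs_def] by (simp add: power_divide)
        then have "(\<lambda>n. ennreal (p n)) \<longlonglongrightarrow> ennreal (2 * C * m\<^sup>2)" by (rule tendsto_ennrealI)
        then show "l2sq (ball x0 1) (u t) \<le> ennreal (2 * C * m\<^sup>2)"
          by (rule LIMSEQ_le_const) (use elim t in auto)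
      qed
    qed
  qed
qed

text \<open>Young's inequality with weight \<epsilon> = m makes the bound linear in the tail
  integral, as the Gronwall argument requires; for m = 0 the weight is sent to 0 instead.\<close>

lemma local_L1_estimate:
  obtains C where "0 \<le> C"
    "\<And>x0 b. 0 < b \<Longrightarrow> b < T \<Longrightarrow>
      AE t in lborel. t < b \<longrightarrow> (\<integral>\<^sup>+x\<in>ball x0 1. ennreal \<bar>u t x\<bar> \<partial>lborel) \<le>
        ennreal C * (\<integral>\<^sup>+t\<in>{..b}. (\<integral>\<^sup>+y. ennreal (\<bar>u t y\<bar> * tail_weight s (y - x0)) \<partial>lborel) \<partial>lborel)"
proof -
  obtain C where C: "0 \<le> C" and est: "\<And>x0 b m. 0 < b \<Longrightarrow> b < T \<Longrightarrow> 0 \<le> m \<Longrightarrow>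
      (\<integral>\<^sup>+t\<in>{..b}. (\<integral>\<^sup>+y. ennreal (\<bar>u t y\<bar> * tail_weight s (y - x0)) \<partial>lborel) \<partial>lborel) \<le> ennreal m \<Longrightarrow>
      AE t in lborel. t < b \<longrightarrow> l2sq (ball x0 1) (u t) \<le> ennreal (C * m\<^sup>2)"
    by (rule local_estimate) blast
  define v where "v = measure lborel (ball (0::'a) 1)"
  have vol: "emeasure lborel (ball x0 1) = ennreal v" for x0 :: 'a
  proof -
    have "emeasure lborel (ball x0 1) = emeasure lborel (ball (0::'a) 1)" by (simp add: emeasure_ball)
    also have "\<dots> = ennreal v" unfolding v_def
      using emeasure_lborel_ball_finite[of "0::'a" 1] by (intro emeasure_eq_ennreal_measure) auto
    finally show ?thesis .
  qed
  show ?thesis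
  proof (rule that[of "v + C"])
    show "0 \<le> v + C" using C by (simp add: v_def)
    fix x0 :: 'a and b :: real assume b: "0 < b" "b < T"
    \<comment> \<open>This instance only lends the finiteness of the tail integral and the Young
      bounds; 1/2 satisfies 1 + 2 \<delta> \<le> 2.\<close>
    interpret c: nonlocal_cutoff s T l \<Lambda> k u x0 1 "1/2" by unfold_locales auto
    define I where "I = (\<integral>\<^sup>+t\<in>{..b}. (\<integral>\<^sup>+y. ennreal (\<bar>u t y\<bar> * tail_weight s (y - x0)) \<partial>lborel) \<partial>lborel)"
    have "I \<le> (\<integral>\<^sup>+t. c.tl t \<partial>lborel)"
      unfolding I_def c.tl_def by (intro nn_integral_mono) (auto simp: indicator_def)
    then have "I < \<infinity>" using c.tl_time by (rule le_less_trans)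
    then obtain m where m: "0 \<le> m" "I = ennreal m" by (cases I) auto
    have "AE t in lborel. t < b \<longrightarrow> l2sq (ball x0 1) (u t) \<le> ennreal (C * m\<^sup>2)"
      by (rule est[OF b m(1)]) (use m(2) in \<open>simp add: I_def\<close>)
    then show "AE t in lborel. t < b \<longrightarrow> (\<integral>\<^sup>+x\<in>ball x0 1. ennreal \<bar>u t x\<bar> \<partial>lborel) \<le>
        ennreal (v + C) * (\<integral>\<^sup>+t\<in>{..b}. (\<integral>\<^sup>+y. ennreal (\<bar>u t y\<bar> * tail_weight s (y - x0)) \<partial>lborel) \<partial>lborel)"
    proof eventually_elim
      case (elim t)
      show ?case
      proof
        assume "t < b"
        then have l2: "l2sq (ball x0 1) (u t) \<le> ennreal (C * m\<^sup>2)" using elim by simp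
        have bound: "(\<integral>\<^sup>+x\<in>ball x0 1. ennreal \<bar>u t x\<bar> \<partial>lborel) \<le> ennreal (\<epsilon> * v + C * m\<^sup>2 / \<epsilon>)" if e: "0 < \<epsilon>" for \<epsilon>
        proof -
          have "(\<integral>\<^sup>+x\<in>ball x0 1. ennreal \<bar>u t x\<bar> \<partial>lborel) = c.absint (\<lambda>x. indicator (ball x0 1) x * u t x)"
            unfolding c.absint_def by (intro nn_integral_cong) (auto simp: indicator_def)
          also have "\<dots> \<le> ennreal \<epsilon> * emeasure lborel (ball x0 1) + ennreal (1 / \<epsilon>) * l2sq (ball x0 1) (\<lambda>x. indicator (ball x0 1) x * u t x)"
            by (rule c.absint_le[OF _ _ _ e]) (auto simp: indicator_def)
          also have "l2sq (ball x0 1) (\<lambda>x. indicator (ball x0 1) x * u t x) \<le> l2sq (ball x0 1) (u t)"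
            by (rule c.l2sq_mult_le) (auto simp: indicator_def)
          also have "ennreal \<epsilon> * emeasure lborel (ball x0 1) + ennreal (1 / \<epsilon>) * l2sq (ball x0 1) (u t) \<le> ennreal \<epsilon> * ennreal v + ennreal (1 / \<epsilon>) * ennreal (C * m\<^sup>2)"
            unfolding vol by (intro add_left_mono mult_left_mono l2) auto
          also have "\<dots> = ennreal (\<epsilon> * v + 1 / \<epsilon> * (C * m\<^sup>2))"
            using e C by (simp add: ennreal_mult ennreal_plus v_def del: times_divide_eq_left)
          finally show ?thesis by (simp add: add_left_mono mult_left_mono)
        qed
        show "(\<integral>\<^sup>+x\<in>ball x0 1. ennreal \<bar>u t x\<bar> \<partial>lborel) \<le> ennreal (v + C) * (\<integral>\<^sup>+t\<in>{..b}. (\<integral>\<^sup>+y. ennreal (\<bar>u t y\<bar> * tail_weight s (y - x0)) \<partial>lborel) \<partial>lborel)"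
        proof (cases "m = 0")
          case True
          have "(\<integral>\<^sup>+x\<in>ball x0 1. ennreal \<bar>u t x\<bar> \<partial>lborel) \<le> 0"
          proof (rule ennreal_le_epsilon)
            fix e :: real assume e: "0 < e"
            have "(\<integral>\<^sup>+x\<in>ball x0 1. ennreal \<bar>u t x\<bar> \<partial>lborel) \<le> ennreal (e / (v + 1) * v)"
              using bound[of "e / (v + 1)"] e True by (simp add: v_def add_nonneg_pos)
            also have "\<dots> \<le> ennreal e"
            proof (rule ennreal_leI)
              have v0: "0 \<le> v" by (simp add: v_def)
              have "e / (v + 1) * v \<le> e / (v + 1) * (v + 1)" using e v0 by (intro mult_left_mono) auto
              also have "\<dots> = e" using v0 by simp
              finally show "e / (v + 1) * v \<le> e" .
            qed
            finally show "(\<integral>\<^sup>+x\<in>ball x0 1. ennreal \<bar>u t x\<bar> \<partial>lborel) \<le> 0 + ennreal e" by simp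
          qed
          then show ?thesis by simp
        next
          case False
          then have "0 < m" using m by simp
          then have "(\<integral>\<^sup>+x\<in>ball x0 1. ennreal \<bar>u t x\<bar> \<partial>lborel) \<le> ennreal ((v + C) * m)"
            using bound[of m] by (simp add: power2_eq_square algebra_simps)
          also have "\<dots> = ennreal (v + C) * I" using m C by (simp add: ennreal_mult v_def)
          finally show ?thesis by (simp add: I_def)
        qed
      qed
    qed
  qed
qed

definition mass :: "real \<Rightarrow> ennreal" where
  "mass t = (\<integral>\<^sup>+x. ennreal (\<bar>u t x\<bar> * tail_weight s x) \<partial>lborel)"

lemma mass_measurable [measurable]: "mass \<in> borel_measurable borel"
  unfolding mass_def[abs_def] by measurable

text \<open>Multiplying the local estimate by \<open>tail_weight s x0\<close> and integrating over \<open>x0\<close> closes up,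
  because the weight is comparable to its convolution with itself and with the indicator of a ball.\<close>

lemma mass_estimate:
  obtains C where "0 \<le> C"
    "\<And>a b. 0 \<le> a \<Longrightarrow> a < b \<Longrightarrow> b < T \<Longrightarrow> AE t in lborel. t < a \<longrightarrow> mass t = 0 \<Longrightarrow>
      (\<integral>\<^sup>+t\<in>{..b}. mass t \<partial>lborel) \<le> ennreal (C * (b - a)) * (\<integral>\<^sup>+t\<in>{..b}. mass t \<partial>lborel)"
proof -
  let ?D = "real DIM('a) + 2 * s"
  obtain C where C: "0 \<le> C" and est: "\<And>x0 b. 0 < b \<Longrightarrow> b < T \<Longrightarrow>
      AE t in lborel. t < b \<longrightarrow> (\<integral>\<^sup>+x\<in>ball x0 1. ennreal \<bar>u t x\<bar> \<partial>lborel) \<le>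
        ennreal C * (\<integral>\<^sup>+t\<in>{..b}. (\<integral>\<^sup>+y. ennreal (\<bar>u t y\<bar> * tail_weight s (y - x0)) \<partial>lborel) \<partial>lborel)"
    by (rule local_L1_estimate) blast
  define w0 where "w0 = unit_ball_vol (real DIM('a))"
  have w0: "0 < w0" by (simp add: w0_def)
  define W where "W = enn2real (\<integral>\<^sup>+z. ennreal (tail_weight s z) \<partial>(lborel :: 'a measure))"
  have W: "(\<integral>\<^sup>+z. ennreal (tail_weight s z) \<partial>(lborel :: 'a measure)) = ennreal W" "0 \<le> W"
    using tail_weight_integrable[OF s(1), where 'a='a] by (auto simp: W_def)
  define C' where "C' = 2 powr ?D / w0 * (C * (2 * 2 powr ?D * W))"
  have C': "0 \<le> C'" using C W w0 by (simp add: C'_def)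
  have t0: "0 \<le> tail_weight s v" for v :: 'a by (auto intro: less_imp_le tail_weight_pos)
  show ?thesis
  proof (rule that[OF C'])
    fix a b :: real assume ab: "0 \<le> a" "a < b" "b < T" and z: "AE t in lborel. t < a \<longrightarrow> mass t = 0"
    have b: "0 < b" using ab by simp
    define I where "I x0 = (\<integral>\<^sup>+t\<in>{..b}. (\<integral>\<^sup>+y. ennreal (\<bar>u t y\<bar> * tail_weight s (y - x0)) \<partial>lborel) \<partial>lborel)" for x0
    have [measurable]: "I \<in> borel_measurable borel" unfolding I_def[abs_def] by measurable
    \<comment> \<open>Written with \<open>dist x0 x < 1\<close> instead of the indicator of a ball
      so that joint measurability in x and \<open>x0\<close> is immediate.\<close>
    define L where "L t x0 = (\<integral>\<^sup>+x. ennreal \<bar>u t x\<bar> * (if dist x0 x < 1 then 1 else 0) \<partial>lborel)" for t x0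
    have Lm [measurable]: "(\<lambda>(t, x0). L t x0) \<in> borel_measurable (borel \<Otimes>\<^sub>M borel)" unfolding L_def by measurable
    have Lb: "L t x0 = (\<integral>\<^sup>+x\<in>ball x0 1. ennreal \<bar>u t x\<bar> \<partial>lborel)" for t x0
      unfolding L_def by (intro nn_integral_cong) (auto simp: indicator_def)
    \<comment> \<open>The volume of the unit ball about x is inserted, and Tonelli exchanges x with
      the centre \<open>x0\<close>; at distance less than 1 the two weights differ by at most the
      power of 2.\<close>
    have lower: "ennreal w0 * mass t \<le> ennreal (2 powr ?D) * (\<integral>\<^sup>+x0. ennreal (tail_weight s x0) * L t x0 \<partial>lborel)" for t
    proof -
      have "ennreal w0 * mass t = (\<integral>\<^sup>+x. (\<integral>\<^sup>+x0. ennreal (\<bar>u t x\<bar> * tail_weight s x) * indicator (ball x 1) x0 \<partial>lborel) \<partial>lborel)"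
        unfolding mass_def
        by (subst nn_integral_cmult[symmetric], measurable, intro nn_integral_cong, subst nn_integral_cmult_indicator)
          (auto simp: emeasure_ball w0_def mult.commute)
      also have "\<dots> \<le> (\<integral>\<^sup>+x. (\<integral>\<^sup>+x0. ennreal (2 powr ?D) * (ennreal (tail_weight s x0) * (ennreal \<bar>u t x\<bar> * (if dist x0 x < 1 then 1 else 0))) \<partial>lborel) \<partial>lborel)"
      proof (intro nn_integral_mono)
        fix x x0 :: 'a
        show "ennreal (\<bar>u t x\<bar> * tail_weight s x) * indicator (ball x 1) x0 \<le> ennreal (2 powr ?D) * (ennreal (tail_weight s x0) * (ennreal \<bar>u t x\<bar> * (if dist x0 x < 1 then 1 else 0)))"
        proof (cases "dist x0 x < 1")
          case True
          have "tail_weight s (x0 - (x0 - x)) \<le> (1 + norm (x0 - x)) powr ?D * tail_weight s x0"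
            by (rule tail_weight_mult_le[OF s(1)])
          also have "\<dots> \<le> 2 powr ?D * tail_weight s x0"
            using True s t0[of x0] by (intro mult_right_mono powr_mono2) (auto simp: dist_norm)
          finally have "\<bar>u t x\<bar> * tail_weight s x \<le> \<bar>u t x\<bar> * (2 powr ?D * tail_weight s x0)"
            by (intro mult_left_mono) auto
          then have "ennreal (\<bar>u t x\<bar> * tail_weight s x) \<le> ennreal (2 powr ?D * (tail_weight s x0 * \<bar>u t x\<bar>))"
            by (intro ennreal_leI) (simp add: mult_ac)
          then show ?thesis using True t0[of x0] by (simp add: ennreal_mult dist_commute)
        qed (simp add: dist_commute)
      qed
      also have "\<dots> = (\<integral>\<^sup>+x0. (\<integral>\<^sup>+x. ennreal (2 powr ?D) * (ennreal (tail_weight s x0) * (ennreal \<bar>u t x\<bar> * (if dist x0 x < 1 then 1 else 0))) \<partial>lborel) \<partial>lborel)"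
        by (rule lborel_pair.Fubini') measurable
      also have "\<dots> = ennreal (2 powr ?D) * (\<integral>\<^sup>+x0. (\<integral>\<^sup>+x. ennreal (tail_weight s x0) * (ennreal \<bar>u t x\<bar> * (if dist x0 x < 1 then 1 else 0)) \<partial>lborel) \<partial>lborel)"
        by (rule nn_integral2_cmult) measurable
      also have "(\<integral>\<^sup>+x0. (\<integral>\<^sup>+x. ennreal (tail_weight s x0) * (ennreal \<bar>u t x\<bar> * (if dist x0 x < 1 then 1 else 0)) \<partial>lborel) \<partial>lborel)
         = (\<integral>\<^sup>+x0. ennreal (tail_weight s x0) * L t x0 \<partial>lborel)"
        unfolding L_def by (intro nn_integral_cong nn_integral_cmult) measurable
      finally show ?thesis .
    qed
    \<comment> \<open>Tonelli moves the integral over the centres inside, where it becomes the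
      convolution of the weight with itself.\<close>
    have upper: "(\<integral>\<^sup>+x0. ennreal (tail_weight s x0) * I x0 \<partial>lborel) \<le> ennreal (2 * 2 powr ?D * W) * (\<integral>\<^sup>+t\<in>{..b}. mass t \<partial>lborel)"
    proof -
      have "(\<integral>\<^sup>+x0. ennreal (tail_weight s x0) * I x0 \<partial>lborel) =
        (\<integral>\<^sup>+x0. (\<integral>\<^sup>+t. (\<integral>\<^sup>+y. ennreal (tail_weight s x0) * ennreal (\<bar>u t y\<bar> * tail_weight s (y - x0)) * indicator {..b} t \<partial>lborel) \<partial>lborel) \<partial>lborel)"
        unfolding I_def
        by (intro nn_integral_cong, subst nn_integral_cmult[symmetric], measurable, intro nn_integral_cong)
          (simp add: nn_integral_cmult nn_integral_multc mult_ac)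
      also have "\<dots> = (\<integral>\<^sup>+t. (\<integral>\<^sup>+x0. (\<integral>\<^sup>+y. ennreal (tail_weight s x0) * ennreal (\<bar>u t y\<bar> * tail_weight s (y - x0)) * indicator {..b} t \<partial>lborel) \<partial>lborel) \<partial>lborel)"
        by (rule lborel_pair.Fubini') measurable
      also have "\<dots> = (\<integral>\<^sup>+t. (\<integral>\<^sup>+y. (\<integral>\<^sup>+x0. ennreal (tail_weight s x0) * ennreal (\<bar>u t y\<bar> * tail_weight s (y - x0)) * indicator {..b} t \<partial>lborel) \<partial>lborel) \<partial>lborel)"
        by (intro nn_integral_cong lborel_pair.Fubini') measurable
      also have "\<dots> \<le> (\<integral>\<^sup>+t. (\<integral>\<^sup>+y. ennreal (2 * 2 powr ?D * W) * (ennreal (\<bar>u t y\<bar> * tail_weight s y) * indicator {..b} t) \<partial>lborel) \<partial>lborel)"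
      proof (intro nn_integral_mono)
        fix t :: real and y :: 'a
        have "(\<integral>\<^sup>+x0. ennreal (tail_weight s x0) * ennreal (\<bar>u t y\<bar> * tail_weight s (y - x0)) * indicator {..b} t \<partial>lborel) =
          (\<integral>\<^sup>+x0. (ennreal \<bar>u t y\<bar> * indicator {..b} t) * ennreal (tail_weight s x0 * tail_weight s (y - x0)) \<partial>lborel)"
          using t0 by (intro nn_integral_cong) (simp add: ennreal_mult mult_ac)
        also have "\<dots> = (ennreal \<bar>u t y\<bar> * indicator {..b} t) * (\<integral>\<^sup>+x0. ennreal (tail_weight s x0 * tail_weight s (y - x0)) \<partial>lborel)"
          by (rule nn_integral_cmult) measurable
        also have "\<dots> \<le> (ennreal \<bar>u t y\<bar> * indicator {..b} t) * (ennreal (2 * 2 powr ?D) * ennreal W * ennreal (tail_weight s y))"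
          using tail_weight_convolution[OF s(1), of y] unfolding W(1) by (intro mult_left_mono) auto
        also have "\<dots> = ennreal (2 * 2 powr ?D * W) * (ennreal (\<bar>u t y\<bar> * tail_weight s y) * indicator {..b} t)"
          using W(2) t0[of y] by (simp add: ennreal_mult mult_ac)
        finally show "(\<integral>\<^sup>+x0. ennreal (tail_weight s x0) * ennreal (\<bar>u t y\<bar> * tail_weight s (y - x0)) * indicator {..b} t \<partial>lborel) \<le>
          ennreal (2 * 2 powr ?D * W) * (ennreal (\<bar>u t y\<bar> * tail_weight s y) * indicator {..b} t)" .
      qed
      also have "\<dots> = ennreal (2 * 2 powr ?D * W) * (\<integral>\<^sup>+t. (\<integral>\<^sup>+y. (ennreal (\<bar>u t y\<bar> * tail_weight s y) * indicator {..b} t) \<partial>lborel) \<partial>lborel)"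
        by (rule nn_integral2_cmult) measurable
      also have "(\<integral>\<^sup>+t. (\<integral>\<^sup>+y. (ennreal (\<bar>u t y\<bar> * tail_weight s y) * indicator {..b} t) \<partial>lborel) \<partial>lborel) = (\<integral>\<^sup>+t\<in>{..b}. mass t \<partial>lborel)"
        unfolding mass_def by (intro nn_integral_cong nn_integral_multc) measurable
      finally show ?thesis .
    qed
    \<comment> \<open>The bound supplied by the local estimate does not depend on t, so integrating
      over [a, b] gains the length b - a, the small factor of the Gronwall step.\<close>
    have L_le: "(\<integral>\<^sup>+t. L t x0 * indicator {a..b} t \<partial>lborel) \<le> ennreal (b - a) * (ennreal C * I x0)" for x0
    proof -
      have "(\<integral>\<^sup>+t. L t x0 * indicator {a..b} t \<partial>lborel) \<le> (\<integral>\<^sup>+t. (ennreal C * I x0) * indicator {a..b} t \<partial>lborel)"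
      proof (rule nn_integral_mono_AE)
        show "AE t in lborel. L t x0 * indicator {a..b} t \<le> (ennreal C * I x0) * indicator {a..b} t"
          using est[OF b ab(3), of x0] AE_lborel_singleton[of b]
          by eventually_elim (auto simp: Lb I_def indicator_def)
      qed
      also have "\<dots> = ennreal (b - a) * (ennreal C * I x0)"
        using ab by (subst nn_integral_cmult_indicator) (auto simp: mult_ac)
      finally show ?thesis .
    qed
    have "ennreal w0 * (\<integral>\<^sup>+t\<in>{..b}. mass t \<partial>lborel) = (\<integral>\<^sup>+t. ennreal w0 * (mass t * indicator {..b} t) \<partial>lborel)"
      by (rule nn_integral_cmult[symmetric]) measurable
    also have "\<dots> \<le> (\<integral>\<^sup>+t. ennreal (2 powr ?D) * (\<integral>\<^sup>+x0. ennreal (tail_weight s x0) * (L t x0 * indicator {a..b} t) \<partial>lborel) \<partial>lborel)"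
    proof (rule nn_integral_mono_AE)
      show "AE t in lborel. ennreal w0 * (mass t * indicator {..b} t) \<le> ennreal (2 powr ?D) * (\<integral>\<^sup>+x0. ennreal (tail_weight s x0) * (L t x0 * indicator {a..b} t) \<partial>lborel)"
        using z
      proof eventually_elim
        case (elim t)
        show ?case
        proof (cases "t \<in> {a..b}")
          case True then show ?thesis using lower[of t] by simp
        next
          case False then show ?thesis using elim by (cases "t < a") auto
        qed
      qed
    qed
    also have "\<dots> = ennreal (2 powr ?D) * (\<integral>\<^sup>+t. (\<integral>\<^sup>+x0. ennreal (tail_weight s x0) * (L t x0 * indicator {a..b} t) \<partial>lborel) \<partial>lborel)"
      by (rule nn_integral_cmult) measurable
    also have "(\<integral>\<^sup>+t. (\<integral>\<^sup>+x0. ennreal (tail_weight s x0) * (L t x0 * indicator {a..b} t) \<partial>lborel) \<partial>lborel)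
       = (\<integral>\<^sup>+x0. (\<integral>\<^sup>+t. ennreal (tail_weight s x0) * (L t x0 * indicator {a..b} t) \<partial>lborel) \<partial>lborel)"
      by (rule lborel_pair.Fubini') measurable
    also have "\<dots> = (\<integral>\<^sup>+x0. ennreal (tail_weight s x0) * (\<integral>\<^sup>+t. L t x0 * indicator {a..b} t \<partial>lborel) \<partial>lborel)"
      by (intro nn_integral_cong nn_integral_cmult) measurable
    also have "\<dots> \<le> (\<integral>\<^sup>+x0. ennreal (tail_weight s x0) * (ennreal (b - a) * (ennreal C * I x0)) \<partial>lborel)"
      by (intro nn_integral_mono mult_left_mono L_le) auto
    also have "\<dots> = (\<integral>\<^sup>+x0. ennreal (b - a) * ennreal C * (ennreal (tail_weight s x0) * I x0) \<partial>lborel)"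
      by (simp only: mult_ac)
    also have "\<dots> = ennreal (b - a) * ennreal C * (\<integral>\<^sup>+x0. ennreal (tail_weight s x0) * I x0 \<partial>lborel)"
      by (rule nn_integral_cmult) measurable
    also have "ennreal (2 powr ?D) * (ennreal (b - a) * ennreal C * (\<integral>\<^sup>+x0. ennreal (tail_weight s x0) * I x0 \<partial>lborel))
      \<le> ennreal (2 powr ?D) * (ennreal (b - a) * ennreal C * (ennreal (2 * 2 powr ?D * W) * (\<integral>\<^sup>+t\<in>{..b}. mass t \<partial>lborel)))"
      by (intro mult_left_mono upper) auto
    finally have main: "ennreal w0 * (\<integral>\<^sup>+t\<in>{..b}. mass t \<partial>lborel) \<le>
      ennreal (2 powr ?D) * (ennreal (b - a) * ennreal C * (ennreal (2 * 2 powr ?D * W) * (\<integral>\<^sup>+t\<in>{..b}. mass t \<partial>lborel)))"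
      by (simp add: mult_left_mono)
    have "(\<integral>\<^sup>+t\<in>{..b}. mass t \<partial>lborel) = ennreal (1 / w0) * (ennreal w0 * (\<integral>\<^sup>+t\<in>{..b}. mass t \<partial>lborel))"
      using w0 by (simp only: mult.assoc[symmetric]) (simp add: ennreal_mult[symmetric])
    also have "\<dots> \<le> ennreal (1 / w0) * (ennreal (2 powr ?D) * (ennreal (b - a) * ennreal C * (ennreal (2 * 2 powr ?D * W) * (\<integral>\<^sup>+t\<in>{..b}. mass t \<partial>lborel))))"
      by (intro mult_left_mono main) auto
    also have "\<dots> = (ennreal (1 / w0) * ennreal (2 powr ?D) * ennreal (b - a) * ennreal C * ennreal (2 * 2 powr ?D * W)) * (\<integral>\<^sup>+t\<in>{..b}. mass t \<partial>lborel)"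
      by (simp only: mult.assoc)
    also have "ennreal (1 / w0) * ennreal (2 powr ?D) * ennreal (b - a) * ennreal C * ennreal (2 * 2 powr ?D * W) = ennreal (C' * (b - a))"
    proof -
      have e5: "ennreal q1 * ennreal q2 * ennreal q3 * ennreal q4 * ennreal q5 = ennreal (q1 * q2 * q3 * q4 * q5)"
        if "0 \<le> q1" "0 \<le> q2" "0 \<le> q3" "0 \<le> q4" "0 \<le> q5" for q1 q2 q3 q4 q5
        using that by (simp add: ennreal_mult)
      have "C' * (b - a) = 1 / w0 * 2 powr ?D * (b - a) * C * (2 * 2 powr ?D * W)" by (simp add: C'_def)
      then show ?thesis using w0 ab C W by (subst e5) auto
    qed
    finally show "(\<integral>\<^sup>+t\<in>{..b}. mass t \<partial>lborel) \<le> ennreal (C' * (b - a)) * (\<integral>\<^sup>+t\<in>{..b}. mass t \<partial>lborel)" .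
  qed
qed

text \<open>Gronwall by steps of fixed length: on each step the mass integral is at most half of
  itself and, being finite, zero.\<close>

theorem unique: "AE t in lborel. AE x in lborel. u t x = 0"
proof -
  obtain C where C: "0 \<le> C" and est: "\<And>a b. 0 \<le> a \<Longrightarrow> a < b \<Longrightarrow> b < T \<Longrightarrow> AE t in lborel. t < a \<longrightarrow> mass t = 0 \<Longrightarrow>
      (\<integral>\<^sup>+t\<in>{..b}. mass t \<partial>lborel) \<le> ennreal (C * (b - a)) * (\<integral>\<^sup>+t\<in>{..b}. mass t \<partial>lborel)"
    by (rule mass_estimate) blast
  have fin: "(\<integral>\<^sup>+t\<in>{..b}. mass t \<partial>lborel) < \<infinity>" for b
  proof -
    have "(\<integral>\<^sup>+t\<in>{..b}. mass t \<partial>lborel) \<le> (\<integral>\<^sup>+t. mass t \<partial>lborel)"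
      by (intro nn_integral_mono) (auto simp: indicator_def)
    then show ?thesis using u_L1 by (auto simp: mass_def intro: le_less_trans)
  qed
  \<comment> \<open>Keeps C times the step length at most 1/2; C + 1 avoids division by 0.\<close>
  define \<tau> where "\<tau> = 1 / (2 * (C + 1))"
  have \<tau>: "0 < \<tau>" using C by (simp add: \<tau>_def)
  have step: "AE t in lborel. t < b \<longrightarrow> mass t = 0"
    if a: "0 \<le> a" "AE t in lborel. t < a \<longrightarrow> mass t = 0" and b: "a < b" "b \<le> a + \<tau>" "b < T" for a b
  proof -
    define Z where "Z = (\<integral>\<^sup>+t\<in>{..b}. mass t \<partial>lborel)"
    obtain z where z: "0 \<le> z" "Z = ennreal z" using fin[of b] by (cases Z) (auto simp: Z_def)
    have "C * (b - a) \<le> (C + 1) * \<tau>" using C b by (intro mult_mono) auto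
    also have "\<dots> = 1 / 2" using C by (simp add: \<tau>_def field_simps)
    finally have half: "C * (b - a) \<le> 1 / 2" .
    have "Z \<le> ennreal (C * (b - a)) * Z" unfolding Z_def by (rule est[OF a(1) b(1,3) a(2)])
    also have "\<dots> \<le> ennreal (1 / 2) * Z" by (intro mult_right_mono ennreal_leI half) auto
    finally have "ennreal z \<le> ennreal (1 / 2 * z)" unfolding z by (subst ennreal_mult) (use z in auto)
    then have "z \<le> 1 / 2 * z" using z by (subst (asm) ennreal_le_iff) auto
    then have "z = 0" using z by simp
    then have "Z = 0" using z by simp
    then have "AE t in lborel. mass t * indicator {..b} t = 0" unfolding Z_def by (subst (asm) nn_integral_0_iff_AE) auto
    then show ?thesis by eventually_elim (auto simp: indicator_def)
  qed
  have m0: "mass t = 0" if "t \<le> 0 \<or> T \<le> t" for t using u_zero[OF that] by (simp add: mass_def)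
  have all: "AE t in lborel. t < b \<longrightarrow> mass t = 0" if "0 \<le> b" "b < T" "b \<le> real n * \<tau>" for n b
    using that
  proof (induction n arbitrary: b)
    case 0
    then show ?case using m0 by auto
  next
    case (Suc n)
    define a where "a = max 0 (b - \<tau>)"
    show ?case
    proof (cases "a < b")
      case True
      show ?thesis
      proof (rule step[of a])
        show "AE t in lborel. t < a \<longrightarrow> mass t = 0"
          using Suc.prems \<tau> by (intro Suc.IH) (auto simp: a_def algebra_simps)
      qed (use True Suc.prems \<tau> in \<open>auto simp: a_def\<close>)
    next
      case False
      then have "b \<le> 0" using \<tau> by (auto simp: a_def)
      then show ?thesis using m0 by auto
    qed
  qed
  \<comment> \<open>The estimates require b < T, so (0, T) is exhausted by the times T -
    T/(j+1).\<close>
  have "AE t in lborel. \<forall>j::nat. t < T - T / real (Suc j) \<longrightarrow> mass t = 0"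
    unfolding AE_all_countable
  proof
    fix j :: nat
    obtain n :: nat where "(T - T / real (Suc j)) / \<tau> \<le> real n" using real_arch_simple by blast
    then have "T - T / real (Suc j) \<le> real n * \<tau>" using \<tau> by (simp add: pos_divide_le_eq)
    moreover have "0 \<le> T - T / real (Suc j)" using T by (simp add: field_simps)
    moreover have "T - T / real (Suc j) < T" using T by simp
    ultimately show "AE t in lborel. t < T - T / real (Suc j) \<longrightarrow> mass t = 0" by (intro all)
  qed
  then show ?thesis
  proof eventually_elim
    case (elim t)
    have "mass t = 0"
    proof (cases "t < T")
      case True
      obtain j :: nat where "T / (T - t) \<le> real j" using real_arch_simple by blast
      then have "T / (T - t) < real (Suc j)" by simp
      then have "t < T - T / real (Suc j)" using True by (simp add: field_simps)
      then show ?thesis using elim by blast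
    qed (use m0 in auto)
    then have "AE x in lborel. ennreal (\<bar>u t x\<bar> * tail_weight s x) = 0"
      unfolding mass_def by (subst (asm) nn_integral_0_iff_AE) auto
    then show "AE x in lborel. u t x = 0"
    proof eventually_elim
      case (elim x)
      then show ?case using tail_weight_pos[of s x] by (simp add: ennreal_eq_0_iff mult_le_0_iff)
    qed
  qed
qed

end

section \<open>From Lebesgue to Borel measurable solutions\<close>

text \<open>By completeness of Lebesgue measure a function that agrees a.e. with a Borel function is
  itself measurable, so the integrals of the original formulation can be rewritten with Borel
  data.\<close>

lemma integral_lebesgue_cong:
  fixes f g :: "'c::euclidean_space \<Rightarrow> real"
  assumes g: "g \<in> borel_measurable borel" and ae: "AE x in lborel. f x = g x"
  shows "(\<integral>x. f x \<partial>lebesgue) = (\<integral>x. g x \<partial>lborel)"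
proof -
  have g': "g \<in> borel_measurable lebesgue" using g by (intro measurable_completion) simp
  have "AE x in lebesgue. g x = f x" using ae by (simp add: AE_completion_iff eq_commute)
  from borel_measurable_AE[OF g' this] have f: "f \<in> borel_measurable lebesgue" .
  have "(\<integral>x. f x \<partial>lebesgue) = (\<integral>x. g x \<partial>lebesgue)"
    by (rule integral_cong_AE[OF f g']) (use ae in \<open>simp add: AE_completion_iff\<close>)
  also have "\<dots> = (\<integral>x. g x \<partial>lborel)" by (rule integral_completion) (use g in simp)
  finally show ?thesis .
qed

lemma nn_integral_lebesgue_cong:
  assumes "AE x in lborel. f x = g x"
  shows "(\<integral>\<^sup>+x. f x \<partial>lebesgue) = (\<integral>\<^sup>+x. g x \<partial>lborel)"
  unfolding nn_integral_completion by (rule nn_integral_cong_AE[OF assms])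

lemma AE_lborel_pair:
  assumes "AE p in (lborel :: ('c::euclidean_space \<times> 'd::euclidean_space) measure). P p"
  shows "AE x in lborel. AE y in lborel. P (x, y)"
  using assms unfolding lborel_prod[symmetric] by (rule lborel_pair.AE_pair)

text \<open>Makes a.e. equality of functions on space usable inside integrals over pairs of
  points.\<close>

lemma AE_lborel_fst_snd:
  assumes "AE x in (lborel :: 'c::euclidean_space measure). P x"
  shows "AE p in (lborel :: ('c \<times> 'c) measure). P (fst p) \<and> P (snd p)"
proof -
  obtain N where N: "N \<in> null_sets lborel" "{x. \<not> P x} \<subseteq> N"
    using assms by (auto elim!: AE_E simp: null_sets_def)
  have [measurable]: "N \<in> sets borel" using N(1) by auto
  have n: "AE x in lborel. x \<notin> N" using N(1) by (rule AE_not_in)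
  have "AE p in lborel \<Otimes>\<^sub>M lborel. fst p \<notin> N \<and> snd p \<notin> N"
  proof (rule lborel_pair.AE_pair_measure)
    show "{p \<in> space (lborel \<Otimes>\<^sub>M lborel). fst p \<notin> N \<and> snd p \<notin> N} \<in> sets (lborel \<Otimes>\<^sub>M lborel)" by measurable
    show "AE x in lborel. AE y in lborel. fst (x, y) \<notin> N \<and> snd (x, y) \<notin> N"
      using n by eventually_elim (use n in auto)
  qed
  then have "AE p in (lborel :: ('c \<times> 'c) measure). fst p \<notin> N \<and> snd p \<notin> N" by (simp only: lborel_prod)
  then show ?thesis by eventually_elim (use N in auto)
qed

lemma borel_version_real:
  fixes f :: "'c::euclidean_space \<Rightarrow> real"
  assumes f: "f \<in> borel_measurable (lebesgue_on S)" and S: "S \<in> sets lebesgue"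
  obtains g where "g \<in> borel_measurable borel" "AE x in lborel. x \<in> S \<longrightarrow> f x = g x"
proof -
  have "(\<lambda>x. indicator S x *\<^sub>R f x) \<in> borel_measurable lebesgue"
    using f S by (subst (asm) borel_measurable_restrict_space_iff) auto
  from completion_ex_borel_measurable_real[OF this]
  obtain g where g: "g \<in> borel_measurable lborel" "AE x in lborel. indicator S x *\<^sub>R f x = g x" by auto
  from g(2) have "AE x in lborel. x \<in> S \<longrightarrow> f x = g x" by eventually_elim auto
  then show ?thesis using g(1) that by auto
qed

lemma L2_sqnorm_eq:
  assumes "AE x in lborel. v x = V x" shows "L2_sqnorm A v = l2sq A V"
  unfolding L2_sqnorm_def l2sq_def
  by (rule nn_integral_lebesgue_cong) (use assms in \<open>auto elim!: eventually_mono\<close>)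

lemma Hs_sqseminorm_eq:
  fixes v :: "'a::euclidean_space \<Rightarrow> real"
  assumes ae: "AE x in lborel. v x = V x" and [measurable]: "V \<in> borel_measurable borel" "A \<in> sets borel"
  shows "Hs_sqseminorm s A v = hsq s A V"
proof -
  define g where "g p = ennreal ((V (fst p) - V (snd p))\<^sup>2 * riesz s (fst p - snd p)) * indicator A (snd p) * indicator A (fst p)" for p :: "'a \<times> 'a"
  have gm [measurable]: "g \<in> borel_measurable borel"
    unfolding borel_prod[symmetric] g_def[abs_def] by measurable
  have "Hs_sqseminorm s A v = (\<integral>\<^sup>+p. g p \<partial>lborel)"
    unfolding Hs_sqseminorm_def
  proof (rule nn_integral_lebesgue_cong)
    show "AE p in lborel. (case p of (x, y) \<Rightarrow> ennreal ((v x - v y)\<^sup>2 / norm (x - y) powr (real DIM('a) + 2 * s))) * indicator (A \<times> A) p = g p"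
      using AE_lborel_fst_snd[OF ae]
    proof eventually_elim
      case (elim p)
      have "norm z powr (- real DIM('a) - 2 * s) = 1 / norm z powr (real DIM('a) + 2 * s)" for z :: 'a
        using powr_minus_divide[of "norm z" "real DIM('a) + 2 * s"] by simp
      then show ?case using elim
        by (cases p) (auto simp: g_def riesz_def indicator_def)
    qed
  qed
  also have "\<dots> = (\<integral>\<^sup>+x. \<integral>\<^sup>+y. g (x, y) \<partial>lborel \<partial>lborel)" by (rule nn_integral_lborel2) measurable
  also have "\<dots> = hsq s A V"
    unfolding hsq_def g_def fst_conv snd_conv by (rule nn_integral2_indicator[symmetric]) measurable
  finally show ?thesis .
qed

lemma bounded_of_cont_support:
  fixes f :: "real \<Rightarrow> real"
  assumes "continuous_on UNIV f" "\<And>t. t \<notin> {a..b} \<Longrightarrow> f t = 0"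
  obtains C where "0 \<le> C" "\<And>t. \<bar>f t\<bar> \<le> C"
proof -
  have "bounded (f ` {a..b})"
    by (intro compact_imp_bounded compact_continuous_image continuous_on_subset[OF assms(1)]) auto
  then obtain C where "\<forall>x\<in>{a..b}. \<bar>f x\<bar> \<le> C" unfolding bounded_iff by auto
  then have C: "\<And>t. t \<in> {a..b} \<Longrightarrow> \<bar>f t\<bar> \<le> C" by blast
  have "\<bar>f t\<bar> \<le> max 0 C" for t using C[of t] assms(2)[of t] by (cases "t \<in> {a..b}") auto
  then show ?thesis by (intro that[of "max 0 C"]) auto
qed

text \<open>Couples a solution \<open>u\<close> and the kernel \<open>K\<close> with Borel versions
  \<open>U\<close> and \<open>k\<close>. The equalities hold almost everywhere, whereas the bounds
  on \<open>k\<close> and the vanishing of \<open>U\<close> outside (0, T) are imposed everywhere,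
  as the abstract part of the proof expects.\<close>

locale borel_solution =
  fixes s T \<Lambda> :: real and K :: "real \<Rightarrow> 'a::euclidean_space \<Rightarrow> 'a \<Rightarrow> ennreal" and k :: "real \<Rightarrow> 'a \<Rightarrow> 'a \<Rightarrow> real"
    and u U :: "real \<Rightarrow> 'a \<Rightarrow> real"
  assumes sT: "0 < s" "s < 1" "0 < T" "0 < \<Lambda>"
    and kb: "(\<lambda>(t, x, y). k t x y) \<in> borel_measurable borel" "\<And>t x y. 0 \<le> k t x y" "\<And>t x y. k t x y \<le> \<Lambda> * riesz s (x - y)"
    and kK: "AE t in lborel. 0 < t \<and> t < T \<longrightarrow> (AE p in lborel. enn2real (K t (fst p) (snd p)) = k t (fst p) (snd p))"
    and Ub: "(\<lambda>(t, x). U t x) \<in> borel_measurable borel" "\<And>t x. t \<le> 0 \<or> T \<le> t \<Longrightarrow> U t x = 0"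
    and uU: "AE p in lborel. 0 < fst p \<and> fst p < T \<longrightarrow> u (fst p) (snd p) = U (fst p) (snd p)"
    and sol: "solution_class s {0<..<T} UNIV u"
begin

lemma uU_slice: "AE t in lborel. 0 < t \<and> t < T \<longrightarrow> (AE x in lborel. u t x = U t x)"
  using AE_lborel_pair[OF uU] by eventually_elim auto

lemma U_slice: "U t \<in> borel_measurable borel"
  using measurable_compose[OF borel_measurable_Pair[OF measurable_const measurable_ident] Ub(1), of t] by simp

sublocale nonlocal_data s T \<Lambda> k U
proof unfold_locales
  fix R :: real
  have "compact (cball (0::'a) R)" by simp
  then obtain M :: real where M: "AE t in lebesgue_on {0<..<T}. L2_sqnorm (cball 0 R) (u t) \<le> ennreal M"
    using sol unfolding solution_class_def Linf_L2loc_def by blast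
  then have "AE t in lebesgue. t \<in> {0<..<T} \<longrightarrow> L2_sqnorm (cball 0 R) (u t) \<le> ennreal M"
    by (subst (asm) AE_restrict_space_iff) auto
  then have "AE t in lborel. t \<in> {0<..<T} \<longrightarrow> L2_sqnorm (cball 0 R) (u t) \<le> ennreal M" by (simp add: AE_completion_iff)
  then have "AE t in lborel. l2sq (ball 0 R) (U t) \<le> ennreal M"
    using uU_slice
  proof eventually_elim
    case (elim t)
    show ?case
    proof (cases "0 < t \<and> t < T")
      case True
      then have "l2sq (cball 0 R) (U t) \<le> ennreal M" using elim L2_sqnorm_eq[of "u t" "U t" "cball 0 R"] by auto
      then show ?thesis using l2sq_mono[of "ball 0 R" "cball 0 R" "U t"] by (auto intro: order_trans)
    next
      case False
      then have "U t x = 0" for x by (intro Ub(2)) auto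
      then show ?thesis by (simp add: l2sq_def)
    qed
  qed
  then show "\<exists>M::real. AE t in lborel. l2sq (ball 0 R) (U t) \<le> ennreal M" by blast
next
  fix R :: real
  have "compact (closure (ball (0::'a) R))" by simp
  then have fin: "(\<integral>\<^sup>+t\<in>{0<..<T}. (L2_sqnorm (ball 0 R) (u t) + Hs_sqseminorm s (ball 0 R) (u t)) \<partial>lebesgue) < \<infinity>"
    using sol unfolding solution_class_def L2_Hsloc_def L2_Hs_def by (metis open_ball subset_UNIV)
  have "(\<integral>\<^sup>+t. hsq s (ball 0 R) (U t) \<partial>lborel) \<le> (\<integral>\<^sup>+t. (L2_sqnorm (ball 0 R) (u t) + Hs_sqseminorm s (ball 0 R) (u t)) * indicator {0<..<T} t \<partial>lborel)"
  proof (rule nn_integral_mono_AE)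
    show "AE t in lborel. hsq s (ball 0 R) (U t) \<le> (L2_sqnorm (ball 0 R) (u t) + Hs_sqseminorm s (ball 0 R) (u t)) * indicator {0<..<T} t"
      using uU_slice
    proof eventually_elim
      case (elim t)
      show ?case
      proof (cases "0 < t \<and> t < T")
        case True
        then have "Hs_sqseminorm s (ball 0 R) (u t) = hsq s (ball 0 R) (U t)"
          using elim U_slice by (intro Hs_sqseminorm_eq) auto
        then show ?thesis using True by simp
      next
        case False
        then have "U t x = 0" for x by (intro Ub(2)) auto
        then show ?thesis by (simp add: hsq_def)
      qed
    qed
  qed
  also have "\<dots> < \<infinity>" using fin by (simp add: nn_integral_completion)
  finally show "(\<integral>\<^sup>+t. hsq s (ball 0 R) (U t) \<partial>lborel) < \<infinity>" .
next
  have fin: "(\<integral>\<^sup>+t\<in>{0<..<T}. (\<integral>\<^sup>+x. ennreal (\<bar>u t x\<bar> * tail_weight s x) \<partial>lebesgue) \<partial>lebesgue) < \<infinity>"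
    using sol unfolding solution_class_def L1_L1w_def by blast
  have "(\<integral>\<^sup>+t. (\<integral>\<^sup>+x. ennreal (\<bar>U t x\<bar> * tail_weight s x) \<partial>lborel) \<partial>lborel) \<le>
    (\<integral>\<^sup>+t. (\<integral>\<^sup>+x. ennreal (\<bar>u t x\<bar> * tail_weight s x) \<partial>lebesgue) * indicator {0<..<T} t \<partial>lborel)"
  proof (rule nn_integral_mono_AE)
    show "AE t in lborel. (\<integral>\<^sup>+x. ennreal (\<bar>U t x\<bar> * tail_weight s x) \<partial>lborel) \<le> (\<integral>\<^sup>+x. ennreal (\<bar>u t x\<bar> * tail_weight s x) \<partial>lebesgue) * indicator {0<..<T} t"
      using uU_slice
    proof eventually_elim
      case (elim t)
      show ?case
      proof (cases "0 < t \<and> t < T")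
        case True
        then have "(\<integral>\<^sup>+x. ennreal (\<bar>u t x\<bar> * tail_weight s x) \<partial>lebesgue) = (\<integral>\<^sup>+x. ennreal (\<bar>U t x\<bar> * tail_weight s x) \<partial>lborel)"
          using elim by (intro nn_integral_lebesgue_cong) (auto elim!: eventually_mono)
        then show ?thesis using True by simp
      next
        case False
        then have "U t x = 0" for x by (intro Ub(2)) auto
        then show ?thesis by simp
      qed
    qed
  qed
  also have "\<dots> < \<infinity>" using fin by (simp add: nn_integral_completion)
  finally show "(\<integral>\<^sup>+t. (\<integral>\<^sup>+x. ennreal (\<bar>U t x\<bar> * tail_weight s x) \<partial>lborel) \<partial>lborel) < \<infinity>" .
qed (use sT kb Ub in auto)

text \<open>The factor \<open>c\<close> will be the value of the time weight at the fixed time of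
  the slice.\<close>

lemma energy_eq:
  assumes t: "AE p in lborel. enn2real (K t (fst p) (snd p)) = k t (fst p) (snd p)" "AE x in lborel. u t x = U t x"
    and [measurable]: "\<psi> \<in> borel_measurable borel"
  shows "energy (K t) (u t) (\<lambda>x. c * \<psi> x) = c * form (k t) (U t) \<psi>"
proof -
  define g where "g p = c * ((U t (fst p) - U t (snd p)) * (\<psi> (fst p) - \<psi> (snd p)) * k t (fst p) (snd p))" for p
  have gm: "g \<in> borel_measurable borel"
    unfolding borel_prod[symmetric] g_def[abs_def] by measurable
  have "energy (K t) (u t) (\<lambda>x. c * \<psi> x) = (\<integral>p. g p \<partial>lborel)"
    unfolding energy_def
  proof (rule integral_lebesgue_cong[OF gm])
    show "AE p in lborel. (case p of (x, y) \<Rightarrow> (u t x - u t y) * (c * \<psi> x - c * \<psi> y) * enn2real (K t x y)) = g p"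
      using t(1) AE_lborel_fst_snd[OF t(2)]
      by eventually_elim (simp add: g_def case_prod_beta algebra_simps)
  qed
  also have "\<dots> = c * (\<integral>p. (U t (fst p) - U t (snd p)) * (\<psi> (fst p) - \<psi> (snd p)) * k t (fst p) (snd p) \<partial>lborel)"
    unfolding g_def by (rule integral_mult_right_zero)
  also have "\<dots> = c * form (k t) (U t) \<psi>"
    unfolding form_def lborel_prod case_prod_beta' ..
  finally show ?thesis .
qed

text \<open>The link to the original weak formulation: the product of \<eta> and \<psi> is a
  legitimate test function whose weak time derivative is the product of \<open>\<eta>'\<close> and
  \<psi>, and the inequalities for super- and subsolution combine to an equation.\<close>

lemma weak_form_nonneg:
  assumes cauchy: "cauchy_solution s K T \<mu> u"
    and \<eta>: "\<And>t. (\<eta> has_real_derivative \<eta>' t) (at t)" "continuous_on UNIV \<eta>'"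
    and \<eta>0: "\<And>t. 0 \<le> \<eta> t" and ab: "0 < a" "b < T" "\<And>t. t \<le> a \<or> b \<le> t \<Longrightarrow> \<eta> t = 0"
    and \<psi>m [measurable]: "\<psi> \<in> borel_measurable borel" and \<psi>0: "\<And>x. 0 \<le> \<psi> x"
    and \<rho>: "\<rho> < 2" "\<And>x. \<rho> \<le> dist x0 x \<Longrightarrow> \<psi> x = 0"
    and fin: "l2sq UNIV \<psi> < \<infinity>" "hsq s UNIV \<psi> < \<infinity>"
  shows "(\<integral>t. \<eta> t * form (k t) (U t) \<psi> \<partial>lborel) = (\<integral>t. \<eta>' t * (\<integral>x. U t x * \<psi> x \<partial>lborel) \<partial>lborel)"
proof -
  define \<delta> where "\<delta> = (2 - max 0 \<rho>) / 2"
  interpret ball: nonlocal_ball s T \<Lambda> k U x0 "max 0 \<rho>" \<delta>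
    by unfold_locales (use \<rho> in \<open>auto simp: \<delta>_def max_def field_simps\<close>)
  have \<delta>0: "0 < \<delta>" using \<rho> by (simp add: \<delta>_def)
  have adm: "ball.adm \<psi>"
    unfolding ball.adm_def
  proof (intro conjI allI impI)
    show "\<psi> x = 0" if "max 0 \<rho> + \<delta> \<le> dist x0 x" for x using that \<delta>0 by (intro \<rho>(2)) auto
    show "l2sq ball.B \<psi> < \<infinity>" using l2sq_mono[of ball.B UNIV \<psi>] fin(1) by (auto intro: le_less_trans)
    show "hsq s ball.B \<psi> < \<infinity>" using hsq_mono[of ball.B UNIV s \<psi>] fin(2) by (auto intro: le_less_trans)
  qed measurable
  \<comment> \<open>\<open>a\<close> and \<open>b\<close> need not be ordered; comparing both with
    T/2 orders them and only enlarges the interval that carries \<eta>.\<close>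
  define a' b' where "a' = min a (T / 2)" and "b' = max b (T / 2)"
  have ab': "0 < a'" "a' \<le> b'" "b' < T" "\<eta> t = 0" if "t \<notin> {a'<..<b'}" for t
  proof -
    have "t \<le> a \<or> b \<le> t" using that by (auto simp: a'_def b'_def)
    then show "\<eta> t = 0" by (rule ab(3))
  qed (use ab sT in \<open>auto simp: a'_def b'_def min_def max_def\<close>)
  \<comment> \<open>Instantiation at \<open>a'\<close>, which lies outside the open interval,
    discharges the premise of the first three facts.\<close>
  note ab' = ab'(1-3)[of a', simplified] ab'(4)
  \<comment> \<open>The equation is available on intervals with positive left end; (a'/2, T)
    contains the closed interval [a', b'] carrying \<eta>.\<close>
  define \<epsilon> where "\<epsilon> = a' / 2"
  define I where "I = {\<epsilon><..<T}"
  have Isub: "{a'..b'} \<subseteq> I" using ab' by (auto simp: I_def \<epsilon>_def)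
  have I0: "t \<in> I \<Longrightarrow> 0 < t \<and> t < T" for t using ab' by (auto simp: I_def \<epsilon>_def)
  have \<epsilon>: "\<epsilon> \<in> {0<..<T}" using ab' by (auto simp: \<epsilon>_def)
  have \<eta>z: "\<eta> t = 0" if "t \<notin> {a'..b'}" for t using that ab'(4)[of t] by auto
  have \<eta>'z: "\<eta>' t = 0" if "t \<notin> {a'..b'}" for t
  proof -
    have "((\<lambda>_. 0) has_real_derivative 0) (at t)" by simp
    then have "(\<eta> has_real_derivative 0) (at t)"
      by (rule has_field_derivative_transform_within_open[where S = "- {a'..b'}"]) (use that \<eta>z in auto)
    then show ?thesis using DERIV_unique[OF \<eta>(1)] by blast
  qed
  have \<eta>I: "\<eta> t = 0" "\<eta>' t = 0" if "t \<notin> I" for t using that Isub \<eta>z[of t] \<eta>'z[of t] by blast+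
  have \<eta>c: "continuous_on UNIV \<eta>" using \<eta>(1) by (intro DERIV_continuous_on) (auto intro: has_field_derivative_at_within)
  have [measurable]: "\<eta> \<in> borel_measurable borel" "\<eta>' \<in> borel_measurable borel"
    using \<eta>c \<eta>(2) by (auto intro: borel_measurable_continuous_onI)
  obtain C1 where C1: "0 \<le> C1" "\<And>t. \<bar>\<eta> t\<bar> \<le> C1" using bounded_of_cont_support[OF \<eta>c \<eta>z] by blast
  obtain C2 where C2: "0 \<le> C2" "\<And>t. \<bar>\<eta>' t\<bar> \<le> C2" using bounded_of_cont_support[OF \<eta>(2) \<eta>'z] by blast
  \<comment> \<open>The closed ball of radius 2 about \<open>x0\<close>, which contains the support
    of \<psi>, lies in the open ball of radius \<open>R\<close> about 0.\<close>
  define R where "R = norm x0 + 3"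
  have \<psi>R: "\<psi> x = 0" if "x \<notin> ball 0 R" for x
  proof (rule \<rho>(2))
    have "R \<le> norm x" using that by simp
    also have "\<dots> \<le> dist x0 x + norm x0" using norm_triangle_ineq[of "x - x0" x0] by (simp add: dist_norm norm_minus_commute)
    finally show "\<rho> \<le> dist x0 x" using \<rho>(1) by (simp add: R_def)
  qed
  define \<phi> where "\<phi> t x = \<eta> t * \<psi> x" for t x
  define g where "g t x = \<eta>' t * \<psi> x" for t x
  have prodm: "(\<lambda>(t, x). f t * \<psi> x) \<in> borel_measurable (lebesgue_on (I \<times> A))" if [measurable]: "f \<in> borel_measurable borel" for f :: "real \<Rightarrow> real" and A
  proof -
    have "(\<lambda>(t, x). f t * \<psi> x) \<in> borel_measurable borel" unfolding borel_prod[symmetric] by measurable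
    then have "(\<lambda>(t, x). f t * \<psi> x) \<in> borel_measurable lebesgue" by (intro measurable_completion) simp
    then show ?thesis by (rule measurable_restrict_space1)
  qed
  have l2prod: "L2_sqnorm A (\<lambda>x. c * \<psi> x) \<le> ennreal (c\<^sup>2) * l2sq UNIV \<psi>" for c and A :: "'a set"
  proof -
    have "L2_sqnorm A (\<lambda>x. c * \<psi> x) = l2sq A (\<lambda>x. c * \<psi> x)" by (rule L2_sqnorm_eq) simp
    also have "\<dots> \<le> l2sq UNIV (\<lambda>x. c * \<psi> x)" by (rule l2sq_mono) simp
    also have "\<dots> = ennreal (c\<^sup>2) * l2sq UNIV \<psi>"
      unfolding l2sq_def by (subst nn_integral_cmult[symmetric]) (auto simp: power_mult_distrib ennreal_mult)
    finally show ?thesis .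
  qed
  have hsprod: "Hs_sqseminorm s UNIV (\<lambda>x. c * \<psi> x) = ennreal (c\<^sup>2) * hsq s UNIV \<psi>" for c
  proof -
    have "Hs_sqseminorm s UNIV (\<lambda>x. c * \<psi> x) = hsq s UNIV (\<lambda>x. c * \<psi> x)" by (rule Hs_sqseminorm_eq) auto
    also have "\<dots> = (\<integral>\<^sup>+x. \<integral>\<^sup>+y. ennreal (c\<^sup>2) * ennreal ((\<psi> x - \<psi> y)\<^sup>2 * riesz s (x - y)) \<partial>lborel \<partial>lborel)"
    proof -
      have "(c * p - c * q)\<^sup>2 = c\<^sup>2 * (p - q)\<^sup>2" for p q :: real by (simp add: power_mult_distrib flip: right_diff_distrib)
      then show ?thesis unfolding hsq_def by (simp add: ennreal_mult mult.assoc)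
    qed
    also have "\<dots> = ennreal (c\<^sup>2) * hsq s UNIV \<psi>"
      unfolding hsq_def by (subst nn_integral2_cmult) measurable
    finally show ?thesis .
  qed
  have timefin: "(\<integral>\<^sup>+t\<in>I. F t \<partial>lebesgue) < \<infinity>" if "\<And>t. F t \<le> ennreal c * G" "G < \<infinity>" for F :: "real \<Rightarrow> ennreal" and c G
  proof -
    have "(\<integral>\<^sup>+t\<in>I. F t \<partial>lebesgue) \<le> (\<integral>\<^sup>+t. (ennreal c * G) * indicator {0..T} t \<partial>lborel)"
      unfolding nn_integral_completion
      by (intro nn_integral_mono mult_mono that) (use I0 in \<open>auto simp: indicator_def less_imp_le\<close>)
    also have "\<dots> < \<infinity>" using that(2) emeasure_lborel_cbox_finite[of 0 T]
      by (auto simp: nn_integral_cmult_indicator ennreal_mult_less_top)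
    finally show ?thesis .
  qed
  have sqle: "c\<^sup>2 \<le> C\<^sup>2" if "\<bar>c\<bar> \<le> C" for c C :: real using that by (simp add: abs_le_square_iff[symmetric])
  have H1: "H1_L2 I (ball 0 R) \<phi> g"
    unfolding H1_L2_def L2_L2_def meas_on_def
  proof (intro conjI ballI)
    show "(\<lambda>(t, x). \<phi> t x) \<in> borel_measurable (lebesgue_on (I \<times> ball 0 R))" unfolding \<phi>_def by (rule prodm) measurable
    show "(\<lambda>(t, x). g t x) \<in> borel_measurable (lebesgue_on (I \<times> ball 0 R))" unfolding g_def by (rule prodm) measurable
    show "(\<integral>\<^sup>+t\<in>I. L2_sqnorm (ball 0 R) (\<phi> t) \<partial>lebesgue) < \<infinity>"
    proof (rule timefin[OF _ fin(1)])
      fix t show "L2_sqnorm (ball 0 R) (\<phi> t) \<le> ennreal (C1\<^sup>2) * l2sq UNIV \<psi>"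
        unfolding \<phi>_def by (rule order_trans[OF l2prod]) (intro mult_right_mono ennreal_leI sqle C1, simp)
    qed
    show "(\<integral>\<^sup>+t\<in>I. L2_sqnorm (ball 0 R) (g t) \<partial>lebesgue) < \<infinity>"
    proof (rule timefin[OF _ fin(1)])
      fix t show "L2_sqnorm (ball 0 R) (g t) \<le> ennreal (C2\<^sup>2) * l2sq UNIV \<psi>"
        unfolding g_def by (rule order_trans[OF l2prod]) (intro mult_right_mono ennreal_leI sqle C2, simp)
    qed
    fix \<zeta> assume \<zeta>: "\<zeta> \<in> Cc_infinity I"
    have d0: "\<zeta> differentiable_on UNIV" "deriv \<zeta> differentiable_on UNIV"
      using \<zeta> unfolding Cc_infinity_def by (auto dest: spec[of _ "0::nat"] spec[of _ "1::nat"])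
    have dz: "(\<zeta> has_real_derivative deriv \<zeta> t) (at t)" for t
      using d0(1) by (simp add: differentiable_on_def field_differentiable_derivI real_differentiable_def field_differentiable_def DERIV_deriv_iff_real_differentiable)
    have dc: "isCont (deriv \<zeta>) t" for t
      using differentiable_imp_continuous_on[OF d0(2)] by (simp add: continuous_on_eq_continuous_at)
    have zc: "continuous_on UNIV \<zeta>" by (rule differentiable_imp_continuous_on[OF d0(1)])
    have zm [measurable]: "\<zeta> \<in> borel_measurable borel" using zc by (rule borel_measurable_continuous_onI)
    have dm [measurable]: "deriv \<zeta> \<in> borel_measurable borel"
      using differentiable_imp_continuous_on[OF d0(2)] by (rule borel_measurable_continuous_onI)
    \<comment> \<open>Classical integration by parts on [a', b'], without boundary terms as \<eta>
      vanishes at both ends; the weak derivative required by \<open>H1_L2\<close> then holds at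
      every x.\<close>
    have ibp: "(\<integral>t. \<eta> t * deriv \<zeta> t \<partial>lborel) = - (\<integral>t. \<eta>' t * \<zeta> t \<partial>lborel)"
    proof -
      have "(\<integral>t. (\<eta> t * deriv \<zeta> t) * indicator {a'..b'} t \<partial>lborel)
        = \<eta> b' * \<zeta> b' - \<eta> a' * \<zeta> a' - (\<integral>t. (\<eta>' t * \<zeta> t) * indicator {a'..b'} t \<partial>lborel)"
        by (rule integral_by_parts[OF ab'(2) _ _ \<eta>(1) dz]) (use dc \<eta>(2) in \<open>auto simp: continuous_on_eq_continuous_at\<close>)
      moreover have "\<eta> b' = 0" "\<eta> a' = 0" using ab'(4) by auto
      moreover have "(\<eta> t * deriv \<zeta> t) * indicator {a'..b'} t = \<eta> t * deriv \<zeta> t" "(\<eta>' t * \<zeta> t) * indicator {a'..b'} t = \<eta>' t * \<zeta> t" for t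
        using \<eta>z[of t] \<eta>'z[of t] by (cases "t \<in> {a'..b'}"; simp)+
      ultimately show ?thesis by simp
    qed
    show "AE x in lebesgue_on (ball 0 R). (LINT t:I|lebesgue. deriv \<zeta> t * \<phi> t x) = - (LINT t:I|lebesgue. \<zeta> t * g t x)"
    proof (rule AE_I2)
      fix x
      have 1: "(LINT t:I|lebesgue. deriv \<zeta> t * \<phi> t x) = (\<integral>t. \<psi> x * (\<eta> t * deriv \<zeta> t) \<partial>lborel)"
        unfolding set_lebesgue_integral_def
      proof (rule integral_lebesgue_cong)
        show "AE t in lborel. indicat_real I t *\<^sub>R (deriv \<zeta> t * \<phi> t x) = \<psi> x * (\<eta> t * deriv \<zeta> t)"
          using \<eta>I by (intro AE_I2) (auto simp: \<phi>_def indicator_def mult_ac)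
      qed measurable
      have 2: "(LINT t:I|lebesgue. \<zeta> t * g t x) = (\<integral>t. \<psi> x * (\<eta>' t * \<zeta> t) \<partial>lborel)"
        unfolding set_lebesgue_integral_def
      proof (rule integral_lebesgue_cong)
        show "AE t in lborel. indicat_real I t *\<^sub>R (\<zeta> t * g t x) = \<psi> x * (\<eta>' t * \<zeta> t)"
          using \<eta>I by (intro AE_I2) (auto simp: g_def indicator_def mult_ac)
      qed measurable
      show "(LINT t:I|lebesgue. deriv \<zeta> t * \<phi> t x) = - (LINT t:I|lebesgue. \<zeta> t * g t x)"
        unfolding 1 2 by (simp add: ibp)
    qed
  qed
  have Hs: "L2_Hs s I UNIV \<phi>"
    unfolding L2_Hs_def meas_on_def
  proof
    show "(\<lambda>(t, x). \<phi> t x) \<in> borel_measurable (lebesgue_on (I \<times> UNIV))" unfolding \<phi>_def by (rule prodm) measurable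
    show "(\<integral>\<^sup>+t\<in>I. (L2_sqnorm UNIV (\<phi> t) + Hs_sqseminorm s UNIV (\<phi> t)) \<partial>lebesgue) < \<infinity>"
    proof (rule timefin)
      show "l2sq UNIV \<psi> + hsq s UNIV \<psi> < \<infinity>" using fin by simp
      fix t
      have "L2_sqnorm UNIV (\<phi> t) + Hs_sqseminorm s UNIV (\<phi> t) \<le> ennreal ((\<eta> t)\<^sup>2) * l2sq UNIV \<psi> + ennreal ((\<eta> t)\<^sup>2) * hsq s UNIV \<psi>"
        unfolding \<phi>_def hsprod by (intro add_right_mono l2prod)
      also have "\<dots> = ennreal ((\<eta> t)\<^sup>2) * (l2sq UNIV \<psi> + hsq s UNIV \<psi>)" by (simp add: distrib_left)
      also have "\<dots> \<le> ennreal (C1\<^sup>2) * (l2sq UNIV \<psi> + hsq s UNIV \<psi>)" by (intro mult_right_mono ennreal_leI sqle C1) simp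
      finally show "L2_sqnorm UNIV (\<phi> t) + Hs_sqseminorm s UNIV (\<phi> t) \<le> ennreal (C1\<^sup>2) * (l2sq UNIV \<psi> + hsq s UNIV \<psi>)" .
    qed
  qed
  have supp: "closure {(t, x). \<phi> t x \<noteq> 0} \<subseteq> I \<times> ball 0 R"
  proof -
    have "{(t, x). \<phi> t x \<noteq> 0} \<subseteq> {a'..b'} \<times> cball x0 2"
      using \<eta>z \<rho> by (fastforce simp: \<phi>_def)
    then have "closure {(t, x). \<phi> t x \<noteq> 0} \<subseteq> {a'..b'} \<times> cball x0 2"
      by (rule closure_minimal) (intro closed_Times; simp)
    also have "\<dots> \<subseteq> I \<times> ball 0 R"
    proof -
      have "norm x < R" if "dist x0 x \<le> 2" for x
        using that norm_triangle_ineq[of "x - x0" x0] by (simp add: R_def dist_norm norm_minus_commute)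
      then show ?thesis using Isub by auto
    qed
    finally show ?thesis .
  qed
  have \<phi>0: "\<forall>t x. \<phi> t x \<ge> 0" using \<eta>0 \<psi>0 by (auto simp: \<phi>_def)
  have "0 < R" by (simp add: R_def add_nonneg_pos)
  then have ws: "weak_solution s K I (ball 0 R) u"
    using cauchy \<epsilon> unfolding cauchy_solution_def global_weak_solution_def I_def by blast
  define A where "A = (LINT (t, x):I \<times> ball 0 R|lebesgue. u t x * g t x)"
  define E where "E = (LINT t:I|lebesgue. energy (K t) (u t) (\<phi> t))"
  have "- A + E \<ge> 0"
    using ws H1 Hs \<phi>0 supp unfolding weak_solution_def weak_supersolution_def A_def E_def by blast
  \<comment> \<open>A weak solution is also a subsolution, so the negative of \<open>u\<close>
    passes the same test and gives the reverse inequality.\<close>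
  moreover have "A - E \<ge> 0"
  proof -
    have "- (LINT (t, x):I \<times> ball 0 R|lebesgue. - u t x * g t x) + (LINT t:I|lebesgue. energy (K t) (\<lambda>x. - u t x) (\<phi> t)) \<ge> 0"
      using ws H1 Hs \<phi>0 supp unfolding weak_solution_def weak_subsolution_def weak_supersolution_def by blast
    moreover have "(LINT (t, x):I \<times> ball 0 R|lebesgue. - u t x * g t x) = - A"
      unfolding A_def set_lebesgue_integral_def
      by (subst Bochner_Integration.integral_minus[symmetric], rule Bochner_Integration.integral_cong) auto
    moreover have "energy (K t) (\<lambda>x. - u t x) (\<phi> t) = - energy (K t) (u t) (\<phi> t)" for t
      unfolding energy_def
      by (subst Bochner_Integration.integral_minus[symmetric], rule Bochner_Integration.integral_cong) (auto simp: algebra_simps)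
    ultimately show ?thesis by (simp add: E_def set_lebesgue_integral_def)
  qed
  ultimately have AE: "A = E" by simp
  have E_eq: "E = (\<integral>t. \<eta> t * form (k t) (U t) \<psi> \<partial>lborel)"
    unfolding E_def set_lebesgue_integral_def
  proof (rule integral_lebesgue_cong)
    show "(\<lambda>t. \<eta> t * form (k t) (U t) \<psi>) \<in> borel_measurable borel"
      using borel_measurable_integrable[OF ball.form_time_integrable[OF adm]] by simp
    show "AE t in lborel. indicat_real I t *\<^sub>R energy (K t) (u t) (\<phi> t) = \<eta> t * form (k t) (U t) \<psi>"
      using kK uU_slice
    proof eventually_elim
      case (elim t)
      show ?case
      proof (cases "t \<in> I")
        case True
        then show ?thesis using elim I0[OF True] unfolding \<phi>_def by (simp add: energy_eq)
      next
        case False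
        then have "\<eta> t = 0" using \<eta>z Isub by blast
        then show ?thesis using False by simp
      qed
    qed
  qed
  have A_eq: "A = (\<integral>t. \<eta>' t * (\<integral>x. U t x * \<psi> x \<partial>lborel) \<partial>lborel)"
  proof -
    define f where "f p = U (fst p) (snd p) * (\<eta>' (fst p) * \<psi> (snd p))" for p
    have fm: "f \<in> borel_measurable borel" unfolding borel_prod[symmetric] f_def[abs_def] by measurable
    have "A = (\<integral>p. f p \<partial>lborel)"
      unfolding A_def set_lebesgue_integral_def
    proof (rule integral_lebesgue_cong[OF fm])
      show "AE p in lborel. indicat_real (I \<times> ball 0 R) p *\<^sub>R (case p of (t, x) \<Rightarrow> u t x * g t x) = f p"
        using uU
      proof eventually_elim
        case (elim p)
        show ?case
        proof (cases "p \<in> I \<times> ball 0 R")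
          case True
          then show ?thesis using elim I0[of "fst p"] by (auto simp: f_def g_def case_prod_beta)
        next
          case False
          then have "\<eta>' (fst p) = 0 \<or> \<psi> (snd p) = 0" using \<eta>I \<psi>R[of "snd p"] by (cases p) auto
          then show ?thesis using False by (auto simp: f_def)
        qed
      qed
    qed
    also have "\<dots> = (\<integral>p. f p \<partial>(lborel \<Otimes>\<^sub>M lborel))" by (simp add: lborel_prod)
    also have "\<dots> = (\<integral>t. (\<integral>x. f (t, x) \<partial>lborel) \<partial>lborel)"
    proof (rule lborel_pair.integral_fst'[symmetric])
      show "integrable (lborel \<Otimes>\<^sub>M lborel) f"
      proof (rule integrableI_bounded)
        show fm': "f \<in> borel_measurable (lborel \<Otimes>\<^sub>M lborel)" using fm by (simp add: lborel_prod)
        have "(\<integral>\<^sup>+p. ennreal (norm (f p)) \<partial>(lborel \<Otimes>\<^sub>M lborel)) = (\<integral>\<^sup>+t. \<integral>\<^sup>+x. ennreal (norm (f (t, x))) \<partial>lborel \<partial>lborel)"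
          by (rule lborel.nn_integral_fst[symmetric]) (rule measurable_compose[OF fm'], measurable)
        also have "\<dots> \<le> (\<integral>\<^sup>+t. \<integral>\<^sup>+x. ennreal C2 * ennreal \<bar>U t x * \<psi> x\<bar> \<partial>lborel \<partial>lborel)"
        proof (intro nn_integral_mono)
          fix t x
          have "\<bar>U t x * (\<eta>' t * \<psi> x)\<bar> = \<bar>\<eta>' t\<bar> * \<bar>U t x * \<psi> x\<bar>" by (simp add: abs_mult mult_ac)
          also have "\<dots> \<le> C2 * \<bar>U t x * \<psi> x\<bar>" by (intro mult_right_mono C2) auto
          finally show "ennreal (norm (f (t, x))) \<le> ennreal C2 * ennreal \<bar>U t x * \<psi> x\<bar>"
            using C2 by (subst ennreal_mult[symmetric]) (auto simp: f_def intro: ennreal_leI)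
        qed
        also have "\<dots> = ennreal C2 * (\<integral>\<^sup>+t. ball.absprod t \<psi> \<partial>lborel)"
          unfolding ball.absprod_def by (rule nn_integral2_cmult) measurable
        also have "\<dots> < \<infinity>" using ball.adm_time(2)[OF adm] by (simp add: ennreal_mult_less_top)
        finally show "(\<integral>\<^sup>+p. ennreal (norm (f p)) \<partial>(lborel \<Otimes>\<^sub>M lborel)) < \<infinity>" .
      qed
    qed
    also have "\<dots> = (\<integral>t. \<eta>' t * (\<integral>x. U t x * \<psi> x \<partial>lborel) \<partial>lborel)"
    proof (rule Bochner_Integration.integral_cong[OF refl])
      fix t
      have "f (t, x) = \<eta>' t * (U t x * \<psi> x)" for x by (simp add: f_def)
      then show "(\<integral>x. f (t, x) \<partial>lborel) = \<eta>' t * (\<integral>x. U t x * \<psi> x \<partial>lborel)" by simp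
    qed
    finally show ?thesis .
  qed
  show ?thesis using AE unfolding E_eq A_eq by simp
qed

end

section \<open>Borel versions of the kernel, the solutions and the coercivity condition\<close>

lemma nn_integral_lebesgue_square:
  fixes g :: "'a::euclidean_space \<Rightarrow> 'a \<Rightarrow> real"
  assumes ae: "AE p in lborel. f p = ennreal (g (fst p) (snd p))"
    and [measurable]: "(\<lambda>(x, y). g x y) \<in> borel_measurable (borel \<Otimes>\<^sub>M borel)" "A \<in> sets borel"
  shows "(\<integral>\<^sup>+p\<in>A \<times> A. f p \<partial>lebesgue) = (\<integral>\<^sup>+x\<in>A. (\<integral>\<^sup>+y\<in>A. ennreal (g x y) \<partial>lborel) \<partial>lborel)"
proof -
  define h where "h p = ennreal (g (fst p) (snd p)) * indicator A (snd p) * indicator A (fst p)" for p :: "'a \<times> 'a"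
  have hm: "h \<in> borel_measurable borel"
    unfolding borel_prod[symmetric] h_def[abs_def] by measurable
  have "(\<integral>\<^sup>+p\<in>A \<times> A. f p \<partial>lebesgue) = (\<integral>\<^sup>+p. h p \<partial>lborel)"
  proof (rule nn_integral_lebesgue_cong)
    show "AE p in lborel. f p * indicator (A \<times> A) p = h p"
      using ae
    proof eventually_elim
      case (elim p)
      then show ?case by (cases p) (auto simp: h_def indicator_def)
    qed
  qed
  also have "\<dots> = (\<integral>\<^sup>+x. \<integral>\<^sup>+y. h (x, y) \<partial>lborel \<partial>lborel)" by (rule nn_integral_lborel2[OF hm])
  also have "\<dots> = (\<integral>\<^sup>+x\<in>A. (\<integral>\<^sup>+y\<in>A. ennreal (g x y) \<partial>lborel) \<partial>lborel)"
    unfolding h_def fst_conv snd_conv by (rule nn_integral2_indicator[symmetric]) measurable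
  finally show ?thesis .
qed

lemma AE_lborel_off_diagonal: "AE p in (lborel :: ('a::euclidean_space \<times> 'a) measure). fst p \<noteq> snd p"
proof -
  have "AE p in lborel \<Otimes>\<^sub>M lborel. fst p \<noteq> (snd p :: 'a)"
  proof (rule lborel_pair.AE_pair_measure)
    show "{p \<in> space (lborel \<Otimes>\<^sub>M lborel). fst p \<noteq> (snd p :: 'a)} \<in> sets (lborel \<Otimes>\<^sub>M lborel)" by measurable
    show "AE x in lborel. AE y in lborel. fst (x, y) \<noteq> (snd (x, y) :: 'a)"
    proof (rule AE_I2)
      fix x :: 'a show "AE y in lborel. fst (x, y) \<noteq> snd (x, y)"
        using AE_lborel_singleton[of x] by eventually_elim auto
    qed
  qed
  then show ?thesis by (simp only: lborel_prod)
qed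

text \<open>Selects a good time inside a prescribed interval.\<close>

lemma AE_lborel_interval:
  fixes p q :: real
  assumes "AE x in lborel. P x" "p < q" obtains x where "p < x" "x < q" "P x"
proof -
  have "\<exists>x. p < x \<and> x < q \<and> P x"
  proof (rule ccontr)
    assume "\<not> ?thesis"
    then have "AE x in lborel. x \<notin> {p<..<q}" using assms(1) by (auto elim!: eventually_mono)
    then have "emeasure lborel {p<..<q} = 0" by (subst (asm) AE_iff_measurable[of "{p<..<q}"]) auto
    then show False using assms(2) by simp
  qed
  then show ?thesis using that by blast
qed

text \<open>Off the diagonal the upper bound makes \<open>K\<close> finite, so for almost every time
  the passage to real values changes \<open>K\<close> on a null set of pairs only.\<close>

lemma kernel_borel_version:
  fixes K :: "real \<Rightarrow> 'a::euclidean_space \<Rightarrow> 'a \<Rightarrow> ennreal"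
  assumes \<Lambda>: "0 < \<Lambda>" and K: "jump_kernel T K" "kernel_upper_bound s \<Lambda> T K"
  obtains k where "(\<lambda>(t, x, y). k t x y) \<in> borel_measurable borel" "\<And>t x y. 0 \<le> k t x y"
    "\<And>t x y. k t x y \<le> \<Lambda> * riesz s (x - y)"
    "AE t in lborel. 0 < t \<and> t < T \<longrightarrow> (AE p in lborel. K t (fst p) (snd p) = ennreal (k t (fst p) (snd p)))"
proof -
  let ?S = "{0<..<T} \<times> (UNIV :: 'a set) \<times> (UNIV :: 'a set)"
  let ?D = "real DIM('a) + 2 * s"
  have "open ?S" by (intro open_Times) auto
  then have S: "?S \<in> sets lebesgue" by (intro sets_completionI_sets) auto
  have "(\<lambda>(t, x, y). K t x y) \<in> borel_measurable (lebesgue_on ?S)" using K(1) unfolding jump_kernel_def by blast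
  then have "(\<lambda>p. enn2real (case p of (t, x, y) \<Rightarrow> K t x y)) \<in> borel_measurable (lebesgue_on ?S)" by measurable
  then obtain g where g: "g \<in> borel_measurable borel"
    "AE p in lborel. p \<in> ?S \<longrightarrow> enn2real (case p of (t, x, y) \<Rightarrow> K t x y) = g p"
    using borel_version_real[OF _ S] by blast
  \<comment> \<open>Clamping enforces the bounds everywhere; almost everywhere it changes nothing,
    because \<open>K\<close> satisfies them off the diagonal.\<close>
  define k where "k t x y = max 0 (min (g (t, x, y)) (\<Lambda> * riesz s (x - y)))" for t x y
  show ?thesis
  proof (rule that[of k])
    have "(\<lambda>p. max 0 (min (g p) (\<Lambda> * riesz s (fst (snd p) - snd (snd p))))) \<in> borel_measurable borel"
    proof -
      have "(\<lambda>p :: real \<times> 'a \<times> 'a. fst (snd p) - snd (snd p)) \<in> borel_measurable borel"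
        unfolding borel_prod[symmetric] by measurable
      then show ?thesis using g(1) by measurable
    qed
    then show "(\<lambda>(t, x, y). k t x y) \<in> borel_measurable borel" by (simp add: k_def case_prod_beta')
    show "0 \<le> k t x y" for t x y by (simp add: k_def)
    show "k t x y \<le> \<Lambda> * riesz s (x - y)" for t x y using \<Lambda> by (simp add: k_def)
    show "AE t in lborel. 0 < t \<and> t < T \<longrightarrow> (AE p in lborel. K t (fst p) (snd p) = ennreal (k t (fst p) (snd p)))"
      using AE_lborel_pair[OF g(2)]
    proof eventually_elim
      case (elim t)
      show ?case
      proof
        assume t: "0 < t \<and> t < T"
        show "AE p in lborel. K t (fst p) (snd p) = ennreal (k t (fst p) (snd p))"
          using elim AE_lborel_off_diagonal
        proof eventually_elim
          case (elim p)
          have gp: "enn2real (K t (fst p) (snd p)) = g (t, fst p, snd p)" using elim(1) t by (cases p) auto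
          define n where "n = norm (fst p - snd p) powr ?D"
          have n: "0 < n" using elim(2) by (simp add: n_def)
          have "K t (fst p) (snd p) \<le> ennreal \<Lambda> / ennreal n"
            using K(2) t unfolding kernel_upper_bound_def n_def by auto
          also have "\<dots> = ennreal (\<Lambda> / n)" using \<Lambda> n by (simp add: divide_ennreal)
          also have "\<Lambda> / n = \<Lambda> * riesz s (fst p - snd p)"
            using powr_minus_divide[of "norm (fst p - snd p)" ?D] by (simp add: n_def riesz_def)
          finally have le: "K t (fst p) (snd p) \<le> ennreal (\<Lambda> * riesz s (fst p - snd p))" .
          then have fin: "K t (fst p) (snd p) < \<infinity>" by (rule le_less_trans) simp
          have "enn2real (K t (fst p) (snd p)) \<le> enn2real (ennreal (\<Lambda> * riesz s (fst p - snd p)))"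
            by (rule enn2real_mono[OF le]) simp
          then have "enn2real (K t (fst p) (snd p)) \<le> \<Lambda> * riesz s (fst p - snd p)" using \<Lambda> by simp
          then have "k t (fst p) (snd p) = enn2real (K t (fst p) (snd p))"
            unfolding k_def gp[symmetric] by (simp add: min_absorb1)
          then show ?case using fin by simp
        qed
      qed
    qed
  qed
qed

lemma solution_borel_version:
  fixes u :: "real \<Rightarrow> 'a::euclidean_space \<Rightarrow> real"
  assumes "solution_class s {0<..<T} UNIV u"
  obtains U where "(\<lambda>(t, x). U t x) \<in> borel_measurable borel" "\<And>t x. t \<le> 0 \<or> T \<le> t \<Longrightarrow> U t x = 0"
    "AE p in lborel. 0 < fst p \<and> fst p < T \<longrightarrow> u (fst p) (snd p) = U (fst p) (snd p)"
proof -
  let ?S = "{0<..<T} \<times> (UNIV :: 'a set)"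
  have "open ?S" by (intro open_Times) auto
  then have S: "?S \<in> sets lebesgue" by (intro sets_completionI_sets) auto
  have "(\<lambda>(t, x). u t x) \<in> borel_measurable (lebesgue_on ?S)"
    using assms unfolding solution_class_def Linf_L2loc_def meas_on_def by blast
  then obtain g where g: "g \<in> borel_measurable borel" "AE p in lborel. p \<in> ?S \<longrightarrow> (case p of (t, x) \<Rightarrow> u t x) = g p"
    using borel_version_real[OF _ S] by blast
  define U where "U t x = (if 0 < t \<and> t < T then g (t, x) else 0)" for t x
  show ?thesis
  proof (rule that[of U])
    have [measurable]: "g \<in> borel_measurable (borel \<Otimes>\<^sub>M borel)" using g(1) by (simp add: borel_prod)
    show "(\<lambda>(t, x). U t x) \<in> borel_measurable borel"
      unfolding borel_prod[symmetric] U_def by measurable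
    show "AE p in lborel. 0 < fst p \<and> fst p < T \<longrightarrow> u (fst p) (snd p) = U (fst p) (snd p)"
      using g(2)
    proof eventually_elim
      case (elim p)
      then show ?case by (cases p) (auto simp: U_def)
    qed
  qed (auto simp: U_def)
qed

lemma l2sq_diff_le:
  fixes v w :: "'a::euclidean_space \<Rightarrow> real"
  assumes [measurable]: "v \<in> borel_measurable borel" "w \<in> borel_measurable borel" "A \<in> sets borel"
  shows "l2sq A (\<lambda>x. v x - w x) \<le> 2 * l2sq A v + 2 * l2sq A w"
proof -
  have "l2sq A (\<lambda>x. v x - w x) \<le> (\<integral>\<^sup>+x. 2 * (ennreal ((v x)\<^sup>2) * indicator A x) + 2 * (ennreal ((w x)\<^sup>2) * indicator A x) \<partial>lborel)"
    unfolding l2sq_def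
  proof (rule nn_integral_mono)
    fix x
    have "ennreal ((v x - w x)\<^sup>2) \<le> ennreal (2 * (v x)\<^sup>2 + 2 * (w x)\<^sup>2)"
      using sq_diff_le[of "v x" "w x" 0] by (intro ennreal_leI) simp
    then show "ennreal ((v x - w x)\<^sup>2) * indicator A x \<le> 2 * (ennreal ((v x)\<^sup>2) * indicator A x) + 2 * (ennreal ((w x)\<^sup>2) * indicator A x)"
      by (auto simp: indicator_def ennreal_plus ennreal_mult)
  qed
  also have "\<dots> = 2 * l2sq A v + 2 * l2sq A w"
    unfolding l2sq_def by (subst nn_integral_add, measurable, subst (1 2) nn_integral_cmult, measurable)
  finally show ?thesis .
qed

lemma hsq_diff_le:
  fixes v w :: "'a::euclidean_space \<Rightarrow> real"
  assumes [measurable]: "v \<in> borel_measurable borel" "w \<in> borel_measurable borel" "A \<in> sets borel"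
  shows "hsq s A (\<lambda>x. v x - w x) \<le> 2 * hsq s A v + 2 * hsq s A w"
proof -
  let ?f = "\<lambda>v x y. ennreal ((v x - v y)\<^sup>2 * riesz s (x - y)) * indicator A y * indicator A x :: ennreal"
  have eq: "hsq s A v = (\<integral>\<^sup>+x. \<integral>\<^sup>+y. ?f v x y \<partial>lborel \<partial>lborel)" if [measurable]: "v \<in> borel_measurable borel" for v
    unfolding hsq_def by (rule nn_integral2_indicator) measurable
  have "hsq s A (\<lambda>x. v x - w x) = (\<integral>\<^sup>+x. \<integral>\<^sup>+y. ?f (\<lambda>x. v x - w x) x y \<partial>lborel \<partial>lborel)"
    by (rule eq) measurable
  also have "\<dots> \<le> (\<integral>\<^sup>+x. \<integral>\<^sup>+y. 2 * ?f v x y + 2 * ?f w x y \<partial>lborel \<partial>lborel)"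
  proof (intro nn_integral_mono)
    fix x y
    have "((v x - w x) - (v y - w y))\<^sup>2 \<le> 2 * (v x - v y)\<^sup>2 + 2 * (w x - w y)\<^sup>2"
    proof -
      have "(a - b)\<^sup>2 \<le> 2 * p\<^sup>2 + 2 * q\<^sup>2" if "a - b = p - q" for a b p q :: real
        unfolding that using sum_squares_ge_zero[of "p + q" 0] by (simp add: power2_eq_square algebra_simps)
      then show ?thesis by (simp add: algebra_simps)
    qed
    then have "((v x - w x) - (v y - w y))\<^sup>2 * riesz s (x - y) \<le> (2 * (v x - v y)\<^sup>2 + 2 * (w x - w y)\<^sup>2) * riesz s (x - y)"
      by (rule mult_right_mono) simp
    then have "((v x - w x) - (v y - w y))\<^sup>2 * riesz s (x - y) \<le> 2 * ((v x - v y)\<^sup>2 * riesz s (x - y)) + 2 * ((w x - w y)\<^sup>2 * riesz s (x - y))"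
      by (simp only: distrib_right mult.assoc)
    then have "ennreal (((v x - w x) - (v y - w y))\<^sup>2 * riesz s (x - y)) \<le> ennreal (2 * ((v x - v y)\<^sup>2 * riesz s (x - y)) + 2 * ((w x - w y)\<^sup>2 * riesz s (x - y)))"
      by (rule ennreal_leI)
    also have "\<dots> = 2 * ennreal ((v x - v y)\<^sup>2 * riesz s (x - y)) + 2 * ennreal ((w x - w y)\<^sup>2 * riesz s (x - y))"
      by (simp add: ennreal_plus ennreal_mult)
    finally show "?f (\<lambda>x. v x - w x) x y \<le> 2 * ?f v x y + 2 * ?f w x y" by (auto simp: indicator_def)
  qed
  also have "\<dots> = (\<integral>\<^sup>+x. \<integral>\<^sup>+y. 2 * ?f v x y \<partial>lborel \<partial>lborel) + (\<integral>\<^sup>+x. \<integral>\<^sup>+y. 2 * ?f w x y \<partial>lborel \<partial>lborel)"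
    by (rule nn_integral2_add) measurable
  also have "(\<integral>\<^sup>+x. \<integral>\<^sup>+y. 2 * ?f v x y \<partial>lborel \<partial>lborel) = 2 * hsq s A v"
    unfolding eq[OF assms(1)] by (rule nn_integral2_cmult) measurable
  also have "(\<integral>\<^sup>+x. \<integral>\<^sup>+y. 2 * ?f w x y \<partial>lborel \<partial>lborel) = 2 * hsq s A w"
    unfolding eq[OF assms(2)] by (rule nn_integral2_cmult) measurable
  finally show ?thesis .
qed

text \<open>The exceptional set of times comes from the replacement of the kernel alone, so it is
  independent of the ball and of \<open>v\<close>; this order of quantifiers is essential because
  \<open>v\<close> will depend on the time.\<close>

lemma coercive_borel_version:
  fixes K :: "real \<Rightarrow> 'a::euclidean_space \<Rightarrow> 'a \<Rightarrow> ennreal"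
  assumes kb: "(\<lambda>(t, x, y). k t x y) \<in> borel_measurable borel"
    and kK: "AE t in lborel. 0 < t \<and> t < T \<longrightarrow> (AE p in lborel. K t (fst p) (snd p) = ennreal (k t (fst p) (snd p)))"
    and co: "kernel_coercive s l T K"
  shows "AE t in lborel. 0 < t \<and> t < T \<longrightarrow>
      (\<forall>x0 r v. 0 < r \<longrightarrow> v \<in> borel_measurable borel \<longrightarrow> l2sq (ball x0 r) v < \<infinity> \<longrightarrow> hsq s (ball x0 r) v < \<infinity> \<longrightarrow>
        ennreal l * hsq s (ball x0 r) v \<le>
        (\<integral>\<^sup>+x\<in>ball x0 r. (\<integral>\<^sup>+y\<in>ball x0 r. ennreal ((v x - v y)\<^sup>2 * k t x y) \<partial>lborel) \<partial>lborel))"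
  using kK
proof eventually_elim
  case (elim t)
  show ?case
  proof (intro impI allI)
    fix x0 :: 'a and r :: real and v :: "'a \<Rightarrow> real"
    assume t: "0 < t \<and> t < T" and r: "0 < r" and v [measurable]: "v \<in> borel_measurable borel"
      and fin: "l2sq (ball x0 r) v < \<infinity>" "hsq s (ball x0 r) v < \<infinity>"
    have [measurable]: "(\<lambda>(x, y). k t x y) \<in> borel_measurable (borel \<Otimes>\<^sub>M borel)"
    proof -
      have "(\<lambda>p :: 'a \<times> 'a. (t, p)) \<in> borel_measurable borel" by measurable
      from measurable_compose[OF this kb] show ?thesis by (simp add: borel_prod case_prod_beta')
    qed
    have H: "Hs_sqseminorm s (ball x0 r) v = hsq s (ball x0 r) v" by (rule Hs_sqseminorm_eq) auto
    have L: "L2_sqnorm (ball x0 r) v = l2sq (ball x0 r) v" by (rule L2_sqnorm_eq) auto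
    have "v \<in> borel_measurable lebesgue" using v by (intro measurable_completion) simp
    then have "v \<in> borel_measurable (lebesgue_on (ball x0 r))" by (rule measurable_restrict_space1)
    then have "v \<in> Hs s (ball x0 r)" using fin unfolding Hs_def by (simp add: H L)
    then have "ennreal l * Hs_sqseminorm s (ball x0 r) v \<le>
      (\<integral>\<^sup>+(x, y)\<in>ball x0 r \<times> ball x0 r. ennreal ((v x - v y)\<^sup>2) * K t x y \<partial>lebesgue)"
      using co t r unfolding kernel_coercive_def by auto
    also have "\<dots> = (\<integral>\<^sup>+x\<in>ball x0 r. (\<integral>\<^sup>+y\<in>ball x0 r. ennreal ((v x - v y)\<^sup>2 * k t x y) \<partial>lborel) \<partial>lborel)"
    proof (rule nn_integral_lebesgue_square)
      show "AE p in lborel. (case p of (x, y) \<Rightarrow> ennreal ((v x - v y)\<^sup>2) * K t x y) = ennreal ((v (fst p) - v (snd p))\<^sup>2 * k t (fst p) (snd p))"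
        using elim[rule_format, OF t] by eventually_elim (simp add: case_prod_beta ennreal_mult')
    qed measurable
    finally show "ennreal l * hsq s (ball x0 r) v \<le>
        (\<integral>\<^sup>+x\<in>ball x0 r. (\<integral>\<^sup>+y\<in>ball x0 r. ennreal ((v x - v y)\<^sup>2 * k t x y) \<partial>lborel) \<partial>lborel)"
      by (simp add: H)
  qed
qed

text \<open>Allows the pairing with a difference of two solutions to be split at almost every single
  time, for the initial condition.\<close>

lemma (in nonlocal_data) integrable_slice:
  assumes c: "continuous_on UNIV \<psi>" and R: "\<And>x. norm x > R \<Longrightarrow> \<psi> x = 0"
  shows "AE t in lborel. integrable lborel (\<lambda>x. u t x * \<psi> x)"
proof -
  interpret b: nonlocal_ball s T \<Lambda> k u 0 0 "1/2" by unfold_locales auto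
  have [measurable]: "\<psi> \<in> borel_measurable borel" using c by (rule borel_measurable_continuous_onI)
  have "bounded (\<psi> ` cball 0 R)"
    by (intro compact_imp_bounded compact_continuous_image continuous_on_subset[OF c]) auto
  then obtain C where C: "\<forall>x\<in>cball 0 R. \<bar>\<psi> x\<bar> \<le> C" unfolding bounded_iff by auto
  have "l2sq (ball 0 (R + 1)) \<psi> \<le> (\<integral>\<^sup>+x. ennreal (C\<^sup>2) * indicator (ball 0 (R + 1)) x \<partial>(lborel :: 'a measure))"
    unfolding l2sq_def
  proof (intro nn_integral_mono mult_right_mono ennreal_leI)
    fix x show "(\<psi> x)\<^sup>2 \<le> C\<^sup>2"
    proof (cases "norm x > R")
      case False
      then have "\<bar>\<psi> x\<bar> \<le> \<bar>C\<bar>" using C by (intro order_trans[OF _ abs_ge_self]) auto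
      then show ?thesis by (simp add: abs_le_square_iff)
    qed (simp add: R)
  qed auto
  also have "\<dots> < \<infinity>" using emeasure_lborel_ball_finite[of "0::'a" "R + 1"]
    by (subst nn_integral_cmult_indicator) (auto simp: ennreal_mult_less_top)
  finally have l2: "l2sq (ball 0 (R + 1)) \<psi> < \<infinity>" .
  obtain M :: real where M: "AE t in lborel. l2sq (ball 0 (R + 1)) (u t) \<le> ennreal M" using u_L2 by blast
  then show ?thesis
  proof eventually_elim
    case (elim t)
    have "b.absprod t \<psi> \<le> ennreal 1 * l2sq (ball 0 (R + 1)) (u t) + ennreal (1 / 1) * l2sq (ball 0 (R + 1)) \<psi>"
      by (rule b.absprod_le) (use R in auto)
    also have "\<dots> < \<infinity>" using elim l2 by (auto intro: le_less_trans)
    finally show ?case by (intro b.prod_integrable) auto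
  qed
qed

text \<open>Equation and function spaces are linear, and the common measure \<open>\<mu>\<close>
  cancels in the initial condition. Since neither form nor pairing is linear unless it converges
  absolutely, the splitting is done at almost every time and then integrated.\<close>

lemma difference_nonlocal_cauchy:
  assumes 1: "borel_solution s T \<Lambda> K k u1 U1" and 2: "borel_solution s T \<Lambda> K k u2 U2"
    and l: "0 < l"
    and co: "AE t in lborel. 0 < t \<and> t < T \<longrightarrow>
      (\<forall>x0 r v. 0 < r \<longrightarrow> v \<in> borel_measurable borel \<longrightarrow> l2sq (ball x0 r) v < \<infinity> \<longrightarrow> hsq s (ball x0 r) v < \<infinity> \<longrightarrow>
        ennreal l * hsq s (ball x0 r) v \<le>
        (\<integral>\<^sup>+x\<in>ball x0 r. (\<integral>\<^sup>+y\<in>ball x0 r. ennreal ((v x - v y)\<^sup>2 * k t x y) \<partial>lborel) \<partial>lborel))"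
    and c: "cauchy_solution s K T \<mu> u1" "cauchy_solution s K T \<mu> u2"
  shows "nonlocal_cauchy s T l \<Lambda> k (\<lambda>t x. U1 t x - U2 t x)"
proof -
  interpret b1: borel_solution s T \<Lambda> K k u1 U1 by (rule 1)
  interpret b2: borel_solution s T \<Lambda> K k u2 U2 by (rule 2)
  define w where "w t x = U1 t x - U2 t x" for t x
  have wm [measurable (raw)]: "(\<lambda>m. w (f m) (g m)) \<in> borel_measurable M" if "f \<in> borel_measurable M" "g \<in> borel_measurable M" for f g M
    unfolding w_def using b1.u_measurable[OF that] b2.u_measurable[OF that] by measurable
  have "nonlocal_cauchy s T l \<Lambda> k w"
  proof unfold_locales
    show "(\<lambda>(t, x). w t x) \<in> borel_measurable borel" unfolding borel_prod[symmetric] by measurable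
    show "w t x = 0" if "t \<le> 0 \<or> T \<le> t" for t x using b1.u_zero[OF that] b2.u_zero[OF that] by (simp add: w_def)
    show "\<exists>M::real. AE t in lborel. l2sq (ball 0 R) (w t) \<le> ennreal M" for R
    proof -
      obtain M1 M2 :: real where "AE t in lborel. l2sq (ball 0 R) (U1 t) \<le> ennreal M1" "AE t in lborel. l2sq (ball 0 R) (U2 t) \<le> ennreal M2"
        using b1.u_L2 b2.u_L2 by blast
      then have "AE t in lborel. l2sq (ball 0 R) (w t) \<le> ennreal (2 * max 0 M1 + 2 * max 0 M2)"
      proof eventually_elim
        case (elim t)
        have "l2sq (ball 0 R) (w t) \<le> 2 * l2sq (ball 0 R) (U1 t) + 2 * l2sq (ball 0 R) (U2 t)"
          unfolding w_def[abs_def] using b1.U_slice b2.U_slice by (intro l2sq_diff_le) auto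
        also have "\<dots> \<le> 2 * ennreal (max 0 M1) + 2 * ennreal (max 0 M2)"
          by (intro add_mono mult_left_mono order_trans[OF elim(1)] order_trans[OF elim(2)] ennreal_leI) auto
        finally show ?case by (simp add: ennreal_plus ennreal_mult del: max_def)
      qed
      then show ?thesis by blast
    qed
    show "(\<integral>\<^sup>+t. hsq s (ball 0 R) (w t) \<partial>lborel) < \<infinity>" for R
    proof -
      have "(\<integral>\<^sup>+t. hsq s (ball 0 R) (w t) \<partial>lborel) \<le> (\<integral>\<^sup>+t. 2 * hsq s (ball 0 R) (U1 t) + 2 * hsq s (ball 0 R) (U2 t) \<partial>lborel)"
        unfolding w_def[abs_def] using b1.U_slice b2.U_slice by (intro nn_integral_mono hsq_diff_le) auto
      also have "\<dots> = (\<integral>\<^sup>+t. 2 * hsq s (ball 0 R) (U1 t) \<partial>lborel) + (\<integral>\<^sup>+t. 2 * hsq s (ball 0 R) (U2 t) \<partial>lborel)"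
        by (rule nn_integral_add) measurable
      also have "\<dots> = 2 * (\<integral>\<^sup>+t. hsq s (ball 0 R) (U1 t) \<partial>lborel) + 2 * (\<integral>\<^sup>+t. hsq s (ball 0 R) (U2 t) \<partial>lborel)"
        by (simp add: nn_integral_cmult)
      also have "\<dots> < \<infinity>" using b1.u_Hs[of R] b2.u_Hs[of R] by (simp add: ennreal_mult_less_top)
      finally show ?thesis .
    qed
    show "(\<integral>\<^sup>+t. (\<integral>\<^sup>+x. ennreal (\<bar>w t x\<bar> * tail_weight s x) \<partial>lborel) \<partial>lborel) < \<infinity>"
    proof -
      have "(\<integral>\<^sup>+t. (\<integral>\<^sup>+x. ennreal (\<bar>w t x\<bar> * tail_weight s x) \<partial>lborel) \<partial>lborel) \<le>
        (\<integral>\<^sup>+t. (\<integral>\<^sup>+x. ennreal (\<bar>U1 t x\<bar> * tail_weight s x) + ennreal (\<bar>U2 t x\<bar> * tail_weight s x) \<partial>lborel) \<partial>lborel)"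
      proof (intro nn_integral_mono)
        fix t :: real and x :: 'a
        have tw: "0 \<le> tail_weight s x" by (rule less_imp_le[OF tail_weight_pos])
        have "\<bar>w t x\<bar> * tail_weight s x \<le> (\<bar>U1 t x\<bar> + \<bar>U2 t x\<bar>) * tail_weight s x"
          unfolding w_def by (intro mult_right_mono abs_triangle_ineq4 tw)
        then show "ennreal (\<bar>w t x\<bar> * tail_weight s x) \<le> ennreal (\<bar>U1 t x\<bar> * tail_weight s x) + ennreal (\<bar>U2 t x\<bar> * tail_weight s x)"
          using tw by (subst ennreal_plus[symmetric]) (auto intro!: ennreal_leI simp: distrib_right simp del: ennreal_plus)
      qed
      also have "\<dots> = (\<integral>\<^sup>+t. (\<integral>\<^sup>+x. ennreal (\<bar>U1 t x\<bar> * tail_weight s x) \<partial>lborel) \<partial>lborel) + (\<integral>\<^sup>+t. (\<integral>\<^sup>+x. ennreal (\<bar>U2 t x\<bar> * tail_weight s x) \<partial>lborel) \<partial>lborel)"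
        by (rule nn_integral2_add) measurable
      also have "\<dots> < \<infinity>" using b1.u_L1 b2.u_L1 by simp
      finally show ?thesis .
    qed
    show "0 < l" by (rule l)
    show "AE t in lborel. 0 < t \<and> t < T \<longrightarrow>
      (\<forall>x0 r v. 0 < r \<longrightarrow> v \<in> borel_measurable borel \<longrightarrow> l2sq (ball x0 r) v < \<infinity> \<longrightarrow> hsq s (ball x0 r) v < \<infinity> \<longrightarrow>
        ennreal l * hsq s (ball x0 r) v \<le>
        (\<integral>\<^sup>+x\<in>ball x0 r. (\<integral>\<^sup>+y\<in>ball x0 r. ennreal ((v x - v y)\<^sup>2 * k t x y) \<partial>lborel) \<partial>lborel))" by (rule co)
  next
    fix \<eta> \<eta>' :: "real \<Rightarrow> real" and \<psi> :: "'a \<Rightarrow> real" and a b :: real and x0 :: 'a and \<rho> :: real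
    assume \<eta>: "\<And>t. (\<eta> has_real_derivative \<eta>' t) (at t)" "continuous_on UNIV \<eta>'" "\<And>t. 0 \<le> \<eta> t"
      and ab: "0 < a" "b < T" "\<And>t. t \<le> a \<or> b \<le> t \<Longrightarrow> \<eta> t = 0"
      and \<psi>: "\<psi> \<in> borel_measurable borel" "\<And>x. 0 \<le> \<psi> x" "\<rho> < 2" "\<And>x. \<rho> \<le> dist x0 x \<Longrightarrow> \<psi> x = 0"
        "l2sq UNIV \<psi> < \<infinity>" "hsq s UNIV \<psi> < \<infinity>"
    note [measurable] = \<psi>(1)
    define \<delta> where "\<delta> = (2 - max 0 \<rho>) / 2"
    interpret n1: nonlocal_ball s T \<Lambda> k U1 x0 "max 0 \<rho>" \<delta>
      by unfold_locales (use \<psi>(3) in \<open>auto simp: \<delta>_def max_def field_simps\<close>)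
    interpret n2: nonlocal_ball s T \<Lambda> k U2 x0 "max 0 \<rho>" \<delta>
      by unfold_locales (use \<psi>(3) in \<open>auto simp: \<delta>_def max_def field_simps\<close>)
    have \<delta>0: "0 < \<delta>" using \<psi>(3) by (simp add: \<delta>_def)
    have adm: "n1.adm \<psi>"
      unfolding n1.adm_def
    proof (intro conjI allI impI)
      show "\<psi> x = 0" if "max 0 \<rho> + \<delta> \<le> dist x0 x" for x using that \<delta>0 by (intro \<psi>(4)) auto
      show "l2sq n1.B \<psi> < \<infinity>" using l2sq_mono[of n1.B UNIV \<psi>] \<psi>(5) by (auto intro: le_less_trans)
      show "hsq s n1.B \<psi> < \<infinity>" using hsq_mono[of n1.B UNIV s \<psi>] \<psi>(6) by (auto intro: le_less_trans)
    qed measurable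
    \<comment> \<open>Admissibility does not involve the solution, so both interpretations share the
      predicate.\<close>
    then have adm2: "n2.adm \<psi>" .
    have \<eta>c: "continuous_on UNIV \<eta>" using \<eta>(1) by (intro DERIV_continuous_on) (auto intro: has_field_derivative_at_within)
    have \<eta>z: "\<eta> t = 0" if "t \<notin> {a..b}" for t using that by (intro ab(3)) auto
    have \<eta>'z: "\<eta>' t = 0" if "t \<notin> {a..b}" for t
    proof -
      have "((\<lambda>_. 0) has_real_derivative 0) (at t)" by simp
      then have "(\<eta> has_real_derivative 0) (at t)"
        by (rule has_field_derivative_transform_within_open[where S = "- {a..b}"]) (use that \<eta>z in auto)
      then show ?thesis using DERIV_unique[OF \<eta>(1)] by blast
    qed
    obtain C1 where C1: "0 \<le> C1" "\<And>t. \<bar>\<eta> t\<bar> \<le> C1" using bounded_of_cont_support[OF \<eta>c \<eta>z] by blast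
    obtain C2 where C2: "0 \<le> C2" "\<And>t. \<bar>\<eta>' t\<bar> \<le> C2" using bounded_of_cont_support[OF \<eta>(2) \<eta>'z] by blast
    have m [measurable]: "\<eta> \<in> borel_measurable borel" "\<eta>' \<in> borel_measurable borel"
      using \<eta>c \<eta>(2) by (auto intro: borel_measurable_continuous_onI)
    have bdi: "integrable lborel (\<lambda>t. h t * f t)"
      if [measurable]: "h \<in> borel_measurable borel" and h: "\<And>t. \<bar>h t\<bar> \<le> d" and f: "integrable lborel f" for f h :: "real \<Rightarrow> real" and d
    proof (rule Bochner_Integration.integrable_bound[OF integrable_mult_right[of d, OF f]])
      have [measurable]: "f \<in> borel_measurable borel" using f by simp
      show "(\<lambda>t. h t * f t) \<in> borel_measurable lborel" by measurable
      show "AE t in lborel. norm (h t * f t) \<le> norm (d * f t)"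
      proof (rule AE_I2)
        fix t show "norm (h t * f t) \<le> norm (d * f t)"
          using h[of t] by (auto simp: abs_mult intro!: mult_right_mono)
      qed
    qed
    note F1 = n1.form_time_integrable[OF adm] and F2 = n2.form_time_integrable[OF adm2]
    note P1 = n1.fpair_time_integrable[OF adm] and P2 = n2.fpair_time_integrable[OF adm2]
    have aeF: "AE t in lborel. form (k t) (w t) \<psi> = form (k t) (U1 t) \<psi> - form (k t) (U2 t) \<psi>"
    proof -
      have "AE t in lborel. n1.absform t \<psi> \<noteq> \<infinity>" "AE t in lborel. n2.absform t \<psi> \<noteq> \<infinity>"
        using n1.adm_time(1)[OF adm] n2.adm_time(1)[OF adm2]
        by (intro nn_integral_noteq_infinite; auto simp: less_top)+
      then show ?thesis
      proof eventually_elim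
        case (elim t)
        have i: "integrable (lborel \<Otimes>\<^sub>M lborel) (\<lambda>(x, y). (U1 t x - U1 t y) * (\<psi> x - \<psi> y) * k t x y)"
          "integrable (lborel \<Otimes>\<^sub>M lborel) (\<lambda>(x, y). (U2 t x - U2 t y) * (\<psi> x - \<psi> y) * k t x y)"
          using elim by (intro n1.form_integrand_integrable n2.form_integrand_integrable; simp add: less_top)+
        show ?case
          unfolding form_def by (subst Bochner_Integration.integral_diff[OF i, symmetric])
            (auto intro!: Bochner_Integration.integral_cong simp: w_def algebra_simps)
      qed
    qed
    have aeP: "AE t in lborel. (\<integral>x. w t x * \<psi> x \<partial>lborel) = n1.fpair t \<psi> - n2.fpair t \<psi>"
    proof -
      have "AE t in lborel. n1.absprod t \<psi> \<noteq> \<infinity>" "AE t in lborel. n2.absprod t \<psi> \<noteq> \<infinity>"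
        using n1.adm_time(2)[OF adm] n2.adm_time(2)[OF adm2]
        by (intro nn_integral_noteq_infinite; auto simp: less_top)+
      then show ?thesis
      proof eventually_elim
        case (elim t)
        have i: "integrable lborel (\<lambda>x. U1 t x * \<psi> x)" "integrable lborel (\<lambda>x. U2 t x * \<psi> x)"
          using elim by (intro n1.prod_integrable n2.prod_integrable; simp add: less_top)+
        show ?case
          unfolding n1.fpair_def n2.fpair_def by (subst Bochner_Integration.integral_diff[OF i, symmetric])
            (auto intro!: Bochner_Integration.integral_cong simp: w_def algebra_simps)
      qed
    qed
    have [measurable]: "(\<lambda>t. form (k t) (w t) \<psi>) \<in> borel_measurable borel"
      by (rule form_measurable) measurable
    have "(\<integral>t. \<eta> t * form (k t) (w t) \<psi> \<partial>lborel) = (\<integral>t. \<eta> t * form (k t) (U1 t) \<psi> - \<eta> t * form (k t) (U2 t) \<psi> \<partial>lborel)"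
    proof (rule integral_cong_AE)
      show "AE t in lborel. \<eta> t * form (k t) (w t) \<psi> = \<eta> t * form (k t) (U1 t) \<psi> - \<eta> t * form (k t) (U2 t) \<psi>"
        using aeF by eventually_elim (simp add: right_diff_distrib)
    qed (use borel_measurable_integrable[OF F1] borel_measurable_integrable[OF F2] in auto)
    also have "\<dots> = (\<integral>t. \<eta> t * form (k t) (U1 t) \<psi> \<partial>lborel) - (\<integral>t. \<eta> t * form (k t) (U2 t) \<psi> \<partial>lborel)"
      by (rule Bochner_Integration.integral_diff[OF bdi[OF m(1) C1(2) F1] bdi[OF m(1) C1(2) F2]])
    also have "(\<integral>t. \<eta> t * form (k t) (U1 t) \<psi> \<partial>lborel) = (\<integral>t. \<eta>' t * n1.fpair t \<psi> \<partial>lborel)"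
      unfolding n1.fpair_def by (rule b1.weak_form_nonneg[OF c(1) \<eta> ab \<psi>])
    also have "(\<integral>t. \<eta> t * form (k t) (U2 t) \<psi> \<partial>lborel) = (\<integral>t. \<eta>' t * n2.fpair t \<psi> \<partial>lborel)"
      unfolding n2.fpair_def by (rule b2.weak_form_nonneg[OF c(2) \<eta> ab \<psi>])
    also have "(\<integral>t. \<eta>' t * n1.fpair t \<psi> \<partial>lborel) - (\<integral>t. \<eta>' t * n2.fpair t \<psi> \<partial>lborel) = (\<integral>t. \<eta>' t * n1.fpair t \<psi> - \<eta>' t * n2.fpair t \<psi> \<partial>lborel)"
      by (rule Bochner_Integration.integral_diff[OF bdi[OF m(2) C2(2) P1] bdi[OF m(2) C2(2) P2], symmetric])
    also have "\<dots> = (\<integral>t. \<eta>' t * (\<integral>x. w t x * \<psi> x \<partial>lborel) \<partial>lborel)"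
    proof (rule integral_cong_AE)
      show "AE t in lborel. \<eta>' t * n1.fpair t \<psi> - \<eta>' t * n2.fpair t \<psi> = \<eta>' t * (\<integral>x. w t x * \<psi> x \<partial>lborel)"
        using aeP by eventually_elim (simp add: right_diff_distrib)
      show "(\<lambda>t. \<eta>' t * (\<integral>x. w t x * \<psi> x \<partial>lborel)) \<in> borel_measurable lborel" by measurable
    qed (use borel_measurable_integrable[OF P1] borel_measurable_integrable[OF P2] in auto)
    finally show "(\<integral>t. \<eta> t * form (k t) (w t) \<psi> \<partial>lborel) = (\<integral>t. \<eta>' t * (\<integral>x. w t x * \<psi> x \<partial>lborel) \<partial>lborel)" .
  next
    fix \<psi> :: "'a \<Rightarrow> real" and R e :: real
    assume \<psi>: "continuous_on UNIV \<psi>" "\<And>x. norm x > R \<Longrightarrow> \<psi> x = 0" and e: "0 < e"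
    have [measurable]: "\<psi> \<in> borel_measurable borel" using \<psi>(1) by (rule borel_measurable_continuous_onI)
    have "closure {x. \<psi> x \<noteq> 0} \<subseteq> cball 0 R"
      by (rule closure_minimal) (use \<psi>(2) in \<open>auto simp: not_less[symmetric]\<close>)
    then have "bounded (closure {x. \<psi> x \<noteq> 0})" using bounded_subset bounded_cball by blast
    then have cp: "compact (closure {x. \<psi> x \<noteq> 0})" by (simp add: compact_eq_bounded_closed)
    have "((\<lambda>t. \<integral>x. \<psi> x * u1 t x \<partial>lebesgue) \<longlongrightarrow> (\<integral>x. \<psi> x \<partial>\<mu>)) (at_right 0)"
      "((\<lambda>t. \<integral>x. \<psi> x * u2 t x \<partial>lebesgue) \<longlongrightarrow> (\<integral>x. \<psi> x \<partial>\<mu>)) (at_right 0)"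
      using c cp \<psi>(1) unfolding cauchy_solution_def by blast+
    then have "((\<lambda>t. (\<integral>x. \<psi> x * u1 t x \<partial>lebesgue) - (\<integral>x. \<psi> x * u2 t x \<partial>lebesgue)) \<longlongrightarrow> (\<integral>x. \<psi> x \<partial>\<mu>) - (\<integral>x. \<psi> x \<partial>\<mu>)) (at_right 0)"
      by (rule tendsto_diff)
    then have "\<forall>\<^sub>F t in at_right 0. dist ((\<integral>x. \<psi> x * u1 t x \<partial>lebesgue) - (\<integral>x. \<psi> x * u2 t x \<partial>lebesgue)) 0 < e"
      using e by (intro tendstoD) auto
    then obtain d where d: "0 < d" "\<And>t. 0 < t \<Longrightarrow> t < d \<Longrightarrow> dist ((\<integral>x. \<psi> x * u1 t x \<partial>lebesgue) - (\<integral>x. \<psi> x * u2 t x \<partial>lebesgue)) 0 < e"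
      unfolding eventually_at_right_field by auto
    have slice1: "AE t in lborel. integrable lborel (\<lambda>x. U1 t x * \<psi> x)"
      by (rule b1.integrable_slice[where R = R]) (use \<psi> in auto)
    have slice2: "AE t in lborel. integrable lborel (\<lambda>x. U2 t x * \<psi> x)"
      by (rule b2.integrable_slice[where R = R]) (use \<psi> in auto)
    show "\<exists>d>0. AE t in lborel. 0 < t \<and> t < d \<longrightarrow> \<bar>\<integral>x. w t x * \<psi> x \<partial>lborel\<bar> \<le> e"
    proof (intro exI conjI)
      \<comment> \<open>The Borel versions are identified with the solutions inside (0, T)
        only.\<close>
      show "0 < min d T" using d b1.T by simp
      show "AE t in lborel. 0 < t \<and> t < min d T \<longrightarrow> \<bar>\<integral>x. w t x * \<psi> x \<partial>lborel\<bar> \<le> e"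
        using slice1 slice2 b1.uU_slice b2.uU_slice
      proof eventually_elim
        case (elim t)
        show ?case
        proof
          assume t: "0 < t \<and> t < min d T"
          have [measurable]: "U1 t \<in> borel_measurable borel" "U2 t \<in> borel_measurable borel" using b1.U_slice b2.U_slice by auto
          have 1: "(\<integral>x. \<psi> x * u1 t x \<partial>lebesgue) = (\<integral>x. U1 t x * \<psi> x \<partial>lborel)"
            by (rule integral_lebesgue_cong) (measurable, use elim(3) t in \<open>auto elim!: eventually_mono simp: mult.commute\<close>)
          have 2: "(\<integral>x. \<psi> x * u2 t x \<partial>lebesgue) = (\<integral>x. U2 t x * \<psi> x \<partial>lborel)"
            by (rule integral_lebesgue_cong) (measurable, use elim(4) t in \<open>auto elim!: eventually_mono simp: mult.commute\<close>)
          have "(\<integral>x. w t x * \<psi> x \<partial>lborel) = (\<integral>x. U1 t x * \<psi> x \<partial>lborel) - (\<integral>x. U2 t x * \<psi> x \<partial>lborel)"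
            unfolding w_def left_diff_distrib by (rule Bochner_Integration.integral_diff[OF elim(1,2)])
          then show "\<bar>\<integral>x. w t x * \<psi> x \<partial>lborel\<bar> \<le> e" using d(2)[of t] t unfolding 1 2 by (simp add: dist_real_def)
        qed
      qed
    qed
  qed (use b1.s b1.T b1.\<Lambda> b1.kb in auto)
  then show ?thesis by (simp add: w_def[abs_def])
qed

text \<open>Almost every time is a time of agreement, and such times accumulate at each t from
  below; continuity with values in local L2 carries the agreement to t, the final time
  included.\<close>

lemma time_continuous_rep_unique:
  fixes u1 u2 v1 v2 :: "real \<Rightarrow> 'a::euclidean_space \<Rightarrow> real"
  assumes u: "AE t in lborel. 0 < t \<and> t < T \<longrightarrow> (AE x in lborel. u1 t x = u2 t x)"
    and r1: "time_continuous_rep T u1 v1" and r2: "time_continuous_rep T u2 v2" and t: "t \<in> {0<..T}"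
  shows "AE x in lebesgue. v1 t x = v2 t x"
proof -
  have ae: "AE \<tau> in lborel. 0 < \<tau> \<and> \<tau> < T \<longrightarrow> (AE x in lborel. v \<tau> x = u \<tau> x)" if "time_continuous_rep T u v" for u v :: "real \<Rightarrow> 'a \<Rightarrow> real"
  proof -
    have "AE \<tau> in lebesgue. \<tau> \<in> {0<..<T} \<longrightarrow> (AE x in lebesgue. v \<tau> x = u \<tau> x)"
      using that unfolding time_continuous_rep_def by (subst (asm) AE_restrict_space_iff) auto
    then show ?thesis by (simp add: AE_completion_iff)
  qed
  have good: "AE \<tau> in lborel. 0 < \<tau> \<and> \<tau> < T \<longrightarrow> (AE x in lebesgue. v1 \<tau> x = v2 \<tau> x)"
    using u ae[OF r1] ae[OF r2]
  proof eventually_elim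
    case (elim \<tau>)
    show ?case
    proof
      assume \<tau>: "0 < \<tau> \<and> \<tau> < T"
      have "AE x in lborel. v1 \<tau> x = v2 \<tau> x"
        using elim(1)[rule_format, OF \<tau>] elim(2)[rule_format, OF \<tau>] elim(3)[rule_format, OF \<tau>] by eventually_elim simp
      then show "AE x in lebesgue. v1 \<tau> x = v2 \<tau> x" by (simp add: AE_completion_iff)
    qed
  qed
  have m: "v1 \<tau> \<in> borel_measurable lebesgue" "v2 \<tau> \<in> borel_measurable lebesgue" if "\<tau> \<in> {0<..T}" for \<tau>
    using r1 r2 that unfolding time_continuous_rep_def by auto
  have zero: "L2_sqnorm (cball 0 R) (\<lambda>x. v1 t x - v2 t x) = 0" for R
  proof -
    have C: "compact (cball (0::'a) R)" by simp
    have "L2_sqnorm (cball 0 R) (\<lambda>x. v1 t x - v2 t x) \<le> 0"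
    proof (rule ennreal_le_epsilon)
      fix e :: real assume e: "0 < e"
      have "((\<lambda>\<tau>. L2_sqnorm (cball 0 R) (\<lambda>x. v1 \<tau> x - v1 t x)) \<longlongrightarrow> 0) (at t within {0<..T})"
        "((\<lambda>\<tau>. L2_sqnorm (cball 0 R) (\<lambda>x. v2 \<tau> x - v2 t x)) \<longlongrightarrow> 0) (at t within {0<..T})"
        using r1 r2 t C unfolding time_continuous_rep_def by blast+
      then have "\<forall>\<^sub>F \<tau> in at t within {0<..T}. L2_sqnorm (cball 0 R) (\<lambda>x. v1 \<tau> x - v1 t x) < ennreal (e / 4)"
        "\<forall>\<^sub>F \<tau> in at t within {0<..T}. L2_sqnorm (cball 0 R) (\<lambda>x. v2 \<tau> x - v2 t x) < ennreal (e / 4)"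
        using e by (auto dest!: order_tendstoD(2)[of _ 0 _ "ennreal (e / 4)"])
      then have "\<forall>\<^sub>F \<tau> in at t within {0<..T}. L2_sqnorm (cball 0 R) (\<lambda>x. v1 \<tau> x - v1 t x) < ennreal (e / 4) \<and>
          L2_sqnorm (cball 0 R) (\<lambda>x. v2 \<tau> x - v2 t x) < ennreal (e / 4)" by eventually_elim simp
      then obtain d where d: "0 < d" "\<And>\<tau>. \<tau> \<in> {0<..T} \<Longrightarrow> \<tau> \<noteq> t \<Longrightarrow> dist \<tau> t < d \<Longrightarrow>
          L2_sqnorm (cball 0 R) (\<lambda>x. v1 \<tau> x - v1 t x) < ennreal (e / 4) \<and> L2_sqnorm (cball 0 R) (\<lambda>x. v2 \<tau> x - v2 t x) < ennreal (e / 4)"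
        unfolding eventually_at by metis
      \<comment> \<open>Approaching from the left works for t = T as well and keeps the chosen time
        inside (0, T).\<close>
      have "max 0 (t - d) < t" using t d by auto
      then obtain \<tau> where \<tau>: "max 0 (t - d) < \<tau>" "\<tau> < t" and g: "0 < \<tau> \<and> \<tau> < T \<longrightarrow> (AE x in lebesgue. v1 \<tau> x = v2 \<tau> x)"
        by (rule AE_lborel_interval[OF good])
      have \<tau>T: "\<tau> \<in> {0<..T}" "0 < \<tau> \<and> \<tau> < T" using \<tau> t by auto
      have dd: "L2_sqnorm (cball 0 R) (\<lambda>x. v1 \<tau> x - v1 t x) < ennreal (e / 4)" "L2_sqnorm (cball 0 R) (\<lambda>x. v2 \<tau> x - v2 t x) < ennreal (e / 4)"
        using d(2)[OF \<tau>T(1)] \<tau> by (auto simp: dist_real_def)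
      note [measurable] = m[OF t] m[OF \<tau>T(1)]
      have bm [measurable]: "cball (0::'a) R \<in> sets lebesgue" by (intro sets_completionI_sets) simp
      have "L2_sqnorm (cball 0 R) (\<lambda>x. v1 t x - v2 t x) \<le> (\<integral>\<^sup>+x. 2 * (ennreal ((v1 \<tau> x - v1 t x)\<^sup>2) * indicator (cball 0 R) x) +
          2 * (ennreal ((v2 \<tau> x - v2 t x)\<^sup>2) * indicator (cball 0 R) x) \<partial>lebesgue)"
        unfolding L2_sqnorm_def
      proof (rule nn_integral_mono_AE)
        show "AE x in lebesgue. ennreal ((v1 t x - v2 t x)\<^sup>2) * indicator (cball 0 R) x \<le>
          2 * (ennreal ((v1 \<tau> x - v1 t x)\<^sup>2) * indicator (cball 0 R) x) + 2 * (ennreal ((v2 \<tau> x - v2 t x)\<^sup>2) * indicator (cball 0 R) x)"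
          using g[rule_format, OF \<tau>T(2)]
        proof eventually_elim
          case (elim x)
          have "(v1 t x - v2 t x)\<^sup>2 \<le> 2 * (v1 \<tau> x - v1 t x)\<^sup>2 + 2 * (v2 \<tau> x - v2 t x)\<^sup>2"
            using sq_diff_le[of "v1 t x" "v2 t x" "v1 \<tau> x"] elim by (simp add: power2_commute)
          then have "ennreal ((v1 t x - v2 t x)\<^sup>2) \<le> ennreal (2 * (v1 \<tau> x - v1 t x)\<^sup>2 + 2 * (v2 \<tau> x - v2 t x)\<^sup>2)" by (rule ennreal_leI)
          then show ?case by (auto simp: indicator_def ennreal_plus ennreal_mult)
        qed
      qed
      also have "\<dots> = (\<integral>\<^sup>+x. 2 * (ennreal ((v1 \<tau> x - v1 t x)\<^sup>2) * indicator (cball 0 R) x) \<partial>lebesgue) +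
          (\<integral>\<^sup>+x. 2 * (ennreal ((v2 \<tau> x - v2 t x)\<^sup>2) * indicator (cball 0 R) x) \<partial>lebesgue)"
        by (rule nn_integral_add) measurable
      also have "(\<integral>\<^sup>+x. 2 * (ennreal ((v1 \<tau> x - v1 t x)\<^sup>2) * indicator (cball 0 R) x) \<partial>lebesgue) = 2 * L2_sqnorm (cball 0 R) (\<lambda>x. v1 \<tau> x - v1 t x)"
        unfolding L2_sqnorm_def by (rule nn_integral_cmult) measurable
      also have "(\<integral>\<^sup>+x. 2 * (ennreal ((v2 \<tau> x - v2 t x)\<^sup>2) * indicator (cball 0 R) x) \<partial>lebesgue) = 2 * L2_sqnorm (cball 0 R) (\<lambda>x. v2 \<tau> x - v2 t x)"
        unfolding L2_sqnorm_def by (rule nn_integral_cmult) measurable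
      also have "2 * L2_sqnorm (cball 0 R) (\<lambda>x. v1 \<tau> x - v1 t x) + 2 * L2_sqnorm (cball 0 R) (\<lambda>x. v2 \<tau> x - v2 t x) \<le> 2 * ennreal (e / 4) + 2 * ennreal (e / 4)"
        using dd by (intro add_mono mult_left_mono less_imp_le) auto
      also have "\<dots> = 0 + ennreal e" using e by (simp flip: ennreal_numeral ennreal_mult ennreal_plus)
      finally show "L2_sqnorm (cball 0 R) (\<lambda>x. v1 t x - v2 t x) \<le> 0 + ennreal e" .
    qed
    then show ?thesis by simp
  qed
  have "AE x in lebesgue. \<forall>n::nat. x \<in> cball 0 (real n) \<longrightarrow> v1 t x = v2 t x"
    unfolding AE_all_countable
  proof
    fix n :: nat
    note [measurable] = m[OF t]
    have [measurable]: "cball (0::'a) (real n) \<in> sets lebesgue" by (intro sets_completionI_sets) simp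
    have "AE x in lebesgue. ennreal ((v1 t x - v2 t x)\<^sup>2) * indicator (cball 0 (real n)) x = 0"
      using zero[of "real n"] unfolding L2_sqnorm_def by (subst (asm) nn_integral_0_iff_AE) measurable
    then show "AE x in lebesgue. x \<in> cball 0 (real n) \<longrightarrow> v1 t x = v2 t x"
      by eventually_elim (auto simp: indicator_def ennreal_eq_0_iff split: if_splits)
  qed
  then show ?thesis
  proof eventually_elim
    case (elim x)
    obtain n :: nat where "norm x \<le> real n" using real_arch_simple by blast
    then show ?case using elim by auto
  qed
qed

text \<open>Equality almost everywhere does not see single times, in particular not the final one;
  the second conjunct covers these through the representatives that are continuous in time.\<close>

theorem propositionA1:
  fixes s T l \<Lambda> :: real
    and K :: "real \<Rightarrow> 'a::euclidean_space \<Rightarrow> 'a \<Rightarrow> ennreal"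
    and \<mu> :: "'a measure"
    and u\<^sub>1 u\<^sub>2 :: "real \<Rightarrow> 'a \<Rightarrow> real"
  assumes "0 < s" and "s < 1" and "0 < T"
    and "0 < l" and "l \<le> \<Lambda>"
    and "jump_kernel T K"
    and "kernel_upper_bound s \<Lambda> T K"
    and "kernel_coercive s l T K"
    and "radon_measure \<mu>"
    and "cauchy_solution s K T \<mu> u\<^sub>1"
    and "cauchy_solution s K T \<mu> u\<^sub>2"
    and "solution_class s {0<..<T} UNIV u\<^sub>1"
    and "solution_class s {0<..<T} UNIV u\<^sub>2"
  shows "(AE (t, x) in lebesgue_on ({0<..<T} \<times> UNIV). u\<^sub>1 t x = u\<^sub>2 t x) \<and>
    (\<forall>v\<^sub>1 v\<^sub>2. time_continuous_rep T u\<^sub>1 v\<^sub>1 \<and> time_continuous_rep T u\<^sub>2 v\<^sub>2 \<longrightarrow>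
       (\<forall>t\<in>{0<..T}. AE x in lebesgue. v\<^sub>1 t x = v\<^sub>2 t x))"
proof -
  have \<Lambda>: "0 < \<Lambda>" using assms(4,5) by simp
  obtain k where k: "(\<lambda>(t, x, y). k t x y) \<in> borel_measurable borel" "\<And>t x y. 0 \<le> k t x y"
    "\<And>t x y. k t x y \<le> \<Lambda> * riesz s (x - y)"
    "AE t in lborel. 0 < t \<and> t < T \<longrightarrow> (AE p in lborel. K t (fst p) (snd p) = ennreal (k t (fst p) (snd p)))"
    using kernel_borel_version[OF \<Lambda> assms(6,7)] by blast
  have kK: "AE t in lborel. 0 < t \<and> t < T \<longrightarrow> (AE p in lborel. enn2real (K t (fst p) (snd p)) = k t (fst p) (snd p))"
    using k(4) by eventually_elim (auto elim!: eventually_mono simp: k(2))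
  obtain U1 where U1: "(\<lambda>(t, x). U1 t x) \<in> borel_measurable borel" "\<And>t x. t \<le> 0 \<or> T \<le> t \<Longrightarrow> U1 t x = 0"
    "AE p in lborel. 0 < fst p \<and> fst p < T \<longrightarrow> u\<^sub>1 (fst p) (snd p) = U1 (fst p) (snd p)"
    using solution_borel_version[OF assms(12)] by blast
  obtain U2 where U2: "(\<lambda>(t, x). U2 t x) \<in> borel_measurable borel" "\<And>t x. t \<le> 0 \<or> T \<le> t \<Longrightarrow> U2 t x = 0"
    "AE p in lborel. 0 < fst p \<and> fst p < T \<longrightarrow> u\<^sub>2 (fst p) (snd p) = U2 (fst p) (snd p)"
    using solution_borel_version[OF assms(13)] by blast
  have b1: "borel_solution s T \<Lambda> K k u\<^sub>1 U1"
    by unfold_locales (use assms \<Lambda> k kK U1 in auto)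
  have b2: "borel_solution s T \<Lambda> K k u\<^sub>2 U2"
    by unfold_locales (use assms \<Lambda> k kK U2 in auto)
  interpret nonlocal_cauchy s T l \<Lambda> k "\<lambda>t x. U1 t x - U2 t x"
    by (rule difference_nonlocal_cauchy[OF b1 b2 assms(4) coercive_borel_version[OF k(1,4) assms(8)] assms(10,11)])
  \<comment> \<open>Uniqueness was obtained slice by slice; with the null set measurable in the
    product, Fubini turns it into a statement on time-space.\<close>
  have "AE p in lborel \<Otimes>\<^sub>M lborel. U1 (fst p) (snd p) - U2 (fst p) (snd p) = 0"
  proof (rule lborel_pair.AE_pair_measure)
    show "AE t in lborel. AE x in lborel. U1 (fst (t, x)) (snd (t, x)) - U2 (fst (t, x)) (snd (t, x)) = 0"
      using unique by simp
    have "(\<lambda>p. U1 (fst p) (snd p) - U2 (fst p) (snd p)) \<in> borel_measurable (lborel \<Otimes>\<^sub>M lborel)"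
      using u_borel by (simp add: lborel_prod case_prod_beta')
    then show "{p \<in> space (lborel \<Otimes>\<^sub>M lborel). U1 (fst p) (snd p) - U2 (fst p) (snd p) = 0} \<in> sets (lborel \<Otimes>\<^sub>M lborel)"
      by measurable
  qed
  then have "AE p in lborel. U1 (fst p) (snd p) - U2 (fst p) (snd p) = 0" by (simp only: lborel_prod)
  then have eq: "AE p in lborel. 0 < fst p \<and> fst p < T \<longrightarrow> u\<^sub>1 (fst p) (snd p) = u\<^sub>2 (fst p) (snd p)"
    using U1(3) U2(3) by eventually_elim auto
  have slice: "AE t in lborel. 0 < t \<and> t < T \<longrightarrow> (AE x in lborel. u\<^sub>1 t x = u\<^sub>2 t x)"
    using AE_lborel_pair[OF eq] by eventually_elim auto
  have "open ({0<..<T} \<times> (UNIV :: 'a set))" by (intro open_Times) auto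
  then have S: "{0<..<T} \<times> (UNIV :: 'a set) \<in> sets lebesgue" by (intro sets_completionI_sets) auto
  have "AE p in lebesgue. p \<in> {0<..<T} \<times> UNIV \<longrightarrow> (case p of (t, x) \<Rightarrow> u\<^sub>1 t x = u\<^sub>2 t x)"
    unfolding AE_completion_iff using eq by eventually_elim auto
  then have "AE (t, x) in lebesgue_on ({0<..<T} \<times> UNIV). u\<^sub>1 t x = u\<^sub>2 t x"
    using S by (subst AE_restrict_space_iff) auto
  then show ?thesis using time_continuous_rep_unique[OF slice] by blast
qed

end
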